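(* Let $T>0$, let $\rho_0,\rho_T$ be probability densities on $\mathbb{R}^d$ supported on bounded domains $\Omega_0,\Omega_T\subset\mathbb{R}^d$ respectively, and let $Q:\mathbb{R}^d\to\mathbb{R}$ be such that $\tilde Q(z):=\frac T2 Q(z)+|z|^2$ belongs to $C^4(\mathbb{R}^d)$ and satisfies $D^2\tilde Q\ge\varepsilon_0 I$ for some $\varepsilon_0>0$. Let $\mathcal F(\rho)=\int_{\mathbb{R}^d}Q\,d\rho$. Then Problems 1, 2, 3 (defined in the context, with this $\mathcal F$) are equivalent to solving an optimal transport problem with cost function $c(x,y)=\tilde Q^*(x+y)$, where $\tilde Q^*$ is the Legendre transform of $\tilde Q$. There exists a potential $\tilde\phi$ such that the optimal transport map $\mathbf m$ of $\rho_0$ onto $\rho_T$ with cost $c$ is given by $\mathbf m(x)=y$ such that $D_x\tilde Q^*(x+y)=D_x\tilde\phi(x)$. Then $\phi=\frac2T\big(\tilde\phi-\frac{|x|^2}{2}\big)$ is the initial velocity potential, i.e. $v(0,x)=\partial_t\gamma(0,x)=\nabla\phi(x)$, where $v$ and $\gamma$ are the optimisers from Problems 1 and 2 respectively.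
   Context: $\mathcal P_2$ denotes the set of probability measures on $\mathbb{R}^d$ with finite second moment; $f_\#\mu$ is the push-forward of $\mu$ by $f$. Problem 1: minimise $I(\rho,v)=\int_{[0,T]\times\mathbb{R}^d}\frac12|v(t,x)|^2\,d\rho(t,x)\,dt+\mathcal F(\rho(T/2))$ among curves $\rho:[0,T]\to\mathcal P_2$ and vector fields $v\in L^2([0,T]\times\mathbb{R}^d,dt\times d\rho(t))$ with $\partial_t\rho+\nabla\cdot(\rho v)=0$, $\rho(0)=\rho_0$, $\rho(T)=\rho_T$. Problem 2: let $\Gamma=C^1([0,T];\mathbb{R}^d)$ be the space of continuously differentiable curves. To each $x\in\mathrm{supp}(\rho_0)$ associate $\gamma(\cdot,x)\in\Gamma$ with $\gamma(0,x)=x$. Minimise $J(\gamma)=\int_{\mathbb{R}^d}\int_0^T\frac12|\partial_t\gamma(t,x)|^2\,dt\,d\rho_0(x)+\mathcal F(\rho(T/2))$ among all such $\gamma$, where $\rho(T/2)=\gamma(T/2)_\#\rho_0$, under the constraint $\rho_T=\gamma(T)_\#\rho_0$. Problem 3: minimise $K(\rho)=\frac2T W_2^2(\rho_0,\rho)+\mathcal F(\rho)+\frac2T W_2^2(\rho,\rho_T)$ among $\rho\in\mathcal P_2$, where $W_2^2(\mu,\nu)=\inf_\pi\int\frac12|x-y|^2\,d\pi(x,y)$, the infimum being over probability measures $\pi$ on $\mathbb{R}^d\times\mathbb{R}^d$ with marginals $\mu,\nu$. The initial velocity potential $\phi$ is characterised by $\nabla\phi(x)=\frac2T(\nabla\Phi^*(x)-x)$,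 where $\Phi^*$ is a convex potential such that $\nabla\Phi^*_\#\rho_0=\rho$ and $\rho$ is the optimiser in Problem 3. Convention: the optimal transport problem with cost $c$ is a maximisation problem, namely to maximise $\int_{\Omega_0}\rho_0(x)\,\tilde Q^*(x+\mathbf s(x))\,dx$ among maps $\mathbf s:\Omega_0\to\Omega_T$ with $\mathbf s_\#\rho_0=\rho_T$.
   Formalization: Problem 2 generally has no optimiser among C^1 curves, as optimal paths have a velocity jump at T/2. The value, form and initial velocity of optimisers are stated for C^1 curves and for curves C^1 on each half of [0,T]; existence of an optimiser is stated only for the latter. *)

theory Defs
  imports "HOL-Probability.Probability"
begin

section \<open>Calculus\<close>

definition grad :: "('a::euclidean_space \<Rightarrow> real) \<Rightarrow> 'a \<Rightarrow> 'a" where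
  "grad f x = (THE D. GDERIV f x :> D)"

text \<open>\<^term>\<open>C_k k f\<close>: all iterated directional derivatives of order at most \<open>k\<close> exist
  everywhere (as Frechet derivatives of the preceding ones) and are continuous.\<close>

primrec C_k :: "nat \<Rightarrow> ('a::real_normed_vector \<Rightarrow> 'b::real_normed_vector) \<Rightarrow> bool" where
  "C_k 0 f \<longleftrightarrow> continuous_on UNIV f"
| "C_k (Suc k) f \<longleftrightarrow>
     f differentiable_on UNIV \<and> (\<forall>h. C_k k (\<lambda>x. frechet_derivative f (at x) h))"

definition hessian :: "('a::real_normed_vector \<Rightarrow> real) \<Rightarrow> 'a \<Rightarrow> 'a \<Rightarrow> 'a \<Rightarrow> real" where
  "hessian f x h k = frechet_derivative (\<lambda>z. frechet_derivative f (at z) h) (at x) k"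

text \<open>The supremum is taken in the reals, so it is meaningful only where it is finite; this is
  the case at every \<open>p\<close> for continuous \<open>f\<close> with superlinear growth, in particular for
  strongly convex \<open>f\<close>.\<close>

definition legendre :: "('a::real_inner \<Rightarrow> real) \<Rightarrow> 'a \<Rightarrow> real" where
  "legendre f p = (SUP z. p \<bullet> z - f z)"

definition C1_on :: "real \<Rightarrow> real \<Rightarrow> (real \<Rightarrow> 'a::real_normed_vector) set" where
  "C1_on a b = {g. \<exists>g'. (\<forall>t\<in>{a..b}. (g has_vector_derivative g' t) (at t within {a..b}))
                       \<and> continuous_on {a..b} g'}"

section \<open>Measures\<close>

definition bounded_domain :: "'a::euclidean_space set \<Rightarrow> bool" where
  "bounded_domain \<Omega> \<longleftrightarrow> open \<Omega> \<and> connected \<Omega> \<and> \<Omega> \<noteq> {} \<and> bounded \<Omega>"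

definition of_density :: "('a::euclidean_space \<Rightarrow> real) \<Rightarrow> 'a measure" where
  "of_density r = density lborel (\<lambda>x. ennreal (r x))"

definition prob_density_on :: "'a::euclidean_space set \<Rightarrow> ('a \<Rightarrow> real) \<Rightarrow> bool" where
  "prob_density_on \<Omega> r \<longleftrightarrow> r \<in> borel_measurable borel \<and> (\<forall>x. 0 \<le> r x) \<and>
     (\<forall>x. x \<notin> \<Omega> \<longrightarrow> r x = 0) \<and> prob_space (of_density r)"

definition P2 :: "'a::euclidean_space measure \<Rightarrow> bool" where
  "P2 \<mu> \<longleftrightarrow> sets \<mu> = sets borel \<and> prob_space \<mu> \<and> (\<integral>\<^sup>+x. ennreal ((norm x)\<^sup>2) \<partial>\<mu>) < \<infinity>"

definition msupport :: "'a::topological_space measure \<Rightarrow> 'a set" where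
  "msupport \<mu> = {x. \<forall>U. open U \<longrightarrow> x \<in> U \<longrightarrow> emeasure \<mu> U > 0}"

definition couplings ::
    "'a::euclidean_space measure \<Rightarrow> 'a measure \<Rightarrow> ('a \<times> 'a) measure set" where
  "couplings \<mu> \<nu> = {\<pi>. sets \<pi> = sets borel \<and> prob_space \<pi> \<and>
                       distr \<pi> borel fst = \<mu> \<and> distr \<pi> borel snd = \<nu>}"

definition W2sq :: "'a::euclidean_space measure \<Rightarrow> 'a measure \<Rightarrow> ennreal" where
  "W2sq \<mu> \<nu> = (INF \<pi>\<in>couplings \<mu> \<nu>. \<integral>\<^sup>+(x, y). ennreal (1/2 * (norm (x - y))\<^sup>2) \<partial>\<pi>)"

text \<open>The integral of \<open>Q\<close> as an extended real: the Bochner integral would be \<open>0\<close> when \<open>Q\<close> is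
  not integrable, whereas \<open>\<integral>Q d\<mu> = \<infinity>\<close> is possible here. If \<open>(T/2) Q + |z|\<^sup>2\<close> is strongly convex, the
  negative part of \<open>Q\<close> grows at most quadratically and is integrable for \<open>\<mu>\<close> with finite second
  moment.\<close>

definition potential_energy :: "('a::euclidean_space \<Rightarrow> real) \<Rightarrow> 'a measure \<Rightarrow> ereal" where
  "potential_energy Q \<mu> =
     enn2ereal (\<integral>\<^sup>+x. ennreal (Q x) \<partial>\<mu>) - enn2ereal (\<integral>\<^sup>+x. ennreal (- Q x) \<partial>\<mu>)"

section \<open>Problem 1\<close>

definition narrowly_continuous :: "real \<Rightarrow> (real \<Rightarrow> 'a::euclidean_space measure) \<Rightarrow> bool" where
  "narrowly_continuous T \<rho> \<longleftrightarrow> (\<forall>f :: 'a \<Rightarrow> real. continuous_on UNIV f \<longrightarrow> bounded (range f) \<longrightarrow>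
     continuous_on {0..T} (\<lambda>t. \<integral>x. f x \<partial>\<rho> t))"

definition test_functions :: "real \<Rightarrow> (real \<times> 'a::euclidean_space \<Rightarrow> real) set" where
  "test_functions T = {\<zeta>. (\<forall>k. C_k k \<zeta>) \<and> compact (closure {p. \<zeta> p \<noteq> 0}) \<and>
                           closure {p. \<zeta> p \<noteq> 0} \<subseteq> {0<..<T} \<times> UNIV}"

text \<open>\<open>\<partial>\<^sub>t\<rho> + \<nabla>\<cdot>(\<rho>v) = 0\<close> in the sense of distributions on \<open>(0,T) \<times> \<real>\<^sup>d\<close>. The derivative of \<open>\<zeta>\<close> at
  \<open>(t, x)\<close> in direction \<open>(1, v t x)\<close> is \<open>\<partial>\<^sub>t\<zeta> + \<nabla>\<zeta> \<cdot> v\<close>.\<close>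

definition continuity_equation ::
    "real \<Rightarrow> (real \<Rightarrow> 'a::euclidean_space measure) \<Rightarrow> (real \<Rightarrow> 'a \<Rightarrow> 'a) \<Rightarrow> bool" where
  "continuity_equation T \<rho> v \<longleftrightarrow> (\<forall>\<zeta>\<in>test_functions T.
     (LINT t:{0..T}|lborel. (\<integral>x. frechet_derivative \<zeta> (at (t, x)) (1, v t x) \<partial>\<rho> t)) = 0)"

definition kinetic_action ::
    "real \<Rightarrow> (real \<Rightarrow> 'a::euclidean_space measure) \<Rightarrow> (real \<Rightarrow> 'a \<Rightarrow> 'a) \<Rightarrow> ennreal" where
  "kinetic_action T \<rho> v =
     (\<integral>\<^sup>+t\<in>{0..T}. (\<integral>\<^sup>+x. ennreal (1/2 * (norm (v t x))\<^sup>2) \<partial>\<rho> t) \<partial>lborel)"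

definition admissible1 ::
    "real \<Rightarrow> 'a::euclidean_space measure \<Rightarrow> 'a measure \<Rightarrow>
     (real \<Rightarrow> 'a measure) \<times> (real \<Rightarrow> 'a \<Rightarrow> 'a) \<Rightarrow> bool" where
  "admissible1 T \<mu>0 \<mu>T = (\<lambda>(\<rho>, v).
     (\<forall>t\<in>{0..T}. P2 (\<rho> t)) \<and> narrowly_continuous T \<rho> \<and>
     (\<lambda>(t, x). v t x) \<in> borel_measurable borel \<and> kinetic_action T \<rho> v < \<infinity> \<and>
     continuity_equation T \<rho> v \<and> \<rho> 0 = \<mu>0 \<and> \<rho> T = \<mu>T)"

definition I_functional ::
    "real \<Rightarrow> ('a::euclidean_space \<Rightarrow> real) \<Rightarrow>
     (real \<Rightarrow> 'a measure) \<times> (real \<Rightarrow> 'a \<Rightarrow> 'a) \<Rightarrow> ereal" where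
  "I_functional T Q = (\<lambda>(\<rho>, v). enn2ereal (kinetic_action T \<rho> v) + potential_energy Q (\<rho> (T/2)))"

abbreviation "optimal1 T Q \<mu>0 \<mu>T \<equiv> is_arg_min (I_functional T Q) (admissible1 T \<mu>0 \<mu>T)"

section \<open>Problem 2\<close>

text \<open>A family of curves is written \<open>\<gamma> x t\<close> for \<open>\<gamma>(t, x)\<close>; only its values for \<open>x\<close> in the support of
  \<open>\<rho>\<^sub>0\<close> matter. The class \<open>\<Gamma>\<close> of curves is a parameter. The literal choice is
  \<^term>\<open>C1_curves T\<close>; as the potential acts impulsively at time \<open>T/2\<close>, minimising curves in general
  have a kink there, and the infimum over \<^term>\<open>C1_curves T\<close> is in general attained only in
  \<^term>\<open>kinked_curves T\<close>.\<close>

abbreviation C1_curves :: "real \<Rightarrow> (real \<Rightarrow> 'a::real_normed_vector) set" where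
  "C1_curves T \<equiv> C1_on 0 T"

abbreviation kinked_curves :: "real \<Rightarrow> (real \<Rightarrow> 'a::real_normed_vector) set" where
  "kinked_curves T \<equiv> C1_on 0 (T/2) \<inter> C1_on (T/2) T"

definition admissible2 ::
    "real \<Rightarrow> (real \<Rightarrow> 'a::euclidean_space) set \<Rightarrow> 'a measure \<Rightarrow> 'a measure \<Rightarrow>
     ('a \<Rightarrow> real \<Rightarrow> 'a) \<Rightarrow> bool" where
  "admissible2 T \<Gamma> \<mu>0 \<mu>T \<gamma> \<longleftrightarrow>
     (\<forall>x\<in>msupport \<mu>0. \<gamma> x \<in> \<Gamma> \<and> \<gamma> x 0 = x) \<and>
     (\<forall>t\<in>{0..T}. (\<lambda>x. \<gamma> x t) \<in> borel_measurable borel) \<and>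
     distr \<mu>0 borel (\<lambda>x. \<gamma> x T) = \<mu>T"

definition J_functional ::
    "real \<Rightarrow> ('a::euclidean_space \<Rightarrow> real) \<Rightarrow> 'a measure \<Rightarrow> ('a \<Rightarrow> real \<Rightarrow> 'a) \<Rightarrow> ereal" where
  "J_functional T Q \<mu>0 \<gamma> =
     enn2ereal (\<integral>\<^sup>+x. (\<integral>\<^sup>+t\<in>{0..T}.
        ennreal (1/2 * (norm (vector_derivative (\<gamma> x) (at t within {0..T})))\<^sup>2) \<partial>lborel) \<partial>\<mu>0)
     + potential_energy Q (distr \<mu>0 borel (\<lambda>x. \<gamma> x (T/2)))"

abbreviation "optimal2 T \<Gamma> Q \<mu>0 \<mu>T \<equiv> is_arg_min (J_functional T Q \<mu>0) (admissible2 T \<Gamma> \<mu>0 \<mu>T)"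

section \<open>Problem 3\<close>

definition K_functional ::
    "real \<Rightarrow> ('a::euclidean_space \<Rightarrow> real) \<Rightarrow> 'a measure \<Rightarrow> 'a measure \<Rightarrow> 'a measure \<Rightarrow> ereal" where
  "K_functional T Q \<mu>0 \<mu>T \<rho> =
     ereal (2/T) * enn2ereal (W2sq \<mu>0 \<rho>) + potential_energy Q \<rho> + ereal (2/T) * enn2ereal (W2sq \<rho> \<mu>T)"

abbreviation "optimal3 T Q \<mu>0 \<mu>T \<equiv> is_arg_min (K_functional T Q \<mu>0 \<mu>T) P2"

section \<open>Optimal transport with cost \<open>Qtilde\<^sup>*(x + y)\<close>\<close>

definition Qtilde :: "real \<Rightarrow> ('a::euclidean_space \<Rightarrow> real) \<Rightarrow> 'a \<Rightarrow> real" where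
  "Qtilde T Q z = T/2 * Q z + (norm z)\<^sup>2"

definition cost :: "real \<Rightarrow> ('a::euclidean_space \<Rightarrow> real) \<Rightarrow> 'a \<Rightarrow> 'a \<Rightarrow> real" where
  "cost T Q x y = legendre (Qtilde T Q) (x + y)"

definition transport_map ::
    "'a::euclidean_space set \<Rightarrow> 'a set \<Rightarrow> ('a \<Rightarrow> real) \<Rightarrow> ('a \<Rightarrow> real) \<Rightarrow> ('a \<Rightarrow> 'a) \<Rightarrow> bool" where
  "transport_map \<Omega>0 \<Omega>T r0 rT s \<longleftrightarrow> s \<in> borel_measurable borel \<and> s ` \<Omega>0 \<subseteq> \<Omega>T \<and>
     distr (of_density r0) borel s = of_density rT"

definition transport_value ::
    "('a \<Rightarrow> 'a \<Rightarrow> real) \<Rightarrow> 'a::euclidean_space set \<Rightarrow> ('a \<Rightarrow> real) \<Rightarrow> ('a \<Rightarrow> 'a) \<Rightarrow> real" where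
  "transport_value c \<Omega>0 r0 s = (LINT x:\<Omega>0|lborel. r0 x * c x (s x))"

abbreviation "optimal_map c \<Omega>0 \<Omega>T r0 rT \<equiv>
  is_arg_max (transport_value c \<Omega>0 r0) (transport_map \<Omega>0 \<Omega>T r0 rT)"

text \<open>Potentials are \<open>c\<close>-convex, as usual for the maximisation form of the transport problem.\<close>

definition c_convex :: "('a \<Rightarrow> 'b \<Rightarrow> real) \<Rightarrow> 'b set \<Rightarrow> ('a \<Rightarrow> real) \<Rightarrow> bool" where
  "c_convex c Y \<phi> \<longleftrightarrow> (\<exists>\<psi>. \<forall>x. bdd_above ((\<lambda>y. c x y - \<psi> y) ` Y) \<and>
                              \<phi> x = (SUP y\<in>Y. c x y - \<psi> y))"

text \<open>\<open>\<phi>\<close> is a potential of the optimal map: for almost every \<open>x\<close>, the optimal \<open>m x\<close> is the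
  solution \<open>y\<close> of \<open>D\<^sub>x c(x, y) = D\<phi>(x)\<close>.\<close>

definition transport_potential ::
    "('a \<Rightarrow> 'a \<Rightarrow> real) \<Rightarrow> 'a::euclidean_space set \<Rightarrow> 'a set \<Rightarrow> ('a \<Rightarrow> real) \<Rightarrow> ('a \<Rightarrow> real) \<Rightarrow>
     ('a \<Rightarrow> real) \<Rightarrow> bool" where
  "transport_potential c \<Omega>0 \<Omega>T r0 rT \<phi> \<longleftrightarrow>
     c_convex c \<Omega>T \<phi> \<and> (AE x in of_density r0. \<phi> differentiable at x) \<and>
     (\<forall>m. optimal_map c \<Omega>0 \<Omega>T r0 rT m \<longrightarrow>
        (AE x in of_density r0. \<forall>y. grad (\<lambda>x'. c x' y) x = grad \<phi> x \<longleftrightarrow> y = m x))"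

section \<open>From the transport map to the evolution\<close>

text \<open>Constant velocity on each half of \<open>[0, T]\<close>, from \<open>x\<close> via \<open>z\<close> to \<open>y\<close>.\<close>

definition broken_line :: "real \<Rightarrow> 'a::real_vector \<Rightarrow> 'a \<Rightarrow> 'a \<Rightarrow> real \<Rightarrow> 'a" where
  "broken_line T x z y t =
     (if t \<le> T/2 then x + (2*t/T) *\<^sub>R (z - x) else z + (2*t/T - 1) *\<^sub>R (y - z))"

text \<open>The midpoint \<open>z = DQtilde\<^sup>*(x + y)\<close> minimises \<open>|x - z|\<^sup>2/T + |z - y|\<^sup>2/T + Q(z)\<close>.\<close>

definition midpoint_of :: "real \<Rightarrow> ('a::euclidean_space \<Rightarrow> real) \<Rightarrow> 'a \<Rightarrow> 'a \<Rightarrow> 'a" where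
  "midpoint_of T Q x y = grad (legendre (Qtilde T Q)) (x + y)"

definition trajectory ::
    "real \<Rightarrow> ('a::euclidean_space \<Rightarrow> real) \<Rightarrow> ('a \<Rightarrow> 'a) \<Rightarrow> 'a \<Rightarrow> real \<Rightarrow> 'a" where
  "trajectory T Q m x = broken_line T x (midpoint_of T Q x (m x)) (m x)"

section \<open>Initial velocity potential\<close>

definition brenier_potential ::
    "'a::euclidean_space measure \<Rightarrow> 'a measure \<Rightarrow> ('a \<Rightarrow> real) \<Rightarrow> bool" where
  "brenier_potential \<mu> \<nu> \<Phi> \<longleftrightarrow> convex_on UNIV \<Phi> \<and> (AE x in \<mu>. \<Phi> differentiable at x) \<and>
     distr \<mu> borel (grad \<Phi>) = \<nu>"

text \<open>\<open>\<nabla>\<phi>(x) = (2/T) (\<nabla>\<Phi>(x) - x)\<close> with \<open>\<Phi>\<close> convex and \<open>\<nabla>\<Phi>\<close> pushing \<open>\<mu>0\<close> to the optimiser of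
  Problem 3.\<close>

definition initial_velocity_potential ::
    "real \<Rightarrow> ('a::euclidean_space \<Rightarrow> real) \<Rightarrow> 'a measure \<Rightarrow> 'a measure \<Rightarrow> ('a \<Rightarrow> real) \<Rightarrow> bool" where
  "initial_velocity_potential T Q \<mu>0 \<mu>T \<phi> \<longleftrightarrow>
     (AE x in \<mu>0. \<phi> differentiable at x) \<and>
     (\<forall>\<rho>. optimal3 T Q \<mu>0 \<mu>T \<rho> \<longrightarrow>
        (\<exists>\<Phi>. brenier_potential \<mu>0 \<rho> \<Phi>) \<and>
        (\<forall>\<Phi>. brenier_potential \<mu>0 \<rho> \<Phi> \<longrightarrow>
           (AE x in \<mu>0. grad \<phi> x = (2/T) *\<^sub>R (grad \<Phi> x - x))))"

text \<open>An optimal \<open>v\<close> is determined only up to \<open>dt \<times> d\<rho>(t)\<close>-null sets, so \<open>v(0, x) = w(x)\<close> is a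
  statement about its initial trace: every optimal \<open>v\<close> has the value \<open>w x\<close> along the
  characteristic \<open>x + t w(x)\<close> for almost every \<open>t\<close> near \<open>0\<close>, and some optimal \<open>v\<close> (the
  representative that is continuous along characteristics) has it for every such \<open>t\<close>, including
  \<open>t = 0\<close>.\<close>

definition initial_velocity1 ::
    "real \<Rightarrow> ('a::euclidean_space \<Rightarrow> real) \<Rightarrow> 'a measure \<Rightarrow> 'a measure \<Rightarrow> ('a \<Rightarrow> 'a) \<Rightarrow> bool" where
  "initial_velocity1 T Q \<mu>0 \<mu>T w \<longleftrightarrow>
     (\<forall>\<rho> v. optimal1 T Q \<mu>0 \<mu>T (\<rho>, v) \<longrightarrow>
        (AE t in lborel. 0 < t \<and> t < T/2 \<longrightarrow> (AE x in \<mu>0. v t (x + t *\<^sub>R w x) = w x))) \<and>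
     (\<exists>\<rho> v. optimal1 T Q \<mu>0 \<mu>T (\<rho>, v) \<and>
        (\<forall>t. 0 \<le> t \<and> t < T/2 \<longrightarrow> (AE x in \<mu>0. v t (x + t *\<^sub>R w x) = w x)))"

end

theory Submission
  imports Defs "HOL-Complex_Analysis.Great_Picard"
begin

text \<open>Completing the square, \<open>|x - z|\<^sup>2/T + |z - y|\<^sup>2/T + Q z\<close> equals
  \<open>(|x|\<^sup>2 + |y|\<^sup>2)/T - (2/T) Qt\<^sup>*(x + y)\<close> plus \<open>2/T\<close> times the Fenchel gap of \<open>Qt\<close> at the pair
  \<open>(z, x + y)\<close>, which vanishes only at \<open>z = DQt\<^sup>*(x + y)\<close>. Eliminating the midpoint \<open>z\<close> thus leaves
  the transport problem with cost \<open>Qt\<^sup>*(x + y)\<close>. Its dual has a minimiser \<open>(\<phi>, \<psi>)\<close> by Arzela--Ascoli, and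
  differentiating the dual functional shows that \<open>m x = DQt (D\<phi> x) - x\<close> transports \<open>\<rho>\<^sub>0\<close> to \<open>\<rho>\<^sub>T\<close>.
  For Problems 1 and 3 the lower bound goes through the weak Kantorovich inequality, which the kinetic
  action satisfies because mollified Hopf--Lax evolutions are admissible test functions; testing it with
  \<open>|z|\<^sup>2/2\<close> minus a conjugate of \<open>\<phi>\<close> or \<open>\<psi>\<close> gives the value, and perturbing this test
  function identifies the measures in the case of equality. Problem 2 is treated curve by curve. An optimal
  velocity field is obtained by inverting \<open>x \<mapsto> (1 - s) x + s D\<phi> x\<close> as the gradient of a conjugate function.\<close>

section \<open>Smooth functions\<close>

text \<open>None of the three problems needs an existence theory of its own. Each functional is
  bounded below by one number, and competitors built from the dual potentials attain it (over C1
  curves only in the limit), so value, existence and uniqueness come from the same inequality. The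
  easy half of Kantorovich duality suffices for this. The obstacle is regularity: competing measures
  are arbitrary elements of \<open>P2\<close>, velocities are only square integrable and potentials
  merely convex. Differentiability almost everywhere is therefore used only for the two given
  densities, and statements at inner times are pulled back to them. Conjugates are taken over the
  compact closures of the domains; this makes them globally Lipschitz and leaves |z|^2/2 as the
  dominating term of the test functions. Laws are read off from the first variation of a supremum:
  \<open>pushforward_envelope\<close> alone gives the image of the optimal map, the law at T/2 and
  the laws at the other inner times. The second half of the evolution is the first one run backwards
  from \<open>\<mu>T\<close> with \<psi>, since the cost is symmetric.\<close>

abbreviation "fder f p \<equiv> frechet_derivative f (at p)"

lemma C_k_SucI:
  assumes "\<And>x. (f has_derivative f' x) (at x)" "\<And>h. C_k k (\<lambda>x. f' x h)"
  shows "C_k (Suc k) f"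
proof -
  have "fder f x = f' x" for x
    using frechet_derivative_at[OF assms(1)] by simp
  then show ?thesis
    using assms by (auto simp: differentiable_on_def differentiable_def)
qed

lemma C_k_Suc_has_derivative:
  "C_k (Suc k) f \<Longrightarrow> (f has_derivative fder f x) (at x)"
  by (auto simp: differentiable_on_def frechet_derivative_works)

lemma C_k_SucD: "C_k (Suc k) f \<Longrightarrow> C_k k f"
proof (induction k arbitrary: f)
  case 0
  then show ?case by (auto intro: differentiable_imp_continuous_on)
next
  case (Suc k)
  then show ?case by (metis C_k.simps(2))
qed

lemma C_k_continuous: "C_k k f \<Longrightarrow> continuous_on UNIV f"
  by (cases k) (auto intro: differentiable_imp_continuous_on)

lemma C_k_const [simp]: "C_k k (\<lambda>x. c)"
proof (induction k arbitrary: c)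
  case (Suc k)
  show ?case by (rule C_k_SucI[where f' = "\<lambda>_ _. 0"]) (auto simp: Suc)
qed simp

lemma C_k_bounded_linear: "bounded_linear f \<Longrightarrow> C_k k f"
proof (cases k)
  case (Suc m)
  assume f: "bounded_linear f"
  show ?thesis unfolding Suc
    by (rule C_k_SucI[where f' = "\<lambda>_. f"]) (auto intro: bounded_linear_imp_has_derivative f)
qed (auto intro: linear_continuous_on)

lemma C_k_add: "C_k k f \<Longrightarrow> C_k k g \<Longrightarrow> C_k k (\<lambda>x. f x + g x)"
proof (induction k arbitrary: f g)
  case (Suc k)
  show ?case
    by (rule C_k_SucI[OF has_derivative_add[OF C_k_Suc_has_derivative C_k_Suc_has_derivative]])
      (use Suc in auto)
qed (auto intro: continuous_intros)

lemma C_k_mult: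
  fixes f g :: "'a::real_normed_vector \<Rightarrow> real"
  shows "C_k k f \<Longrightarrow> C_k k g \<Longrightarrow> C_k k (\<lambda>x. f x * g x)"
proof (induction k arbitrary: f g)
  case (Suc k)
  show ?case
    by (rule C_k_SucI[OF has_derivative_mult[OF C_k_Suc_has_derivative C_k_Suc_has_derivative]])
      (use Suc.prems C_k_SucD[OF Suc.prems(1)] C_k_SucD[OF Suc.prems(2)] Suc.IH in \<open>auto intro!: C_k_add\<close>)
qed (auto intro: continuous_intros)

lemma C_k_compose_linear:
  assumes "bounded_linear l" shows "C_k k f \<Longrightarrow> C_k k (\<lambda>x. f (l x))"
proof (induction k arbitrary: f)
  case 0
  then show ?case
    using continuous_on_compose2[of UNIV f UNIV l] linear_continuous_on[OF assms] by auto
next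
  case (Suc k)
  show ?case
    by (rule C_k_SucI[OF has_derivative_compose[OF bounded_linear_imp_has_derivative[OF assms]
            C_k_Suc_has_derivative]]) (use Suc in auto)
qed

text \<open>The outer function comes with the whole sequence of its derivatives, because the
  derivative of \<open>b j (q x)\<close> contains \<open>b (Suc j) (q x)\<close> and the induction
  has to move along the sequence.\<close>

lemma C_k_compose_real:
  fixes b :: "nat \<Rightarrow> real \<Rightarrow> real"
  assumes b: "\<And>j t. (b j has_real_derivative b (Suc j) t) (at t)" and q: "\<And>k. C_k k q"
  shows "C_k k (\<lambda>x. b j (q x))"
proof (induction k arbitrary: j)
  case 0
  have "continuous_on UNIV (b j)"
    using b DERIV_isCont by (metis continuous_at_imp_continuous_on)
  then show ?case using q[of 0] by (auto intro: continuous_on_compose2)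
next
  case (Suc k)
  have *: "((\<lambda>x. b j (q x)) has_derivative (\<lambda>h. b (Suc j) (q x) * fder q x h)) (at x)" for x
    using has_derivative_compose[OF C_k_Suc_has_derivative[OF q[of "Suc 0"]]
        b[unfolded has_field_derivative_def]] .
  show ?case
    by (rule C_k_SucI[OF *]) (use Suc q[of "Suc k"] in \<open>auto intro!: C_k_mult\<close>)
qed

lemma C_k_inner_self: "C_k k (\<lambda>x::'a::real_inner. x \<bullet> x)"
proof (cases k)
  case (Suc m)
  have "((\<lambda>x::'a. x \<bullet> x) has_derivative (\<lambda>h. 2 * (x \<bullet> h))) (at x)" for x
    by (auto intro!: derivative_eq_intros simp: inner_commute)
  then show ?thesis unfolding Suc
    by (rule C_k_SucI) (intro C_k_bounded_linear bounded_linear_mult_right[THEN bounded_linear_compose] bounded_linear_inner_left)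
qed (auto intro: continuous_intros)

subsection \<open>Mollification\<close>

text \<open>The classical flat function exp(-1/t). The polynomial in 1/t in front makes the family
  closed under differentiation, so that one argument at t = 0 serves all orders.\<close>

definition flat_exp :: "real poly \<Rightarrow> real \<Rightarrow> real" where
  "flat_exp P t = (if t > 0 then poly P (1/t) * exp (- 1/t) else 0)"

lemma tendsto_poly_exp_0: "((\<lambda>u::real. poly P u * exp (- u)) \<longlongrightarrow> 0) at_top"
proof (induction P)
  case 0 then show ?case by simp
next
  case (pCons a P)
  have A: "((\<lambda>u::real. a * (u^0 / exp u)) \<longlongrightarrow> a * 0) at_top"
    by (intro tendsto_intros tendsto_power_div_exp_0)
  have B: "((\<lambda>u::real. u * poly P u * exp (- u)) \<longlongrightarrow> 0) at_top"
  proof -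
    have "((\<lambda>u::real. \<Sum>i\<le>degree P. coeff P i * (u ^ Suc i / exp u)) \<longlongrightarrow> (\<Sum>i\<le>degree P. coeff P i * 0)) at_top"
      by (intro tendsto_intros tendsto_power_div_exp_0)
    moreover have "(\<Sum>i\<le>degree P. coeff P i * (u ^ Suc i / exp u)) = u * poly P u * exp (- u)" for u :: real
      unfolding poly_altdef sum_distrib_left sum_distrib_right
      by (intro sum.cong) (auto simp: exp_minus field_simps)
    ultimately show ?thesis by simp
  qed
  show ?case using tendsto_add[OF A B] by (simp add: exp_minus field_simps)
qed

text \<open>With u = 1/t the derivative of P(u) exp(-u) with respect to t is u^2 (P(u) - P'(u))
  exp(-u), since du/dt = -u^2.\<close>

definition flat_deriv :: "real poly \<Rightarrow> real poly" where
  "flat_deriv P = [:0, 0, 1:] * (P - pderiv P)"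

lemma flat_exp_DERIV: "(flat_exp P has_real_derivative flat_exp (flat_deriv P) t) (at t)"
proof -
  consider "t > 0" | "t < 0" | "t = 0" by linarith
  then show ?thesis
  proof cases
    case 1
    have "((\<lambda>t. poly P (1/t) * exp (- 1/t)) has_real_derivative flat_exp (flat_deriv P) t) (at t)"
      using 1 by (auto intro!: derivative_eq_intros DERIV_compose_FDERIV poly_DERIV
          simp: flat_exp_def flat_deriv_def field_simps power2_eq_square)
    moreover have "eventually (\<lambda>s. flat_exp P s = poly P (1/s) * exp (- 1/s)) (nhds t)"
      by (rule eventually_nhds_in_open[of "{0<..}", THEN eventually_mono]) (use 1 in \<open>auto simp: flat_exp_def\<close>)
    ultimately show ?thesis using 1 by (subst DERIV_cong_ev[OF refl _ refl]) auto
  next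
    case 2
    have "eventually (\<lambda>s. flat_exp P s = 0) (nhds t)"
      by (rule eventually_nhds_in_open[of "{..<0}", THEN eventually_mono]) (use 2 in \<open>auto simp: flat_exp_def\<close>)
    then show ?thesis using 2 by (subst DERIV_cong_ev[OF refl _ refl]) (auto simp: flat_exp_def)
  next
    case 3
    have R: "((\<lambda>h. flat_exp P h / h) \<longlongrightarrow> 0) (at_right 0)"
    proof (rule filterlim_cong[THEN iffD1, OF refl refl])
      \<comment> \<open>\<open>pCons 0 P\<close> multiplies by its argument 1/h and thereby absorbs
        the division by h in the difference quotient at 0.\<close>
      show "((\<lambda>h. poly (pCons 0 P) (inverse h) * exp (- inverse h)) \<longlongrightarrow> 0) (at_right (0::real))"
        by (rule filterlim_compose[OF tendsto_poly_exp_0 filterlim_inverse_at_top_right])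
      show "\<forall>\<^sub>F h in at_right 0. poly (pCons 0 P) (inverse h) * exp (- inverse h) = flat_exp P h / h"
        by (auto simp: eventually_at_filter flat_exp_def field_simps intro!: always_eventually)
    qed
    have L: "((\<lambda>h. flat_exp P h / h) \<longlongrightarrow> 0) (at_left 0)"
      by (rule tendsto_eventually) (auto simp: eventually_at_filter flat_exp_def intro!: always_eventually)
    have "((\<lambda>h. flat_exp P h / h) \<longlongrightarrow> 0) (at 0)"
      using L R by (simp add: filterlim_split_at)
    then show ?thesis using 3 by (simp add: DERIV_def flat_exp_def)
  qed
qed

lemma C_k_flat_exp_compose: "(\<And>k. C_k k q) \<Longrightarrow> C_k k (\<lambda>x. flat_exp P (q x))"
  using C_k_compose_real[of "\<lambda>j. flat_exp ((flat_deriv ^^ j) P)" q k 0] flat_exp_DERIV by simp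

text \<open>The argument is built from the inner square and not from the norm, which is not
  differentiable at the origin.\<close>

definition bump :: "real \<Rightarrow> 'a::euclidean_space \<Rightarrow> real" where
  "bump e x = flat_exp 1 (e^2 - x \<bullet> x)"

lemma C_k_bump: "C_k k (bump e)"
  unfolding bump_def
proof (rule C_k_flat_exp_compose)
  show "C_k k (\<lambda>x::'a. e^2 - x \<bullet> x)" for k
    using C_k_add[OF C_k_const C_k_mult[OF C_k_const C_k_inner_self], of k "e^2" "-1"] by simp
qed

lemma bump_nonneg: "bump e x \<ge> 0" by (simp add: bump_def flat_exp_def)
lemma bump_pos: "norm x < e \<Longrightarrow> bump e x > 0"
  by (auto simp: bump_def flat_exp_def power2_norm_eq_inner[symmetric] intro!: power_strict_mono)
lemma bump_eq_0: "e \<ge> 0 \<Longrightarrow> norm x \<ge> e \<Longrightarrow> bump e x = 0"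
  by (auto simp: bump_def flat_exp_def dot_square_norm dest: power2_less_imp_less)

lemma continuous_bump: "continuous_on UNIV (bump e)" using C_k_bump[of 0] by simp

lemma integrable_compact_support:
  fixes f :: "'a::euclidean_space \<Rightarrow> real"
  assumes "continuous_on UNIV f" "\<And>x. norm x > e \<Longrightarrow> f x = 0"
  shows "integrable lborel f"
proof -
  have "integrable lborel (\<lambda>x. indicator (cball 0 e) x *\<^sub>R f x)"
    by (rule borel_integrable_compact) (auto intro: continuous_on_subset[OF assms(1)])
  moreover have "(\<lambda>x. indicator (cball 0 e) x *\<^sub>R f x) = f"
    using assms(2) by (auto simp: indicator_def fun_eq_iff)
  ultimately show ?thesis by simp
qed

lemma integrable_bump: "e \<ge> 0 \<Longrightarrow> integrable lborel (bump e)"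
  by (rule integrable_compact_support[where e=e]) (auto simp: continuous_bump bump_eq_0)

lemma integral_bump_pos: "e > 0 \<Longrightarrow> integral\<^sup>L lborel (bump e :: 'a::euclidean_space \<Rightarrow> real) > 0"
proof (rule ccontr)
  assume e: "e > 0" and "\<not> ?thesis"
  then have "integral\<^sup>L lborel (bump e :: 'a \<Rightarrow> real) = 0"
    using Bochner_Integration.integral_nonneg[of lborel "bump e :: 'a \<Rightarrow> real", OF bump_nonneg] by linarith
  then have "AE x::'a in lborel. bump e x = 0"
    by (subst (asm) integral_nonneg_eq_0_iff_AE) (use e in \<open>auto simp: integrable_bump bump_nonneg\<close>)
  then have "AE x::'a in lborel. x \<notin> ball 0 e"
    by eventually_elim (use bump_pos in force)
  then have "emeasure lborel (ball (0::'a) e) = 0"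
    by (subst (asm) AE_iff_measurable[of "ball 0 e"]) auto
  then have "measure lborel (ball (0::'a) e) = 0" by (simp add: measure_def)
  then show False using content_ball_pos[OF e, of "0::'a"] by simp
qed

definition mollifier :: "real \<Rightarrow> 'a::euclidean_space \<Rightarrow> real" where
  "mollifier e x = bump e x / integral\<^sup>L lborel (bump e :: 'a \<Rightarrow> real)"

text \<open>The shift acts on f, so inequalities between translates of f survive by integration;
  \<open>mollify_conv\<close> moves the shift to the kernel when a derivative is wanted.\<close>

definition mollify :: "real \<Rightarrow> ('a::euclidean_space \<Rightarrow> real) \<Rightarrow> 'a \<Rightarrow> real" where
  "mollify e f p = (\<integral>q. f (p + q) * mollifier e q \<partial>lborel)"

lemma C_k_mollifier: "C_k k (mollifier e)"
  using C_k_mult[OF C_k_bump C_k_const, of k e "1 / integral\<^sup>L lborel (bump e :: 'a \<Rightarrow> real)"]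
  by (simp add: mollifier_def[abs_def])

lemma mollifier_props:
  fixes x :: "'a::euclidean_space"
  assumes "e > 0"
  shows mollifier_nonneg: "mollifier e x \<ge> 0"
    and mollifier_eq_0: "norm x \<ge> e \<Longrightarrow> mollifier e x = 0"
    and integrable_mollifier: "integrable lborel (mollifier e :: 'a \<Rightarrow> real)"
    and integral_mollifier: "integral\<^sup>L lborel (mollifier e :: 'a \<Rightarrow> real) = 1"
  using assms integral_bump_pos[OF assms, where 'a='a]
  by (auto simp: mollifier_def[abs_def] bump_nonneg bump_eq_0 integrable_bump)

lemma continuous_mollifier: "continuous_on UNIV (mollifier e)"
  using C_k_mollifier[of 0] by simp

lemma integrable_mollify:
  assumes "e > 0" "continuous_on UNIV f"
  shows "integrable lborel (\<lambda>q. f (p + q) * mollifier e q)"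
  by (rule integrable_compact_support[where e=e])
    (auto intro!: continuous_intros continuous_mollifier continuous_on_compose2[OF assms(2)]
       simp: mollifier_eq_0[OF assms(1)])

text \<open>The two base points may differ. This is what carries Lipschitz bounds and the
  finite-difference form of the Hamilton--Jacobi inequality over to mollifications.\<close>

lemma mollify_mono:
  assumes e: "e > 0" and f: "continuous_on UNIV f" and g: "continuous_on UNIV g"
    and le: "\<And>q. norm q < e \<Longrightarrow> f (p + q) \<le> g (p' + q) + B"
  shows "mollify e f p \<le> mollify e g p' + B"
proof -
  have "mollify e f p \<le> (\<integral>q. g (p' + q) * mollifier e q + B * mollifier e q \<partial>lborel)"
    unfolding mollify_def
  proof (rule integral_mono)
    show "integrable lborel (\<lambda>q. f (p + q) * mollifier e q)" by (rule integrable_mollify[OF e f])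
    show "integrable lborel (\<lambda>q. g (p' + q) * mollifier e q + B * mollifier e q)"
      by (intro Bochner_Integration.integrable_add integrable_mult_right integrable_mollify integrable_mollifier e g)
    fix q show "f (p + q) * mollifier e q \<le> g (p' + q) * mollifier e q + B * mollifier e q"
      using le[of q] mollifier_eq_0[OF e, of q] mollifier_nonneg[OF e, of q]
      by (cases "norm q < e") (auto simp: distrib_right[symmetric] intro!: mult_right_mono)
  qed
  also have "\<dots> = mollify e g p' + B"
    by (simp add: mollify_def integrable_mollify e f g integrable_mollifier integral_mollifier)
  finally show ?thesis .
qed

lemma mollify_const: "e > 0 \<Longrightarrow> mollify e (\<lambda>_. c) p = c"
  by (simp add: mollify_def integral_mollifier)

lemma mollify_le:
  assumes "e > 0" "continuous_on UNIV f" "\<And>q. norm q < e \<Longrightarrow> f (p + q) \<le> B"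
  shows "mollify e f p \<le> B"
  using mollify_mono[of e f "\<lambda>_. B" p p 0] assms by (simp add: mollify_const)

lemma mollify_ge:
  assumes "e > 0" "continuous_on UNIV f" "\<And>q. norm q < e \<Longrightarrow> B \<le> f (p + q)"
  shows "B \<le> mollify e f p"
  using mollify_mono[of e "\<lambda>_. B" f p p 0] assms by (simp add: mollify_const)

lemma mollify_conv:
  fixes f :: "'a::euclidean_space \<Rightarrow> real"
  assumes e: "e > 0" and f: "continuous_on UNIV f"
  shows "mollify e f p = (\<integral>q. f q * mollifier e (q - p) \<partial>lborel)"
proof -
  have [measurable]: "f \<in> borel_measurable borel" "(mollifier e :: 'a \<Rightarrow> real) \<in> borel_measurable borel"
    by (auto intro!: borel_measurable_continuous_onI f continuous_mollifier)
  have "(\<integral>q. f q * mollifier e (q - p) \<partial>lborel) = (\<integral>q. f q * mollifier e (q - p) \<partial>(distr lborel borel ((+) p)))"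
    by (simp add: lborel_distr_plus)
  also have "\<dots> = mollify e f p"
    by (subst integral_distr) (auto simp: mollify_def)
  finally show ?thesis by simp
qed

text \<open>All derivatives fall on the kernel, so f need only be continuous. The Leibniz rule works
  on a box; hence the integral is first cut down to a box containing the supports of all kernels
  centred within distance 1 of p, which explains the radius e + 1.\<close>

lemma convolution_has_derivative:
  fixes f k :: "'a::euclidean_space \<Rightarrow> real"
  assumes f: "continuous_on UNIV f"
    and k: "\<And>j. C_k j k" and k0: "\<And>x. norm x > e \<Longrightarrow> k x = 0"
  shows "((\<lambda>p. \<integral>q. f q * k (q - p) \<partial>lborel) has_derivative
       (\<lambda>h. \<integral>q. f q * fder k (q - p) (- h) \<partial>lborel)) (at p)"
proof -
  have dk: "(k has_derivative fder k x) (at x)" for x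
    using C_k_Suc_has_derivative k by blast
  have dk0: "fder k x h = 0" if "norm x > e" for x h
  proof -
    have "eventually (\<lambda>y. k y = 0) (nhds x)"
      by (rule eventually_nhds_in_open[of "- cball 0 e", THEN eventually_mono])
        (use that k0 in auto)
    then have "(k has_derivative (\<lambda>_. 0)) (at x)"
      using k0[OF that] by (intro has_derivative_transform_eventually[OF has_derivative_const[of 0]])
       (auto simp: eventually_at_filter elim: eventually_mono)
    then show ?thesis using frechet_derivative_at by metis
  qed
  define D where "D x = Blinfun (fder k x)" for x
  have D: "blinfun_apply (D x) = fder k x" for x
    unfolding D_def using dk by (intro bounded_linear_Blinfun_apply has_derivative_bounded_linear)
  have contD: "continuous_on UNIV D"
    by (rule continuous_on_blinfun_componentwise) (use k[of "Suc 0"] in \<open>auto simp: D\<close>)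
  obtain b where b: "ball p (e + 1) \<subseteq> cbox (-b) b" 
    using bounded_subset_cbox_symmetric[OF bounded_ball] by metis
  have vanish: "norm (q - x) > e" if "x \<in> ball p 1" "q \<notin> cbox (-b) b" for x q
  proof -
    have "q \<notin> ball p (e + 1)" using b that by auto
    then have "norm (q - p) \<ge> e + 1" by (simp add: dist_norm norm_minus_commute)
    moreover have "norm (q - p) \<le> norm (q - x) + norm (x - p)"
      using norm_triangle_ineq[of "q - x" "x - p"] by simp
    ultimately show ?thesis using that by (simp add: dist_norm norm_minus_commute)
  qed
  have conv: "(\<integral>q. f q * g (q - x) \<partial>lborel) = integral (cbox (-b) b) (\<lambda>q. f q * g (q - x))"
    if x: "x \<in> ball p 1" and g: "continuous_on UNIV g" "\<And>x. norm x > e \<Longrightarrow> g x = 0" for x and g :: "'a \<Rightarrow> real"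
  proof -
    have "(\<integral>q. f q * g (q - x) \<partial>lborel) = (LINT q:cbox (-b) b|lborel. f q * g (q - x))"
      unfolding set_lebesgue_integral_def
      by (rule Bochner_Integration.integral_cong) (use vanish[OF x] g in \<open>auto simp: indicator_def\<close>)
    also have "\<dots> = integral (cbox (-b) b) (\<lambda>q. f q * g (q - x))"
      by (intro set_borel_integral_eq_integral(2) borel_integrable_compact[folded set_integrable_def]
         continuous_intros continuous_on_compose2[OF g(1)] continuous_on_subset[OF f]) auto
    finally show ?thesis .
  qed
  have contk: "continuous_on UNIV k" using k C_k_continuous by blast
  have contdk: "continuous_on UNIV (\<lambda>x. fder k x h)" for h
    using k[of "Suc 0"] by simp
  let ?D' = "\<lambda>x q. f q *\<^sub>R (D (q - x) o\<^sub>L (- id_blinfun))"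
  have contD': "continuous_on (ball p 1 \<times> cbox (-b) b) (\<lambda>(x, q). ?D' x q)"
    unfolding split_beta
    by (intro continuous_intros continuous_on_compose2[OF contD] continuous_on_compose2[OF f]) auto
  have "((\<lambda>x. integral (cbox (-b) b) (\<lambda>q. f q * k (q - x))) has_derivative
     integral (cbox (-b) b) (?D' p)) (at p within ball p 1)"
  proof (rule leibniz_rule[OF _ _ contD'])
    fix x q
    have "((\<lambda>x. k (q - x)) has_derivative (\<lambda>h. fder k (q - x) (- h))) (at x within ball p 1)"
      by (rule has_derivative_compose[OF _ dk]) (auto intro!: derivative_eq_intros)
    moreover have "blinfun_apply (?D' x q) = (\<lambda>h. f q * fder k (q - x) (- h))"
      by (rule ext) (simp add: D blinfun.bilinear_simps)
    ultimately show "((\<lambda>x. f q * k (q - x)) has_derivative blinfun_apply (?D' x q)) (at x within ball p 1)"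
      by (simp add: has_derivative_mult_right)
  next
    show "(\<lambda>q. f q * k (q - x)) integrable_on cbox (-b) b" for x
      by (intro integrable_continuous continuous_intros continuous_on_compose2[OF contk] continuous_on_subset[OF f]) auto
  qed auto
  then have "((\<lambda>x. integral (cbox (-b) b) (\<lambda>q. f q * k (q - x))) has_derivative
     integral (cbox (-b) b) (?D' p)) (at p)"
    by (subst (asm) at_within_open) auto
  then have "((\<lambda>x. \<integral>q. f q * k (q - x) \<partial>lborel) has_derivative
     integral (cbox (-b) b) (?D' p)) (at p)"
    by (rule has_derivative_transform_within_open[of _ _ _ _ "ball p 1"])
      (auto simp: conv[OF _ contk k0])
  moreover have "blinfun_apply (integral (cbox (-b) b) (?D' p)) =
      (\<lambda>h. \<integral>q. f q * fder k (q - p) (- h) \<partial>lborel)"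
  proof
    fix h
    have "blinfun_apply (integral (cbox (-b) b) (?D' p)) h = integral (cbox (-b) b) (\<lambda>q. blinfun_apply (?D' p q) h)"
      by (rule blinfun_apply_integral)
        (intro integrable_continuous continuous_on_compose2[OF contD'[unfolded split_beta], of _ "\<lambda>q. (p, q)", simplified] continuous_intros, auto)
    also have "\<dots> = (\<integral>q. f q * fder k (q - p) (- h) \<partial>lborel)"
      using conv[OF _ contdk dk0, of p "- h"] by (simp add: D blinfun.bilinear_simps)
    finally show "blinfun_apply (integral (cbox (-b) b) (?D' p)) h = \<dots>" .
  qed
  ultimately show ?thesis by simp
qed

lemma frechet_derivative_eq_0_outside:
  fixes k :: "'a::real_normed_vector \<Rightarrow> real"
  assumes "closed S" "\<And>x. x \<notin> S \<Longrightarrow> k x = 0" "x \<notin> S"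
  shows "fder k x = (\<lambda>_. 0)"
proof -
  have "(k has_derivative (\<lambda>_. 0)) (at x)"
    by (rule has_derivative_transform_within_open[OF has_derivative_const[of 0], of "- S"]) (use assms in auto)
  then show ?thesis using frechet_derivative_at by metis
qed

text \<open>The kernel is generalised in the induction because the derivative of a convolution is
  the convolution with a derivative of the kernel, whose support is no larger.\<close>

lemma C_k_convolution:
  fixes f k :: "'a::euclidean_space \<Rightarrow> real"
  assumes f: "continuous_on UNIV f"
  shows "(\<And>j. C_k j k) \<Longrightarrow> (\<And>x. norm x > e \<Longrightarrow> k x = 0) \<Longrightarrow>
     C_k n (\<lambda>p. \<integral>q. f q * k (q - p) \<partial>lborel)"
proof (induction n arbitrary: k)
  case 0
  then show ?case
    using convolution_has_derivative[OF f 0] has_derivative_continuous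
    by (fastforce simp: continuous_on_eq_continuous_at)
next
  case (Suc n)
  show ?case
  proof (rule C_k_SucI[OF convolution_has_derivative[OF f Suc.prems]])
    fix h
    have "fder k x (- h) = - fder k x h" for x
      using C_k_Suc_has_derivative[OF Suc.prems(1)] has_derivative_linear linear_neg by blast
    then have "C_k j (\<lambda>x. fder k x (- h))" for j
      using Suc.prems(1)[of "Suc j"] C_k_mult[OF C_k_const[of j "-1"], of "\<lambda>x. fder k x h"] by simp
    moreover have "fder k x = (\<lambda>_. 0)" if "norm x > e" for x
      by (rule frechet_derivative_eq_0_outside[OF closed_cball[of 0 e]]) (use Suc.prems(2) that in auto)
    ultimately show "C_k n (\<lambda>p. \<integral>q. f q * fder k (q - p) (- h) \<partial>lborel)"
      by (intro Suc.IH) simp_all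
  qed
qed

lemma C_k_mollify:
  assumes e: "e > 0" and f: "continuous_on UNIV f"
  shows "C_k n (mollify e f)"
proof -
  have "C_k n (\<lambda>p. \<integral>q. f q * mollifier e (q - p) \<partial>lborel)"
    by (rule C_k_convolution[OF f C_k_mollifier, of e]) (simp add: mollifier_eq_0[OF e])
  moreover have "mollify e f = (\<lambda>p. \<integral>q. f q * mollifier e (q - p) \<partial>lborel)"
    using mollify_conv[OF e f] by auto
  ultimately show ?thesis by simp
qed

lemma has_derivative_directional:
  fixes f :: "'a::real_normed_vector \<Rightarrow> real"
  assumes f: "(f has_derivative f') (at p)"
  shows "((\<lambda>s. (f (p + s *\<^sub>R h) - f p) / s) \<longlongrightarrow> f' h) (at 0)"
proof -
  have "((\<lambda>s. p + s *\<^sub>R h) has_derivative (\<lambda>s. s *\<^sub>R h)) (at 0)"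
    by (auto intro!: derivative_eq_intros)
  from has_derivative_compose[OF this, of f f']
  have "((\<lambda>s. f (p + s *\<^sub>R h)) has_derivative (\<lambda>s. f' (s *\<^sub>R h))) (at 0)"
    using f by simp
  moreover have "(\<lambda>s. f' (s *\<^sub>R h)) = (*) (f' h)"
    using linear_scale[OF has_derivative_linear[OF f]] by (auto simp: mult.commute)
  ultimately have "((\<lambda>s. f (p + s *\<^sub>R h)) has_real_derivative f' h) (at 0)"
    by (simp add: has_field_derivative_def)
  then show ?thesis by (simp add: DERIV_def)
qed

text \<open>Only increments in one direction and of one sign of s are compared. This recovers a
  pointwise differential inequality from its finite-difference form.\<close>

lemma has_derivative_le:
  fixes f :: "'a::real_normed_vector \<Rightarrow> real"
  assumes f: "(f has_derivative f') (at p)"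
    and le: "\<And>s. 0 < s \<Longrightarrow> s < d \<Longrightarrow> f (p + s *\<^sub>R h) \<le> f p + s * B" and d: "d > 0"
  shows "f' h \<le> B"
proof -
  have "((\<lambda>s. (f (p + s *\<^sub>R h) - f p) / s) \<longlongrightarrow> f' h) (at_right 0)"
    using has_derivative_directional[OF f] by (rule tendsto_mono[rotated]) (simp add: at_le)
  moreover have "eventually (\<lambda>s. (f (p + s *\<^sub>R h) - f p) / s \<le> B) (at_right 0)"
    unfolding eventually_at_right_field
    by (rule exI[of _ d]) (use le d in \<open>auto simp: field_simps\<close>)
  ultimately show ?thesis by (intro tendsto_upperbound) auto
qed

section \<open>Convex functions\<close>

lemma GDERIV_unique: "GDERIV f x :> D \<Longrightarrow> GDERIV f x :> D' \<Longrightarrow> D = D'"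
proof -
  assume "GDERIV f x :> D" "GDERIV f x :> D'"
  then have "(\<lambda>h. h \<bullet> D) = (\<lambda>h. h \<bullet> D')"
    unfolding gderiv_def by (rule has_derivative_unique)
  then have "h \<bullet> D = h \<bullet> D'" for h by metis
  then have "(D - D') \<bullet> (D - D') = 0" by (metis inner_diff_right right_minus_eq)
  then show ?thesis by simp
qed

lemma grad_eq: "GDERIV f x :> D \<Longrightarrow> grad f x = D"
  unfolding grad_def using GDERIV_unique by (intro the_equality)

lemma differentiable_GDERIV:
  fixes f :: "'a::euclidean_space \<Rightarrow> real"
  assumes "f differentiable at x" shows "GDERIV f x :> grad f x"
proof -
  obtain f' where f': "(f has_derivative f') (at x)" using assms by (auto simp: differentiable_def)
  then interpret f': linear f' by (rule has_derivative_linear)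
  have "f' h = h \<bullet> (\<Sum>b\<in>Basis. f' b *\<^sub>R b)" for h
  proof -
    have "f' h = f' (\<Sum>b\<in>Basis. (h \<bullet> b) *\<^sub>R b)" by (simp add: euclidean_representation)
    also have "\<dots> = (\<Sum>b\<in>Basis. (h \<bullet> b) * f' b)" by (simp add: f'.sum f'.scale)
    finally show ?thesis by (simp add: inner_sum_right mult.commute)
  qed
  then have "f' = (\<lambda>h. h \<bullet> (\<Sum>b\<in>Basis. f' b *\<^sub>R b))" by (rule ext)
  then have "GDERIV f x :> (\<Sum>b\<in>Basis. f' b *\<^sub>R b)" using f' by (simp add: gderiv_def)
  then show ?thesis using grad_eq by metis
qed

lemma GDERIV_differentiable: "GDERIV f x :> D \<Longrightarrow> f differentiable at x"
  by (auto simp: gderiv_def differentiable_def)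

lemma GDERIV_bound:
  assumes "GDERIV f x :> D" "e > 0"
  obtains d where "d > 0" "\<And>y. norm (y - x) < d \<Longrightarrow> \<bar>f y - f x - (y - x) \<bullet> D\<bar> \<le> e * norm (y - x)"
proof -
  have "\<exists>d>0. \<forall>y. norm (y - x) < d \<longrightarrow> norm (f y - f x - (y - x) \<bullet> D) \<le> e * norm (y - x)"
    using assms unfolding gderiv_def has_derivative_at_alt by blast
  then show ?thesis using that by auto
qed

text \<open>Envelope principle in quantitative form: an affine minorant of \<open>f\<close> near \<open>x\<close> whose slope is
  bounded away from the gradient stays uniformly below \<open>f x\<close> at \<open>x\<close>.\<close>

lemma slope_gap:
  fixes f :: "'a::euclidean_space \<Rightarrow> real"
  assumes f: "GDERIV f x :> D" and U: "open U" "x \<in> U" and \<delta>: "\<delta> > 0"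
  obtains \<kappa> where "\<kappa> > 0"
    "\<And>F p. (\<And>y. y \<in> U \<Longrightarrow> F + p \<bullet> (y - x) \<le> f y) \<Longrightarrow> norm (p - D) \<ge> \<delta> \<Longrightarrow> F \<le> f x - \<kappa>"
proof -
  obtain d where d: "d > 0" "\<And>y. norm (y - x) < d \<Longrightarrow> \<bar>f y - f x - (y - x) \<bullet> D\<bar> \<le> \<delta> / 2 * norm (y - x)"
    using GDERIV_bound[OF f, of "\<delta>/2"] \<delta> by auto
  obtain r0 where r0: "r0 > 0" "ball x r0 \<subseteq> U" using U by (meson openE)
  define r where "r = min d r0 / 2"
  have r: "r > 0" "r < d" "r < r0" using d r0 by (auto simp: r_def)
  show ?thesis
  proof (rule that[of "r * \<delta> / 2"])
    show "r * \<delta> / 2 > 0" using r \<delta> by simp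
    fix F p assume F: "\<And>y. y \<in> U \<Longrightarrow> F + p \<bullet> (y - x) \<le> f y" and p: "norm (p - D) \<ge> \<delta>"
    \<comment> \<open>Along u the minorant outruns the tangent of f by r |p - D| \<ge> r \<delta>,
      whereas the remainder of f makes up for at most r \<delta> / 2.\<close>
    define u where "u = (p - D) /\<^sub>R norm (p - D)"
    have pD: "norm (p - D) > 0" using p \<delta> by linarith
    have u: "norm u = 1" "(p - D) \<bullet> u = norm (p - D)"
      using pD by (auto simp: u_def dot_square_norm power2_eq_square)
    have "F + p \<bullet> (r *\<^sub>R u) \<le> f (x + r *\<^sub>R u)"
      using F[of "x + r *\<^sub>R u"] r r0(2) u by (auto simp: subset_eq dist_norm)
    moreover have "f (x + r *\<^sub>R u) - f x - (r *\<^sub>R u) \<bullet> D \<le> \<delta> / 2 * r"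
      using abs_le_D1[OF d(2)[of "x + r *\<^sub>R u"]] r u by auto
    moreover have "p \<bullet> (r *\<^sub>R u) - (r *\<^sub>R u) \<bullet> D = r * norm (p - D)"
      by (simp add: inner_diff_left inner_commute algebra_simps flip: u(2))
    moreover have "r * norm (p - D) \<ge> r * \<delta>" using p r by simp
    moreover have "\<delta> / 2 * r = r * \<delta> / 2" "r * \<delta> = 2 * (r * \<delta> / 2)" by auto
    ultimately show "F \<le> f x - r * \<delta> / 2" by linarith
  qed
qed

text \<open>The qualitative case of \<open>slope_gap\<close>, with \<delta> the distance between p
  and D. It turns equality in inequalities of Fenchel type into a formula for the contact
  point.\<close>

lemma slope_eq_gradient:
  fixes f :: "'a::euclidean_space \<Rightarrow> real"
  assumes f: "GDERIV f x :> D" and U: "open U" "x \<in> U" and le: "\<And>y. y \<in> U \<Longrightarrow> f x + p \<bullet> (y - x) \<le> f y"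
  shows "p = D"
proof (rule ccontr)
  assume "p \<noteq> D"
  then have "norm (p - D) > 0" by simp
  then show False
  proof (rule slope_gap[OF f U])
    fix \<kappa> :: real assume "\<kappa> > 0" and
      "\<And>F q. (\<And>y. y \<in> U \<Longrightarrow> F + q \<bullet> (y - x) \<le> f y) \<Longrightarrow> norm (q - D) \<ge> norm (p - D) \<Longrightarrow> F \<le> f x - \<kappa>"
    from this(2)[OF le] this(1) show False by simp
  qed
qed

subsection \<open>Strongly convex functions and their Legendre transform\<close>

text \<open>First-order form of the Hessian bound. The hypothesis on second derivatives is converted
  into it once, in \<open>strongly_convex_hessian\<close>.\<close>

locale strongly_convex =
  fixes f :: "'a::euclidean_space \<Rightarrow> real" and \<epsilon> :: real
  assumes eps: "\<epsilon> > 0"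
    and gderiv: "GDERIV f x :> grad f x"
    and cont_grad: "continuous_on UNIV (grad f)"
    and strong: "f y \<ge> f x + grad f x \<bullet> (y - x) + \<epsilon> / 2 * (norm (y - x))^2"
begin

lemma continuous: "continuous_on S f"
  by (intro continuous_at_imp_continuous_on ballI has_derivative_continuous[OF gderiv[unfolded gderiv_def]])

lemma maximiser_exists: "\<exists>z. \<forall>w. p \<bullet> w - f w \<le> p \<bullet> z - f z"
proof -
  \<comment> \<open>Beyond this radius the quadratic term beats the linear one, so the maximisation
    can be restricted to a ball: w = 0 does at least as well as any point outside.\<close>
  define R where "R = 2 * norm (p - grad f 0) / \<epsilon>"
  have far: "p \<bullet> w - f w \<le> - f 0" if "norm w \<ge> R" for w
  proof -
    have "p \<bullet> w - f w \<le> - f 0 + (p - grad f 0) \<bullet> w - \<epsilon> / 2 * (norm w)^2"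
      using strong[of 0 w] by (simp add: inner_diff_left algebra_simps)
    also have "\<dots> \<le> - f 0 + norm w * (norm (p - grad f 0) - \<epsilon> / 2 * norm w)"
      using Cauchy_Schwarz_ineq2[of "p - grad f 0" w] by (simp add: algebra_simps power2_eq_square)
    also have "\<dots> \<le> - f 0 + norm w * 0"
      using that eps by (intro add_left_mono mult_left_mono) (auto simp: R_def field_simps)
    finally show ?thesis by simp
  qed
  have "R \<ge> 0" using eps by (simp add: R_def)
  then have "\<exists>z\<in>cball 0 R. \<forall>w\<in>cball 0 R. p \<bullet> w - f w \<le> p \<bullet> z - f z"
    by (intro continuous_attains_sup continuous_on_diff continuous continuous_on_inner
       continuous_on_const continuous_on_id) auto
  then obtain z where z: "z \<in> cball 0 R" "\<And>w. w \<in> cball 0 R \<Longrightarrow> p \<bullet> w - f w \<le> p \<bullet> z - f z"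
    by blast
  have "p \<bullet> w - f w \<le> p \<bullet> z - f z" for w
    using far[of w] z(2)[of w] z(2)[of 0] \<open>R \<ge> 0\<close> by (cases "norm w \<le> R") auto
  then show ?thesis by blast
qed

text \<open>A maximiser in the Legendre transform. It turns out to be a right inverse of
  \<open>grad f\<close> and the gradient of the transform.\<close>

definition conj_grad :: "'a \<Rightarrow> 'a" where
  "conj_grad p = (SOME z. \<forall>w. p \<bullet> w - f w \<le> p \<bullet> z - f z)"

lemma conj_grad_max: "p \<bullet> w - f w \<le> p \<bullet> conj_grad p - f (conj_grad p)"
  unfolding conj_grad_def using someI_ex[OF maximiser_exists[of p]] by blast

lemma grad_conj_grad: "grad f (conj_grad p) = p"
  by (rule slope_eq_gradient[OF gderiv open_UNIV UNIV_I, symmetric])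
    (use conj_grad_max[of p] in \<open>simp add: inner_diff_right algebra_simps\<close>)

lemma legendre_eq: "legendre f p = p \<bullet> conj_grad p - f (conj_grad p)"
  unfolding legendre_def by (rule cSup_eq_maximum) (auto simp: conj_grad_max)

text \<open>This is \<open>strong\<close> based at \<open>conj_grad p\<close>, where the gradient of
  f is p. The quadratic remainder yields the equality case and the smoothness of the
  transform.\<close>

lemma fenchel_young_strong: "legendre f p + f z \<ge> p \<bullet> z + \<epsilon> / 2 * (norm (z - conj_grad p))^2"
  using strong[of "conj_grad p" z] by (simp add: grad_conj_grad legendre_eq inner_diff_right)

lemma fenchel_young: "legendre f p + f z \<ge> p \<bullet> z"
  using fenchel_young_strong[of p z] eps by (smt (verit) divide_pos_pos mult_nonneg_nonneg zero_le_power2)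

lemma fenchel_eqD: "legendre f p + f z = p \<bullet> z \<Longrightarrow> z = conj_grad p"
  using fenchel_young_strong[of p z] eps
  by (auto simp: mult_le_0_iff power2_eq_square)

lemma legendre_ge: "legendre f q \<ge> legendre f p + conj_grad p \<bullet> (q - p)"
  using fenchel_young[of q "conj_grad p"] by (simp add: legendre_eq[of p] inner_diff_right inner_diff_left inner_commute)

text \<open>Strong convexity of f dualises to a quadratic upper bound. The remainder (\<epsilon>/2)
  |w - z|^2 of \<open>fenchel_young_strong\<close> absorbs the cross term (q - p) . (w - z) by
  Young's inequality and leaves |q - p|^2 / (2 \<epsilon>).\<close>

lemma legendre_le: "legendre f q \<le> legendre f p + conj_grad p \<bullet> (q - p) + (norm (q - p))^2 / (2 * \<epsilon>)"
proof -
  define z where "z = conj_grad p"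
  define w where "w = conj_grad q"
  have "legendre f q = q \<bullet> w - f w" by (simp add: legendre_eq w_def)
  also have "\<dots> \<le> legendre f p + (q - p) \<bullet> w - \<epsilon> / 2 * (norm (w - z))^2"
    using fenchel_young_strong[of p w] by (simp add: z_def inner_diff_left)
  also have "\<dots> = legendre f p + z \<bullet> (q - p) + ((q - p) \<bullet> (w - z) - \<epsilon> / 2 * (norm (w - z))^2)"
    by (simp add: algebra_simps inner_commute)
  also have "(q - p) \<bullet> (w - z) - \<epsilon> / 2 * (norm (w - z))^2 \<le> (norm (q - p))^2 / (2 * \<epsilon>)"
  proof -
    have "(q - p) \<bullet> (w - z) \<le> norm (q - p) * norm (w - z)" by (rule norm_cauchy_schwarz)
    moreover have "0 \<le> (norm (q - p) - \<epsilon> * norm (w - z))^2" by simp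
    then have "2 * \<epsilon> * (norm (q - p) * norm (w - z)) \<le> (norm (q - p))^2 + \<epsilon>^2 * (norm (w - z))^2"
      by (simp add: power2_eq_square algebra_simps)
    then have "norm (q - p) * norm (w - z) \<le> (norm (q - p))^2 / (2 * \<epsilon>) + \<epsilon> / 2 * (norm (w - z))^2"
      using eps by (simp add: field_simps power2_eq_square)
    ultimately show ?thesis by linarith
  qed
  finally show ?thesis by (simp add: z_def)
qed

lemma legendre_GDERIV: "GDERIV (legendre f) p :> conj_grad p"
  unfolding gderiv_def has_derivative_at_alt
proof (intro conjI allI impI)
  show "bounded_linear (\<lambda>h. h \<bullet> conj_grad p)" by (rule bounded_linear_inner_left)
  fix e :: real assume e: "e > 0"
  show "\<exists>d>0. \<forall>y. norm (y - p) < d \<longrightarrow>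
      norm (legendre f y - legendre f p - (y - p) \<bullet> conj_grad p) \<le> e * norm (y - p)"
  \<comment> \<open>The remainder is at most |y - p|^2 / (2 \<epsilon>), which drops below e |y - p|
    as soon as |y - p| < 2 \<epsilon> e.\<close>
  proof (intro exI[of _ "2 * \<epsilon> * e"] conjI allI impI)
    fix y assume "norm (y - p) < 2 * \<epsilon> * e"
    then have "norm (y - p) * norm (y - p) / (2 * \<epsilon>) \<le> (2 * \<epsilon> * e) * norm (y - p) / (2 * \<epsilon>)"
      using eps by (intro divide_right_mono mult_right_mono) auto
    then show "norm (legendre f y - legendre f p - (y - p) \<bullet> conj_grad p) \<le> e * norm (y - p)"
      using legendre_ge[of p y] legendre_le[of y p] eps by (simp add: inner_commute power2_eq_square)
  qed (use e eps in simp)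
qed

lemma grad_legendre: "grad (legendre f) p = conj_grad p"
  by (rule grad_eq[OF legendre_GDERIV])

lemma conj_grad_lipschitz: "norm (conj_grad p - conj_grad q) \<le> norm (p - q) / \<epsilon>"
proof (cases "conj_grad p = conj_grad q")
  case False
  let ?n = "norm (conj_grad p - conj_grad q)"
  have "\<epsilon> * ?n^2 \<le> (p - q) \<bullet> (conj_grad p - conj_grad q)"
    using strong[of "conj_grad p" "conj_grad q"] strong[of "conj_grad q" "conj_grad p"]
    by (simp add: grad_conj_grad norm_minus_commute algebra_simps)
  also have "\<dots> \<le> norm (p - q) * ?n" by (rule norm_cauchy_schwarz)
  finally show ?thesis using False eps by (simp add: power2_eq_square field_simps)
next
  case True
  then show ?thesis using eps by simp
qed

lemma continuous_conj_grad: "continuous_on S conj_grad"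
proof (rule lipschitz_on_continuous_on[of "1 / \<epsilon>"])
  show "(1 / \<epsilon>)-lipschitz_on S conj_grad"
    using conj_grad_lipschitz eps by (intro lipschitz_onI) (auto simp: dist_norm)
qed

lemma continuous_legendre: "continuous_on S (legendre f)"
  by (intro continuous_at_imp_continuous_on ballI has_derivative_continuous[OF legendre_GDERIV[unfolded gderiv_def]])

lemma convex_legendre: "convex_on UNIV (legendre f)"
proof (rule convex_onI)
  fix t :: real and x y :: 'a assume t: "0 < t" "t < 1"
  define p where "p = (1 - t) *\<^sub>R x + t *\<^sub>R y"
  have "(1 - t) * (legendre f p + conj_grad p \<bullet> (x - p)) + t * (legendre f p + conj_grad p \<bullet> (y - p))
     \<le> (1 - t) * legendre f x + t * legendre f y"
    using t legendre_ge by (intro add_mono mult_left_mono) auto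
  moreover have "(1 - t) * (conj_grad p \<bullet> (x - p)) + t * (conj_grad p \<bullet> (y - p)) = 0"
    by (simp add: p_def algebra_simps inner_simps)
  ultimately show "legendre f ((1 - t) *\<^sub>R x + t *\<^sub>R y) \<le> (1 - t) * legendre f x + t * legendre f y"
    by (simp only: p_def[symmetric]) (simp add: distrib_left; simp add: left_diff_distrib)
qed simp

end

text \<open>Taylor expansion with Lagrange remainder on the segment from x to y. The family
  \<open>diff\<close> lists the restriction of f to the segment and its first two derivatives in the
  shape that \<open>Maclaurin2\<close> expects.\<close>

lemma strongly_convex_hessian:
  fixes f :: "'a::euclidean_space \<Rightarrow> real"
  assumes C: "C_k 2 f" and e: "\<epsilon> > 0" and H: "\<forall>x h. hessian f x h h \<ge> \<epsilon> * (norm h)^2"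
  shows "strongly_convex f \<epsilon>"
proof
  show "\<epsilon> > 0" by fact
  have C2: "C_k (Suc (Suc 0)) f" using C by (simp add: numeral_2_eq_2)
  have d: "(f has_derivative fder f x) (at x)" for x
    using C_k_Suc_has_derivative[OF C2] .
  show G: "GDERIV f x :> grad f x" for x
    using d by (intro differentiable_GDERIV) (auto simp: differentiable_def)
  have fd: "fder f x h = h \<bullet> grad f x" for x h
    using frechet_derivative_at[OF G[unfolded gderiv_def], of x] by metis
  have C1: "C_k (Suc 0) (\<lambda>x. h \<bullet> grad f x)" for h
    using C2 by (simp add: fd)
  have "continuous_on UNIV (\<lambda>x. \<Sum>b\<in>Basis. (b \<bullet> grad f x) *\<^sub>R b)"
    by (rule continuous_on_sum[OF continuous_on_scaleR[OF C_k_continuous[OF C1] continuous_on_const]])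
  then show "continuous_on UNIV (grad f)"
    by (simp add: inner_commute[of _ "grad f _"] euclidean_representation)
  fix x y :: 'a
  define h where "h = y - x"
  define diff where "diff m t = (if m = 0 then f (x + t *\<^sub>R h) else if m = (1::nat) then h \<bullet> grad f (x + t *\<^sub>R h)
      else hessian f (x + t *\<^sub>R h) h h)" for m and t :: real
  have l: "((\<lambda>t::real. x + t *\<^sub>R h) has_derivative (\<lambda>s. s *\<^sub>R h)) (at t)" for t
    by (auto intro!: derivative_eq_intros)
  have D0: "(diff 0 has_real_derivative diff 1 t) (at t)" for t
    using has_derivative_compose[OF l G[unfolded gderiv_def]]
    by (simp add: diff_def[abs_def] has_field_derivative_def mult.commute[of _ "h \<bullet> _"] cong: if_cong)
  have D1: "(diff 1 has_real_derivative diff 2 t) (at t)" for t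
  proof -
    have *: "((\<lambda>x. h \<bullet> grad f x) has_derivative fder (\<lambda>x. h \<bullet> grad f x) z) (at z)" for z
      using C_k_Suc_has_derivative[OF C1] .
    have "fder (\<lambda>x. h \<bullet> grad f x) z (s *\<^sub>R h) = hessian f z h h * s" for z s
      using linear_scale[OF has_derivative_linear[OF *]] by (simp add: hessian_def fd)
    then show ?thesis using has_derivative_compose[OF l *]
      by (simp add: diff_def[abs_def] has_field_derivative_def)
  qed
  have "\<exists>t. 0 < t \<and> t \<le> 1 \<and> diff 0 1 = (\<Sum>m<2. diff m 0 / fact m * 1 ^ m) + diff 2 t / fact 2 * 1 ^ 2"
    using D0 D1 by (intro Maclaurin2) (auto simp: numeral_2_eq_2 less_Suc_eq)
  then obtain t where "f y = f x + h \<bullet> grad f x + hessian f (x + t *\<^sub>R h) h h / 2"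
    by (auto simp: diff_def numeral_2_eq_2 h_def)
  then show "f y \<ge> f x + grad f x \<bullet> (y - x) + \<epsilon> / 2 * (norm (y - x))^2"
    using H[rule_format, where x = "x + t *\<^sub>R h" and h = h] by (simp add: h_def inner_commute)
qed

subsection \<open>Differentiability almost everywhere\<close>

text \<open>Fubini in an arbitrary direction b without a change of coordinates: the measure of N is
  averaged over its translates by t b with t in [0,1], and after exchanging the integrals each inner
  one runs over a countable set.\<close>

lemma null_set_countable_lines:
  fixes N :: "'a::euclidean_space set"
  assumes N[measurable]: "N \<in> sets borel" and c: "\<And>x. countable {t::real. x + t *\<^sub>R b \<in> N}"
  shows "N \<in> null_sets lborel"
proof -
  have shift: "(\<integral>\<^sup>+x. indicator N (x + t *\<^sub>R b) \<partial>lborel) = emeasure lborel N" for t :: real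
  proof -
    have "emeasure lborel N = (\<integral>\<^sup>+x. indicator N x \<partial>distr lborel borel ((+) (t *\<^sub>R b)))"
      by (simp add: lborel_distr_plus)
    also have "\<dots> = (\<integral>\<^sup>+x. indicator N (x + t *\<^sub>R b) \<partial>lborel)"
      by (subst nn_integral_distr) (auto simp: add.commute)
    finally show ?thesis by simp
  qed
  have "emeasure lborel N = (\<integral>\<^sup>+t. emeasure lborel N * indicator {0..1::real} t \<partial>lborel)"
    by (subst nn_integral_cmult_indicator) auto
  also have "\<dots> = (\<integral>\<^sup>+t. (\<integral>\<^sup>+x. indicator N (x + t *\<^sub>R b) * indicator {0..1::real} t \<partial>lborel) \<partial>lborel)"
    by (simp add: nn_integral_multc shift)
  also have "\<dots> = (\<integral>\<^sup>+x. (\<integral>\<^sup>+t. indicator N (x + t *\<^sub>R b) * indicator {0..1::real} t \<partial>lborel) \<partial>lborel)"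
    by (rule lborel_pair.Fubini'[symmetric]) measurable
  also have "(\<lambda>x. \<integral>\<^sup>+t. indicator N (x + t *\<^sub>R b) * indicator {0..1::real} t \<partial>lborel) = (\<lambda>x. 0)"
  proof
    fix x
    have "AE t in lborel. t \<notin> {t::real. x + t *\<^sub>R b \<in> N}"
      by (rule AE_not_in[OF countable_imp_null_set_lborel[OF c]])
    then have "AE t in lborel. indicator N (x + t *\<^sub>R b) * indicator {0..1::real} t = (0::ennreal)"
      by eventually_elim auto
    then have "(\<integral>\<^sup>+t. indicator N (x + t *\<^sub>R b) * indicator {0..1::real} t \<partial>lborel) = integral\<^sup>N lborel (\<lambda>t::real. 0)"
      by (rule nn_integral_cong_AE)
    then show "(\<integral>\<^sup>+t. indicator N (x + t *\<^sub>R b) * indicator {0..1::real} t \<partial>lborel) = 0" by simp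
  qed
  finally show ?thesis by (intro null_setsI) auto
qed

text \<open>A one-sided directional derivative taken along 1/(n+1). As a limit of a sequence of
  continuous functions it is Borel for continuous f, whether or not the derivative exists.\<close>

definition rdiff :: "('a::euclidean_space \<Rightarrow> real) \<Rightarrow> 'a \<Rightarrow> 'a \<Rightarrow> real" where
  "rdiff f b x = lim (\<lambda>n. (f (x + (1 / real (Suc n)) *\<^sub>R b) - f x) / (1 / real (Suc n)))"

lemma borel_measurable_rdiff:
  assumes "continuous_on UNIV f" shows "rdiff f b \<in> borel_measurable borel"
  unfolding rdiff_def
  by (intro borel_measurable_lim_metric borel_measurable_continuous_onI continuous_intros
      continuous_on_compose2[OF assms]) auto

lemma rdiff_GDERIV:
  assumes "GDERIV f x :> D" shows "rdiff f b x = b \<bullet> D"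
proof -
  have lim: "((\<lambda>s. (f (x + s *\<^sub>R b) - f x) / s) \<longlongrightarrow> b \<bullet> D) (at 0)"
    using assms unfolding gderiv_def by (rule has_derivative_directional)
  have "filterlim (\<lambda>n. 1 / real (Suc n)) (at 0) sequentially"
    by (intro filterlim_atI LIMSEQ_Suc[OF lim_1_over_n]) auto
  from filterlim_compose[OF lim this] show ?thesis
    unfolding rdiff_def by (rule limI)
qed

locale convex_function =
  fixes f :: "'a::euclidean_space \<Rightarrow> real"
  assumes conv: "convex_on UNIV f"
begin

lemma cont: "continuous_on S f"
  using convex_on_continuous[OF open_UNIV conv] continuous_on_subset by blast

lemma borel: "f \<in> borel_measurable borel"
  by (rule borel_measurable_continuous_onI[OF cont])

lemma ineq: "0 \<le> t \<Longrightarrow> t \<le> 1 \<Longrightarrow> f ((1 - t) *\<^sub>R x + t *\<^sub>R y) \<le> (1 - t) * f x + t * f y"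
  using convex_onD[OF conv] by simp

lemma slope_mono:
  assumes "0 < s" "s \<le> t"
  shows "(f (x + s *\<^sub>R b) - f x) / s \<le> (f (x + t *\<^sub>R b) - f x) / t"
proof -
  have "f ((1 - s/t) *\<^sub>R x + (s/t) *\<^sub>R (x + t *\<^sub>R b)) \<le> (1 - s/t) * f x + (s/t) * f (x + t *\<^sub>R b)"
    using assms by (intro ineq) auto
  moreover have "(1 - s/t) *\<^sub>R x + (s/t) *\<^sub>R (x + t *\<^sub>R b) = x + s *\<^sub>R b"
    using assms by (simp add: algebra_simps)
  ultimately have "f (x + s *\<^sub>R b) \<le> (1 - s/t) * f x + (s/t) * f (x + t *\<^sub>R b)"
    by (simp only:)
  then have "f (x + s *\<^sub>R b) - f x \<le> (s/t) * (f (x + t *\<^sub>R b) - f x)"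
    by (simp add: algebra_simps)
  then show ?thesis using assms by (simp add: field_simps)
qed

lemma slope_two_sided:
  assumes "0 < s" "0 < t"
  shows "(f x - f (x - s *\<^sub>R b)) / s \<le> (f (x + t *\<^sub>R b) - f x) / t"
proof -
  define u where "u = s / (s + t)"
  have u: "0 \<le> u" "u \<le> 1" "u * (s + t) = s" using assms by (auto simp: u_def)
  have "f ((1 - u) *\<^sub>R (x - s *\<^sub>R b) + u *\<^sub>R (x + t *\<^sub>R b)) \<le> (1 - u) * f (x - s *\<^sub>R b) + u * f (x + t *\<^sub>R b)"
    using u by (intro ineq)
  moreover have "(1 - u) *\<^sub>R (x - s *\<^sub>R b) + u *\<^sub>R (x + t *\<^sub>R b) = x + (u * (s + t) - s) *\<^sub>R b"
    by (simp add: algebra_simps)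
  ultimately have "(s + t) * f x \<le> (s + t) * ((1 - u) * f (x - s *\<^sub>R b) + u * f (x + t *\<^sub>R b))"
    using assms u by (intro mult_left_mono) auto
  moreover have "(s + t) * (1 - u) = t" "(s + t) * u = s" using u(3) by (auto simp: algebra_simps)
  then have "(s + t) * ((1 - u) * f (x - s *\<^sub>R b) + u * f (x + t *\<^sub>R b)) = t * f (x - s *\<^sub>R b) + s * f (x + t *\<^sub>R b)"
    by (metis (no_types, opaque_lifting) distrib_left mult.assoc)
  ultimately show ?thesis using assms by (simp add: field_simps)
qed

lemma rdiff_tendsto: "(\<lambda>n. (f (x + (1 / real (Suc n)) *\<^sub>R b) - f x) / (1 / real (Suc n))) \<longlonglongrightarrow> rdiff f b x"
proof -
  let ?q = "\<lambda>n. (f (x + (1 / real (Suc n)) *\<^sub>R b) - f x) / (1 / real (Suc n))"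
  have "decseq ?q" by (intro decseq_SucI slope_mono) (auto simp: frac_le)
  moreover have "\<forall>n. f x - f (x - b) \<le> ?q n"
    using slope_two_sided[of 1 "1 / real (Suc n)" x b for n] by simp
  ultimately obtain L where L: "?q \<longlonglongrightarrow> L" by (rule decseq_convergent)
  show ?thesis unfolding rdiff_def limI[OF L] by (rule L)
qed

lemma rdiff_le_slope:
  assumes "t > 0" shows "rdiff f b x \<le> (f (x + t *\<^sub>R b) - f x) / t"
proof (rule LIMSEQ_le_const2[OF rdiff_tendsto])
  from reals_Archimedean2 obtain N where N: "1 / t < real N" ..
  have "(f (x + (1 / real (Suc n)) *\<^sub>R b) - f x) / (1 / real (Suc n)) \<le> (f (x + t *\<^sub>R b) - f x) / t" if "n \<ge> N" for n
  proof (rule slope_mono)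
    have "real N \<le> real n" using that by (rule of_nat_mono)
    then have "1 / t < real (Suc n)" using N by linarith
    then have "1 < real (Suc n) * t" using assms by (simp only: pos_divide_less_eq)
    then show "1 / real (Suc n) \<le> t" by (subst pos_divide_le_eq) (auto simp: mult.commute)
  qed simp
  then show "\<exists>N. \<forall>n\<ge>N. (f (x + (1 / real (Suc n)) *\<^sub>R b) - f x) / (1 / real (Suc n)) \<le> (f (x + t *\<^sub>R b) - f x) / t"
    by blast
qed

lemma slope_le_rdiff:
  assumes "e > 0"
  obtains d where "d > 0" "\<And>t. 0 < t \<Longrightarrow> t \<le> d \<Longrightarrow> (f (x + t *\<^sub>R b) - f x) / t \<le> rdiff f b x + e"
proof -
  obtain n where n: "(f (x + (1 / real (Suc n)) *\<^sub>R b) - f x) / (1 / real (Suc n)) < rdiff f b x + e"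
    using eventually_happens[OF order_tendstoD(2)[OF rdiff_tendsto[where x = x and b = b], of "rdiff f b x + e"]] assms
    by auto
  show ?thesis
    by (rule that[of "1 / real (Suc n)"]) (use slope_mono[of _ "1 / real (Suc n)" x b] n in \<open>fastforce+\<close>)
qed

text \<open>The left derivative is \<open>- rdiff f (- b)\<close>. Both one-sided derivatives are
  compared with the slope of the chord between the two points, so the jumps of the derivative at
  different points of a line do not overlap.\<close>

lemma rdiff_neg_le:
  assumes "s < t" shows "rdiff f b (x + s *\<^sub>R b) \<le> - rdiff f (- b) (x + t *\<^sub>R b)"
proof -
  have "rdiff f b (x + s *\<^sub>R b) \<le> (f (x + s *\<^sub>R b + (t - s) *\<^sub>R b) - f (x + s *\<^sub>R b)) / (t - s)"
    using assms by (intro rdiff_le_slope) simp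
  moreover have "rdiff f (- b) (x + t *\<^sub>R b) \<le> (f (x + t *\<^sub>R b + (t - s) *\<^sub>R (- b)) - f (x + t *\<^sub>R b)) / (t - s)"
    using assms by (intro rdiff_le_slope) simp
  ultimately show ?thesis by (simp add: algebra_simps diff_divide_distrib)
qed

lemma rdiff_left_le_right: "- rdiff f (- b) x \<le> rdiff f b x"
proof -
  have "- rdiff f (- b) x \<le> q" if q: "rdiff f b x < q" for q
  proof -
    obtain d where d: "d > 0" "\<And>t. 0 < t \<Longrightarrow> t \<le> d \<Longrightarrow> (f (x + t *\<^sub>R b) - f x) / t \<le> rdiff f b x + (q - rdiff f b x)"
      using slope_le_rdiff[where x = x and b = b and e = "q - rdiff f b x"] q by auto
    have "rdiff f (- b) x \<ge> - ((f (x + d *\<^sub>R b) - f x) / d)"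
    proof (rule LIMSEQ_le_const[OF rdiff_tendsto])
      have "- ((f (x + d *\<^sub>R b) - f x) / d) \<le> (f (x + (1 / real (Suc n)) *\<^sub>R (- b)) - f x) / (1 / real (Suc n))" for n
        using slope_two_sided[of "1 / real (Suc n)" d x b] d(1) by (simp add: field_simps)
      then show "\<exists>N. \<forall>n\<ge>N. - ((f (x + d *\<^sub>R b) - f x) / d) \<le> (f (x + (1 / real (Suc n)) *\<^sub>R (- b)) - f x) / (1 / real (Suc n))"
        by blast
    qed
    then show ?thesis using d(2)[of d] d(1) by simp
  qed
  then show ?thesis by (meson dense_ge)
qed

definition kinks :: "'a \<Rightarrow> 'a set" where
  "kinks b = {x. rdiff f b x \<noteq> - rdiff f (- b) x}"

text \<open>On each line the jumps are disjoint open intervals. Picking a rational number in each of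
  them injects the kinks into the rationals.\<close>

lemma kinks_null: "kinks b \<in> null_sets lborel"
proof (rule null_set_countable_lines)
  have [measurable]: "rdiff f b \<in> borel_measurable borel" for b
    by (rule borel_measurable_rdiff[OF cont])
  show "kinks b \<in> sets borel" unfolding kinks_def by measurable
  fix x
  let ?T = "{t. x + t *\<^sub>R b \<in> kinks b}"
  have "\<forall>t\<in>?T. \<exists>q::rat. - rdiff f (- b) (x + t *\<^sub>R b) < of_rat q \<and> of_rat q < rdiff f b (x + t *\<^sub>R b)"
  proof
    fix t assume "t \<in> ?T"
    then have "- rdiff f (- b) (x + t *\<^sub>R b) < rdiff f b (x + t *\<^sub>R b)"
      using rdiff_left_le_right[of b "x + t *\<^sub>R b"] by (auto simp: kinks_def)
    then show "\<exists>q::rat. - rdiff f (- b) (x + t *\<^sub>R b) < of_rat q \<and> of_rat q < rdiff f b (x + t *\<^sub>R b)"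
      by (rule of_rat_dense)
  qed
  then obtain q :: "real \<Rightarrow> rat" where q: "\<And>t. t \<in> ?T \<Longrightarrow> - rdiff f (- b) (x + t *\<^sub>R b) < of_rat (q t) \<and> of_rat (q t) < rdiff f b (x + t *\<^sub>R b)"
    by metis
  have "q s \<noteq> q t" if "s \<in> ?T" "t \<in> ?T" "s < t" for s t
    using q[OF that(1)] q[OF that(2)] rdiff_neg_le[OF that(3), of b x] by auto
  then have "inj_on q ?T" by (intro linorder_inj_onI) auto
  then show "countable ?T" by (rule countable_image_inj_on[rotated]) auto
qed

text \<open>Jensen's inequality along the coordinate axes bounds the remainder from above, and convexity
  turns this into a bound from below.\<close>

lemma GDERIV_rdiff:
  assumes x: "\<And>b. b \<in> Basis \<Longrightarrow> x \<notin> kinks b"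
  shows "GDERIV f x :> (\<Sum>b\<in>Basis. rdiff f b x *\<^sub>R b)"
proof -
  define D where "D = (\<Sum>b\<in>Basis. rdiff f b x *\<^sub>R b)"
  define N where "N = real DIM('a)"
  have "real 1 \<le> real DIM('a)" by (intro of_nat_mono) (simp add: Suc_le_eq)
  then have N: "N \<ge> 1" by (simp add: N_def)
  define g where "g h = f (x + h) - f x - h \<bullet> D" for h
  have Db: "b \<bullet> D = rdiff f b x" if "b \<in> Basis" for b
    using that by (simp add: D_def inner_sum_right inner_Basis if_distrib sum.delta cong: if_cong)
  have gconv: "convex_on UNIV g"
  proof (rule convex_onI)
    fix t :: real and h k :: 'a assume t: "0 < t" "t < 1"
    have "f ((1 - t) *\<^sub>R (x + h) + t *\<^sub>R (x + k)) \<le> (1 - t) * f (x + h) + t * f (x + k)"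
      using t by (intro ineq) auto
    moreover have "(1 - t) *\<^sub>R (x + h) + t *\<^sub>R (x + k) = x + ((1 - t) *\<^sub>R h + t *\<^sub>R k)"
      by (simp add: algebra_simps)
    ultimately show "g ((1 - t) *\<^sub>R h + t *\<^sub>R k) \<le> (1 - t) * g h + t * g k"
      by (simp add: g_def inner_add_left algebra_simps)
  qed simp
  have axis: "\<exists>d>0. \<forall>t. \<bar>t\<bar> \<le> d \<longrightarrow> g (t *\<^sub>R b) \<le> e * \<bar>t\<bar>" if "e > 0" "b \<in> Basis" for e b
  proof -
    obtain d1 where d1: "d1 > 0" "\<And>t. 0 < t \<Longrightarrow> t \<le> d1 \<Longrightarrow> (f (x + t *\<^sub>R b) - f x) / t \<le> rdiff f b x + e"
      using slope_le_rdiff[OF \<open>e > 0\<close>] by blast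
    obtain d2 where d2: "d2 > 0" "\<And>t. 0 < t \<Longrightarrow> t \<le> d2 \<Longrightarrow> (f (x + t *\<^sub>R (- b)) - f x) / t \<le> rdiff f (- b) x + e"
      using slope_le_rdiff[OF \<open>e > 0\<close>] by blast
    have eq: "rdiff f (- b) x = - rdiff f b x" using x[OF that(2)] by (simp add: kinks_def)
    have "g (t *\<^sub>R b) \<le> e * \<bar>t\<bar>" if "\<bar>t\<bar> \<le> min d1 d2" for t
    proof -
      consider "t = 0" | "t > 0" | "t < 0" by linarith
      then show ?thesis
      proof cases
        case 2
        then show ?thesis using d1(2)[of t] that Db[OF \<open>b \<in> Basis\<close>] by (simp add: g_def field_simps)
      next
        case 3
        then show ?thesis using d2(2)[of "- t"] that Db[OF \<open>b \<in> Basis\<close>] eq by (simp add: g_def field_simps)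
      qed (simp add: g_def)
    qed
    then show ?thesis using d1(1) d2(1) by (intro exI[of _ "min d1 d2"]) auto
  qed
  have upper: "\<exists>d>0. \<forall>h. norm h < d \<longrightarrow> g h \<le> e * norm h" if "e > 0" for e
  proof -
    have "\<forall>b\<in>Basis. \<exists>d>0. \<forall>t. \<bar>t\<bar> \<le> d \<longrightarrow> g (t *\<^sub>R b) \<le> (e / N) * \<bar>t\<bar>"
      using that N axis[of "e / N"] by auto
    then obtain d where d: "\<And>b. b \<in> Basis \<Longrightarrow> d b > 0" "\<And>b t. b \<in> Basis \<Longrightarrow> \<bar>t\<bar> \<le> d b \<Longrightarrow> g (t *\<^sub>R b) \<le> (e / N) * \<bar>t\<bar>"
      by metis
    define d0 where "d0 = Min (d ` (Basis :: 'a set))"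
    have d0: "d0 > 0" "\<And>b. b \<in> Basis \<Longrightarrow> d0 \<le> d b" using d by (auto simp: d0_def)
    have "g h \<le> e * norm h" if h: "norm h < d0 / N" for h
    proof -
      \<comment> \<open>h is the mean of N vectors on the axes, each stretched by N, the dimension.
        This accounts for the radius d0 / N and the slope e / N.\<close>
      have "h = (\<Sum>b\<in>Basis. (1 / N) *\<^sub>R ((N * (h \<bullet> b)) *\<^sub>R b))"
        using N by (simp add: euclidean_representation)
      then have "g h = g (\<Sum>b\<in>Basis. (1 / N) *\<^sub>R ((N * (h \<bullet> b)) *\<^sub>R b))" by simp
      also have "\<dots> \<le> (\<Sum>b\<in>Basis. (1 / N) * g ((N * (h \<bullet> b)) *\<^sub>R b))"
        using N by (intro convex_on_sum[OF _ _ gconv]) (auto simp: N_def)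
      also have "\<dots> \<le> (\<Sum>b\<in>(Basis::'a set). (1 / N) * (e * norm h))"
      proof (intro sum_mono mult_left_mono)
        fix b :: 'a assume b: "b \<in> Basis"
        have hb: "\<bar>h \<bullet> b\<bar> \<le> norm h" by (rule Basis_le_norm[OF b])
        then have "N * \<bar>h \<bullet> b\<bar> \<le> N * norm h" using N by simp
        also have "\<dots> \<le> d0" using h N by (simp add: field_simps)
        finally have "\<bar>N * (h \<bullet> b)\<bar> \<le> d b" using d0(2)[OF b] N by (simp add: abs_mult)
        then have "g ((N * (h \<bullet> b)) *\<^sub>R b) \<le> (e / N) * \<bar>N * (h \<bullet> b)\<bar>" by (rule d(2)[OF b])
        also have "\<dots> = e * \<bar>h \<bullet> b\<bar>" using N by (simp add: abs_mult)
        also have "\<dots> \<le> e * norm h" using hb \<open>e > 0\<close> by simp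
        finally show "g ((N * (h \<bullet> b)) *\<^sub>R b) \<le> e * norm h" .
      qed (use N in simp)
      also have "\<dots> = e * norm h" using N by (simp add: N_def)
      finally show ?thesis .
    qed
    then show ?thesis using d0 N by (intro exI[of _ "d0 / N"]) auto
  qed
  have lower: "- g (- h) \<le> g h" for h
    using convex_onD[OF gconv, of "1/2" h "- h"] by (simp add: g_def field_simps)
  show ?thesis unfolding D_def[symmetric] gderiv_def has_derivative_at_alt
  proof (intro conjI allI impI)
    show "bounded_linear (\<lambda>h. h \<bullet> D)" by (rule bounded_linear_inner_left)
    fix e :: real assume "e > 0"
    then obtain d where d: "d > 0" "\<And>h. norm h < d \<Longrightarrow> g h \<le> e * norm h" using upper by blast
    have "norm (f y - f x - (y - x) \<bullet> D) \<le> e * norm (y - x)" if "norm (y - x) < d" for y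
      using d(2)[of "y - x"] d(2)[of "x - y"] lower[of "y - x"] that
      by (simp add: g_def norm_minus_commute abs_le_iff)
    then show "\<exists>d>0. \<forall>y. norm (y - x) < d \<longrightarrow> norm (f y - f x - (y - x) \<bullet> D) \<le> e * norm (y - x)"
      using d(1) by blast
  qed
qed

lemma differentiable_iff: "f differentiable at x \<longleftrightarrow> (\<forall>b\<in>Basis. x \<notin> kinks b)"
proof
  assume "f differentiable at x"
  then have "rdiff f b x = b \<bullet> grad f x" for b
    using rdiff_GDERIV differentiable_GDERIV by blast
  then show "\<forall>b\<in>Basis. x \<notin> kinks b" by (simp add: kinks_def)
qed (use GDERIV_rdiff GDERIV_differentiable in blast)

lemma AE_differentiable: "AE x in lborel. f differentiable at x"
  unfolding differentiable_iff
  by (intro AE_finite_allI) (auto intro: AE_not_in[OF kinks_null])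

lemma grad_measurable: "grad f \<in> borel_measurable borel"
proof -
  have [measurable]: "rdiff f b \<in> borel_measurable borel" for b
    by (rule borel_measurable_rdiff[OF cont])
  have [measurable]: "{x. \<forall>b\<in>Basis. x \<notin> kinks b} \<in> sets borel"
    unfolding kinks_def by simp measurable
  \<comment> \<open>Where f has no gradient the definite description ranges over a predicate that is
    false throughout, so \<open>grad f\<close> takes one fixed value there and is measurable on the
    whole space.\<close>
  have "grad f = (\<lambda>x. if x \<in> {x. \<forall>b\<in>Basis. x \<notin> kinks b} then \<Sum>b\<in>Basis. rdiff f b x *\<^sub>R b else (THE D. False))"
  proof
    fix x
    show "grad f x = (if x \<in> {x. \<forall>b\<in>Basis. x \<notin> kinks b} then \<Sum>b\<in>Basis. rdiff f b x *\<^sub>R b else (THE D. False))"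
    proof (cases "\<forall>b\<in>Basis. x \<notin> kinks b")
      case True
      then show ?thesis using grad_eq[OF GDERIV_rdiff] by simp
    next
      case False
      then have "\<not> GDERIV f x :> D" for D using GDERIV_differentiable differentiable_iff by blast
      then show ?thesis using False by (auto simp: grad_def)
    qed
  qed
  also have "\<dots> \<in> borel_measurable borel" by measurable
  finally show ?thesis .
qed

lemma subgradient:
  assumes "GDERIV f x :> D" shows "f y \<ge> f x + D \<bullet> (y - x)"
  using rdiff_le_slope[of 1 "y - x" x] rdiff_GDERIV[OF assms, of "y - x"] by (simp add: inner_commute)

end

section \<open>Bounded Lipschitz functions and measures\<close>

text \<open>The class of test functions: rich enough to determine a probability measure and
  preserved by the Hopf--Lax evolution.\<close>

definition bdd_lipschitz :: "('a::metric_space \<Rightarrow> real) \<Rightarrow> bool" where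
  "bdd_lipschitz h \<longleftrightarrow> bounded (range h) \<and> (\<exists>L. L-lipschitz_on UNIV h)"

lemma bdd_lipschitzI:
  fixes h :: "'a::real_normed_vector \<Rightarrow> real"
  assumes "\<And>x. \<bar>h x\<bar> \<le> B" "\<And>x y. \<bar>h x - h y\<bar> \<le> L * norm (x - y)"
  shows "bdd_lipschitz h"
proof -
  have "\<bar>L\<bar>-lipschitz_on UNIV h"
  proof (rule lipschitz_onI)
    fix x y :: 'a
    have "L * norm (x - y) \<le> \<bar>L\<bar> * norm (x - y)" by (intro mult_right_mono) auto
    with assms(2)[of x y] show "dist (h x) (h y) \<le> \<bar>L\<bar> * dist x y" by (simp add: dist_norm)
  qed simp
  then show ?thesis using assms(1) by (auto simp: bdd_lipschitz_def bounded_iff)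
qed

lemma bdd_lipschitzE:
  fixes h :: "'a::real_normed_vector \<Rightarrow> real"
  assumes "bdd_lipschitz h"
  obtains B L where "B \<ge> 0" "L \<ge> 0" "\<And>x. \<bar>h x\<bar> \<le> B" "\<And>x y. \<bar>h x - h y\<bar> \<le> L * norm (x - y)"
proof -
  obtain B where B: "\<And>x. \<bar>h x\<bar> \<le> B" using assms by (auto simp: bdd_lipschitz_def bounded_iff)
  obtain L where L: "L-lipschitz_on UNIV h" using assms by (auto simp: bdd_lipschitz_def)
  have "B \<ge> 0" using B[of 0] by linarith
  moreover have "L \<ge> 0" using L by (rule lipschitz_on_nonneg)
  moreover have "\<bar>h x - h y\<bar> \<le> L * norm (x - y)" for x y
    using lipschitz_onD[OF L, of x y] by (simp add: dist_norm)
  ultimately show ?thesis using B that by blast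
qed

lemma bdd_lipschitz_uminus:
  fixes h :: "'a::real_normed_vector \<Rightarrow> real"
  assumes "bdd_lipschitz h" shows "bdd_lipschitz (\<lambda>x. - h x)"
proof -
  obtain B L where "\<And>x. \<bar>h x\<bar> \<le> B" "\<And>x y. \<bar>h x - h y\<bar> \<le> L * norm (x - y)"
    using bdd_lipschitzE[OF assms] by metis
  then show ?thesis by (intro bdd_lipschitzI[of _ B L]) (auto simp: abs_minus_commute)
qed

lemma bdd_lipschitz_continuous: "bdd_lipschitz h \<Longrightarrow> continuous_on S h"
  by (auto simp: bdd_lipschitz_def intro: lipschitz_on_continuous_on lipschitz_on_subset)

lemma bdd_lipschitz_borel:
  fixes h :: "'a::metric_space \<Rightarrow> real"
  shows "bdd_lipschitz h \<Longrightarrow> h \<in> borel_measurable borel"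
  by (intro borel_measurable_continuous_onI bdd_lipschitz_continuous)

lemma integrable_bounded:
  fixes h :: "'a::metric_space \<Rightarrow> real"
  assumes "prob_space \<mu>" "sets \<mu> = sets borel" "h \<in> borel_measurable borel" "\<And>x. \<bar>h x\<bar> \<le> B"
  shows "integrable \<mu> h"
proof -
  interpret prob_space \<mu> by fact
  show ?thesis by (rule integrable_const_bound[of _ B]) (use assms in \<open>auto cong: measurable_cong_sets\<close>)
qed

lemma integrable_bdd_lipschitz:
  fixes h :: "'a::real_normed_vector \<Rightarrow> real"
  assumes "prob_space \<mu>" "sets \<mu> = sets borel" "bdd_lipschitz h"
  shows "integrable \<mu> h"
proof -
  obtain B where "\<And>x. \<bar>h x\<bar> \<le> B" using bdd_lipschitzE[OF assms(3)] by metis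
  then show ?thesis using assms bdd_lipschitz_borel by (intro integrable_bounded)
qed

lemma open_indicator_approx:
  fixes U :: "'a::euclidean_space set"
  assumes "open U"
  obtains f :: "nat \<Rightarrow> 'a \<Rightarrow> real" where "\<And>n. bdd_lipschitz (f n)" "\<And>n x. 0 \<le> f n x" "\<And>n x. f n x \<le> 1"
    "\<And>x. (\<lambda>n. f n x) \<longlonglongrightarrow> indicator U x"
\<comment> \<open>The whole space is treated apart because \<open>infdist\<close> to the empty set
  is 0 by convention, which would make the approximating functions vanish.\<close>
proof (cases "U = UNIV")
  case True
  show ?thesis
    by (rule that[of "\<lambda>_ _. 1"]) (auto simp: True intro: bdd_lipschitzI[of _ 1 0])
next
  case False
  define f where "f n x = min 1 (real n * infdist x (- U))" for n and x :: 'a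
  have "\<bar>f n x - f n y\<bar> \<le> real n * norm (x - y)" for n x y
  proof -
    have "\<bar>f n x - f n y\<bar> \<le> \<bar>real n * infdist x (- U) - real n * infdist y (- U)\<bar>"
      by (auto simp: f_def)
    also have "\<dots> \<le> real n * norm (x - y)"
      using infdist_triangle_abs[of x "- U" y]
      by (simp add: right_diff_distrib[symmetric] abs_mult dist_norm mult_left_mono)
    finally show ?thesis .
  qed
  moreover have "0 \<le> f n x" "f n x \<le> 1" for n x by (auto simp: f_def infdist_nonneg)
  moreover have "(\<lambda>n. f n x) \<longlonglongrightarrow> indicator U x" for x
  proof (cases "x \<in> U")
    case True
    have pos: "infdist x (- U) > 0"
      using True assms False in_closed_iff_infdist_zero[of "- U" x] infdist_nonneg[of x "- U"]
      by (auto simp: closed_open order.strict_iff_order)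
    obtain N where N: "1 / infdist x (- U) < real N" using reals_Archimedean2 by blast
    have "f n x = 1" if "n \<ge> N" for n
    proof -
      have "1 / infdist x (- U) < real n" using N that by (meson less_le_trans of_nat_mono)
      then show ?thesis using pos by (simp add: f_def field_simps)
    qed
    then show ?thesis using True by (intro tendsto_eventually) (auto simp: eventually_sequentially)
  next
    case False
    then show ?thesis by (simp add: f_def)
  qed
  ultimately show ?thesis
    by (intro that[of f] bdd_lipschitzI[of _ 1]) (auto simp: abs_le_iff intro: order.trans[of _ 0])
qed

lemma emeasure_open_tendsto:
  fixes f :: "nat \<Rightarrow> 'a::euclidean_space \<Rightarrow> real"
  assumes "prob_space \<mu>" "sets \<mu> = sets borel" and U: "open U"
    and f: "\<And>n. bdd_lipschitz (f n)" "\<And>n x. 0 \<le> f n x" "\<And>n x. f n x \<le> 1" "\<And>x. (\<lambda>n. f n x) \<longlonglongrightarrow> indicator U x"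
  shows "(\<lambda>n. \<integral>x. f n x \<partial>\<mu>) \<longlonglongrightarrow> measure \<mu> U"
proof -
  interpret prob_space \<mu> by fact
  note [measurable_cong] = assms(2)
  have [measurable]: "f n \<in> borel_measurable borel" for n by (rule bdd_lipschitz_borel[OF f(1)])
  have [measurable]: "U \<in> sets borel" using U by simp
  have "(\<lambda>n. \<integral>x. f n x \<partial>\<mu>) \<longlonglongrightarrow> (\<integral>x. indicator U x \<partial>\<mu>)"
    by (rule integral_dominated_convergence[where w = "\<lambda>_. 1"])
      (use f in \<open>auto intro: order.trans[OF _ f(3)]\<close>)
  then show ?thesis using U by (simp add: assms(2))
qed

lemma measure_eqI_bdd_lipschitz:
  fixes \<mu> \<nu> :: "'a::euclidean_space measure"
  assumes p: "prob_space \<mu>" "prob_space \<nu>" and s: "sets \<mu> = sets borel" "sets \<nu> = sets borel"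
    and eq: "\<And>h. bdd_lipschitz h \<Longrightarrow> (\<integral>x. h x \<partial>\<mu>) = (\<integral>x. h x \<partial>\<nu>)"
  shows "\<mu> = \<nu>"
proof (rule measure_eqI_generator_eq[where A = "\<lambda>_. UNIV" and \<Omega> = UNIV and E = "{U. open U}"])
  interpret M: prob_space \<mu> by fact
  interpret N: prob_space \<nu> by fact
  show "Int_stable {U::'a set. open U}" by (auto simp: Int_stable_def)
  fix U :: "'a set" assume "U \<in> {U. open U}"
  then have U: "open U" by simp
  from open_indicator_approx[OF U] obtain f where f: "\<And>n. bdd_lipschitz (f n)"
      "\<And>n x. 0 \<le> f n x" "\<And>n x. f n x \<le> 1" "\<And>x. (\<lambda>n. f n x) \<longlonglongrightarrow> indicator U x" by metis
  have "measure \<mu> U = measure \<nu> U"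
    using emeasure_open_tendsto[OF p(1) s(1) U f] emeasure_open_tendsto[OF p(2) s(2) U f] eq[OF f(1)]
    by (auto intro: LIMSEQ_unique)
  then show "emeasure \<mu> U = emeasure \<nu> U" by (simp add: M.emeasure_eq_measure N.emeasure_eq_measure)
next
  interpret M: prob_space \<mu> by fact
  show "emeasure \<mu> UNIV \<noteq> \<infinity>" for i :: nat by simp
qed (use s in \<open>auto simp: borel_def\<close>)

subsection \<open>Differentiating suprema\<close>

text \<open>Well-posedness in the sense of Tykhonov: every maximising sequence converges to z. It
  takes the place of compactness when Y is the whole space.\<close>

definition well_posed :: "'a::metric_space set \<Rightarrow> ('a \<Rightarrow> real) \<Rightarrow> 'a \<Rightarrow> bool" where
  "well_posed Y F z \<longleftrightarrow> z \<in> Y \<and> (\<forall>y\<in>Y. F y \<le> F z) \<and>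
     (\<forall>\<delta>>0. \<exists>\<kappa>>0. \<forall>y\<in>Y. dist y z \<ge> \<delta> \<longrightarrow> F y \<le> F z - \<kappa>)"

lemma well_posed_SUP:
  assumes w: "well_posed Y F z" and B: "\<And>y. \<bar>h y\<bar> \<le> B" and e: "e > 0"
  shows "bdd_above ((\<lambda>y. F y - e * h y) ` Y)"
    and "F z - e * h z \<le> (SUP y\<in>Y. F y - e * h y)"
    and "\<bar>(SUP y\<in>Y. F y - e * h y) - F z\<bar> \<le> e * B"
proof -
  have le: "F y - e * h y \<le> F z + e * B" if "y \<in> Y" for y
  proof -
    have "- h y \<le> B" using B[of y] by linarith
    then have "e * (- h y) \<le> e * B" using e by (intro mult_left_mono) auto
    moreover have "F y \<le> F z" using w that by (auto simp: well_posed_def)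
    ultimately show ?thesis by simp
  qed
  then show bdd: "bdd_above ((\<lambda>y. F y - e * h y) ` Y)" by (auto intro!: bdd_aboveI)
  have z: "z \<in> Y" using w by (simp add: well_posed_def)
  then show ge: "F z - e * h z \<le> (SUP y\<in>Y. F y - e * h y)" by (intro cSUP_upper bdd)
  have "e * h z \<le> e * B" using B[of z] e by (intro mult_left_mono) auto
  moreover have "(SUP y\<in>Y. F y - e * h y) \<le> F z + e * B" using z le by (intro cSUP_least) auto
  ultimately show "\<bar>(SUP y\<in>Y. F y - e * h y) - F z\<bar> \<le> e * B" using ge by linarith
qed

text \<open>Danskin's theorem at 0. Once 2 e B is below the gap \<kappa>, points at distance
  \<delta> or more cannot compete with z, and on the remaining ones h is close to
  \<open>h z\<close>.\<close>

lemma envelope_limit: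
  assumes w: "well_posed Y F z" and B: "\<And>y. \<bar>h y\<bar> \<le> B" and h: "isCont h z"
    and e: "\<And>n. e n > 0" "e \<longlonglongrightarrow> 0"
  shows "(\<lambda>n. ((SUP y\<in>Y. F y - e n * h y) - F z) / e n) \<longlonglongrightarrow> - h z"
proof (rule tendstoI)
  fix \<eta> :: real assume \<eta>: "\<eta> > 0"
  obtain \<delta> where \<delta>: "\<delta> > 0" "\<And>y. dist y z < \<delta> \<Longrightarrow> dist (h y) (h z) < \<eta> / 2"
    using h \<eta> unfolding continuous_at by (metis half_gt_zero LIM_def dist_self)
  obtain \<kappa> where \<kappa>: "\<kappa> > 0" "\<And>y. y \<in> Y \<Longrightarrow> dist y z \<ge> \<delta> \<Longrightarrow> F y \<le> F z - \<kappa>"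
    using w \<delta>(1) by (auto simp: well_posed_def)
  have "(\<lambda>n. 2 * e n * B) \<longlonglongrightarrow> 2 * 0 * B" by (intro tendsto_intros e)
  then have "eventually (\<lambda>n. 2 * e n * B < \<kappa>) sequentially"
    using \<kappa>(1) by (intro order_tendstoD(2)[where y = "2 * 0 * B"]) auto
  then show "eventually (\<lambda>n. dist (((SUP y\<in>Y. F y - e n * h y) - F z) / e n) (- h z) < \<eta>) sequentially"
  proof eventually_elim
    case (elim n)
    have "F y - e n * h y \<le> F z - e n * h z + e n * (\<eta> / 2)" if y: "y \<in> Y" for y
    proof (cases "dist y z < \<delta>")
      case True
      then have "h z - h y \<le> \<eta> / 2" using \<delta>(2)[OF True] unfolding dist_real_def by linarith
      then have "e n * (h z - h y) \<le> e n * (\<eta> / 2)" using e(1)[of n] by (intro mult_left_mono) auto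
      moreover have "F y \<le> F z" using w y by (auto simp: well_posed_def)
      ultimately show ?thesis by (simp add: algebra_simps)
    next
      case False
      have "e n * (h z - h y) \<le> e n * (2 * B)"
        using B[of z] B[of y] e(1)[of n] by (intro mult_left_mono) auto
      moreover have "e n * (\<eta> / 2) > 0" using e(1)[of n] \<eta> by simp
      ultimately show ?thesis using \<kappa>(2)[OF y] False elim by (simp add: algebra_simps)
    qed
    then have "(SUP y\<in>Y. F y - e n * h y) \<le> F z - e n * h z + e n * (\<eta> / 2)"
      using w by (intro cSUP_least) (auto simp: well_posed_def)
    moreover note well_posed_SUP(2)[where h = h, OF w B e(1)[of n]]
    ultimately have "\<bar>(SUP y\<in>Y. F y - e n * h y) - F z + e n * h z\<bar> \<le> e n * (\<eta> / 2)"
      using e(1)[of n] \<eta> by (auto simp: abs_le_iff intro: order.trans[of _ 0])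
    then have "\<bar>(SUP y\<in>Y. F y - e n * h y) - F z + e n * h z\<bar> / e n \<le> \<eta> / 2"
      using e(1)[of n] by (simp add: field_simps)
    moreover have "((SUP y\<in>Y. F y - e n * h y) - F z) / e n - (- h z) = ((SUP y\<in>Y. F y - e n * h y) - F z + e n * h z) / e n"
      using less_imp_neq[OF e(1)[of n], symmetric] by (simp only: add_divide_distrib) simp
    ultimately show ?case using \<eta> e(1)[of n] unfolding dist_real_def by (simp only: abs_divide abs_of_pos)
  qed
qed

text \<open>If \<open>\<nu>\<close> acts as a subgradient of \<open>h \<mapsto> \<integral> sup\<^sub>y (F x y - h y) d\<mu>\<close> at \<open>0\<close> up to sign, then it is
  the law of the maximiser.\<close>

lemma pushforward_envelope:
  fixes Z :: "'a::euclidean_space \<Rightarrow> 'b::euclidean_space"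
  assumes p: "prob_space \<mu>" "prob_space \<nu>" and s: "sets \<mu> = sets borel" "sets \<nu> = sets borel"
    and Z[measurable]: "Z \<in> borel_measurable borel"
    and w: "AE x in \<mu>. well_posed Y (F x) (Z x)"
    and int: "integrable \<mu> (\<lambda>x. F x (Z x))"
    and le: "\<And>h e. bdd_lipschitz h \<Longrightarrow> e > 0 \<Longrightarrow>
       \<exists>G. G \<in> borel_measurable \<mu> \<and> (AE x in \<mu>. G x = (SUP y\<in>Y. F x y - e * h y)) \<and>
           (\<integral>x. F x (Z x) \<partial>\<mu>) \<le> (\<integral>x. G x \<partial>\<mu>) + e * (\<integral>y. h y \<partial>\<nu>)"
  shows "\<nu> = distr \<mu> borel Z"
proof -
  interpret M: prob_space \<mu> by fact
  interpret N: prob_space \<nu> by fact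
  note [measurable_cong] = s
  \<comment> \<open>One inequality for all h is enough, as the reverse one is that for -h. It is the
    limit of the difference quotients, which are bounded by B. The measurable function G stands in
    for the supremum, which is prescribed only almost everywhere.\<close>
  have half: "(\<integral>x. h (Z x) \<partial>\<mu>) \<le> (\<integral>y. h y \<partial>\<nu>)" if h: "bdd_lipschitz h" for h
  proof -
    obtain B where B: "B \<ge> 0" "\<And>x. \<bar>h x\<bar> \<le> B" using bdd_lipschitzE[OF h] by metis
    have [measurable]: "h \<in> borel_measurable borel" by (rule bdd_lipschitz_borel[OF h])
    define e where "e n = 1 / real (Suc n)" for n
    have e: "e n > 0" for n by (simp add: e_def)
    have e0: "e \<longlonglongrightarrow> 0" unfolding e_def by (rule LIMSEQ_Suc[OF lim_1_over_n])
    have "\<forall>n. \<exists>G. G \<in> borel_measurable \<mu> \<and> (AE x in \<mu>. G x = (SUP y\<in>Y. F x y - e n * h y)) \<and>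
           (\<integral>x. F x (Z x) \<partial>\<mu>) \<le> (\<integral>x. G x \<partial>\<mu>) + e n * (\<integral>y. h y \<partial>\<nu>)"
      using le[OF h e] by blast
    from choice[OF this] obtain G where G_all: "\<And>n. G n \<in> borel_measurable \<mu> \<and> (AE x in \<mu>. G n x = (SUP y\<in>Y. F x y - e n * h y)) \<and>
           (\<integral>x. F x (Z x) \<partial>\<mu>) \<le> (\<integral>x. G n x \<partial>\<mu>) + e n * (\<integral>y. h y \<partial>\<nu>)" by blast
    then have G[measurable]: "\<And>n. G n \<in> borel_measurable \<mu>"
      and G_eq: "\<And>n. AE x in \<mu>. G n x = (SUP y\<in>Y. F x y - e n * h y)"
      and G_le: "\<And>n. (\<integral>x. F x (Z x) \<partial>\<mu>) \<le> (\<integral>x. G n x \<partial>\<mu>) + e n * (\<integral>y. h y \<partial>\<nu>)" by auto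
    have [measurable]: "(\<lambda>x. F x (Z x)) \<in> borel_measurable \<mu>" using int by auto
    have ae: "AE x in \<mu>. \<forall>n. G n x = (SUP y\<in>Y. F x y - e n * h y)"
      using G_eq by (simp add: AE_all_countable)
    have bound: "AE x in \<mu>. \<bar>(G n x - F x (Z x)) / e n\<bar> \<le> B" for n
      using ae w
    proof eventually_elim
      case (elim x)
      then have "\<bar>G n x - F x (Z x)\<bar> \<le> e n * B" using well_posed_SUP(3)[OF elim(2) B(2) e[of n]] by simp
      then have "\<bar>G n x - F x (Z x)\<bar> / e n \<le> B"
        using e[of n] by (simp only: pos_divide_le_eq mult.commute)
      then show ?case using e[of n] by (simp only: abs_divide abs_of_pos)
    qed
    have "(\<lambda>n. \<integral>x. (G n x - F x (Z x)) / e n \<partial>\<mu>) \<longlonglongrightarrow> (\<integral>x. - h (Z x) \<partial>\<mu>)"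
    proof (rule integral_dominated_convergence[where w = "\<lambda>_. B"])
      show "AE x in \<mu>. (\<lambda>n. (G n x - F x (Z x)) / e n) \<longlonglongrightarrow> - h (Z x)"
        using ae w
      proof eventually_elim
        case (elim x)
        have "isCont h (Z x)" using bdd_lipschitz_continuous[OF h, of UNIV] by (simp add: continuous_on_eq_continuous_at)
        from envelope_limit[OF elim(2) B(2) this e e0] show ?case using elim(1) by simp
      qed
      show "AE x in \<mu>. norm ((G n x - F x (Z x)) / e n) \<le> B" for n using bound[of n] by simp
    qed auto
    moreover have "- (\<integral>y. h y \<partial>\<nu>) \<le> (\<integral>x. (G n x - F x (Z x)) / e n \<partial>\<mu>)" for n
    proof -
      have "integrable \<mu> (\<lambda>x. (G n x - F x (Z x)) / e n)"
        by (rule M.integrable_const_bound[of _ B]) (use bound in auto)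
      then have "integrable \<mu> (\<lambda>x. (G n x - F x (Z x)) / e n * e n + F x (Z x))"
        by (intro Bochner_Integration.integrable_add integrable_mult_left int)
      moreover have "(\<lambda>x. (G n x - F x (Z x)) / e n * e n + F x (Z x)) = G n"
        using less_imp_neq[OF e[of n]] by auto
      ultimately have iG: "integrable \<mu> (G n)" by simp
      show ?thesis using G_le[of n] e[of n] iG int by (simp add: field_simps)
    qed
    ultimately have "- (\<integral>y. h y \<partial>\<nu>) \<le> (\<integral>x. - h (Z x) \<partial>\<mu>)"
      by (intro LIMSEQ_le_const) auto
    then show ?thesis by simp
  qed
  show ?thesis
  proof (rule measure_eqI_bdd_lipschitz[OF p(2) M.prob_space_distr s(2)])
    fix h :: "'b \<Rightarrow> real" assume h: "bdd_lipschitz h"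
    have [measurable]: "h \<in> borel_measurable borel" by (rule bdd_lipschitz_borel[OF h])
    have "(\<integral>x. h (Z x) \<partial>\<mu>) = (\<integral>y. h y \<partial>\<nu>)"
      using half[OF h] half[OF bdd_lipschitz_uminus[OF h]] by simp
    then show "(\<integral>y. h y \<partial>\<nu>) = (\<integral>y. h y \<partial>distr \<mu> borel Z)" by (simp add: integral_distr)
  qed auto
qed

text \<open>The family may be uncountable: superlevel sets of the supremum are unions of sets open
  in S, so no countable subfamily has to be extracted.\<close>

lemma borel_measurable_cSUP_open:
  fixes f :: "'b \<Rightarrow> 'a::euclidean_space \<Rightarrow> real"
  assumes S: "open S" and Y: "Y \<noteq> {}" and f: "\<And>y. y \<in> Y \<Longrightarrow> continuous_on S (f y)"
    and bdd: "\<And>x. x \<in> S \<Longrightarrow> bdd_above ((\<lambda>y. f y x) ` Y)"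
  shows "(\<lambda>x. if x \<in> S then SUP y\<in>Y. f y x else 0) \<in> borel_measurable borel"
proof (rule borel_measurableI_greater)
  fix a :: real
  have "{x \<in> space borel. a < (if x \<in> S then SUP y\<in>Y. f y x else 0)}
     = (\<Union>y\<in>Y. S \<inter> f y -` {a<..}) \<union> (if a < 0 then - S else {})"
    using bdd Y by (auto simp: less_cSUP_iff)
  moreover have "open (\<Union>y\<in>Y. S \<inter> f y -` {a<..})"
    using f S by (intro open_UN ballI) (auto intro: continuous_open_preimage)
  ultimately show "{x \<in> space borel. a < (if x \<in> S then SUP y\<in>Y. f y x else 0)} \<in> sets borel"
    using S by auto
qed

section \<open>Existence of dual potentials\<close>

text \<open>The cost is \<open>k (x + y)\<close>, so the transform below is its own mirror image and serves both
  marginals.\<close>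

definition ctrans :: "'a::euclidean_space set \<Rightarrow> ('a \<Rightarrow> real) \<Rightarrow> ('a \<Rightarrow> real) \<Rightarrow> 'a \<Rightarrow> real" where
  "ctrans Y k g x = (SUP y\<in>Y. k (x + y) - g y)"

locale sum_cost =
  fixes k :: "'a::euclidean_space \<Rightarrow> real"
  assumes cont: "continuous_on UNIV k"
    and loc_lipschitz: "\<exists>L\<ge>0. \<forall>p q. norm p \<le> R \<longrightarrow> norm q \<le> R \<longrightarrow> \<bar>k p - k q\<bar> \<le> L * norm (p - q)"
begin

definition admissible :: "'a set \<Rightarrow> ('a \<Rightarrow> real) \<Rightarrow> bool" where
  "admissible Y g \<longleftrightarrow> g \<in> borel_measurable borel \<and> (\<exists>B. \<forall>y\<in>Y. \<bar>g y\<bar> \<le> B)"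

lemma cost_bounded:
  assumes "bounded Y" shows "\<exists>B. \<forall>y\<in>Y. \<bar>k (x + y)\<bar> \<le> B"
proof -
  obtain R where R: "\<And>y. y \<in> Y \<Longrightarrow> norm y \<le> R" using assms by (auto simp: bounded_iff)
  have "compact (k ` cball 0 (norm x + R))"
    by (intro compact_continuous_image continuous_on_subset[OF cont]) auto
  then obtain B where B: "\<And>p. norm p \<le> norm x + R \<Longrightarrow> \<bar>k p\<bar> \<le> B"
    using compact_imp_bounded by (fastforce simp: bounded_iff)
  have "\<bar>k (x + y)\<bar> \<le> B" if "y \<in> Y" for y
    using R[OF that] norm_triangle_ineq[of x y] by (intro B) linarith
  then show ?thesis by blast
qed

lemma bdd_above_ctrans:
  assumes "bounded Y" "\<forall>y\<in>Y. \<bar>g y\<bar> \<le> B"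
  shows "bdd_above ((\<lambda>y. k (x + y) - g y) ` Y)"
proof -
  obtain C where C: "\<forall>y\<in>Y. \<bar>k (x + y)\<bar> \<le> C" using cost_bounded[OF assms(1)] by blast
  show ?thesis by (rule bdd_aboveI[of _ "C + B"]) (use C assms(2) in \<open>fastforce simp: abs_le_iff\<close>)
qed

lemma ctrans_ge:
  assumes "bounded Y" "admissible Y g" "y \<in> Y"
  shows "k (x + y) - g y \<le> ctrans Y k g x"
proof -
  obtain B where "\<forall>y\<in>Y. \<bar>g y\<bar> \<le> B" using assms(2) by (auto simp: admissible_def)
  from bdd_above_ctrans[OF assms(1) this] show ?thesis
    unfolding ctrans_def by (intro cSUP_upper assms(3))
qed

lemma ctrans_le:
  assumes "Y \<noteq> {}" "\<And>y. y \<in> Y \<Longrightarrow> k (x + y) - g y \<le> B"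
  shows "ctrans Y k g x \<le> B"
  unfolding ctrans_def using assms by (intro cSUP_least)

lemma ctrans_borel:
  assumes "bounded Y" "Y \<noteq> {}" "admissible Y g"
  shows "ctrans Y k g \<in> borel_measurable borel"
proof -
  obtain B where B: "\<forall>y\<in>Y. \<bar>g y\<bar> \<le> B" using assms(3) by (auto simp: admissible_def)
  have "(\<lambda>x. if x \<in> UNIV then SUP y\<in>Y. k (x + y) - g y else 0) \<in> borel_measurable borel"
    by (intro borel_measurable_cSUP_open assms continuous_intros continuous_on_compose2[OF cont]
        bdd_above_ctrans[OF assms(1) B]) auto
  then show ?thesis by (simp add: ctrans_def[abs_def])
qed

text \<open>The constant does not depend on g, which is the equicontinuity for Arzela--Ascoli. It is
  taken on radius 2 R because the cost is evaluated at a sum of two points of norm at most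
  R.\<close>

lemma ctrans_lipschitz:
  assumes "Y \<noteq> {}" and R: "\<And>y. y \<in> Y \<Longrightarrow> norm y \<le> R" "norm x \<le> R" "norm x' \<le> R"
    and g: "admissible Y g"
    and L: "\<And>p q. norm p \<le> 2 * R \<Longrightarrow> norm q \<le> 2 * R \<Longrightarrow> \<bar>k p - k q\<bar> \<le> L * norm (p - q)"
  shows "\<bar>ctrans Y k g x - ctrans Y k g x'\<bar> \<le> L * norm (x - x')"
proof -
  have Y: "bounded Y" using R(1) by (auto simp: bounded_iff)
  have le: "ctrans Y k g x \<le> ctrans Y k g x' + L * norm (x - x')" if "norm x \<le> R" "norm x' \<le> R" for x x'
  proof (rule ctrans_le[OF assms(1)])
    fix y assume y: "y \<in> Y"
    have "norm (x + y) \<le> 2 * R" "norm (x' + y) \<le> 2 * R"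
      using that R(1)[OF y] norm_triangle_ineq[of x y] norm_triangle_ineq[of x' y] by linarith+
    then have "\<bar>k (x + y) - k (x' + y)\<bar> \<le> L * norm (x - x')" using L[of "x + y" "x' + y"] by simp
    then show "k (x + y) - g y \<le> ctrans Y k g x' + L * norm (x - x')"
      using ctrans_ge[OF Y g y, of x'] by linarith
  qed
  show ?thesis using le[OF R(2,3)] le[OF R(3,2)] by (simp add: norm_minus_commute abs_le_iff)
qed

lemma ctrans_admissible:
  assumes Y: "bounded Y" "Y \<noteq> {}" and X: "bounded X" and g: "admissible Y g"
  shows "admissible X (ctrans Y k g)"
proof (cases "X = {}")
  case False
  then obtain x0 where x0: "x0 \<in> X" by blast
  obtain R1 where R1: "\<And>y. y \<in> Y \<Longrightarrow> norm y \<le> R1" using Y by (auto simp: bounded_iff)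
  obtain R2 where R2: "\<And>y. y \<in> X \<Longrightarrow> norm y \<le> R2" using X by (auto simp: bounded_iff)
  define R where "R = max R1 R2"
  obtain L where L: "L \<ge> 0" "\<And>p q. norm p \<le> 2 * R \<Longrightarrow> norm q \<le> 2 * R \<Longrightarrow> \<bar>k p - k q\<bar> \<le> L * norm (p - q)"
    using loc_lipschitz[of "2 * R"] by blast
  have "\<bar>ctrans Y k g x\<bar> \<le> \<bar>ctrans Y k g x0\<bar> + L * (2 * R)" if "x \<in> X" for x
  proof -
    have "\<bar>ctrans Y k g x - ctrans Y k g x0\<bar> \<le> L * norm (x - x0)"
      by (rule ctrans_lipschitz[OF Y(2), of R])
        (use R1 R2 that x0 g L(2) in \<open>auto simp: R_def intro: le_max_iff_disj[THEN iffD2]\<close>)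
    also have "\<dots> \<le> L * (2 * R)"
      using norm_triangle_ineq4[of x x0] R2[OF that] R2[OF x0] L(1)
      by (intro mult_left_mono) (auto simp: R_def)
    finally show ?thesis by linarith
  qed
  then show ?thesis using ctrans_borel[OF Y g] by (auto simp: admissible_def)
qed (use ctrans_borel[OF Y g] in \<open>auto simp: admissible_def\<close>)

lemma ctrans_anti:
  assumes "bounded Y" "Y \<noteq> {}" "admissible Y g" "\<And>y. y \<in> Y \<Longrightarrow> g y \<le> g' y"
  shows "ctrans Y k g' x \<le> ctrans Y k g x"
proof (rule ctrans_le[OF assms(2)])
  fix y assume "y \<in> Y"
  then show "k (x + y) - g' y \<le> ctrans Y k g x"
    using ctrans_ge[OF assms(1,3), of y x] assms(4)[of y] by linarith
qed

lemma ctrans_shift: "bounded Y \<Longrightarrow> Y \<noteq> {} \<Longrightarrow> admissible Y g \<Longrightarrow>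
  ctrans Y k (\<lambda>y. g y - a) x = ctrans Y k g x + a"
proof -
  assume Y: "bounded Y" "Y \<noteq> {}" "admissible Y g"
  then obtain B where B: "\<forall>y\<in>Y. \<bar>g y\<bar> \<le> B" by (auto simp: admissible_def)
  have "admissible Y (\<lambda>y. g y - a)"
    using Y(3) B by (auto simp: admissible_def intro!: exI[of _ "B + \<bar>a\<bar>"])
  note ge = ctrans_ge[OF Y(1) this]
  have "ctrans Y k g x \<le> ctrans Y k (\<lambda>y. g y - a) x - a"
    by (rule ctrans_le[OF Y(2)]) (use ge[of _ x] in \<open>simp add: algebra_simps\<close>)
  moreover have "ctrans Y k (\<lambda>y. g y - a) x \<le> ctrans Y k g x + a"
    by (rule ctrans_le[OF Y(2)]) (use ctrans_ge[OF Y(1,3), of _ x] in \<open>simp add: algebra_simps\<close>)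
  ultimately show ?thesis by simp
qed

lemma ctrans_double_le:
  assumes "bounded Y" "X \<noteq> {}" "admissible Y g" "y \<in> Y"
  shows "ctrans X k (ctrans Y k g) y \<le> g y"
proof (rule ctrans_le[OF assms(2)])
  fix x show "k (y + x) - ctrans Y k g x \<le> g y"
    using ctrans_ge[OF assms(1,3,4), of x] by (simp add: add.commute)
qed

text \<open>As in a Galois connection: one direction is \<open>ctrans_double_le\<close> for the
  transform of g, the other comes from transforming \<open>ctrans_double_le\<close> for g, which
  reverses the inequality.\<close>

lemma ctrans_triple:
  assumes X: "bounded X" "X \<noteq> {}" and Y: "bounded Y" "Y \<noteq> {}" and g: "admissible Y g" and x: "x \<in> X"
  shows "ctrans Y k (ctrans X k (ctrans Y k g)) x = ctrans Y k g x"
proof (rule antisym)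
  show "ctrans Y k (ctrans X k (ctrans Y k g)) x \<le> ctrans Y k g x"
    by (rule ctrans_double_le[OF X(1) Y(2) ctrans_admissible[OF Y X(1) g] x])
  show "ctrans Y k g x \<le> ctrans Y k (ctrans X k (ctrans Y k g)) x"
    by (intro ctrans_anti Y ctrans_admissible X g ctrans_double_le)
qed

end

section \<open>The dual functional and its minimiser\<close>

locale dual_problem = sum_cost k for k :: "'a::euclidean_space \<Rightarrow> real" +
  fixes X Y :: "'a set" and \<mu> \<nu> :: "'a measure"
  assumes X: "compact X" "X \<noteq> {}" and Y: "compact Y" "Y \<noteq> {}"
    and \<mu>: "prob_space \<mu>" "sets \<mu> = sets borel" "AE x in \<mu>. x \<in> X"
    and \<nu>: "prob_space \<nu>" "sets \<nu> = sets borel" "AE y in \<nu>. y \<in> Y"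
begin

lemma bX: "bounded X" and bY: "bounded Y"
  using X Y compact_imp_bounded by auto

lemma integrable_admissible:
  "admissible X f \<Longrightarrow> integrable \<mu> f" "admissible Y g \<Longrightarrow> integrable \<nu> g"
proof -
  interpret M: prob_space \<mu> by (rule \<mu>)
  interpret N: prob_space \<nu> by (rule \<nu>)
  show "integrable \<mu> f" if f: "admissible X f"
  proof -
    obtain B where "\<forall>x\<in>X. \<bar>f x\<bar> \<le> B" using f by (auto simp: admissible_def)
    then show ?thesis using \<mu>(3) f \<mu>(2)
      by (intro M.integrable_const_bound[of _ B]) (auto simp: admissible_def cong: measurable_cong_sets)
  qed
  show "integrable \<nu> g" if g: "admissible Y g"
  proof -
    obtain B where "\<forall>x\<in>Y. \<bar>g x\<bar> \<le> B" using g by (auto simp: admissible_def)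
    then show ?thesis using \<nu>(3) g \<nu>(2)
      by (intro N.integrable_const_bound[of _ B]) (auto simp: admissible_def cong: measurable_cong_sets)
  qed
qed

text \<open>The Kantorovich dual functional after eliminating the first potential: given g, the
  transform is the smallest function compatible with it.\<close>

definition dual :: "('a \<Rightarrow> real) \<Rightarrow> real" where
  "dual g = (\<integral>x. ctrans Y k g x \<partial>\<mu>) + (\<integral>y. g y \<partial>\<nu>)"

lemma dual_mono:
  assumes "admissible Y g" "admissible Y g'"
    "\<And>x. x \<in> X \<Longrightarrow> ctrans Y k g x \<le> ctrans Y k g' x + a" "\<And>y. y \<in> Y \<Longrightarrow> g y \<le> g' y + b"
  shows "dual g \<le> dual g' + a + b"
proof -
  interpret M: prob_space \<mu> by (rule \<mu>)
  interpret N: prob_space \<nu> by (rule \<nu>)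
  note i = integrable_admissible(1)[OF ctrans_admissible[OF bY Y(2) bX]] integrable_admissible(2)
  have "(\<integral>x. ctrans Y k g x \<partial>\<mu>) \<le> (\<integral>x. ctrans Y k g' x + a \<partial>\<mu>)"
    using \<mu>(3) assms i by (intro integral_mono_AE) auto
  moreover have "(\<integral>y. g y \<partial>\<nu>) \<le> (\<integral>y. g' y + b \<partial>\<nu>)"
    using \<nu>(3) assms i by (intro integral_mono_AE) auto
  ultimately show ?thesis
    using assms i by (simp add: dual_def M.prob_space N.prob_space)
qed

text \<open>The transform at x plus g at y dominates the cost, which is bounded on X + Y.
  Integrating successively over the two probability measures removes x and y.\<close>

lemma dual_bounded_below: "\<exists>C. \<forall>g. admissible Y g \<longrightarrow> C \<le> dual g"
proof -
  interpret M: prob_space \<mu> by (rule \<mu>)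
  interpret N: prob_space \<nu> by (rule \<nu>)
  obtain R1 where R1: "\<And>y. y \<in> Y \<Longrightarrow> norm y \<le> R1" using bY by (auto simp: bounded_iff)
  obtain R2 where R2: "\<And>y. y \<in> X \<Longrightarrow> norm y \<le> R2" using bX by (auto simp: bounded_iff)
  obtain B where "\<forall>p\<in>cball 0 (R1 + R2). \<bar>k (0 + p)\<bar> \<le> B"
    using cost_bounded[OF bounded_cball] by blast
  then have B: "\<And>p. norm p \<le> R1 + R2 \<Longrightarrow> \<bar>k p\<bar> \<le> B" by simp
  have "- B \<le> dual g" if g: "admissible Y g" for g
  proof -
    note i = integrable_admissible(1)[OF ctrans_admissible[OF bY Y(2) bX g]] integrable_admissible(2)[OF g]
    have le: "- B - g y \<le> (\<integral>x. ctrans Y k g x \<partial>\<mu>)" if y: "y \<in> Y" for y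
    proof -
      have "- B - g y \<le> ctrans Y k g x" if "x \<in> X" for x
        using ctrans_ge[OF bY g y, of x] B[of "x + y"] R1[OF y] R2[OF that] norm_triangle_ineq[of x y]
        by (simp add: abs_le_iff)
      then have "(\<integral>x. - B - g y \<partial>\<mu>) \<le> (\<integral>x. ctrans Y k g x \<partial>\<mu>)"
        using \<mu>(3) i by (intro integral_mono_AE) auto
      then show ?thesis by (simp add: M.prob_space)
    qed
    have "(\<integral>y. - B - (\<integral>x. ctrans Y k g x \<partial>\<mu>) \<partial>\<nu>) \<le> (\<integral>y. g y \<partial>\<nu>)"
      using \<nu>(3) le i by (intro integral_mono_AE) (auto simp: diff_le_eq le_diff_eq add.commute)
    then show ?thesis by (simp add: dual_def N.prob_space)
  qed
  then show ?thesis by blast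
qed

lemma dual_minimiser:
  obtains \<phi> \<psi> where "admissible Y \<psi>" "\<phi> = ctrans Y k \<psi>" "\<psi> = ctrans X k \<phi>"
    "\<And>g. admissible Y g \<Longrightarrow> dual \<psi> \<le> dual g"
proof -
  interpret N: prob_space \<nu> by (rule \<nu>)
  interpret M: prob_space \<mu> by (rule \<mu>)
  define S where "S = dual ` {g. admissible Y g}"
  have ne: "S \<noteq> {}" unfolding S_def by (auto simp: admissible_def intro!: exI[of _ "\<lambda>_. 0"])
  have bb: "bdd_below S" using dual_bounded_below unfolding S_def bdd_below_def by blast
  have "\<exists>g. admissible Y g \<and> dual g < Inf S + 1 / real (Suc n)" for n
    using cInf_lessD[OF ne, of "Inf S + 1 / real (Suc n)"] by (auto simp: S_def)
  then obtain g where g: "\<And>n. admissible Y (g n)" "\<And>n. dual (g n) < Inf S + 1 / real (Suc n)" by metis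
  obtain y0 where y0: "y0 \<in> Y" using Y by blast
  obtain R1 where R1: "\<And>y. y \<in> Y \<Longrightarrow> norm y \<le> R1" using bY by (auto simp: bounded_iff)
  obtain R2 where R2: "\<And>y. y \<in> X \<Longrightarrow> norm y \<le> R2" using bX by (auto simp: bounded_iff)
  define R where "R = max R1 R2"
  have R: "\<And>y. y \<in> Y \<Longrightarrow> norm y \<le> R" "\<And>y. y \<in> X \<Longrightarrow> norm y \<le> R"
    using R1 R2 by (fastforce simp: R_def)+
  obtain L where L: "L \<ge> 0" "\<And>p q. norm p \<le> 2 * R \<Longrightarrow> norm q \<le> 2 * R \<Longrightarrow> \<bar>k p - k q\<bar> \<le> L * norm (p - q)"
    using loc_lipschitz[of "2 * R"] by blast
  \<comment> \<open>The double transform does not raise the dual value and makes the sequence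
    equi-Lipschitz on Y. Subtracting the value at y0 then gives a uniform bound and leaves the dual
    value alone, since both measures have mass 1.\<close>
  define q where "q n = ctrans X k (ctrans Y k (g n))" for n
  define p where "p n y = q n y - q n y0" for n y
  have qa: "admissible Y (q n)" for n
    unfolding q_def by (intro ctrans_admissible bX bY X Y g)
  have shift_adm: "admissible Y (\<lambda>y. h y - a)" if h: "admissible Y h" for h a
  proof -
    obtain B where "\<forall>y\<in>Y. \<bar>h y\<bar> \<le> B" using h by (auto simp: admissible_def)
    then show ?thesis using h by (auto simp: admissible_def intro!: exI[of _ "B + \<bar>a\<bar>"])
  qed
  have pa: "admissible Y (p n)" for n unfolding p_def[abs_def] by (rule shift_adm[OF qa])
  have Dq: "dual (q n) \<le> dual (g n)" for n
    using dual_mono[OF qa g(1)[of n], where a = 0 and b = 0] ctrans_double_le[OF bY X(2) g(1)]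
      ctrans_triple[OF bX X(2) bY Y(2) g(1)] by (simp add: q_def)
  have Dp: "dual (p n) = dual (q n)" for n
  proof -
    have "ctrans Y k (p n) = (\<lambda>x. ctrans Y k (q n) x + q n y0)"
      unfolding p_def[abs_def] using ctrans_shift[OF bY Y(2) qa] by auto
    then show ?thesis
      using integrable_admissible(1)[OF ctrans_admissible[OF bY Y(2) bX qa]] integrable_admissible(2)[OF qa]
      by (simp add: dual_def p_def M.prob_space N.prob_space)
  qed
  have plip: "\<bar>p n y - p n y'\<bar> \<le> L * norm (y - y')" if "y \<in> Y" "y' \<in> Y" for n y y'
    using ctrans_lipschitz[OF X(2) R(2) R(1)[OF that(1)] R(1)[OF that(2)] ctrans_admissible[OF bY Y(2) bX g(1)] L(2), of n]
    by (simp add: p_def q_def)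
  have pb: "\<bar>p n y\<bar> \<le> L * (2 * R)" if "y \<in> Y" for n y
  proof -
    have "\<bar>p n y - p n y0\<bar> \<le> L * norm (y - y0)" using plip[OF that y0] .
    also have "\<dots> \<le> L * (2 * R)"
      using norm_triangle_ineq4[of y y0] R(1)[OF that] R(1)[OF y0] L(1) by (intro mult_left_mono) auto
    finally show ?thesis by (simp add: p_def)
  qed
  obtain p0 r where p0: "continuous_on Y p0" "strict_mono (r :: nat \<Rightarrow> nat)"
    and lim: "\<And>e. 0 < e \<Longrightarrow> \<exists>N. \<forall>n y. n \<ge> N \<and> y \<in> Y \<longrightarrow> norm (p (r n) y - p0 y) < e"
  proof (rule Arzela_Ascoli[OF Y(1), of p "L * (2 * R)"])
    show "norm (p n y) \<le> L * (2 * R)" if "y \<in> Y" for n y using pb[OF that] by simp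
    fix x e assume x: "x \<in> Y" and e: "(e::real) > 0"
    have "norm (p n x - p n y) < e" if "y \<in> Y" "norm (x - y) < e / (L + 1)" for n y
    proof -
      have "norm (p n x - p n y) \<le> L * norm (x - y)" using plip[OF x that(1)] by simp
      also have "\<dots> \<le> (L + 1) * norm (x - y)" by (intro mult_right_mono) auto
      also have "\<dots> < e" using that(2) L(1) by (simp add: pos_less_divide_eq mult.commute)
      finally show ?thesis .
    qed
    then show "\<exists>d>0. \<forall>n y. y \<in> Y \<and> norm (x - y) < d \<longrightarrow> norm (p n x - p n y) < e"
      using e L(1) by (intro exI[of _ "e / (L + 1)"]) auto
  qed blast
  \<comment> \<open>The limit is controlled on Y only; extension by 0 makes it Borel on the whole
    space.\<close>
  define p1 where "p1 y = (if y \<in> Y then p0 y else 0)" for y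
  have p1a: "admissible Y p1"
    unfolding admissible_def
  proof
    have "(\<lambda>y. indicator Y y *\<^sub>R p0 y) \<in> borel_measurable borel"
      by (intro borel_measurable_continuous_on_indicator p0(1) borel_closed compact_imp_closed Y(1))
    moreover have "(\<lambda>y. indicator Y y *\<^sub>R p0 y) = p1" by (auto simp: p1_def fun_eq_iff)
    ultimately show "p1 \<in> borel_measurable borel" by simp
    show "\<exists>B. \<forall>y\<in>Y. \<bar>p1 y\<bar> \<le> B"
      using compact_imp_bounded[OF compact_continuous_image[OF p0(1) Y(1)]]
      by (auto simp: bounded_iff p1_def)
  qed
  have "dual p1 \<le> Inf S + e" if e: "e > 0" for e
  proof -
    obtain N where N: "\<And>n y. n \<ge> N \<Longrightarrow> y \<in> Y \<Longrightarrow> \<bar>p (r n) y - p0 y\<bar> < e / 4"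
      using lim[of "e / 4"] e by auto
    obtain N2 where N2: "4 / e < real N2" using reals_Archimedean2 by blast
    define n where "n = max N N2"
    have d: "\<bar>p (r n) y - p1 y\<bar> \<le> e / 4" if "y \<in> Y" for y
      using N[of n y] that by (simp add: n_def p1_def)
    have "dual p1 \<le> dual (p (r n)) + e / 4 + e / 4"
    proof (rule dual_mono[OF p1a pa])
      show "p1 y \<le> p (r n) y + e / 4" if "y \<in> Y" for y using d[OF that] by linarith
      fix x
      show "ctrans Y k p1 x \<le> ctrans Y k (p (r n)) x + e / 4"
      proof (rule ctrans_le[OF Y(2)])
        fix y assume y: "y \<in> Y"
        show "k (x + y) - p1 y \<le> ctrans Y k (p (r n)) x + e / 4"
          using ctrans_ge[OF bY pa y, of x "r n"] d[OF y] by linarith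
      qed
    qed
    also have "dual (p (r n)) \<le> Inf S + 1 / real (Suc (r n))"
      using Dp[of "r n"] Dq[of "r n"] g(2)[of "r n"] by linarith
    also have "1 / real (Suc (r n)) \<le> e / 4"
    proof -
      have "N2 \<le> r n" using seq_suble[OF p0(2), of n] by (simp add: n_def)
      then have "real N2 \<le> real (r n)" by (rule of_nat_mono)
      then have "4 / e < real (Suc (r n))" using N2 by linarith
      then have "4 < real (Suc (r n)) * e" using e by (simp only: pos_divide_less_eq)
      then show ?thesis by (subst pos_divide_le_eq) (auto simp: mult.commute)
    qed
    finally show ?thesis using e by simp
  qed
  then have "dual p1 \<le> Inf S" by (meson field_le_epsilon)
  \<comment> \<open>A further double transform keeps minimality and turns the limit into a pair of
    functions that are transforms of each other everywhere, not only on X and Y.\<close>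
  moreover define \<psi> where "\<psi> = ctrans X k (ctrans Y k p1)"
  have psia: "admissible Y \<psi>" unfolding \<psi>_def by (intro ctrans_admissible bX bY X Y p1a)
  moreover have "dual \<psi> \<le> dual p1"
    using dual_mono[OF psia p1a, where a = 0 and b = 0] ctrans_double_le[OF bY X(2) p1a]
      ctrans_triple[OF bX X(2) bY Y(2) p1a] by (simp add: \<psi>_def)
  ultimately have min: "dual \<psi> \<le> dual g" if "admissible Y g" for g
    using cInf_lower[OF _ bb, of "dual g"] that by (force simp: S_def)
  have "\<psi> = ctrans X k (ctrans Y k \<psi>)"
  proof
    fix y
    have "ctrans X k (ctrans Y k \<psi>) y = ctrans X k (ctrans Y k p1) y"
      unfolding ctrans_def[of X] using ctrans_triple[OF bX X(2) bY Y(2) p1a]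
      by (intro SUP_cong) (auto simp: \<psi>_def)
    then show "\<psi> y = ctrans X k (ctrans Y k \<psi>) y" by (simp add: \<psi>_def)
  qed
  then show ?thesis using that[OF psia refl] min by blast
qed

end

section \<open>Hopf--Lax duality\<close>

text \<open>The Hopf--Lax formula with cost |z - x|^2 / (2 \<sigma>), written with the velocity u
  instead of the endpoint z so that \<sigma> = 0 is allowed and gives b back.\<close>

definition hopf :: "real \<Rightarrow> ('a::euclidean_space \<Rightarrow> real) \<Rightarrow> 'a \<Rightarrow> real" where
  "hopf \<sigma> b x = (SUP u. b (x + \<sigma> *\<^sub>R u) - \<sigma> / 2 * (norm u)^2)"

lemma hopf_bdd:
  assumes "\<And>z. \<bar>b z\<bar> \<le> B" "\<sigma> \<ge> 0"
  shows "bdd_above (range (\<lambda>u. b (x + \<sigma> *\<^sub>R u) - \<sigma> / 2 * (norm u)^2))"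
proof (rule bdd_aboveI[of _ B], clarify)
  fix u :: 'a
  have "0 \<le> \<sigma> / 2 * (norm u)^2" using assms(2) by simp
  then show "b (x + \<sigma> *\<^sub>R u) - \<sigma> / 2 * (norm u)^2 \<le> B" using assms(1)[of "x + \<sigma> *\<^sub>R u"] by linarith
qed

lemma hopf_upper:
  assumes "\<And>z. \<bar>b z\<bar> \<le> B" "\<sigma> \<ge> 0"
  shows "b (x + \<sigma> *\<^sub>R u) - \<sigma> / 2 * (norm u)^2 \<le> hopf \<sigma> b x"
  unfolding hopf_def by (rule cSUP_upper[OF UNIV_I hopf_bdd[OF assms]])

lemma hopf_least:
  assumes "\<And>u. b (x + \<sigma> *\<^sub>R u) - \<sigma> / 2 * (norm u)^2 \<le> C"
  shows "hopf \<sigma> b x \<le> C"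
  unfolding hopf_def using assms by (intro cSUP_least) auto

lemma hopf_ge:
  assumes "\<And>z. \<bar>b z\<bar> \<le> B" "\<sigma> > 0"
  shows "b z - (norm (z - x))^2 / (2 * \<sigma>) \<le> hopf \<sigma> b x"
proof -
  have "b (x + \<sigma> *\<^sub>R ((1 / \<sigma>) *\<^sub>R (z - x))) - \<sigma> / 2 * (norm ((1 / \<sigma>) *\<^sub>R (z - x)))^2 \<le> hopf \<sigma> b x"
    using assms(2) by (intro hopf_upper[where b = b, OF assms(1)]) auto
  moreover have "\<sigma> / 2 * (norm ((1 / \<sigma>) *\<^sub>R (z - x)))^2 = (norm (z - x))^2 / (2 * \<sigma>)"
    unfolding norm_scaleR using assms(2) by (simp add: power_divide power2_eq_square)
  ultimately show ?thesis using assms(2) by simp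
qed

lemma hopf_le:
  assumes "\<sigma> > 0" "\<And>z. b z - (norm (z - x))^2 / (2 * \<sigma>) \<le> C"
  shows "hopf \<sigma> b x \<le> C"
proof (rule hopf_least)
  fix u :: 'a
  show "b (x + \<sigma> *\<^sub>R u) - \<sigma> / 2 * (norm u)^2 \<le> C"
    using assms(2)[of "x + \<sigma> *\<^sub>R u"] assms(1) by (simp add: power_mult_distrib power2_eq_square ac_simps)
qed

lemma hopf_bounded:
  assumes "\<And>z. \<bar>b z\<bar> \<le> B" "\<sigma> \<ge> 0" shows "b x \<le> hopf \<sigma> b x" "\<bar>hopf \<sigma> b x\<bar> \<le> B"
proof -
  show ge: "b x \<le> hopf \<sigma> b x" using hopf_upper[where b = b and x = x and u = 0, OF assms] by simp
  have "hopf \<sigma> b x \<le> B"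
  proof (rule hopf_least)
    fix u :: 'a have "0 \<le> \<sigma> / 2 * (norm u)^2" using assms(2) by simp
    then show "b (x + \<sigma> *\<^sub>R u) - \<sigma> / 2 * (norm u)^2 \<le> B" using assms(1)[of "x + \<sigma> *\<^sub>R u"] by linarith
  qed
  then show "\<bar>hopf \<sigma> b x\<bar> \<le> B" using ge assms(1)[of x] by linarith
qed

lemma hopf_lipschitz:
  assumes B: "\<And>z. \<bar>b z\<bar> \<le> B" and \<sigma>: "\<sigma> \<ge> 0" and L: "\<And>x y. \<bar>b x - b y\<bar> \<le> L * norm (x - y)"
  shows "\<bar>hopf \<sigma> b x - hopf \<sigma> b y\<bar> \<le> L * norm (x - y)"
proof -
  have "hopf \<sigma> b x \<le> hopf \<sigma> b y + L * norm (x - y)" for x y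
  proof (rule hopf_least)
    fix u :: 'a
    show "b (x + \<sigma> *\<^sub>R u) - \<sigma> / 2 * (norm u)^2 \<le> hopf \<sigma> b y + L * norm (x - y)"
      using hopf_upper[where b = b and x = y and u = u, OF B \<sigma>] L[of "x + \<sigma> *\<^sub>R u" "y + \<sigma> *\<^sub>R u"] by simp
  qed
  from this[of x y] this[of y x] show ?thesis by (simp add: norm_minus_commute abs_le_iff)
qed

lemma bdd_lipschitz_hopf: "bdd_lipschitz b \<Longrightarrow> \<sigma> \<ge> 0 \<Longrightarrow> bdd_lipschitz (hopf \<sigma> b)"
  by (erule bdd_lipschitzE, rule bdd_lipschitzI) (auto intro: hopf_bounded hopf_lipschitz)

text \<open>Moving with velocity w for time s and then with u for time \<sigma> is replaced by the
  constant mean velocity v. The endpoint is the same, and by convexity of the square the energy is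
  no larger.\<close>

lemma hopf_semigroup_ge:
  assumes B: "\<And>z. \<bar>b z\<bar> \<le> B" and \<sigma>: "\<sigma> \<ge> 0" "s > 0"
  shows "hopf \<sigma> b (x + s *\<^sub>R w) \<le> hopf (\<sigma> + s) b x + s / 2 * (norm w)^2"
proof (rule hopf_least)
  fix u :: 'a
  define v where "v = (1 / (\<sigma> + s)) *\<^sub>R (s *\<^sub>R w + \<sigma> *\<^sub>R u)"
  have v: "(\<sigma> + s) *\<^sub>R v = s *\<^sub>R w + \<sigma> *\<^sub>R u" using \<sigma> by (simp add: v_def)
  have pos: "\<sigma> + s > 0" using \<sigma> by simp
  have "(\<sigma> + s) * ((\<sigma> + s) * (norm v)^2) = (norm (s *\<^sub>R w + \<sigma> *\<^sub>R u))^2"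
    using pos by (simp add: v[symmetric] power_mult_distrib power2_eq_square)
  also have "\<dots> = s^2 * (norm w)^2 + \<sigma>^2 * (norm u)^2 + 2 * s * \<sigma> * (w \<bullet> u)"
    unfolding power2_norm_eq_inner
    by (simp add: inner_simps inner_commute power2_eq_square algebra_simps)
  also have "\<dots> \<le> (\<sigma> + s) * (s * (norm w)^2 + \<sigma> * (norm u)^2)"
  proof -
    have "0 \<le> s * \<sigma> * (norm (w - u))^2" using \<sigma> by simp
    then show ?thesis unfolding power2_norm_eq_inner
      by (simp add: inner_simps inner_commute power2_eq_square algebra_simps)
  qed
  finally have "(\<sigma> + s) * (norm v)^2 \<le> s * (norm w)^2 + \<sigma> * (norm u)^2"
    using pos by (simp only: mult_le_cancel_left_pos)
  moreover have "b (x + (\<sigma> + s) *\<^sub>R v) - (\<sigma> + s) / 2 * (norm v)^2 \<le> hopf (\<sigma> + s) b x"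
    using \<sigma> by (intro hopf_upper[OF B]) auto
  ultimately show "b (x + s *\<^sub>R w + \<sigma> *\<^sub>R u) - \<sigma> / 2 * (norm u)^2 \<le> hopf (\<sigma> + s) b x + s / 2 * (norm w)^2"
    unfolding v by (simp add: add.assoc)
qed

text \<open>During the additional time a speed |u| gains at most L |u| and costs |u|^2/2 per unit of
  time; the difference never exceeds L^2/2, the Lipschitz rate in time.\<close>

lemma hopf_time:
  assumes B: "\<And>z. \<bar>b z\<bar> \<le> B" and \<sigma>: "\<sigma> \<ge> 0" "s \<ge> 0" and L: "\<And>x y. \<bar>b x - b y\<bar> \<le> L * norm (x - y)"
  shows "hopf \<sigma> b x \<le> hopf (\<sigma> + s) b x" "hopf (\<sigma> + s) b x \<le> hopf \<sigma> b x + s * L^2 / 2"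
proof -
  show "hopf \<sigma> b x \<le> hopf (\<sigma> + s) b x"
    using hopf_semigroup_ge[where b = b and x = x and w = 0 and s = s, OF B] \<sigma> by (cases "s = 0") auto
  show "hopf (\<sigma> + s) b x \<le> hopf \<sigma> b x + s * L^2 / 2"
  proof (rule hopf_least)
    fix u :: 'a
    have "b (x + (\<sigma> + s) *\<^sub>R u) - b (x + \<sigma> *\<^sub>R u) \<le> L * (s * norm u)"
      using abs_le_D1[OF L[of "x + (\<sigma> + s) *\<^sub>R u" "x + \<sigma> *\<^sub>R u"]] \<sigma> by (simp add: algebra_simps)
    moreover have "L * (s * norm u) \<le> s * L^2 / 2 + s / 2 * (norm u)^2"
    proof -
      have "0 \<le> s * (L - norm u)^2" using \<sigma> by simp
      then show ?thesis by (simp add: power2_eq_square algebra_simps)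
    qed
    moreover have "b (x + \<sigma> *\<^sub>R u) - \<sigma> / 2 * (norm u)^2 \<le> hopf \<sigma> b x" by (rule hopf_upper[OF B \<sigma>(1)])
    moreover have "(\<sigma> + s) / 2 * (norm u)^2 = \<sigma> / 2 * (norm u)^2 + s / 2 * (norm u)^2"
      by (simp add: algebra_simps add_divide_distrib)
    ultimately show "b (x + (\<sigma> + s) *\<^sub>R u) - (\<sigma> + s) / 2 * (norm u)^2 \<le> hopf \<sigma> b x + s * L^2 / 2"
      by linarith
  qed
qed

text \<open>The common abstraction of transport costs and kinetic actions: \<open>w\<close> dominates the Kantorovich
  functional of the cost \<open>|x - z|^2 / (2\<tau>)\<close>.\<close>

definition dual_bound :: "real \<Rightarrow> 'a::euclidean_space measure \<Rightarrow> 'a measure \<Rightarrow> real \<Rightarrow> bool" where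
  "dual_bound \<tau> \<mu> \<rho> w \<longleftrightarrow> (\<forall>b. bdd_lipschitz b \<longrightarrow> (\<integral>z. b z \<partial>\<rho>) - (\<integral>x. hopf \<tau> b x \<partial>\<mu>) \<le> w)"

text \<open>The test function g at one end is replaced by \<open>- hopf \<tau> g\<close> at the
  other, whose evolution is at most -g. This allows time to be run backwards from T.\<close>

lemma dual_bound_sym:
  assumes d: "dual_bound \<tau> \<mu> \<rho> w" and \<tau>: "\<tau> > 0"
    and p: "prob_space \<mu>" "sets \<mu> = sets borel" "prob_space \<rho>" "sets \<rho> = sets borel"
  shows "dual_bound \<tau> \<rho> \<mu> w"
  unfolding dual_bound_def
proof (intro allI impI)
  fix g :: "'a \<Rightarrow> real" assume g: "bdd_lipschitz g"
  obtain B where B: "\<And>x. \<bar>g x\<bar> \<le> B" using bdd_lipschitzE[OF g] by metis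
  define b where "b z = - hopf \<tau> g z" for z
  have b: "bdd_lipschitz b"
    unfolding b_def[abs_def] using \<tau> by (intro bdd_lipschitz_uminus bdd_lipschitz_hopf g) auto
  have hb: "hopf \<tau> b x \<le> - g x" for x
  proof (rule hopf_le[OF \<tau>])
    fix z show "b z - (norm (z - x))^2 / (2 * \<tau>) \<le> - g x"
      using hopf_ge[where b = g and z = x and x = z, OF B \<tau>] by (simp add: b_def norm_minus_commute)
  qed
  have "(\<integral>x. hopf \<tau> b x \<partial>\<mu>) \<le> (\<integral>x. - g x \<partial>\<mu>)"
    using \<tau> by (intro integral_mono hb integrable_bdd_lipschitz[OF p(1,2)] bdd_lipschitz_hopf b bdd_lipschitz_uminus g) auto
  moreover have "(\<integral>z. b z \<partial>\<rho>) - (\<integral>x. hopf \<tau> b x \<partial>\<mu>) \<le> w"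
    using d b by (simp add: dual_bound_def)
  ultimately show "(\<integral>z. g z \<partial>\<mu>) - (\<integral>x. hopf \<tau> g x \<partial>\<rho>) \<le> w"
    by (simp add: b_def)
qed

lemma integral_le_nn_integral:
  fixes f g :: "'b \<Rightarrow> real"
  assumes "integrable M f" "\<And>x. x \<in> space M \<Longrightarrow> f x \<le> g x"
  shows "ennreal (\<integral>x. f x \<partial>M) \<le> (\<integral>\<^sup>+x. ennreal (g x) \<partial>M)"
proof -
  have i: "integrable M (\<lambda>x. max 0 (f x))" using assms(1) by simp
  have "ennreal (\<integral>x. f x \<partial>M) \<le> ennreal (\<integral>x. max 0 (f x) \<partial>M)"
    by (intro ennreal_leI integral_mono assms i) auto
  also have "\<dots> = (\<integral>\<^sup>+x. ennreal (max 0 (f x)) \<partial>M)"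
    by (rule nn_integral_eq_integral[symmetric, OF i]) auto
  also have "\<dots> \<le> (\<integral>\<^sup>+x. ennreal (g x) \<partial>M)"
    using assms(2) by (intro nn_integral_mono) (simp add: ennreal_leI max_def ennreal_neg)
  finally show ?thesis .
qed

text \<open>Weak duality: \<open>hopf_ge\<close> integrated against an arbitrary coupling. The
  factor 1/\<tau> translates the cost |x - y|^2/2 of \<open>W2sq\<close> into |x - y|^2/(2
  \<tau>).\<close>

lemma dual_bound_W2sq:
  assumes p: "prob_space \<mu>" "sets \<mu> = sets borel" "prob_space \<rho>" "sets \<rho> = sets borel"
    and \<tau>: "\<tau> > 0" and fin: "W2sq \<mu> \<rho> < \<infinity>"
  shows "dual_bound \<tau> \<mu> \<rho> (enn2real (W2sq \<mu> \<rho>) / \<tau>)"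
  unfolding dual_bound_def
proof (intro allI impI)
  fix b :: "'a \<Rightarrow> real" assume b: "bdd_lipschitz b"
  obtain B where B: "\<And>x. \<bar>b x\<bar> \<le> B" using bdd_lipschitzE[OF b] by metis
  have h: "bdd_lipschitz (hopf \<tau> b)" using b \<tau> by (intro bdd_lipschitz_hopf) auto
  note [measurable] = bdd_lipschitz_borel[OF b] bdd_lipschitz_borel[OF h]
  let ?D = "(\<integral>z. b z \<partial>\<rho>) - (\<integral>x. hopf \<tau> b x \<partial>\<mu>)"
  have "ennreal (\<tau> * ?D) \<le> W2sq \<mu> \<rho>"
    unfolding W2sq_def
  proof (rule INF_greatest)
    fix \<pi> assume "\<pi> \<in> couplings \<mu> \<rho>"
    then have \<pi>: "sets \<pi> = sets borel" "prob_space \<pi>" "distr \<pi> borel fst = \<mu>" "distr \<pi> borel snd = \<rho>"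
      by (auto simp: couplings_def)
    interpret prob_space \<pi> by fact
    have [measurable_cong]: "sets \<pi> = sets (borel \<Otimes>\<^sub>M borel)" by (simp only: \<pi>(1) borel_prod)
    have i1: "integrable \<pi> (\<lambda>p. b (snd p))"
      using integrable_bdd_lipschitz[OF p(3,4) b] \<pi>(4) by (auto intro!: integrable_distr[of snd \<pi> borel])
    have i2: "integrable \<pi> (\<lambda>p. hopf \<tau> b (fst p))"
      using integrable_bdd_lipschitz[OF p(1,2) h] \<pi>(3) by (auto intro!: integrable_distr[of fst \<pi> borel])
    have "\<tau> * ?D = (\<integral>p. \<tau> * (b (snd p) - hopf \<tau> b (fst p)) \<partial>\<pi>)"
      using i1 i2 by (simp add: integral_distr flip: \<pi>(3,4))
    also have "ennreal \<dots> \<le> (\<integral>\<^sup>+p. ennreal (1/2 * (norm (fst p - snd p))^2) \<partial>\<pi>)"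
    proof (rule integral_le_nn_integral)
      show "integrable \<pi> (\<lambda>p. \<tau> * (b (snd p) - hopf \<tau> b (fst p)))" using i1 i2 by simp
      fix p :: "'a \<times> 'a"
      show "\<tau> * (b (snd p) - hopf \<tau> b (fst p)) \<le> 1/2 * (norm (fst p - snd p))^2"
        using hopf_ge[where b = b and z = "snd p" and x = "fst p", OF B \<tau>] \<tau> by (simp add: field_simps norm_minus_commute)
    qed
    finally show "ennreal (\<tau> * ?D) \<le> (\<integral>\<^sup>+(x, y). ennreal (1/2 * (norm (x - y))^2) \<partial>\<pi>)"
      by (simp only: split_beta')
  qed
  then have "\<tau> * ?D \<le> enn2real (W2sq \<mu> \<rho>)"
    using fin by (metis ennreal_enn2real ennreal_le_iff enn2real_nonneg infinity_ennreal_def)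
  then show "?D \<le> enn2real (W2sq \<mu> \<rho>) / \<tau>" using \<tau> by (simp add: field_simps)
qed

section \<open>Test functions of quadratic growth\<close>

lemma P2_integrable_norm2:
  assumes "P2 \<rho>" shows "integrable \<rho> (\<lambda>x. (norm x)^2)"
proof (rule integrableI_nonneg)
  have [measurable_cong]: "sets \<rho> = sets borel" using assms by (simp add: P2_def)
  show "(\<lambda>x. (norm x)^2) \<in> borel_measurable \<rho>" by measurable
qed (use assms in \<open>auto simp: P2_def\<close>)

lemma P2_integrable_quadratic:
  fixes f :: "'a::euclidean_space \<Rightarrow> real"
  assumes "P2 \<rho>" "f \<in> borel_measurable borel" "\<And>z. \<bar>f z\<bar> \<le> C * (1 + (norm z)^2)"
  shows "integrable \<rho> f"
proof -
  have [measurable_cong]: "sets \<rho> = sets borel" using assms by (simp add: P2_def)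
  interpret prob_space \<rho> using assms by (simp add: P2_def)
  have "integrable \<rho> (\<lambda>z. C * (1 + (norm z)^2))" using P2_integrable_norm2[OF assms(1)] by simp
  moreover have "f \<in> borel_measurable \<rho>" using assms(2) by measurable
  ultimately show ?thesis
    by (rule Bochner_Integration.integrable_bound) (use assms(3) in \<open>auto intro: order.trans[OF _ abs_ge_self]\<close>)
qed

text \<open>The relevant test functions grow quadratically and are neither bounded nor Lipschitz.
  Cutting them off from above at n repairs both, because coercivity makes the result constant
  outside a ball; dominated convergence then removes the cut-off.\<close>

lemma dual_bound_coercive:
  fixes f :: "'a::euclidean_space \<Rightarrow> real"
  assumes d: "dual_bound \<tau> \<mu> \<rho> w" and \<tau>: "\<tau> > 0" and \<mu>: "prob_space \<mu>" "sets \<mu> = sets borel" and \<rho>: "P2 \<rho>"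
    and lip: "\<And>r. r \<ge> 0 \<Longrightarrow> \<exists>L. \<forall>x y. norm x \<le> r \<longrightarrow> norm y \<le> r \<longrightarrow> \<bar>f x - f y\<bar> \<le> L * norm (x - y)"
    and coercive: "\<And>N. \<exists>r\<ge>0. \<forall>z. norm z \<ge> r \<longrightarrow> f z \<ge> N"
    and quad: "\<And>z. \<bar>f z\<bar> \<le> C * (1 + (norm z)^2)"
    and K: "integrable \<mu> K" "AE x in \<mu>. \<forall>z. f z - (norm (z - x))^2 / (2 * \<tau>) \<le> K x"
    and f[measurable]: "f \<in> borel_measurable borel"
  shows "(\<integral>z. f z \<partial>\<rho>) - (\<integral>x. K x \<partial>\<mu>) \<le> w"
proof -
  have [measurable_cong]: "sets \<rho> = sets borel" using \<rho> by (simp add: P2_def)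
  have iF: "integrable \<rho> f" by (rule P2_integrable_quadratic[OF \<rho> f quad])
  have trunc: "bdd_lipschitz (\<lambda>z. min N (f z))" for N :: real
  proof -
    obtain r where r: "r \<ge> 0" "\<And>z. norm z \<ge> r \<Longrightarrow> f z \<ge> N" using coercive[of N] by blast
    obtain L where L: "\<And>x y. norm x \<le> r \<Longrightarrow> norm y \<le> r \<Longrightarrow> \<bar>f x - f y\<bar> \<le> L * norm (x - y)"
      using lip[OF r(1)] by blast
    \<comment> \<open>The truncated function is N on and outside the sphere of radius r, so it
      factors through the projection onto the ball. As the projection is 1-Lipschitz, the local
      Lipschitz constant becomes global.\<close>
    define P where "P = closest_point (cball (0::'a) r)"
    have P: "norm (P z) \<le> r" for z
      using closest_point_in_set[of "cball 0 r" z] r(1) by (simp add: P_def)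
    have P1: "norm (P x - P y) \<le> norm (x - y)" for x y
      using closest_point_lipschitz[of "cball (0::'a) r" x y] r(1) by (simp add: P_def dist_norm)
    have eq: "min N (f z) = min N (f (P z))" for z
    proof (cases "norm z < r")
      case True then show ?thesis by (simp add: P_def closest_point_self)
    next
      case False
      have "norm (P z) = r"
      proof (cases "norm z = r")
        case True then show ?thesis by (simp add: P_def closest_point_self)
      next
        case ne: False
        then have z: "norm z > r" using False by simp
        then have z0: "norm z > 0" using r(1) by linarith
        have "dist z (P z) \<le> dist z ((r / norm z) *\<^sub>R z)"
          unfolding P_def using r(1) z0 by (intro closest_point_le) auto
        also have "z - (r / norm z) *\<^sub>R z = (1 - r / norm z) *\<^sub>R z" by (simp add: algebra_simps)
        then have "dist z ((r / norm z) *\<^sub>R z) = \<bar>1 - r / norm z\<bar> * norm z" by (simp add: dist_norm)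
        also have "\<dots> = norm z - r" using z z0 by (simp add: abs_of_nonneg left_diff_distrib)
        finally have "norm z - norm (P z) \<le> norm z - r"
          using norm_triangle_ineq2[of z "P z"] by (simp add: dist_norm)
        then show ?thesis using P[of z] by simp
      qed
      then show ?thesis using r(2)[of z] r(2)[of "P z"] False by (simp add: min_def)
    qed
    have abs_min: "\<bar>min N a - min N b\<bar> \<le> \<bar>a - b\<bar>" for a b :: real by linarith
    have lipP: "\<bar>min N (f x) - min N (f y)\<bar> \<le> \<bar>L\<bar> * norm (x - y)" for x y
    proof -
      have "\<bar>min N (f x) - min N (f y)\<bar> \<le> \<bar>f (P x) - f (P y)\<bar>" unfolding eq[of x] eq[of y] by (rule abs_min)
      also have "\<dots> \<le> L * norm (P x - P y)" by (rule L[OF P P])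
      also have "\<dots> \<le> \<bar>L\<bar> * norm (x - y)" using P1[of x y] by (intro mult_mono) auto
      finally show ?thesis .
    qed
    have "\<bar>min N (f z)\<bar> \<le> \<bar>N\<bar> + \<bar>f 0\<bar> + \<bar>L\<bar> * r" for z
    proof -
      have "\<bar>f (P z) - f 0\<bar> \<le> L * norm (P z - 0)" by (rule L) (use P r in auto)
      also have "\<dots> \<le> \<bar>L\<bar> * r" using P[of z] by (intro mult_mono) auto
      finally show ?thesis unfolding eq[of z] by linarith
    qed
    then show ?thesis using lipP by (rule bdd_lipschitzI)
  qed
  have "(\<integral>z. min (real n) (f z) \<partial>\<rho>) \<le> w + (\<integral>x. K x \<partial>\<mu>)" for n
  proof -
    have "(\<integral>x. hopf \<tau> (\<lambda>z. min (real n) (f z)) x \<partial>\<mu>) \<le> (\<integral>x. K x \<partial>\<mu>)"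
    proof (rule integral_mono_AE[OF integrable_bdd_lipschitz[OF \<mu> bdd_lipschitz_hopf[OF trunc]] K(1)])
      show "AE x in \<mu>. hopf \<tau> (\<lambda>z. min (real n) (f z)) x \<le> K x"
        using K(2)
      proof eventually_elim
        case (elim x)
        show ?case
        proof (rule hopf_le[OF \<tau>])
          fix z show "min (real n) (f z) - (norm (z - x))^2 / (2 * \<tau>) \<le> K x"
            using elim[rule_format, of z] by linarith
        qed
      qed
    qed (use \<tau> in simp)
    moreover have "(\<integral>z. min (real n) (f z) \<partial>\<rho>) - (\<integral>x. hopf \<tau> (\<lambda>z. min (real n) (f z)) x \<partial>\<mu>) \<le> w"
      using d trunc by (simp add: dual_bound_def)
    ultimately show ?thesis by linarith
  qed
  moreover have "(\<lambda>n. \<integral>z. min (real n) (f z) \<partial>\<rho>) \<longlonglongrightarrow> (\<integral>z. f z \<partial>\<rho>)"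
  proof (rule integral_dominated_convergence[where w = "\<lambda>z. \<bar>f z\<bar>"])
    show "integrable \<rho> (\<lambda>z. \<bar>f z\<bar>)" using iF by simp
    show "AE z in \<rho>. (\<lambda>n. min (real n) (f z)) \<longlonglongrightarrow> f z"
    proof (rule AE_I2)
      fix z
      obtain N where "f z \<le> real N" using real_arch_simple by blast
      then have "\<forall>n\<ge>N. min (real n) (f z) = f z" by (auto simp: min_def intro: antisym)
      then show "(\<lambda>n. min (real n) (f z)) \<longlonglongrightarrow> f z"
        by (intro tendsto_eventually) (auto simp: eventually_sequentially)
    qed
  qed auto
  ultimately have "(\<integral>z. f z \<partial>\<rho>) \<le> w + (\<integral>x. K x \<partial>\<mu>)" by (intro LIMSEQ_le_const2) auto
  then show ?thesis by simp
qed

section \<open>Tightness of the duality inequality\<close>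

text \<open>One half of the evolution seen from its outer end: \<mu> is an end marginal and
  \<open>grad \<Psi>\<close> is meant to send it to the midpoint. It is used with \<phi> at time 0,
  with \<psi> at time T, and with interpolated and competing potentials.\<close>

locale half_problem = convex_function \<Psi> for \<Psi> :: "'a::euclidean_space \<Rightarrow> real" +
  fixes \<mu> :: "'a measure" and \<Omega> X :: "'a set"
  assumes \<mu>: "prob_space \<mu>" "sets \<mu> = sets borel" and \<Omega>: "open \<Omega>" "\<Omega> \<subseteq> X" "\<Omega> \<noteq> {}" and X: "compact X"
    and AE\<Omega>: "AE x in \<mu>. x \<in> \<Omega>" and AEd: "AE x in \<mu>. \<Psi> differentiable at x"
begin

text \<open>The convex conjugate of \<Psi> restricted to X. Compactness of X makes it finite
  everywhere and Lipschitz with the radius of X.\<close>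

definition g :: "'a \<Rightarrow> real" where "g z = (SUP x\<in>X. x \<bullet> z - \<Psi> x)"

lemma X_ne: "X \<noteq> {}" using \<Omega> by auto

lemma bounded_on_X:
  assumes "continuous_on X f" shows "\<exists>B. \<forall>x\<in>X. \<bar>f x\<bar> \<le> (B::real)"
  using compact_imp_bounded[OF compact_continuous_image[OF assms X]] by (auto simp: bounded_iff)

lemma integrable_continuous:
  assumes "continuous_on UNIV f" shows "integrable \<mu> (f :: 'a \<Rightarrow> real)"
proof -
  interpret M: prob_space \<mu> by (rule \<mu>)
  obtain B where B: "\<forall>x\<in>X. \<bar>f x\<bar> \<le> B"
    using bounded_on_X[OF continuous_on_subset[OF assms]] by auto
  show ?thesis
    using AE\<Omega> \<Omega>(2) B borel_measurable_continuous_onI[OF assms] \<mu>(2)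
    by (intro M.integrable_const_bound[of _ B]) (auto cong: measurable_cong_sets elim!: eventually_mono)
qed

lemma bdd: "bdd_above ((\<lambda>x. x \<bullet> z - \<Psi> x) ` X)"
proof -
  have "continuous_on X (\<lambda>x. x \<bullet> z - \<Psi> x)" by (intro continuous_intros cont)
  from bounded_on_X[OF this] obtain B where "\<forall>x\<in>X. \<bar>x \<bullet> z - \<Psi> x\<bar> \<le> B" by blast
  then show ?thesis by (intro bdd_aboveI[of _ B]) (auto simp: abs_le_iff)
qed

lemma fenchel: "x \<in> X \<Longrightarrow> x \<bullet> z \<le> \<Psi> x + g z"
  using cSUP_upper[OF _ bdd, of x z] by (simp add: g_def)

lemma g_least: "(\<And>x. x \<in> X \<Longrightarrow> x \<bullet> z - \<Psi> x \<le> B) \<Longrightarrow> g z \<le> B"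
  unfolding g_def using X_ne by (intro cSUP_least)

lemma g_lipschitz: "\<exists>R\<ge>0. \<forall>z z'. \<bar>g z - g z'\<bar> \<le> R * norm (z - z')"
proof -
  obtain R where R: "\<And>x. x \<in> X \<Longrightarrow> norm x \<le> R" using compact_imp_bounded[OF X] by (auto simp: bounded_iff)
  have R0: "R \<ge> 0" using R X_ne norm_ge_zero order.trans by blast
  have le: "g z \<le> g z' + R * norm (z - z')" for z z'
  proof (rule g_least)
    fix x assume x: "x \<in> X"
    have "x \<bullet> (z - z') \<le> norm x * norm (z - z')" by (rule norm_cauchy_schwarz)
    also have "\<dots> \<le> R * norm (z - z')" using R[OF x] by (intro mult_right_mono) auto
    finally show "x \<bullet> z - \<Psi> x \<le> g z' + R * norm (z - z')"
      using fenchel[OF x, of z'] by (simp add: inner_diff_right)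
  qed
  have "\<bar>g z - g z'\<bar> \<le> R * norm (z - z')" for z z'
    using le[of z z'] le[of z' z] by (simp add: norm_minus_commute abs_le_iff)
  then show ?thesis using R0 by blast
qed

lemma g_continuous: "continuous_on UNIV g"
proof -
  obtain R where "R \<ge> 0" "\<And>z z'. \<bar>g z - g z'\<bar> \<le> R * norm (z - z')" using g_lipschitz by blast
  then have "R-lipschitz_on UNIV g" by (intro lipschitz_onI) (auto simp: dist_norm)
  then show ?thesis by (rule lipschitz_on_continuous_on)
qed

lemma fenchel_eq:
  assumes "x \<in> \<Omega>" "\<Psi> differentiable at x"
  shows "g (grad \<Psi> x) = x \<bullet> grad \<Psi> x - \<Psi> x"
proof (rule antisym)
  show "g (grad \<Psi> x) \<le> x \<bullet> grad \<Psi> x - \<Psi> x"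
  proof (rule g_least)
    fix y show "y \<bullet> grad \<Psi> x - \<Psi> y \<le> x \<bullet> grad \<Psi> x - \<Psi> x"
      using subgradient[OF differentiable_GDERIV[OF assms(2)], of y]
      by (simp add: inner_diff_right inner_commute)
  qed
  show "x \<bullet> grad \<Psi> x - \<Psi> x \<le> g (grad \<Psi> x)" using fenchel[of x "grad \<Psi> x"] assms \<Omega> by auto
qed

lemma fenchel_eqD:
  assumes "x \<in> \<Omega>" "\<Psi> differentiable at x" "\<Psi> x + g z \<le> x \<bullet> z"
  shows "z = grad \<Psi> x"
proof (rule slope_eq_gradient[OF differentiable_GDERIV[OF assms(2)] \<Omega>(1) assms(1)])
  fix y assume "y \<in> \<Omega>"
  then show "\<Psi> x + z \<bullet> (y - x) \<le> \<Psi> y"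
    using fenchel[of y z] assms(3) \<Omega>(2) by (auto simp: inner_diff_right inner_commute)
qed

text \<open>For any z the Fenchel inequality makes y \<mapsto> x . z - g z + z . (y - x) an affine
  minorant of \<Psi> on \<Omega>. Its slope is z, so \<open>slope_gap\<close> bounds its value at x
  away from \<open>\<Psi> x\<close> when z is away from the gradient.\<close>

lemma well_posed_grad:
  assumes x: "x \<in> \<Omega>" "\<Psi> differentiable at x"
  shows "well_posed UNIV (\<lambda>z. x \<bullet> z - g z) (grad \<Psi> x)"
  unfolding well_posed_def
proof (intro conjI ballI allI impI)
  have xX: "x \<in> X" using x \<Omega> by auto
  fix z show "x \<bullet> z - g z \<le> x \<bullet> grad \<Psi> x - g (grad \<Psi> x)"
    using fenchel[OF xX, of z] fenchel_eq[OF x] by simp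
next
  fix \<delta> :: real assume "\<delta> > 0"
  from slope_gap[OF differentiable_GDERIV[OF x(2)] \<Omega>(1) x(1) this] obtain \<kappa> where
    \<kappa>: "\<kappa> > 0" "\<And>F p. (\<And>y. y \<in> \<Omega> \<Longrightarrow> F + p \<bullet> (y - x) \<le> \<Psi> y) \<Longrightarrow> norm (p - grad \<Psi> x) \<ge> \<delta> \<Longrightarrow> F \<le> \<Psi> x - \<kappa>"
    by metis
  have "x \<bullet> z - g z \<le> x \<bullet> grad \<Psi> x - g (grad \<Psi> x) - \<kappa>" if z: "dist z (grad \<Psi> x) \<ge> \<delta>" for z
  proof -
    have "x \<bullet> z - g z \<le> \<Psi> x - \<kappa>"
    proof (rule \<kappa>(2)[of _ z])
      fix y assume "y \<in> \<Omega>"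
      then show "x \<bullet> z - g z + z \<bullet> (y - x) \<le> \<Psi> y"
        using fenchel[of y z] \<Omega>(2) by (auto simp: inner_diff_right inner_commute)
    qed (use z in \<open>simp add: dist_norm\<close>)
    then show ?thesis using fenchel_eq[OF x] by simp
  qed
  then show "\<exists>\<kappa>>0. \<forall>z\<in>UNIV. dist z (grad \<Psi> x) \<ge> \<delta> \<longrightarrow> x \<bullet> z - g z \<le> x \<bullet> grad \<Psi> x - g (grad \<Psi> x) - \<kappa>"
    using \<kappa>(1) by blast
qed simp

text \<open>With \<open>\<beta>\<close> a pair of Kantorovich potentials: that
  \<open>\<alpha> \<tau> x + \<beta> \<tau> z\<close> is at most |x - z|^2/(2 \<tau>) for x in X is
  the Fenchel inequality for \<Psi> and g.\<close>

definition \<alpha> :: "real \<Rightarrow> 'a \<Rightarrow> real" where "\<alpha> \<tau> x = ((norm x)^2 / 2 - \<Psi> x) / \<tau>"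
definition \<beta> :: "real \<Rightarrow> 'a \<Rightarrow> real" where "\<beta> \<tau> z = ((norm z)^2 / 2 - g z) / \<tau>"

lemma \<beta>_borel: "\<beta> \<tau> \<in> borel_measurable borel"
  unfolding \<beta>_def[abs_def] divide_inverse by (intro borel_measurable_continuous_onI continuous_intros g_continuous)

lemma norm_sq_lipschitz:
  fixes x y :: 'a
  assumes "norm x \<le> r" "norm y \<le> r" shows "\<bar>(norm x)^2 - (norm y)^2\<bar> \<le> 2 * r * norm (x - y)"
proof -
  have "\<bar>(norm x)^2 - (norm y)^2\<bar> = \<bar>norm x - norm y\<bar> * (norm x + norm y)"
    by (simp add: power2_eq_square square_diff_square_factored abs_mult mult.commute)
  also have "\<dots> \<le> norm (x - y) * (2 * r)"
    using assms norm_triangle_ineq3[of x y] by (intro mult_mono) auto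
  finally show ?thesis by (simp add: mult_ac)
qed

text \<open>The hypotheses of \<open>dual_bound_coercive\<close>. The term |z|^2/2 in
  \<open>\<beta>\<close> dominates both g, of linear growth, and the bounded perturbation.\<close>

lemma perturbed_conditions:
  fixes h :: "'a \<Rightarrow> real" and e :: real
  assumes \<tau>: "\<tau> > 0" and h: "bdd_lipschitz h"
  defines "f \<equiv> \<lambda>z. \<beta> \<tau> z - e / \<tau> * h z"
  shows "r \<ge> 0 \<Longrightarrow> \<exists>L. \<forall>x y. norm x \<le> r \<longrightarrow> norm y \<le> r \<longrightarrow> \<bar>f x - f y\<bar> \<le> L * norm (x - y)"
    and "\<exists>r\<ge>0. \<forall>z. norm z \<ge> r \<longrightarrow> f z \<ge> N"
    and "\<exists>C. \<forall>z. \<bar>f z\<bar> \<le> C * (1 + (norm z)^2)"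
    and "f \<in> borel_measurable borel"
proof -
  obtain R where R: "R \<ge> 0" "\<And>z z'. \<bar>g z - g z'\<bar> \<le> R * norm (z - z')" using g_lipschitz by blast
  obtain B L where B: "B \<ge> 0" "\<And>x. \<bar>h x\<bar> \<le> B" and L: "L \<ge> 0" "\<And>x y. \<bar>h x - h y\<bar> \<le> L * norm (x - y)"
    using bdd_lipschitzE[OF h] by metis
  have f_eq: "\<tau> * f z = (norm z)^2 / 2 - g z - e * h z" for z
    using \<tau> by (simp add: f_def \<beta>_def field_simps)
  have eh: "\<bar>e * h z\<bar> \<le> \<bar>e\<bar> * B" for z using B by (simp add: abs_mult mult_left_mono)
  have g0: "\<bar>g z\<bar> \<le> \<bar>g 0\<bar> + R * norm z" for z using R(2)[of z 0] unfolding diff_zero by linarith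
  show "f \<in> borel_measurable borel"
    unfolding f_def using \<beta>_borel[of \<tau>] bdd_lipschitz_borel[OF h] by measurable
  show "\<exists>L. \<forall>x y. norm x \<le> r \<longrightarrow> norm y \<le> r \<longrightarrow> \<bar>f x - f y\<bar> \<le> L * norm (x - y)" if r: "r \<ge> 0"
  proof (intro exI[of _ "(r + R + \<bar>e\<bar> * L) / \<tau>"] allI impI)
    fix x y :: 'a assume xy: "norm x \<le> r" "norm y \<le> r"
    have key: "\<bar>u\<bar> \<le> a \<Longrightarrow> \<bar>v\<bar> \<le> b \<Longrightarrow> \<bar>w\<bar> \<le> c \<Longrightarrow> \<bar>u / 2 - v - w\<bar> \<le> a / 2 + b + c" for u v w a b c :: real
      by linarith
    have "\<bar>e * h x - e * h y\<bar> \<le> \<bar>e\<bar> * (L * norm (x - y))"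
      using L(2)[of x y] by (simp add: right_diff_distrib[symmetric] abs_mult mult_left_mono)
    moreover have "\<tau> * f x - \<tau> * f y = ((norm x)^2 - (norm y)^2) / 2 - (g x - g y) - (e * h x - e * h y)"
      unfolding f_eq by (simp add: diff_divide_distrib)
    ultimately have "\<bar>\<tau> * f x - \<tau> * f y\<bar> \<le> 2 * r * norm (x - y) / 2 + R * norm (x - y) + \<bar>e\<bar> * (L * norm (x - y))"
      using norm_sq_lipschitz[OF xy] R(2)[of x y] key by (simp only:)
    then have "\<bar>\<tau> * f x - \<tau> * f y\<bar> \<le> (r + R + \<bar>e\<bar> * L) * norm (x - y)"
      by (simp add: algebra_simps)
    then have "\<tau> * \<bar>f x - f y\<bar> \<le> (r + R + \<bar>e\<bar> * L) * norm (x - y)"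
      using \<tau> by (simp add: right_diff_distrib[symmetric] abs_mult)
    then show "\<bar>f x - f y\<bar> \<le> (r + R + \<bar>e\<bar> * L) / \<tau> * norm (x - y)"
      using \<tau> by (simp add: field_simps)
  qed
  show "\<exists>r\<ge>0. \<forall>z. norm z \<ge> r \<longrightarrow> f z \<ge> N"
  proof -
    define A where "A = \<bar>\<tau> * N\<bar> + \<bar>g 0\<bar> + \<bar>e\<bar> * B"
    have A: "A \<ge> 0" using B by (simp add: A_def)
    have "f z \<ge> N" if z: "norm z \<ge> 2 * R + 2 * A + 1" for z
    proof -
      have "A \<le> norm z * (norm z / 2 - R)"
        using mult_mono[of 1 "norm z" A "norm z / 2 - R"] z R(1) A by simp
      then have "A + R * norm z \<le> (norm z)^2 / 2" by (simp add: power2_eq_square algebra_simps)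
      then have "\<tau> * N \<le> \<tau> * f z"
        unfolding f_eq using g0[of z] eh[of z] unfolding A_def by linarith
      then show ?thesis using \<tau> by simp
    qed
    then show ?thesis using R(1) A by (intro exI[of _ "2 * R + 2 * A + 1"]) auto
  qed
  show "\<exists>C. \<forall>z. \<bar>f z\<bar> \<le> C * (1 + (norm z)^2)"
  proof (intro exI[of _ "(1 + \<bar>g 0\<bar> + R + \<bar>e\<bar> * B) / \<tau>"] allI)
    fix z :: 'a
    have "0 \<le> (norm z - 1)^2" by simp
    then have "2 * norm z \<le> 1 + (norm z)^2" by (simp add: power2_eq_square algebra_simps)
    then have "norm z \<le> 1 + (norm z)^2" using norm_ge_zero[of z] by linarith
    then have "R * norm z \<le> R * (1 + (norm z)^2)" using R(1) by (intro mult_left_mono)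
    moreover have "\<bar>g 0\<bar> + \<bar>e\<bar> * B \<le> (\<bar>g 0\<bar> + \<bar>e\<bar> * B) * (1 + (norm z)^2)"
      using B by (simp add: distrib_left)
    moreover have "\<bar>\<tau> * f z\<bar> \<le> (norm z)^2 / 2 + (\<bar>g 0\<bar> + R * norm z) + \<bar>e\<bar> * B"
      unfolding f_eq using g0[of z] eh[of z] zero_le_power2[of "norm z"] by linarith
    ultimately have "\<bar>\<tau> * f z\<bar> \<le> (1 + \<bar>g 0\<bar> + R + \<bar>e\<bar> * B) * (1 + (norm z)^2)"
      using zero_le_power2[of "norm z"] unfolding distrib_right mult_1_left by linarith
    then have "\<tau> * \<bar>f z\<bar> \<le> (1 + \<bar>g 0\<bar> + R + \<bar>e\<bar> * B) * (1 + (norm z)^2)"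
      using \<tau> by (simp add: abs_mult)
    then show "\<bar>f z\<bar> \<le> (1 + \<bar>g 0\<bar> + R + \<bar>e\<bar> * B) / \<tau> * (1 + (norm z)^2)"
      using \<tau> by (simp add: field_simps)
  qed
qed

lemma \<beta>_conditions:
  assumes "\<tau> > 0"
  shows "r \<ge> 0 \<Longrightarrow> \<exists>L. \<forall>x y. norm x \<le> r \<longrightarrow> norm y \<le> r \<longrightarrow> \<bar>\<beta> \<tau> x - \<beta> \<tau> y\<bar> \<le> L * norm (x - y)"
    and "\<exists>r\<ge>0. \<forall>z. norm z \<ge> r \<longrightarrow> \<beta> \<tau> z \<ge> N"
    and "\<exists>C. \<forall>z. \<bar>\<beta> \<tau> z\<bar> \<le> C * (1 + (norm z)^2)"
proof -
  have h: "bdd_lipschitz (\<lambda>_::'a. 0::real)" by (rule bdd_lipschitzI[of _ 0 0]) auto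
  show "r \<ge> 0 \<Longrightarrow> \<exists>L. \<forall>x y. norm x \<le> r \<longrightarrow> norm y \<le> r \<longrightarrow> \<bar>\<beta> \<tau> x - \<beta> \<tau> y\<bar> \<le> L * norm (x - y)"
    "\<exists>r\<ge>0. \<forall>z. norm z \<ge> r \<longrightarrow> \<beta> \<tau> z \<ge> N"
    "\<exists>C. \<forall>z. \<bar>\<beta> \<tau> z\<bar> \<le> C * (1 + (norm z)^2)"
    using perturbed_conditions[OF assms h] by simp_all
qed

lemma \<beta>_integrable: "P2 \<rho> \<Longrightarrow> \<tau> > 0 \<Longrightarrow> integrable \<rho> (\<beta> \<tau>)"
  using \<beta>_conditions(3) by (metis P2_integrable_quadratic \<beta>_borel)

text \<open>The perturbation is scaled by e / \<tau> so that, after completing the square, it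
  appears as \<open>e * h z\<close> in the conjugation problem for x . z - g z. G may be any
  integrable majorant of the perturbed supremum.\<close>

lemma half_perturbed:
  assumes \<tau>: "\<tau> > 0" and \<rho>: "P2 \<rho>" and d: "dual_bound \<tau> \<mu> \<rho> w" and h: "bdd_lipschitz h"
    and G: "integrable \<mu> G" "AE x in \<mu>. \<forall>z. x \<bullet> z - g z - e * h z \<le> G x"
  shows "(\<integral>z. \<beta> \<tau> z \<partial>\<rho>) - e / \<tau> * (\<integral>z. h z \<partial>\<rho>) + (\<integral>x. ((norm x)^2 / 2 - G x) / \<tau> \<partial>\<mu>) \<le> w"
proof -
  have \<rho>': "prob_space \<rho>" "sets \<rho> = sets borel" using \<rho> by (auto simp: P2_def)
  obtain C where C: "\<And>z. \<bar>\<beta> \<tau> z - e / \<tau> * h z\<bar> \<le> C * (1 + (norm z)^2)"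
    using perturbed_conditions(3)[OF \<tau> h] by blast
  have iN: "integrable \<mu> (\<lambda>x. (norm x)^2)" by (intro integrable_continuous continuous_intros)
  have "(\<integral>z. \<beta> \<tau> z - e / \<tau> * h z \<partial>\<rho>) - (\<integral>x. (G x - (norm x)^2 / 2) / \<tau> \<partial>\<mu>) \<le> w"
  proof (rule dual_bound_coercive[OF d \<tau> \<mu> \<rho> perturbed_conditions(1)[OF \<tau> h] perturbed_conditions(2)[OF \<tau> h] C])
    show "integrable \<mu> (\<lambda>x. (G x - (norm x)^2 / 2) / \<tau>)" using G(1) iN by simp
    show "AE x in \<mu>. \<forall>z. \<beta> \<tau> z - e / \<tau> * h z - (norm (z - x))^2 / (2 * \<tau>) \<le> (G x - (norm x)^2 / 2) / \<tau>"
      using G(2)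
    proof eventually_elim
      case (elim x)
      have "\<beta> \<tau> z - e / \<tau> * h z - (norm (z - x))^2 / (2 * \<tau>) = (x \<bullet> z - g z - e * h z - (norm x)^2 / 2) / \<tau>" for z
      proof -
        have "(norm (z - x))^2 = (norm z)^2 - 2 * (x \<bullet> z) + (norm x)^2"
          unfolding power2_norm_eq_inner by (simp add: inner_simps inner_commute)
        then have num: "(norm z)^2 / 2 - g z - e * h z - (norm (z - x))^2 / 2 = x \<bullet> z - g z - e * h z - (norm x)^2 / 2"
          by (simp add: field_simps)
        have "\<beta> \<tau> z - e / \<tau> * h z - (norm (z - x))^2 / (2 * \<tau>) = ((norm z)^2 / 2 - g z - e * h z - (norm (z - x))^2 / 2) / \<tau>"
          by (simp add: \<beta>_def diff_divide_distrib)
        then show ?thesis unfolding num .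
      qed
      note eq = this
      show ?case unfolding eq
      proof
        fix z show "(x \<bullet> z - g z - e * h z - (norm x)^2 / 2) / \<tau> \<le> (G x - (norm x)^2 / 2) / \<tau>"
          using elim[rule_format, of z] \<tau> by (intro divide_right_mono) auto
      qed
    qed
  qed (use perturbed_conditions(4)[OF \<tau> h] in auto)
  moreover have "(\<integral>x. (G x - (norm x)^2 / 2) / \<tau> \<partial>\<mu>) = - (\<integral>x. ((norm x)^2 / 2 - G x) / \<tau> \<partial>\<mu>)"
    by (subst Bochner_Integration.integral_minus[symmetric]) (simp add: minus_divide_left)
  ultimately show ?thesis
    using \<beta>_integrable[OF \<rho> \<tau>] integrable_bdd_lipschitz[OF \<rho>' h] by simp
qed

lemma half_ineq:
  assumes "\<tau> > 0" "P2 \<rho>" "dual_bound \<tau> \<mu> \<rho> w"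
  shows "(\<integral>z. \<beta> \<tau> z \<partial>\<rho>) + (\<integral>x. \<alpha> \<tau> x \<partial>\<mu>) \<le> w"
proof -
  \<comment> \<open>The product \<open>0 * 0\<close> is the term \<open>e * h z\<close> of
    \<open>half_perturbed\<close> for e = 0 and h = 0, with \<Psi> as majorant.\<close>
  have "AE x in \<mu>. \<forall>z. x \<bullet> z - g z - 0 * 0 \<le> \<Psi> x"
    using AE\<Omega> by eventually_elim (use fenchel \<Omega>(2) in \<open>auto simp: diff_le_eq\<close>)
  from half_perturbed[OF assms bdd_lipschitzI[of "\<lambda>_. 0" 0 0] integrable_continuous[OF cont] this]
  show ?thesis by (simp add: \<alpha>_def)
qed

text \<open>If the inequality of \<open>half_ineq\<close> is tight, combining it with the perturbed
  one bounds the drop from \<Psi> to the perturbed supremum by e times the integral of h against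
  \<rho>. This is the variational hypothesis of \<open>pushforward_envelope\<close>.\<close>

lemma half_eq:
  assumes \<tau>: "\<tau> > 0" and \<rho>: "P2 \<rho>" and d: "dual_bound \<tau> \<mu> \<rho> w"
    and eq: "w \<le> (\<integral>z. \<beta> \<tau> z \<partial>\<rho>) + (\<integral>x. \<alpha> \<tau> x \<partial>\<mu>)"
  shows "\<rho> = distr \<mu> borel (grad \<Psi>)"
proof (rule pushforward_envelope[where Y = UNIV and F = "\<lambda>x z. x \<bullet> z - g z", OF \<mu>(1) _ \<mu>(2)])
  show \<rho>': "prob_space \<rho>" "sets \<rho> = sets borel" using \<rho> by (auto simp: P2_def)
  interpret M: prob_space \<mu> by (rule \<mu>)
  show gm: "grad \<Psi> \<in> borel_measurable borel" by (rule grad_measurable)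
  note [measurable_cong] = \<mu>(2)
  have i\<Psi>: "integrable \<mu> \<Psi>" by (rule integrable_continuous[OF cont])
  have iN: "integrable \<mu> (\<lambda>x. (norm x)^2)" by (intro integrable_continuous continuous_intros)
  have val: "AE x in \<mu>. x \<bullet> grad \<Psi> x - g (grad \<Psi> x) = \<Psi> x"
    using AE\<Omega> AEd by eventually_elim (simp add: fenchel_eq)
  have gb: "g \<in> borel_measurable borel" by (rule borel_measurable_continuous_onI[OF g_continuous])
  have Fm: "(\<lambda>x. x \<bullet> grad \<Psi> x - g (grad \<Psi> x)) \<in> borel_measurable \<mu>"
    using gm gb by measurable
  show "integrable \<mu> (\<lambda>x. x \<bullet> grad \<Psi> x - g (grad \<Psi> x))"
    using i\<Psi> by (rule integrable_cong_AE_imp) (use Fm val in \<open>auto elim: eventually_mono\<close>)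
  have valI: "(\<integral>x. x \<bullet> grad \<Psi> x - g (grad \<Psi> x) \<partial>\<mu>) = (\<integral>x. \<Psi> x \<partial>\<mu>)"
    by (rule integral_cong_AE) (use Fm val i\<Psi> in auto)
  show wp: "AE x in \<mu>. well_posed UNIV (\<lambda>z. x \<bullet> z - g z) (grad \<Psi> x)"
    using AE\<Omega> AEd by eventually_elim (rule well_posed_grad)
  fix h :: "'a \<Rightarrow> real" and e :: real assume h: "bdd_lipschitz h" and e: "e > 0"
  obtain B where B: "\<And>x. \<bar>h x\<bar> \<le> B" using bdd_lipschitzE[OF h] by metis
  define G where "G x = (if x \<in> \<Omega> then SUP z\<in>UNIV. x \<bullet> z - g z - e * h z else 0)" for x
  have bdd': "bdd_above (range (\<lambda>z. x \<bullet> z - g z - e * h z))" if "x \<in> \<Omega>" for x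
  proof (rule bdd_aboveI[of _ "\<Psi> x + e * B"], clarify)
    fix z
    have "e * (- h z) \<le> e * B" using B[of z] e by (intro mult_left_mono) (auto simp: abs_le_iff)
    then show "x \<bullet> z - g z - e * h z \<le> \<Psi> x + e * B" using fenchel[of x z] that \<Omega>(2) by auto
  qed
  have G: "G \<in> borel_measurable borel"
    unfolding G_def[abs_def] by (intro borel_measurable_cSUP_open \<Omega>(1) bdd') (auto intro!: continuous_intros)
  have G_eq: "AE x in \<mu>. G x = (SUP z\<in>UNIV. x \<bullet> z - g z - e * h z)"
    using AE\<Omega> by eventually_elim (simp add: G_def)
  have "AE x in \<mu>. \<bar>G x - \<Psi> x\<bar> \<le> e * B"
    using G_eq wp val
  proof eventually_elim
    case (elim x)
    show ?case using well_posed_SUP(3)[where h = h, OF elim(2) B e] elim(1,3) by simp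
  qed
  then have "integrable \<mu> (\<lambda>x. G x - \<Psi> x)"
    by (intro M.integrable_const_bound[of _ "e * B"]) (use G i\<Psi> in auto)
  then have "integrable \<mu> (\<lambda>x. (G x - \<Psi> x) + \<Psi> x)" using i\<Psi> by (rule Bochner_Integration.integrable_add)
  then have iG: "integrable \<mu> G" by simp
  have le: "AE x in \<mu>. \<forall>z. x \<bullet> z - g z - e * h z \<le> G x"
    using AE\<Omega> by eventually_elim (auto simp: G_def intro!: cSUP_upper bdd')
  have "(\<integral>x. \<alpha> \<tau> x \<partial>\<mu>) = ((\<integral>x. (norm x)^2 / 2 \<partial>\<mu>) - (\<integral>x. \<Psi> x \<partial>\<mu>)) / \<tau>"
    using iN i\<Psi> by (simp add: \<alpha>_def)
  moreover have "(\<integral>x. ((norm x)^2 / 2 - G x) / \<tau> \<partial>\<mu>) = ((\<integral>x. (norm x)^2 / 2 \<partial>\<mu>) - (\<integral>x. G x \<partial>\<mu>)) / \<tau>"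
    using iN iG by simp
  ultimately have le1: "((\<integral>x. \<Psi> x \<partial>\<mu>) - (\<integral>x. G x \<partial>\<mu>)) / \<tau> \<le> e / \<tau> * (\<integral>z. h z \<partial>\<rho>)"
    using half_perturbed[OF \<tau> \<rho> d h iG le] eq by (simp add: diff_divide_distrib)
  have "(\<integral>x. \<Psi> x \<partial>\<mu>) - (\<integral>x. G x \<partial>\<mu>) \<le> e * (\<integral>z. h z \<partial>\<rho>)"
  proof -
    have "\<tau> * (((\<integral>x. \<Psi> x \<partial>\<mu>) - (\<integral>x. G x \<partial>\<mu>)) / \<tau>) \<le> \<tau> * (e / \<tau> * (\<integral>z. h z \<partial>\<rho>))"
      using \<tau> le1 by (intro mult_left_mono) auto
    then show ?thesis using \<tau> by simp
  qed
  then show "\<exists>G. G \<in> borel_measurable \<mu> \<and> (AE x in \<mu>. G x = (SUP y\<in>UNIV. x \<bullet> y - g y - e * h y)) \<and>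
      (\<integral>x. x \<bullet> grad \<Psi> x - g (grad \<Psi> x) \<partial>\<mu>) \<le> (\<integral>x. G x \<partial>\<mu>) + e * (\<integral>y. h y \<partial>\<rho>)"
    using G G_eq valI by (intro exI[of _ G]) auto
qed

end

text \<open>Interpolating the potential with the quadratic one moves \<open>\<mu>\<close> along straight lines.\<close>

context half_problem
begin

definition interp :: "real \<Rightarrow> 'a \<Rightarrow> real" where
  "interp s x = (1 - s) * ((norm x)^2 / 2) + s * \<Psi> x"

lemma norm_sq_GDERIV: "GDERIV (\<lambda>x::'a. (norm x)^2 / 2) x :> x"
  unfolding gderiv_def power2_norm_eq_inner by (auto intro!: derivative_eq_intros simp: inner_commute)

lemma convex_norm_sq: "convex_on UNIV (\<lambda>x::'a. (norm x)^2 / 2)"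
proof (rule convex_onI)
  fix t :: real and x y :: 'a assume t: "0 < t" "t < 1"
  have "0 \<le> t * (1 - t) * (norm (x - y))^2" using t by simp
  moreover have "(norm ((1 - t) *\<^sub>R x + t *\<^sub>R y))^2 = (1 - t) * (norm x)^2 + t * (norm y)^2 - t * (1 - t) * (norm (x - y))^2"
    unfolding power2_norm_eq_inner by (simp add: inner_simps inner_commute algebra_simps)
  ultimately show "(norm ((1 - t) *\<^sub>R x + t *\<^sub>R y))^2 / 2 \<le> (1 - t) * ((norm x)^2 / 2) + t * ((norm y)^2 / 2)"
    by simp
qed simp

lemma interp_GDERIV:
  assumes "\<Psi> differentiable at x"
  shows "GDERIV (interp s) x :> (1 - s) *\<^sub>R x + s *\<^sub>R grad \<Psi> x"
  using has_derivative_add[OF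
      has_derivative_mult_right[OF norm_sq_GDERIV[of x, unfolded gderiv_def], of "1 - s"]
      has_derivative_mult_right[OF differentiable_GDERIV[OF assms, unfolded gderiv_def], of s]]
  by (simp add: gderiv_def interp_def[abs_def] inner_add_right)

lemma half_problem_interp:
  assumes "0 \<le> s" "s \<le> 1" shows "half_problem (interp s) \<mu> \<Omega> X"
proof (intro half_problem.intro convex_function.intro half_problem_axioms.intro)
  have "convex_on UNIV (\<lambda>x. (1 - s) * ((norm x)^2 / 2) + s * \<Psi> x)"
    using assms by (intro convex_on_add convex_on_cmul convex_norm_sq conv) auto
  then show "convex_on UNIV (interp s)" by (simp add: interp_def[abs_def])
  show "AE x in \<mu>. interp s differentiable at x"
    using AEd by eventually_elim (rule GDERIV_differentiable[OF interp_GDERIV])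
qed (rule \<mu> \<Omega> X AE\<Omega>)+

lemma grad_interp: "\<Psi> differentiable at x \<Longrightarrow> grad (interp s) x = (1 - s) *\<^sub>R x + s *\<^sub>R grad \<Psi> x"
  by (rule grad_eq[OF interp_GDERIV])

text \<open>A tight inequality on [0, \<tau>] is split at time t. By \<open>sg\<close> the potential
  of the interpolated problem dominates the Hopf--Lax evolution of \<open>\<beta> \<tau>\<close>
  over the remaining time; this bounds a2 from below, forces tightness on [0, t], and
  \<open>half_eq\<close> identifies the law there.\<close>

lemma intermediate:
  assumes \<tau>: "0 < t" "t < \<tau>" and \<sigma>: "P2 \<sigma>" and \<rho>: "P2 \<rho>"
    and d1: "dual_bound t \<mu> \<sigma> a1" and d2: "dual_bound (\<tau> - t) \<sigma> \<rho> a2"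
    and eq: "a1 + a2 \<le> (\<integral>z. \<beta> \<tau> z \<partial>\<rho>) + (\<integral>x. \<alpha> \<tau> x \<partial>\<mu>)"
  shows "\<sigma> = distr \<mu> borel (grad (interp (t / \<tau>)))"
proof -
  define s where "s = t / \<tau>"
  have s: "0 < s" "s < 1" "s * \<tau> = t" using \<tau> by (auto simp: s_def)
  interpret I: half_problem "interp s" \<mu> \<Omega> X using s by (intro half_problem_interp) auto
  have t: "t > 0" "\<tau> - t > 0" "\<tau> > 0" using \<tau> by auto
  \<comment> \<open>Interpolation scales |x|^2/2 - \<open>\<Psi> x\<close> by s, which cancels
    against t = s \<tau>: the potential at the outer end does not change.\<close>
  have alpha: "I.\<alpha> t = \<alpha> \<tau>"
  proof
    fix x
    have "a - ((1 - s) * a + s * p) = s * (a - p)" for a p :: real by (simp add: algebra_simps)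
    from this[of "(norm x)^2 / 2" "\<Psi> x"]
    have "(norm x)^2 / 2 - interp s x = s * ((norm x)^2 / 2 - \<Psi> x)" by (simp only: interp_def)
    then show "I.\<alpha> t x = \<alpha> \<tau> x" using s t by (simp add: I.\<alpha>_def \<alpha>_def flip: s(3))
  qed
  have sg: "\<beta> \<tau> z - (norm (z - y))^2 / (2 * (\<tau> - t)) \<le> I.\<beta> t y" for y z
  proof -
    define D where "D = (norm (z - y))^2 / (2 * (\<tau> - t))"
    have "I.g y \<le> (norm y)^2 / 2 - t * (\<beta> \<tau> z - D)"
    proof (rule I.g_least)
      fix x assume x: "x \<in> X"
      have "\<tau> * \<beta> \<tau> z \<le> (norm z)^2 / 2 - x \<bullet> z + \<Psi> x"
        using fenchel[OF x, of z] t by (simp add: \<beta>_def)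
      then have "s * (\<tau> * \<beta> \<tau> z) \<le> s * ((norm z)^2 / 2 - x \<bullet> z + \<Psi> x)" using s by (intro mult_left_mono) auto
      then have b: "t * \<beta> \<tau> z \<le> s * ((norm z)^2 / 2) - s * (x \<bullet> z) + s * \<Psi> x"
        by (simp only: mult.assoc[symmetric] s(3) right_diff_distrib distrib_left)
      have "\<tau> - t = \<tau> * (1 - s)" using s(3) by (simp add: algebra_simps)
      then have D': "D = (norm (z - y))^2 / (2 * (\<tau> * (1 - s)))" by (simp only: D_def)
      have D: "t * D * (1 - s) = s * ((norm (z - y))^2 / 2)"
        unfolding D' s(3)[symmetric] using s(2) t by (simp add: field_simps)
      \<comment> \<open>The square vanishes exactly when y is the position at time t of a particle
        travelling from x to z at constant speed.\<close>
      have "0 \<le> (norm (y - (1 - s) *\<^sub>R x - s *\<^sub>R z))^2" by simp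
      then have "0 \<le> (norm (y - (1 - s) *\<^sub>R x - s *\<^sub>R z))^2 / 2 / (1 - s)" using s by simp
      also have "\<dots> = (s * ((norm (z - y))^2 / 2)) / (1 - s) - s * ((norm z)^2 / 2) + s * (x \<bullet> z)
          + (norm y)^2 / 2 + (1 - s) * ((norm x)^2 / 2) - x \<bullet> y"
        using s unfolding power2_norm_eq_inner
        by (simp add: field_simps inner_simps inner_commute power2_eq_square)
      also have "(s * ((norm (z - y))^2 / 2)) / (1 - s) = t * D"
        unfolding D[symmetric] using s by simp
      finally show "x \<bullet> y - interp s x \<le> (norm y)^2 / 2 - t * (\<beta> \<tau> z - D)"
        using b by (simp add: interp_def right_diff_distrib)
    qed
    then have "t * (\<beta> \<tau> z - D) \<le> t * I.\<beta> t y" using t by (simp add: I.\<beta>_def)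
    then show ?thesis using t by (simp add: D_def)
  qed
  have \<sigma>': "prob_space \<sigma>" "sets \<sigma> = sets borel" using \<sigma> by (auto simp: P2_def)
  obtain C where C: "\<And>z. \<bar>\<beta> \<tau> z\<bar> \<le> C * (1 + (norm z)^2)" using \<beta>_conditions(3)[OF t(3)] by blast
  have "(\<integral>z. \<beta> \<tau> z \<partial>\<rho>) - (\<integral>x. I.\<beta> t x \<partial>\<sigma>) \<le> a2"
    by (rule dual_bound_coercive[OF d2 t(2) \<sigma>' \<rho> \<beta>_conditions(1)[OF t(3)] \<beta>_conditions(2)[OF t(3)] C
        I.\<beta>_integrable[OF \<sigma> t(1)] _ \<beta>_borel]) (use sg in auto)
  then have "a1 \<le> (\<integral>z. I.\<beta> t z \<partial>\<sigma>) + (\<integral>x. I.\<alpha> t x \<partial>\<mu>)" using eq alpha by simp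
  from I.half_eq[OF t(1) \<sigma> d1 this] show ?thesis by (simp add: s_def)
qed

end

section \<open>The kinetic action dominates the transport cost\<close>

lemma mollifier_step:
  fixes e :: real
  assumes e: "e > 0"
  obtains H :: "real \<Rightarrow> real" where "\<And>k. C_k k H" "\<And>t. (H has_real_derivative mollifier e t) (at t)"
    "\<And>t. t \<le> - e \<Longrightarrow> H t = 0" "\<And>t. t \<ge> e \<Longrightarrow> H t = 1" "\<And>s t. s \<le> t \<Longrightarrow> H s \<le> H t"
proof -
  \<comment> \<open>The integral starts one unit before the support of the mollifier, so the
    fundamental theorem applies in the interior and H already vanishes where it has to be glued to
    0.\<close>
  define H where "H t = integral {-(e+1)..t} (mollifier e)" for t :: real
  have cont: "continuous_on S (mollifier e :: real \<Rightarrow> real)" for S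
    using continuous_mollifier continuous_on_subset by blast
  have z: "mollifier e t = 0" if "t \<le> - e \<or> t \<ge> e" for t :: real
    using that by (intro mollifier_eq_0[OF e]) auto
  have H0: "H t = 0" if "t \<le> - e" for t
  proof -
    have "integral {-(e+1)..t} (mollifier e) = integral {-(e+1)..t} (\<lambda>_::real. 0::real)"
      using that by (intro Henstock_Kurzweil_Integration.integral_cong) (auto simp: z)
    then show ?thesis by (simp add: H_def)
  qed
  have D: "(H has_real_derivative mollifier e t) (at t)" for t
  proof (cases "t > -(e+1)")
    case True
    have "(H has_real_derivative mollifier e t) (at t within {-(e+1)..t+1})"
      unfolding H_def[abs_def] using True by (intro integral_has_real_derivative cont) auto
    then show ?thesis using True by (subst (asm) at_within_interior) auto
  next
    case False
    have "eventually (\<lambda>s. H s = 0) (nhds t)"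
      using False by (intro eventually_nhds_in_open[of "{..<-e}", THEN eventually_mono]) (auto intro: H0)
    then have "(H has_real_derivative 0) (at t) \<longleftrightarrow> ((\<lambda>_. 0) has_real_derivative 0) (at t)"
      by (intro DERIV_cong_ev) auto
    then show ?thesis using z[of t] False by simp
  qed
  have H1: "H t = 1" if "t \<ge> e" for t
  proof -
    have "set_integrable lborel {-(e+1)..t} (mollifier e)"
      unfolding set_integrable_def by (intro borel_integrable_compact cont) auto
    then have "H t = (LINT s:{-(e+1)..t}|lborel. mollifier e s)"
      unfolding H_def by (rule set_borel_integral_eq_integral(2)[symmetric])
    also have "\<dots> = integral\<^sup>L lborel (mollifier e :: real \<Rightarrow> real)"
      unfolding set_lebesgue_integral_def
    proof (rule Bochner_Integration.integral_cong)
      fix s :: real show "indicator {-(e+1)..t} s *\<^sub>R mollifier e s = mollifier e s"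
        using z[of s] that by (cases "s \<le> - e \<or> s \<ge> e") auto
    qed simp
    finally show ?thesis by (simp add: integral_mollifier[OF e])
  qed
  have C: "C_k k H" for k
  proof -
    have *: "(H has_derivative (\<lambda>h. mollifier e t * h)) (at t)" for t
      using D[of t] by (simp add: has_field_derivative_def)
    have "C_k (Suc k) H"
      by (rule C_k_SucI[OF *]) (intro C_k_mult C_k_mollifier C_k_const)
    then show ?thesis by (rule C_k_SucD)
  qed
  have mono: "H s \<le> H t" if "s \<le> t" for s t
    using that D mollifier_nonneg[OF e] by (intro DERIV_nonneg_imp_nondecreasing[of s t H]) blast+
  show ?thesis by (rule that[OF C D H0 H1 mono])
qed

lemma Lipschitz_derivative_bound:
  fixes f :: "'a::real_normed_vector \<Rightarrow> real"
  assumes "(f has_derivative f') (at p)" "\<And>x y. \<bar>f x - f y\<bar> \<le> L * norm (x - y)"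
  shows "\<bar>f' h\<bar> \<le> L * norm h"
proof -
  have le: "f' h \<le> L * norm h" for h
  proof (rule has_derivative_le[OF assms(1), of 1])
    fix s :: real assume s: "0 < s" "s < 1"
    have "f (p + s *\<^sub>R h) - f p \<le> L * norm (s *\<^sub>R h)" using assms(2)[of "p + s *\<^sub>R h" p] by simp
    then show "f (p + s *\<^sub>R h) \<le> f p + s * (L * norm h)" using s by (simp add: mult_ac)
  qed simp
  have "f' (- h) = - f' h" by (rule linear_neg[OF has_derivative_linear[OF assms(1)]])
  then show ?thesis using le[of h] le[of "- h"] by (simp add: abs_le_iff)
qed

lemma mollify_lipschitz:
  assumes e: "e > 0" and f: "\<And>x y. \<bar>f x - f y\<bar> \<le> L * norm (x - y)" and c: "continuous_on UNIV f"
  shows "\<bar>mollify e f x - mollify e f y\<bar> \<le> L * norm (x - y)"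
proof -
  have "mollify e f x \<le> mollify e f y + L * norm (x - y)" for x y
  proof (rule mollify_mono[OF e c c])
    fix q show "f (x + q) \<le> f (y + q) + L * norm (x - y)" using f[of "x + q" "y + q"] by (simp add: abs_le_iff)
  qed
  from this[of x y] this[of y x] show ?thesis by (simp add: norm_minus_commute abs_le_iff)
qed

lemma Lipschitz_continuous:
  fixes f :: "'a::real_normed_vector \<Rightarrow> real"
  assumes "\<And>x y. \<bar>f x - f y\<bar> \<le> L * norm (x - y)" shows "continuous_on S f"
proof (rule lipschitz_on_continuous_on[of "\<bar>L\<bar>"])
  have "\<bar>f x - f y\<bar> \<le> \<bar>L\<bar> * norm (x - y)" for x y
    by (rule order.trans[OF assms]) (intro mult_right_mono, auto)
  then show "\<bar>L\<bar>-lipschitz_on S f" by (intro lipschitz_onI) (auto simp: dist_norm)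
qed

text \<open>The slope 1/R makes the derivative of the cut-off disappear as R grows. Mollification
  with radius 1 is the reason for the margins R - 1 and 2 R + 1.\<close>

lemma smooth_cutoff:
  assumes R: "R \<ge> 1"
  obtains \<theta> :: "'a::euclidean_space \<Rightarrow> real" where "\<And>k. C_k k \<theta>" "\<And>x. 0 \<le> \<theta> x" "\<And>x. \<theta> x \<le> 1"
    "\<And>x. norm x \<le> R - 1 \<Longrightarrow> \<theta> x = 1" "\<And>x. norm x > 2 * R + 1 \<Longrightarrow> \<theta> x = 0"
    "\<And>x y. \<bar>\<theta> x - \<theta> y\<bar> \<le> 1 / R * norm (x - y)"
proof -
  define c where "c x = min 1 (max 0 (2 - norm x / R))" for x :: 'a
  have clip: "\<bar>min 1 (max 0 (2 - a)) - min 1 (max 0 (2 - b))\<bar> \<le> \<bar>a - b\<bar>" for a b :: real by linarith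
  have cl: "\<bar>c x - c y\<bar> \<le> 1 / R * norm (x - y)" for x y
  proof -
    have "\<bar>c x - c y\<bar> \<le> \<bar>norm x / R - norm y / R\<bar>" unfolding c_def by (rule clip)
    also have "\<dots> = \<bar>norm x - norm y\<bar> / R" using R by (simp add: diff_divide_distrib[symmetric])
    also have "\<dots> \<le> norm (x - y) / R" using R norm_triangle_ineq3[of x y] by (intro divide_right_mono) auto
    finally show ?thesis by simp
  qed
  have cc: "continuous_on UNIV c" by (rule Lipschitz_continuous[OF cl])
  have c01: "0 \<le> c x" "c x \<le> 1" for x by (auto simp: c_def)
  have c1: "c x = 1" if "norm x \<le> R" for x using that R by (auto simp: c_def field_simps)
  have c0: "c x = 0" if "norm x \<ge> 2 * R" for x using that R by (auto simp: c_def field_simps)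
  show ?thesis
  proof (rule that[of "mollify 1 c"])
    show "C_k k (mollify 1 c)" for k by (rule C_k_mollify[OF _ cc]) simp
    show ge: "0 \<le> mollify 1 c x" for x by (rule mollify_ge[OF _ cc]) (auto simp: c01)
    show le: "mollify 1 c x \<le> 1" for x by (rule mollify_le[OF _ cc]) (auto simp: c01)
    show "mollify 1 c x = 1" if x: "norm x \<le> R - 1" for x
    proof (rule antisym[OF le mollify_ge[OF _ cc]])
      fix q :: 'a assume "norm q < 1"
      then have "norm (x + q) \<le> R" using x norm_triangle_ineq[of x q] by linarith
      then show "1 \<le> c (x + q)" using c1 by simp
    qed simp
    show "mollify 1 c x = 0" if x: "norm x > 2 * R + 1" for x
    proof (rule antisym[OF mollify_le[OF _ cc] ge])
      fix q :: 'a assume "norm q < 1"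
      then have "norm (x + q) \<ge> 2 * R" using x norm_diff_ineq[of x q] by linarith
      then show "c (x + q) \<le> 0" using c0 by simp
    qed simp
    show "\<bar>mollify 1 c x - mollify 1 c y\<bar> \<le> 1 / R * norm (x - y)" for x y
      by (rule mollify_lipschitz[OF _ cl cc]) simp
  qed
qed

text \<open>\<open>C_k\<close> controls derivatives in fixed directions. Splitting (1, w) along a
  basis leaves finitely many such derivatives, continuous in p, and linear coefficients in w, whence
  joint measurability.\<close>

lemma derivative_split:
  fixes f :: "real \<times> 'a::euclidean_space \<Rightarrow> real"
  assumes f: "C_k 1 f"
  shows "fder f p (1, w) = fder f p (1, 0) + (\<Sum>b\<in>Basis. (w \<bullet> b) * fder f p (0, b))"
    and "continuous_on UNIV (\<lambda>p. fder f p h)"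
proof -
  have f': "C_k (Suc 0) f" using f by simp
  have lin: "linear (fder f p)" for p
    using C_k_Suc_has_derivative[OF f'] by (rule has_derivative_linear)
  have "(1::real, w) = (1, 0) + (\<Sum>b\<in>Basis. (w \<bullet> b) *\<^sub>R (0, b))"
    by (simp add: scaleR_Pair sum_prod[symmetric] euclidean_representation prod_eq_iff fst_sum snd_sum)
  then show "fder f p (1, w) = fder f p (1, 0) + (\<Sum>b\<in>Basis. (w \<bullet> b) * fder f p (0, b))"
    by (simp only: linear_add[OF lin] linear_sum[OF lin] linear_scale[OF lin] real_scaleR_def)
  have "\<forall>h. C_k 0 (\<lambda>p. fder f p h)" using f'[unfolded C_k.simps(2)] by blast
  then show "continuous_on UNIV (\<lambda>p. fder f p h)" by (simp only: C_k.simps(1))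
qed

lemma derivative_measurable:
  fixes f :: "real \<times> 'a::euclidean_space \<Rightarrow> real"
  assumes f: "C_k 1 f" and [measurable]: "P \<in> measurable M borel" "W \<in> measurable M borel"
  shows "(\<lambda>m. fder f (P m) (1, W m)) \<in> borel_measurable M"
proof -
  have [measurable]: "(\<lambda>m. fder f (P m) h) \<in> borel_measurable M" for h
    using measurable_compose[OF assms(2) borel_measurable_continuous_onI[OF derivative_split(2)[OF f]]] .
  show ?thesis unfolding derivative_split(1)[OF f, of _ "W _"] by measurable
qed

section \<open>Measurability and integrability along a curve of measures\<close>

locale continuity_curve =
  fixes T :: real and \<rho> :: "real \<Rightarrow> 'a::euclidean_space measure" and v :: "real \<Rightarrow> 'a \<Rightarrow> 'a"
  assumes T: "T > 0" and P2\<rho>: "\<And>t. t \<in> {0..T} \<Longrightarrow> P2 (\<rho> t)" and nc: "narrowly_continuous T \<rho>"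
    and vm: "(\<lambda>(t, x). v t x) \<in> borel_measurable borel" and kin: "kinetic_action T \<rho> v < \<infinity>"
    and ce: "continuity_equation T \<rho> v"
begin

text \<open>Lebesgue measure living on [0,T] itself, because nothing is known about
  \<open>\<rho> t\<close> at other times: on \<open>space L\<close> every \<rho> t is a probability
  measure.\<close>

definition L :: "real measure" where "L = restrict_space lborel {0..T}"

abbreviation "flux f t \<equiv> \<integral>x. fder f (t, x) (1, v t x) \<partial>\<rho> t"
abbreviation "nnL F \<equiv> \<integral>\<^sup>+t. (\<integral>\<^sup>+x. F t x \<partial>\<rho> t) \<partial>L"

lemma space_L: "space L = {0..T}" by (simp add: L_def space_restrict_space)

lemma prob: "t \<in> {0..T} \<Longrightarrow> prob_space (\<rho> t)" and sets_\<rho>: "t \<in> {0..T} \<Longrightarrow> sets (\<rho> t) = sets borel"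
  using P2\<rho> by (auto simp: P2_def)

lemma measurable_L: "f \<in> borel_measurable borel \<Longrightarrow> f \<in> borel_measurable L"
  unfolding L_def by (rule measurable_restrict_space1) simp

text \<open>Narrow continuity makes t \<mapsto> \<rho> t (U) measurable for open U, by approximating
  the indicator from the Lipschitz class. Open sets form a generator stable under intersection, so
  \<rho> is a kernel and the iterated integrals are measurable in time.\<close>

lemma kernel: "\<rho> \<in> measurable L (subprob_algebra borel)"
proof (rule measurable_subprob_algebra_generated[where \<Omega> = UNIV and G = "{U. open U}"])
  show "sets (borel :: 'a measure) = sigma_sets UNIV {U. open U}" by (simp add: borel_def)
  show "Int_stable {U::'a set. open U}" by (auto simp: Int_stable_def)
  show "subprob_space (\<rho> t)" if "t \<in> space L" for t
    using that prob by (simp add: space_L prob_space_imp_subprob_space)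
  show "sets (\<rho> t) = sets borel" if "t \<in> space L" for t using that sets_\<rho> by (simp add: space_L)
  have em: "(\<lambda>t. emeasure (\<rho> t) U) \<in> borel_measurable L" if U: "open U" for U :: "'a set"
  proof -
    from open_indicator_approx[OF U] obtain f where f: "\<And>n. bdd_lipschitz (f n)"
        "\<And>n x. 0 \<le> f n x" "\<And>n x. f n x \<le> 1" "\<And>x. (\<lambda>n. f n x) \<longlonglongrightarrow> indicator U x" by metis
    have "(\<lambda>t. measure (\<rho> t) U) \<in> borel_measurable L"
    proof (rule borel_measurable_LIMSEQ_metric)
      fix n
      have "continuous_on {0..T} (\<lambda>t. \<integral>x. f n x \<partial>\<rho> t)"
        using nc f(1)[of n] bdd_lipschitz_continuous by (auto simp: narrowly_continuous_def bdd_lipschitz_def)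
      then have "(\<lambda>t. \<integral>x. f n x \<partial>\<rho> t) \<in> borel_measurable (restrict_space borel {0..T})"
        by (rule borel_measurable_continuous_on_restrict)
      moreover have "sets L = sets (restrict_space borel {0..T})"
        unfolding L_def by (rule sets_restrict_space_cong) simp
      ultimately show "(\<lambda>t. \<integral>x. f n x \<partial>\<rho> t) \<in> borel_measurable L"
        using measurable_cong_sets[of L "restrict_space borel {0..T}" borel borel] by blast
    next
      fix t assume "t \<in> space L"
      then show "(\<lambda>n. \<integral>x. f n x \<partial>\<rho> t) \<longlonglongrightarrow> measure (\<rho> t) U"
        by (intro emeasure_open_tendsto prob sets_\<rho> U f) (auto simp: space_L)
    qed
    then have "(\<lambda>t. ennreal (measure (\<rho> t) U)) \<in> borel_measurable L" by measurable
    then show ?thesis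
    proof (rule measurable_cong[THEN iffD1, rotated])
      fix t assume "t \<in> space L"
      then interpret prob_space "\<rho> t" using prob by (simp add: space_L)
      show "ennreal (measure (\<rho> t) U) = emeasure (\<rho> t) U" by (simp add: emeasure_eq_measure)
    qed
  qed
  then show "\<And>A. A \<in> {U. open U} \<Longrightarrow> (\<lambda>t. emeasure (\<rho> t) A) \<in> borel_measurable L" by simp
  show "(\<lambda>t. emeasure (\<rho> t) UNIV) \<in> borel_measurable L" by (rule em) simp
qed simp

lemma pair_measurable: "f \<in> borel_measurable borel \<Longrightarrow> (\<lambda>(t, x). f (t, x)) \<in> borel_measurable (L \<Otimes>\<^sub>M borel)"
  for f :: "real \<times> 'a \<Rightarrow> 'c::topological_space"
proof -
  assume f: "f \<in> borel_measurable borel"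
  have "(\<lambda>t. t) \<in> measurable L borel" by (rule measurable_L) simp
  then have "(\<lambda>p. (fst p, snd p)) \<in> measurable (L \<Otimes>\<^sub>M (borel :: 'a measure)) (borel \<Otimes>\<^sub>M borel)"
    by (intro measurable_Pair measurable_compose[OF measurable_fst] measurable_snd)
  then have "(\<lambda>p. p) \<in> measurable (L \<Otimes>\<^sub>M (borel :: 'a measure)) borel" by (simp add: borel_prod)
  from measurable_compose[OF this f] show ?thesis by (simp add: split_beta')
qed

lemma nn_measurable:
  fixes f :: "real \<times> 'a \<Rightarrow> ennreal"
  assumes "f \<in> borel_measurable borel" shows "(\<lambda>t. \<integral>\<^sup>+x. f (t, x) \<partial>\<rho> t) \<in> borel_measurable L"
  by (rule nn_integral_measurable_subprob_algebra2[OF _ kernel]) (use pair_measurable[OF assms] in simp)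

lemma integral_measurable:
  fixes f :: "real \<times> 'a \<Rightarrow> real"
  assumes f: "f \<in> borel_measurable borel" shows "(\<lambda>t. \<integral>x. f (t, x) \<partial>\<rho> t) \<in> borel_measurable L"
proof -
  note [measurable] = pair_measurable[OF f] kernel measurable_distr2 integral_measurable_subprob_algebra
  \<comment> \<open>Moving \<open>\<rho> t\<close> to the fibre over t makes the integrand
    independent of t, so that only the measure varies.\<close>
  have "(\<lambda>t. integral\<^sup>L (distr (\<rho> t) (L \<Otimes>\<^sub>M borel) (\<lambda>x. (t, x))) (\<lambda>(t, x). f (t, x))) \<in> borel_measurable L"
    by measurable
  then show ?thesis
  proof (rule measurable_cong[THEN iffD1, rotated])
    fix t assume t: "t \<in> space L"
    have [measurable_cong]: "sets (\<rho> t) = sets borel" using t sets_\<rho> by (simp add: space_L)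
    show "integral\<^sup>L (distr (\<rho> t) (L \<Otimes>\<^sub>M borel) (\<lambda>x. (t, x))) (\<lambda>(t, x). f (t, x)) = (\<integral>x. f (t, x) \<partial>\<rho> t)"
      using t pair_measurable[OF f] by (subst integral_distr) (simp_all add: split_beta')
  qed
qed

lemma slice_measurable: "f \<in> borel_measurable borel \<Longrightarrow> (\<lambda>x. f (t, x)) \<in> borel_measurable borel"
  for f :: "real \<times> 'a \<Rightarrow> 'c::topological_space"
  by (rule measurable_compose[of "\<lambda>x. (t, x)"]) (auto intro: borel_measurable_continuous_onI continuous_intros)

lemma double_integrable:
  fixes f :: "real \<times> 'a \<Rightarrow> real"
  assumes f: "f \<in> borel_measurable borel" and fin: "nnL (\<lambda>t x. ennreal \<bar>f (t, x)\<bar>) < \<infinity>"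
  shows "AE t in L. integrable (\<rho> t) (\<lambda>x. f (t, x))" "integrable L (\<lambda>t. \<integral>x. f (t, x) \<partial>\<rho> t)"
proof -
  have m: "(\<lambda>t. \<integral>\<^sup>+x. ennreal \<bar>f (t, x)\<bar> \<partial>\<rho> t) \<in> borel_measurable L"
    by (rule nn_measurable) (use f in measurable)
  have "AE t in L. (\<integral>\<^sup>+x. ennreal \<bar>f (t, x)\<bar> \<partial>\<rho> t) \<noteq> \<infinity>"
    using fin by (intro nn_integral_PInf_AE m) auto
  moreover have sp: "AE t in L. t \<in> {0..T}" using AE_space[of L] by (simp add: space_L)
  ultimately show ae: "AE t in L. integrable (\<rho> t) (\<lambda>x. f (t, x))"
  proof eventually_elim
    case (elim t)
    have [measurable_cong]: "sets (\<rho> t) = sets borel" using elim sets_\<rho> by simp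
    show ?case using elim(1) slice_measurable[OF f, of t] by (intro integrableI_bounded) (auto simp: top.not_eq_extremum)
  qed
  show "integrable L (\<lambda>t. \<integral>x. f (t, x) \<partial>\<rho> t)"
  proof (rule integrableI_bounded[OF integral_measurable[OF f]])
    have "(\<integral>\<^sup>+t. ennreal (norm (\<integral>x. f (t, x) \<partial>\<rho> t)) \<partial>L) \<le> nnL (\<lambda>t x. ennreal \<bar>f (t, x)\<bar>)"
      using ae by (intro nn_integral_mono_AE) (auto elim!: eventually_mono dest: integral_norm_bound_ennreal)
    then show "(\<integral>\<^sup>+t. ennreal (norm (\<integral>x. f (t, x) \<partial>\<rho> t)) \<partial>L) < \<infinity>" using fin by (rule order.strict_trans1)
  qed
qed

lemma finite_L: "finite_measure L"
  using T by (intro finite_measureI) (simp add: space_L L_def emeasure_restrict_space)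

lemma AE_L: "AE t in L. t \<in> {0..T}" using AE_space[of L] by (simp add: space_L)

lemma nn_integral_const_\<rho>: "nnL (\<lambda>t x. c) = c * ennreal T"
proof -
  have "nnL (\<lambda>t x. c) = (\<integral>\<^sup>+t. c \<partial>L)"
    by (rule nn_integral_cong) (auto simp: space_L prob prob_space.emeasure_space_1)
  then show ?thesis using T by (simp add: L_def emeasure_restrict_space space_restrict_space)
qed

definition ke :: "real \<times> 'a \<Rightarrow> real" where "ke p = 1/2 * (norm (v (fst p) (snd p)))^2"
definition \<kappa> :: "real \<Rightarrow> real" where "\<kappa> t = (\<integral>x. ke (t, x) \<partial>\<rho> t)"

lemma vm': "(\<lambda>p. v (fst p) (snd p)) \<in> borel_measurable borel"
  using vm by (simp add: split_beta')

lemma ke_borel: "ke \<in> borel_measurable borel" unfolding ke_def[abs_def] using vm' by measurable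

lemma ke_nonneg: "ke p \<ge> 0" by (simp add: ke_def)

lemma kin_eq: "kinetic_action T \<rho> v = nnL (\<lambda>t x. ennreal (ke (t, x)))"
  unfolding kinetic_action_def ke_def L_def by (subst nn_integral_restrict_space) auto

lemma ke_fin: "nnL (\<lambda>t x. ennreal \<bar>ke (t, x)\<bar>) < \<infinity>"
  using kin unfolding kin_eq by (simp add: ke_nonneg)

lemma ke_integrable: "AE t in L. integrable (\<rho> t) (\<lambda>x. ke (t, x))" "integrable L \<kappa>"
  using double_integrable[OF ke_borel ke_fin] by (auto simp: \<kappa>_def[abs_def])

lemma \<kappa>_nonneg: "\<kappa> t \<ge> 0" unfolding \<kappa>_def by (intro Bochner_Integration.integral_nonneg ke_nonneg)

definition act :: "real \<Rightarrow> real \<Rightarrow> real" where "act a b = (\<integral>t. indicator {a..b} t * \<kappa> t \<partial>L)"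

lemma act_integrable: "integrable L (\<lambda>t. indicator {a..b} t * \<kappa> t)"
proof (rule Bochner_Integration.integrable_bound[OF ke_integrable(2)])
  have "(\<lambda>t. indicator {a..b} t) \<in> borel_measurable L" by (rule measurable_L) simp
  then show "(\<lambda>t. indicator {a..b} t * \<kappa> t) \<in> borel_measurable L"
    using borel_measurable_integrable[OF ke_integrable(2)] by (intro borel_measurable_times)
qed (auto simp: indicator_def)

lemma act_nonneg: "act a b \<ge> 0"
  unfolding act_def by (intro Bochner_Integration.integral_nonneg) (simp add: \<kappa>_nonneg)

lemma act_split:
  assumes "a \<le> b" "b \<le> c" shows "act a b + act b c = act a c"
proof -
  have "AE t in L. t \<noteq> b"
    unfolding L_def by (subst AE_restrict_space_iff) (auto intro: AE_mp[OF AE_lborel_singleton[of b]])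
  then have "act a c = (\<integral>t. indicator {a..b} t * \<kappa> t + indicator {b..c} t * \<kappa> t \<partial>L)"
    unfolding act_def using act_integrable assms
    by (intro integral_cong_AE) (auto elim!: eventually_mono simp: indicator_def)
  also have "\<dots> = act a b + act b c" unfolding act_def by (intro Bochner_Integration.integral_add act_integrable)
  finally show ?thesis by simp
qed

lemma kinetic_act: "kinetic_action T \<rho> v = ennreal (act 0 T)"
proof -
  have "kinetic_action T \<rho> v = (\<integral>\<^sup>+t. ennreal (\<kappa> t) \<partial>L)"
    unfolding kin_eq using ke_integrable(1)
    by (intro nn_integral_cong_AE) (auto elim!: eventually_mono simp: \<kappa>_def ke_nonneg nn_integral_eq_integral)
  also have "\<dots> = ennreal (\<integral>t. \<kappa> t \<partial>L)"
    by (rule nn_integral_eq_integral[OF ke_integrable(2)]) (simp add: \<kappa>_nonneg)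
  also have "(\<integral>t. \<kappa> t \<partial>L) = act 0 T"
    unfolding act_def by (rule Bochner_Integration.integral_cong) (auto simp: space_L)
  finally show ?thesis .
qed

text \<open>Since 1 + |v| \<le> 2 + |v|^2/2, finite action makes every expression of linear growth
  in the velocity integrable, in particular derivatives of test functions along the flow.\<close>

lemma linear_growth_fin:
  fixes F :: "real \<times> 'a \<Rightarrow> real"
  assumes "\<And>t x. t \<in> {0..T} \<Longrightarrow> \<bar>F (t, x)\<bar> \<le> C * (1 + norm (v t x))" "C \<ge> 0"
  shows "nnL (\<lambda>t x. ennreal \<bar>F (t, x)\<bar>) < \<infinity>"
proof -
  have le: "C * (1 + norm (v t x)) \<le> 2 * C + C * ke (t, x)" for t x
  proof -
    have "0 \<le> (norm (v t x) - 1)^2" by simp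
    then have "1 + norm (v t x) \<le> 2 + ke (t, x)" by (simp add: ke_def power2_eq_square algebra_simps)
    then have "C * (1 + norm (v t x)) \<le> C * (2 + ke (t, x))" using assms(2) by (rule mult_left_mono)
    then show ?thesis by (simp add: algebra_simps)
  qed
  have "nnL (\<lambda>t x. ennreal \<bar>F (t, x)\<bar>) \<le> nnL (\<lambda>t x. ennreal (2 * C) + ennreal C * ennreal (ke (t, x)))"
  proof (intro nn_integral_mono)
    fix t x assume "t \<in> space L"
    then have "\<bar>F (t, x)\<bar> \<le> 2 * C + C * ke (t, x)"
      using assms(1)[of t x] le[of t x] by (simp add: space_L)
    then show "ennreal \<bar>F (t, x)\<bar> \<le> ennreal (2 * C) + ennreal C * ennreal (ke (t, x))"
      using assms(2) ke_nonneg by (simp add: ennreal_plus[symmetric] ennreal_mult[symmetric] ennreal_leI del: ennreal_plus)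
  qed
  also have "\<dots> = (\<integral>\<^sup>+t. (\<integral>\<^sup>+x. ennreal (2 * C) \<partial>\<rho> t) + ennreal C * (\<integral>\<^sup>+x. ennreal (ke (t, x)) \<partial>\<rho> t) \<partial>L)"
  proof (rule nn_integral_cong)
    fix t assume "t \<in> space L"
    then have [measurable_cong]: "sets (\<rho> t) = sets borel" using sets_\<rho> by (simp add: space_L)
    have [measurable]: "(\<lambda>x. ke (t, x)) \<in> borel_measurable borel" by (rule slice_measurable[OF ke_borel])
    show "(\<integral>\<^sup>+x. ennreal (2 * C) + ennreal C * ennreal (ke (t, x)) \<partial>\<rho> t) =
       (\<integral>\<^sup>+x. ennreal (2 * C) \<partial>\<rho> t) + ennreal C * (\<integral>\<^sup>+x. ennreal (ke (t, x)) \<partial>\<rho> t)"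
      by (subst nn_integral_add) (auto simp: nn_integral_cmult)
  qed
  also have "\<dots> = ennreal (2 * C) * ennreal T + ennreal C * kinetic_action T \<rho> v"
  proof (subst nn_integral_add)
    have m: "(\<lambda>t. \<integral>\<^sup>+x. ennreal (ke (t, x)) \<partial>\<rho> t) \<in> borel_measurable L"
      using nn_measurable[of "\<lambda>p. ennreal (ke p)"] ke_borel by simp
    then show "(\<lambda>t. ennreal C * (\<integral>\<^sup>+x. ennreal (ke (t, x)) \<partial>\<rho> t)) \<in> borel_measurable L" by measurable
    show "(\<lambda>t. \<integral>\<^sup>+x. ennreal (2 * C) \<partial>\<rho> t) \<in> borel_measurable L"
      using nn_measurable[of "\<lambda>_. ennreal (2 * C)"] by simp
    show "nnL (\<lambda>t x. ennreal (2 * C)) + (\<integral>\<^sup>+t. ennreal C * (\<integral>\<^sup>+x. ennreal (ke (t, x)) \<partial>\<rho> t) \<partial>L) =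
        ennreal (2 * C) * ennreal T + ennreal C * kinetic_action T \<rho> v"
      unfolding nn_integral_const_\<rho> kin_eq by (simp add: nn_integral_cmult[OF m])
  qed
  also have "\<dots> < \<infinity>" using kin by (simp add: ennreal_mult_eq_top_iff less_top[symmetric])
  finally show ?thesis .
qed

lemma derivative_borel:
  fixes f :: "real \<times> 'a \<Rightarrow> real"
  assumes "C_k 1 f" shows "(\<lambda>p. fder f p (1, v (fst p) (snd p))) \<in> borel_measurable borel"
  using derivative_measurable[OF assms measurable_ident vm'] by simp

end

section \<open>Testing the continuity equation\<close>

lemma C_k_translate: "C_k k f \<Longrightarrow> C_k k (\<lambda>x. f (x + c))"
proof (induction k arbitrary: f)
  case 0
  then show ?case by (auto intro!: continuous_on_compose2[of UNIV f] continuous_intros)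
next
  case (Suc k)
  have "((\<lambda>x. f (x + c)) has_derivative fder f (x + c)) (at x)" for x
  proof -
    have "((\<lambda>x. x + c) has_derivative (\<lambda>h. h)) (at x)" by (auto intro!: derivative_eq_intros)
    from has_derivative_compose[OF this C_k_Suc_has_derivative[OF Suc.prems]] show ?thesis .
  qed
  then show ?case by (rule C_k_SucI) (use Suc in auto)
qed

context continuity_curve
begin

lemma mollifier_weight:
  assumes e: "e > 0" and c: "0 \<le> c - e" "c + e \<le> T"
  shows "integrable L (\<lambda>t. mollifier e (t - c))" "(\<integral>t. mollifier e (t - c) \<partial>L) = 1"
proof -
  have z: "indicator {0..T} t * mollifier e (t - c) = mollifier e (t - c)" for t
  proof (cases "\<bar>t - c\<bar> < e")
    case True
    then have "t \<in> {0..T}" using c by auto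
    then show ?thesis by simp
  qed (simp add: mollifier_eq_0[OF e])
  have i: "integrable lborel (\<lambda>t. mollifier e (- c + 1 * t))"
    by (rule lborel_integrable_real_affine[OF integrable_mollifier[OF e]]) simp
  have "(\<integral>t. mollifier e (- c + 1 * t) \<partial>lborel) = 1"
    using lborel_integral_real_affine[of 1 "mollifier e :: real \<Rightarrow> real" "- c"] integral_mollifier[OF e, where 'a=real] by simp
  then show "(\<integral>t. mollifier e (t - c) \<partial>L) = 1"
    unfolding L_def by (subst integral_restrict_space) (simp_all add: z)
  show "integrable L (\<lambda>t. mollifier e (t - c))"
    unfolding L_def by (subst integrable_restrict_space) (use i in \<open>simp_all add: z\<close>)
qed

text \<open>The change of the measure is handled with the integrand frozen at time s, by narrow
  continuity; the change of the integrand is uniform in x by the Lipschitz bound in time.\<close>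

lemma continuous_time_integral:
  assumes f: "continuous_on UNIV f" and B: "\<And>p. \<bar>f p\<bar> \<le> B" and lip: "\<And>t s x. \<bar>f (t, x) - f (s, x)\<bar> \<le> \<Lambda> * \<bar>t - s\<bar>"
  shows "continuous_on {0..T} (\<lambda>t. \<integral>x. f (t, x) \<partial>\<rho> t)"
  unfolding continuous_on_iff
proof (intro ballI allI impI)
  fix s \<eta> :: real assume s: "s \<in> {0..T}" and \<eta>: "\<eta> > 0"
  have cs: "continuous_on UNIV (\<lambda>x. f (t, x))" for t
    by (intro continuous_on_compose2[OF f] continuous_intros) auto
  have fi: "integrable (\<rho> t) (\<lambda>x. f (u, x))" if "t \<in> {0..T}" for t u
    by (rule integrable_bounded[OF prob[OF that] sets_\<rho>[OF that] borel_measurable_continuous_onI[OF cs] B])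
  have "continuous_on {0..T} (\<lambda>t. \<integral>x. f (s, x) \<partial>\<rho> t)"
    using nc cs[of s] B unfolding narrowly_continuous_def by (auto simp: bounded_iff)
  then obtain d where d: "d > 0" "\<And>t. t \<in> {0..T} \<Longrightarrow> dist t s < d \<Longrightarrow> dist (\<integral>x. f (s, x) \<partial>\<rho> t) (\<integral>x. f (s, x) \<partial>\<rho> s) < \<eta> / 2"
    unfolding continuous_on_iff using s \<eta> by (metis half_gt_zero)
  define d' where "d' = min d (\<eta> / (2 * (\<bar>\<Lambda>\<bar> + 1)))"
  have "dist (\<integral>x. f (t, x) \<partial>\<rho> t) (\<integral>x. f (s, x) \<partial>\<rho> s) < \<eta>" if t: "t \<in> {0..T}" "dist t s < d'" for t
  proof -
    interpret prob_space "\<rho> t" by (rule prob[OF t(1)])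
    have "\<bar>t - s\<bar> < \<eta> / (2 * (\<bar>\<Lambda>\<bar> + 1))" using t(2) by (simp add: d'_def dist_real_def)
    then have "\<bar>t - s\<bar> * (2 * (\<bar>\<Lambda>\<bar> + 1)) < \<eta>" by (subst (asm) pos_less_divide_eq) auto
    moreover have "\<Lambda> * \<bar>t - s\<bar> \<le> (\<bar>\<Lambda>\<bar> + 1) * \<bar>t - s\<bar>" by (intro mult_right_mono) auto
    moreover have "\<bar>t - s\<bar> * (2 * (\<bar>\<Lambda>\<bar> + 1)) = 2 * ((\<bar>\<Lambda>\<bar> + 1) * \<bar>t - s\<bar>)" by (simp add: mult_ac)
    ultimately have l: "\<Lambda> * \<bar>t - s\<bar> < \<eta> / 2" by linarith
    have "(\<integral>x. f (t, x) \<partial>\<rho> t) \<le> (\<integral>x. f (s, x) + \<Lambda> * \<bar>t - s\<bar> \<partial>\<rho> t)"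
      using lip[of t _ s] by (intro integral_mono fi t Bochner_Integration.integrable_add) (auto simp: abs_le_iff algebra_simps)
    moreover have "(\<integral>x. f (s, x) - \<Lambda> * \<bar>t - s\<bar> \<partial>\<rho> t) \<le> (\<integral>x. f (t, x) \<partial>\<rho> t)"
      using lip[of t _ s] by (intro integral_mono fi t Bochner_Integration.integrable_diff) (auto simp: abs_le_iff algebra_simps)
    ultimately have "\<bar>(\<integral>x. f (t, x) \<partial>\<rho> t) - (\<integral>x. f (s, x) \<partial>\<rho> t)\<bar> \<le> \<Lambda> * \<bar>t - s\<bar>"
      using fi[OF t(1)] by (simp add: prob_space abs_le_iff)
    moreover have "\<bar>(\<integral>x. f (s, x) \<partial>\<rho> t) - (\<integral>x. f (s, x) \<partial>\<rho> s)\<bar> < \<eta> / 2"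
      using d(2)[OF t(1)] t(2) by (simp add: d'_def dist_real_def)
    ultimately show ?thesis using l unfolding dist_real_def by linarith
  qed
  moreover have "d' > 0" using d(1) \<eta> by (simp add: d'_def)
  ultimately show "\<exists>d>0. \<forall>t\<in>{0..T}. dist t s < d \<longrightarrow> dist (\<integral>x. f (t, x) \<partial>\<rho> t) (\<integral>x. f (s, x) \<partial>\<rho> s) < \<eta>" by blast
qed

text \<open>Testing with \<open>\<chi>(t) f(t, x)\<close>, where \<open>\<chi>\<close> approximates the indicator function of \<open>[a, b]\<close>.\<close>

lemma test_step:
  assumes f: "\<And>k. C_k k f" and supp: "\<And>t x. norm x > R \<Longrightarrow> f (t, x) = 0"
    and B: "\<And>p. \<bar>f p\<bar> \<le> B" and lip: "\<And>t s x. \<bar>f (t, x) - f (s, x)\<bar> \<le> \<Lambda> * \<bar>t - s\<bar>"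
    and C: "C \<ge> 0" "\<And>t x w. t \<in> {0..T} \<Longrightarrow> \<bar>fder f (t, x) (1, w)\<bar> \<le> C * (1 + norm w)"
    and ab: "0 \<le> a" "a < b" "b \<le> T"
    and K: "integrable L K" "\<And>t. K t \<ge> 0"
      "AE t in L. t \<in> {a..b} \<longrightarrow> flux f t \<le> K t"
  shows "(\<integral>x. f (b, x) \<partial>\<rho> b) - (\<integral>x. f (a, x) \<partial>\<rho> a) \<le> (\<integral>t. indicator {a..b} t * K t \<partial>L)"
proof -
  interpret L: finite_measure L by (rule finite_L)
  define g where "g t = (\<integral>x. f (t, x) \<partial>\<rho> t)" for t
  define G where "G t = flux f t" for t
  have fc: "continuous_on UNIV f" using C_k_continuous[OF f[of 0]] .
  have fm: "f \<in> borel_measurable borel" by (rule borel_measurable_continuous_onI[OF fc])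
  have gm: "g \<in> borel_measurable L" unfolding g_def[abs_def] by (rule integral_measurable[OF fm])
  have f_int: "integrable (\<rho> t) (\<lambda>x. f (t, x))" if "t \<in> {0..T}" for t
    by (rule integrable_bounded[OF prob[OF that] sets_\<rho>[OF that] slice_measurable[OF fm] B])
  have gB: "\<bar>g t\<bar> \<le> B" if t: "t \<in> {0..T}" for t
  proof -
    interpret prob_space "\<rho> t" by (rule prob[OF t])
    have "norm (g t) \<le> (\<integral>x. norm (f (t, x)) \<partial>\<rho> t)" unfolding g_def by (rule integral_norm_bound)
    also have "\<dots> \<le> (\<integral>x. B \<partial>\<rho> t)" using f_int[OF t] B by (intro integral_mono) auto
    finally show ?thesis by (simp add: prob_space)
  qed
  have Df_borel: "(\<lambda>p. fder f p (1, v (fst p) (snd p))) \<in> borel_measurable borel"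
    by (rule derivative_borel[OF f])
  have Df_fin: "nnL (\<lambda>t x. ennreal \<bar>fder f (t, x) (1, v (fst (t, x)) (snd (t, x)))\<bar>) < \<infinity>"
    by (rule linear_growth_fin[OF _ C(1)]) (use C(2) in simp)
  note DfI = double_integrable[OF Df_borel Df_fin, simplified]
  have Gi: "integrable L G" unfolding G_def[abs_def] by (rule DfI(2))
  have gcont: "continuous_on {0..T} g" unfolding g_def[abs_def] by (rule continuous_time_integral[OF fc B lip])
  have "g b - g a \<le> (\<integral>t. indicator {a..b} t * K t \<partial>L) + \<eta>" if \<eta>: "\<eta> > 0" for \<eta>
  proof -
    have "a \<in> {0..T}" "b \<in> {0..T}" using ab by auto
    then obtain d1 d2 where d1: "d1 > 0" "\<And>t. t \<in> {0..T} \<Longrightarrow> dist t a < d1 \<Longrightarrow> dist (g t) (g a) < \<eta> / 2"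
      and d2: "d2 > 0" "\<And>t. t \<in> {0..T} \<Longrightarrow> dist t b < d2 \<Longrightarrow> dist (g t) (g b) < \<eta> / 2"
      using gcont \<eta> unfolding continuous_on_iff by (metis half_gt_zero)
    \<comment> \<open>The cut-off switches within distance e of a + 2e and of b - 2e. These zones
      must be disjoint and lie where g is within \<eta>/2 of its values at a and b, hence 6e < b - a
      and 3e < d1, d2.\<close>
    define e where "e = min (min d1 d2) (b - a) / 8"
    have e: "e > 0" "3 * e < d1" "3 * e < d2" "6 * e < b - a" proof -
      have "8 * e = min (min d1 d2) (b - a)" by (simp add: e_def)
      moreover have "min (min d1 d2) (b - a) \<le> d1" "min (min d1 d2) (b - a) \<le> d2" "min (min d1 d2) (b - a) \<le> b - a" "min (min d1 d2) (b - a) > 0"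
        using d1(1) d2(1) ab by auto
      ultimately show "e > 0" "3 * e < d1" "3 * e < d2" "6 * e < b - a" by linarith+
    qed
    obtain H where H: "\<And>k. C_k k H" "\<And>t. (H has_real_derivative mollifier e t) (at t)"
      "\<And>t. t \<le> - e \<Longrightarrow> H t = 0" "\<And>t. t \<ge> e \<Longrightarrow> H t = (1::real)" "\<And>s t. s \<le> t \<Longrightarrow> H s \<le> H t"
      using mollifier_step[OF e(1)] by metis
    define a' where "a' = a + 2 * e"
    define b' where "b' = b - 2 * e"
    define cut where "cut t = H (t - a') - H (t - b')" for t
    define cut' where "cut' t = mollifier e (t - a') - mollifier e (t - b')" for t :: real
    have cut_D: "(cut has_real_derivative cut' t) (at t)" for t
      unfolding cut_def[abs_def] cut'_def
      using DERIV_diff[OF H(2)[of "t + - a'", unfolded DERIV_shift] H(2)[of "t + - b'", unfolded DERIV_shift]] by simp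
    have H01: "0 \<le> H t" "H t \<le> 1" for t
      using H(5)[of "min t (- e)" t] H(3)[of "min t (- e)"] H(5)[of t "max t e"] H(4)[of "max t e"] by auto
    have cut01: "0 \<le> cut t" "cut t \<le> 1" for t
      using H(5)[of "t - b'" "t - a'"] e H01[of "t - a'"] H01[of "t - b'"] by (auto simp: cut_def a'_def b'_def)
    have cut0: "cut t = 0" if "t \<notin> {a + e..b - e}" for t
    proof (cases "t < a + e")
      case True
      then show ?thesis using e H(3)[of "t - a'"] H(3)[of "t - b'"] by (simp add: cut_def a'_def b'_def)
    next
      case False
      then show ?thesis using that e H(4)[of "t - a'"] H(4)[of "t - b'"] by (simp add: cut_def a'_def b'_def)
    qed
    have cutC: "C_k k cut" for k
      using C_k_add[OF C_k_translate[OF H(1), of k "- a'"] C_k_mult[OF C_k_const[of k "-1"] C_k_translate[OF H(1), of k "- b'"]]]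
      by (simp add: cut_def[abs_def])
    define \<zeta> where "\<zeta> p = cut (fst p) * f p" for p
    have "\<zeta> \<in> test_functions T"
      unfolding test_functions_def
    proof (intro CollectI conjI allI)
      show "C_k k \<zeta>" for k
        unfolding \<zeta>_def[abs_def] by (intro C_k_mult C_k_compose_linear[OF bounded_linear_fst] cutC f)
      have sub: "{p. \<zeta> p \<noteq> 0} \<subseteq> {a + e..b - e} \<times> cball 0 R"
      proof
        fix p assume "p \<in> {p. \<zeta> p \<noteq> 0}"
        then have "cut (fst p) \<noteq> 0" "f (fst p, snd p) \<noteq> 0" by (auto simp: \<zeta>_def)
        then show "p \<in> {a + e..b - e} \<times> cball 0 R"
          using cut0[of "fst p"] supp[of "snd p" "fst p"] by (cases p) (auto simp: not_less intro: leI)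
      qed
      have cl: "closed ({a + e..b - e} \<times> cball (0::'a) R)" by (intro closed_Times) auto
      have sub': "closure {p. \<zeta> p \<noteq> 0} \<subseteq> {a + e..b - e} \<times> cball 0 R" by (rule closure_minimal[OF sub cl])
      then show "closure {p. \<zeta> p \<noteq> 0} \<subseteq> {0<..<T} \<times> UNIV" using e ab by auto
      have "compact ({a + e..b - e} \<times> cball (0::'a) R)" by (intro compact_Times) auto
      then show "compact (closure {p. \<zeta> p \<noteq> 0})"
        using compact_Int_closed[of _ "closure {p. \<zeta> p \<noteq> 0}"] sub' by (metis closed_closure inf.absorb_iff2)
    qed
    moreover have D\<zeta>: "fder \<zeta> p h = cut (fst p) * fder f p h + cut' (fst p) * fst h * f p" for p h
    proof -
      have "((\<lambda>p. cut (fst p)) has_derivative (\<lambda>h. cut' (fst p) * fst h)) (at p)"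
        using has_derivative_compose[OF bounded_linear_imp_has_derivative[OF bounded_linear_fst] cut_D[unfolded has_field_derivative_def]] .
      from has_derivative_mult[OF this C_k_Suc_has_derivative[OF f[of "Suc 0"]]]
      have "(\<zeta> has_derivative (\<lambda>h. cut (fst p) * fder f p h + cut' (fst p) * fst h * f p)) (at p)"
        by (simp add: \<zeta>_def[abs_def])
      from fun_cong[OF frechet_derivative_at[OF this, symmetric]] show ?thesis .
    qed
    ultimately have "(LINT t:{0..T}|lborel. flux \<zeta> t) = 0"
      using ce by (auto simp: continuity_equation_def)
    then have zero: "(\<integral>t. flux \<zeta> t \<partial>L) = 0"
      unfolding L_def set_lebesgue_integral_def by (subst integral_restrict_space) auto
    have cutm: "cut \<in> borel_measurable L" "cut' \<in> borel_measurable L"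
      using C_k_continuous[OF cutC] continuous_mollifier[of e, where 'a=real] unfolding cut'_def[abs_def]
      by (auto intro!: measurable_L borel_measurable_continuous_onI continuous_intros continuous_on_compose2[OF continuous_mollifier[of e, where 'a=real]])
    have in_int: "integrable L (\<lambda>t. mollifier e (t - c) * g t)" if c: "0 \<le> c - e" "c + e \<le> T" for c
    proof (rule Bochner_Integration.integrable_bound[OF integrable_mult_right[OF mollifier_weight(1)[OF e(1) c], of B]])
      show "(\<lambda>t. mollifier e (t - c) * g t) \<in> borel_measurable L"
        using mollifier_weight(1)[OF e(1) c] gm by (intro borel_measurable_times) auto
      show "AE t in L. norm (mollifier e (t - c) * g t) \<le> norm (B * mollifier e (t - c))"
        using AE_L
      proof eventually_elim
        case (elim t)
        have "\<bar>g t\<bar> \<le> \<bar>B\<bar>" using gB[OF elim] by linarith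
        then show ?case by (simp add: abs_mult mult.commute mult_right_mono)
      qed
    qed
    have a'T: "0 \<le> a' - e" "a' + e \<le> T" and b'T: "0 \<le> b' - e" "b' + e \<le> T"
      using e ab by (auto simp: a'_def b'_def)
    have weight: "\<bar>(\<integral>t. mollifier e (t - c) * g t \<partial>L) - g s\<bar> \<le> \<eta> / 2"
      if c: "0 \<le> c - e" "c + e \<le> T" and near: "\<And>t. t \<in> {0..T} \<Longrightarrow> \<bar>t - c\<bar> < e \<Longrightarrow> \<bar>g t - g s\<bar> < \<eta> / 2" for c s
    proof -
      have pt: "mollifier e (t - c) * (g s - \<eta> / 2) \<le> mollifier e (t - c) * g t \<and>
          mollifier e (t - c) * g t \<le> mollifier e (t - c) * (g s + \<eta> / 2)" if "t \<in> {0..T}" for t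
      proof (cases "\<bar>t - c\<bar> < e")
        case True
        have "g s - \<eta> / 2 \<le> g t" "g t \<le> g s + \<eta> / 2" using near[OF that True] by linarith+
        then show ?thesis using mollifier_nonneg[OF e(1), of "t - c"] by (auto intro!: mult_left_mono)
      next
        case False then show ?thesis by (simp add: mollifier_eq_0[OF e(1)])
      qed
      note w = mollifier_weight[OF e(1) c]
      have "(\<integral>t. mollifier e (t - c) * g t \<partial>L) \<le> (\<integral>t. mollifier e (t - c) * (g s + \<eta> / 2) \<partial>L)"
        using pt by (intro integral_mono in_int c integrable_mult_left w) (auto simp: space_L)
      moreover have "(\<integral>t. mollifier e (t - c) * (g s - \<eta> / 2) \<partial>L) \<le> (\<integral>t. mollifier e (t - c) * g t \<partial>L)"
        using pt by (intro integral_mono in_int c integrable_mult_left w) (auto simp: space_L)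
      moreover have c': "(\<integral>t. mollifier e (t - c) * y \<partial>L) = y" for y using w by simp
      ultimately have "(\<integral>t. mollifier e (t - c) * g t \<partial>L) \<le> g s + \<eta> / 2" "g s - \<eta> / 2 \<le> (\<integral>t. mollifier e (t - c) * g t \<partial>L)"
        by (simp_all only: c')
      then show ?thesis by linarith
    qed
    have wa: "\<bar>(\<integral>t. mollifier e (t - a') * g t \<partial>L) - g a\<bar> \<le> \<eta> / 2"
      by (rule weight[OF a'T]) (use d1(2) e in \<open>auto simp: a'_def dist_real_def\<close>)
    have wb: "\<bar>(\<integral>t. mollifier e (t - b') * g t \<partial>L) - g b\<bar> \<le> \<eta> / 2"
      by (rule weight[OF b'T]) (use d2(2) e in \<open>auto simp: b'_def dist_real_def\<close>)
    have cut'g: "integrable L (\<lambda>t. cut' t * g t)" "(\<integral>t. cut' t * g t \<partial>L) = (\<integral>t. mollifier e (t - a') * g t \<partial>L) - (\<integral>t. mollifier e (t - b') * g t \<partial>L)"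
      using in_int[OF a'T] in_int[OF b'T] by (auto simp: cut'_def left_diff_distrib)
    have cutG: "integrable L (\<lambda>t. cut t * G t)"
      by (rule Bochner_Integration.integrable_bound[OF Gi])
        (use cutm borel_measurable_integrable[OF Gi] cut01 in \<open>auto simp: abs_mult intro!: mult_left_le_one_le\<close>)
    have K': "integrable L (\<lambda>t. indicator {a..b} t * K t)"
    proof (rule Bochner_Integration.integrable_bound[OF K(1)])
      have "(\<lambda>t. indicator {a..b} t) \<in> borel_measurable L" by (rule measurable_L) simp
      then show "(\<lambda>t. indicator {a..b} t * K t) \<in> borel_measurable L"
        using borel_measurable_integrable[OF K(1)] by (intro borel_measurable_times)
    qed (auto simp: indicator_def)
    \<comment> \<open>cut' is the difference of a unit mass near a and one near b, so the first term
      is close to g a - g b. The second is controlled by K on [a,b] because the cut-off lies between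
      0 and 1.\<close>
    have "0 = (\<integral>t. cut' t * g t + cut t * G t \<partial>L)"
      unfolding zero[symmetric]
    proof (rule integral_cong_AE)
      have \<zeta>1: "C_k 1 \<zeta>" unfolding \<zeta>_def[abs_def] by (intro C_k_mult C_k_compose_linear[OF bounded_linear_fst] cutC f)
      show "(\<lambda>t. \<integral>x. fder \<zeta> (t, x) (1, v t x) \<partial>\<rho> t) \<in> borel_measurable L"
        using integral_measurable[OF derivative_borel[OF \<zeta>1]] by simp
      show "(\<lambda>t. cut' t * g t + cut t * G t) \<in> borel_measurable L"
        using cut'g(1) cutG by (intro borel_measurable_add) auto
      show "AE t in L. flux \<zeta> t = cut' t * g t + cut t * G t"
        using DfI(1) AE_L
        by eventually_elim (simp add: D\<zeta> G_def g_def f_int)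
    qed
    also have "\<dots> = (\<integral>t. cut' t * g t \<partial>L) + (\<integral>t. cut t * G t \<partial>L)"
      by (rule Bochner_Integration.integral_add[OF cut'g(1) cutG])
    also have "(\<integral>t. cut t * G t \<partial>L) \<le> (\<integral>t. indicator {a..b} t * K t \<partial>L)"
    proof (rule integral_mono_AE[OF cutG K'])
      show "AE t in L. cut t * G t \<le> indicator {a..b} t * K t"
        using K(3)
      proof eventually_elim
        case (elim t)
        show ?case
        proof (cases "t \<in> {a + e..b - e}")
          case True
          then have t: "t \<in> {a..b}" using e by auto
          have "cut t * G t \<le> cut t * K t" using elim t cut01(1)[of t] by (intro mult_left_mono) (auto simp: G_def)
          also have "\<dots> \<le> 1 * K t" using cut01(2)[of t] K(2)[of t] by (intro mult_right_mono)
          finally show ?thesis using t by simp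
        next
          case False
          then show ?thesis using cut0[OF False] K(2)[of t] by (simp add: indicator_def)
        qed
      qed
    qed
    finally show ?thesis using wa wb unfolding cut'g(2) by linarith
  qed
  then have "g b - g a \<le> (\<integral>t. indicator {a..b} t * K t \<partial>L)" by (rule field_le_epsilon)
  then show ?thesis by (simp add: g_def)
qed

text \<open>Spatial cut-offs of slope 1/(n+1) give compact support. They add a term of at most
  \<epsilon> |v| with \<epsilon> = B/(n+1), and |v| \<le> 1/2 + |v|^2/2, so finite action makes it
  vanish in the limit.\<close>

lemma smooth_bound:
  assumes ab: "0 \<le> a" "a < b" "b \<le> T"
    and \<xi>: "\<And>k. C_k k \<xi>" and B: "\<And>p. \<bar>\<xi> p\<bar> \<le> B" and lip: "\<And>p q. \<bar>\<xi> p - \<xi> q\<bar> \<le> \<Lambda> * norm (p - q)"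
    and sub: "\<And>t x w. t \<in> {a..b} \<Longrightarrow> fder \<xi> (t, x) (1, w) \<le> 1/2 * (norm w)^2"
  shows "(\<integral>x. \<xi> (b, x) \<partial>\<rho> b) - (\<integral>x. \<xi> (a, x) \<partial>\<rho> a) \<le> act a b"
proof -
  have \<xi>c: "continuous_on UNIV \<xi>" using C_k_continuous[OF \<xi>[of 0]] .
  have \<xi>m: "\<xi> \<in> borel_measurable borel" by (rule borel_measurable_continuous_onI[OF \<xi>c])
  have B0: "B \<ge> 0" using B[of 0] by linarith
  have \<Lambda>0: "\<Lambda> \<ge> 0"
  proof -
    have "0 \<le> \<Lambda> * norm ((1::real, 0::'a) - 0)" using order.trans[OF abs_ge_zero lip] .
    then show ?thesis by (simp add: norm_Pair)
  qed
  have "\<forall>n. \<exists>\<theta>. (\<forall>k. C_k k \<theta>) \<and> (\<forall>x::'a. 0 \<le> \<theta> x) \<and> (\<forall>x. \<theta> x \<le> 1) \<and> (\<forall>x. norm x \<le> real n \<longrightarrow> \<theta> x = 1) \<and>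
     (\<forall>x. norm x > 2 * real (Suc n) + 1 \<longrightarrow> \<theta> x = 0) \<and> (\<forall>x y. \<bar>\<theta> x - \<theta> y\<bar> \<le> 1 / real (Suc n) * norm (x - y))"
  proof
    fix n
    have "real (Suc n) \<ge> 1" by simp
    from smooth_cutoff[OF this, where 'a='a] obtain \<theta> :: "'a \<Rightarrow> real" where *: "\<And>k. C_k k \<theta>" "\<And>x. 0 \<le> \<theta> x" "\<And>x. \<theta> x \<le> 1"
      "\<And>x. norm x \<le> real (Suc n) - 1 \<Longrightarrow> \<theta> x = 1" "\<And>x. norm x > 2 * real (Suc n) + 1 \<Longrightarrow> \<theta> x = 0"
      "\<And>x y. \<bar>\<theta> x - \<theta> y\<bar> \<le> 1 / real (Suc n) * norm (x - y)" by blast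
    show "\<exists>\<theta>. (\<forall>k. C_k k \<theta>) \<and> (\<forall>x::'a. 0 \<le> \<theta> x) \<and> (\<forall>x. \<theta> x \<le> 1) \<and> (\<forall>x. norm x \<le> real n \<longrightarrow> \<theta> x = 1) \<and>
     (\<forall>x. norm x > 2 * real (Suc n) + 1 \<longrightarrow> \<theta> x = 0) \<and> (\<forall>x y. \<bar>\<theta> x - \<theta> y\<bar> \<le> 1 / real (Suc n) * norm (x - y))"
      by (intro exI[of _ \<theta>] conjI allI impI *) auto
  qed
  from choice[OF this] obtain \<theta> :: "nat \<Rightarrow> 'a \<Rightarrow> real" where \<theta>_all:
    "\<forall>n. (\<forall>k. C_k k (\<theta> n)) \<and> (\<forall>x. 0 \<le> \<theta> n x) \<and> (\<forall>x. \<theta> n x \<le> 1) \<and> (\<forall>x. norm x \<le> real n \<longrightarrow> \<theta> n x = 1) \<and>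
     (\<forall>x. norm x > 2 * real (Suc n) + 1 \<longrightarrow> \<theta> n x = 0) \<and> (\<forall>x y. \<bar>\<theta> n x - \<theta> n y\<bar> \<le> 1 / real (Suc n) * norm (x - y))" ..
  have \<theta>: "C_k k (\<theta> n)" "0 \<le> \<theta> n x" "\<theta> n x \<le> 1"
    "norm x \<le> real n \<Longrightarrow> \<theta> n x = 1" "norm x > 2 * real (Suc n) + 1 \<Longrightarrow> \<theta> n x = 0"
    "\<bar>\<theta> n x - \<theta> n y\<bar> \<le> 1 / real (Suc n) * norm (x - y)" for n k x y
    using spec[OF \<theta>_all, of n] by blast+
  define f where "f n p = \<theta> n (snd p) * \<xi> p" for n p
  have step: "(\<integral>x. f n (b, x) \<partial>\<rho> b) - (\<integral>x. f n (a, x) \<partial>\<rho> a) \<le> act a b + B / real (Suc n) * (\<integral>t. 1/2 + \<kappa> t \<partial>L)" for n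
  proof -
    define \<epsilon> where "\<epsilon> = B / real (Suc n)"
    have \<epsilon>0: "\<epsilon> \<ge> 0" using B0 by (simp add: \<epsilon>_def)
    have D\<theta>: "(\<theta> n has_derivative fder (\<theta> n) x) (at x)" for x
      by (rule C_k_Suc_has_derivative, rule \<theta>(1))
    have D\<xi>: "(\<xi> has_derivative fder \<xi> p) (at p)" for p
      by (rule C_k_Suc_has_derivative[OF \<xi>[of "Suc 0"]])
    have Df: "fder (f n) p h = \<theta> n (snd p) * fder \<xi> p h + fder (\<theta> n) (snd p) (snd h) * \<xi> p" for p h
    proof -
      have "((\<lambda>p. \<theta> n (snd p)) has_derivative (\<lambda>h. fder (\<theta> n) (snd p) (snd h))) (at p)"
        using has_derivative_compose[OF bounded_linear_imp_has_derivative[OF bounded_linear_snd] D\<theta>] .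
      from has_derivative_mult[OF this D\<xi>[of p]]
      have "(f n has_derivative (\<lambda>h. \<theta> n (snd p) * fder \<xi> p h + fder (\<theta> n) (snd p) (snd h) * \<xi> p)) (at p)"
        by (simp add: f_def[abs_def])
      from fun_cong[OF frechet_derivative_at[OF this, symmetric]] show ?thesis .
    qed
    have D\<theta>b: "\<bar>fder (\<theta> n) x w * \<xi> p\<bar> \<le> \<epsilon> * norm w" for x w p
    proof -
      have "\<bar>fder (\<theta> n) x w\<bar> \<le> 1 / real (Suc n) * norm w"
        by (rule Lipschitz_derivative_bound[OF D\<theta> \<theta>(6)])
      then have "\<bar>fder (\<theta> n) x w\<bar> * \<bar>\<xi> p\<bar> \<le> (1 / real (Suc n) * norm w) * B"
        using B by (intro mult_mono) auto
      then show ?thesis by (simp add: abs_mult \<epsilon>_def mult_ac)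
    qed
    have D\<xi>b: "\<bar>fder \<xi> p (1, w)\<bar> \<le> \<Lambda> * (1 + norm w)" for p w
    proof -
      have "\<bar>fder \<xi> p (1, w)\<bar> \<le> \<Lambda> * norm (1::real, w)"
        by (rule Lipschitz_derivative_bound[OF D\<xi> lip])
      also have "\<dots> \<le> \<Lambda> * (1 + norm w)"
        using norm_Pair_le[of "1::real" w] \<Lambda>0 by (intro mult_left_mono) auto
      finally show ?thesis .
    qed
    have Dfb: "\<bar>fder (f n) (t, x) (1, w)\<bar> \<le> (\<Lambda> + \<epsilon>) * (1 + norm w)" for t x w
    proof -
      have "\<bar>\<theta> n x * fder \<xi> (t, x) (1, w)\<bar> \<le> 1 * (\<Lambda> * (1 + norm w))"
        unfolding abs_mult using \<theta>(2,3)[of n x] D\<xi>b by (intro mult_mono) auto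
      moreover have "\<epsilon> * norm w \<le> \<epsilon> * (1 + norm w)" using \<epsilon>0 by (intro mult_left_mono) auto
      ultimately show ?thesis
        using D\<theta>b[of x w "(t, x)"] unfolding Df distrib_right by (simp only: snd_conv)
    qed
    have Dfle: "fder (f n) (t, x) (1, v t x) \<le> ke (t, x) + \<epsilon> * (1/2 + ke (t, x))" if t: "t \<in> {a..b}" for t x
    proof -
      have "\<theta> n x * fder \<xi> (t, x) (1, v t x) \<le> \<theta> n x * ke (t, x)"
        using sub[OF t, of x "v t x"] \<theta>(2)[of n x] by (intro mult_left_mono) (auto simp: ke_def)
      also have "\<dots> \<le> 1 * ke (t, x)" using \<theta>(3) ke_nonneg by (intro mult_right_mono)
      finally have 1: "\<theta> n x * fder \<xi> (t, x) (1, v t x) \<le> ke (t, x)" by simp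
      have "0 \<le> (norm (v t x) - 1)^2" by simp
      then have "norm (v t x) \<le> 1/2 + ke (t, x)" by (simp add: ke_def power2_eq_square algebra_simps)
      then have "\<epsilon> * norm (v t x) \<le> \<epsilon> * (1/2 + ke (t, x))" using \<epsilon>0 by (intro mult_left_mono)
      then show ?thesis using 1 D\<theta>b[of x "v t x" "(t, x)"] unfolding Df by (simp only: snd_conv)
    qed
    have "(\<integral>x. f n (b, x) \<partial>\<rho> b) - (\<integral>x. f n (a, x) \<partial>\<rho> a) \<le> (\<integral>t. indicator {a..b} t * (\<kappa> t + \<epsilon> * (1/2 + \<kappa> t)) \<partial>L)"
    proof (rule test_step[where R = "2 * real (Suc n) + 1" and B = B and \<Lambda> = \<Lambda> and C = "\<Lambda> + \<epsilon>"])
      show fC: "C_k k (f n)" for k unfolding f_def[abs_def]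
        by (intro C_k_mult C_k_compose_linear[OF bounded_linear_snd] \<theta> \<xi>)
      show "f n (t, x) = 0" if "norm x > 2 * real (Suc n) + 1" for t x using \<theta>(5)[OF that] by (simp add: f_def)
      show "\<bar>f n p\<bar> \<le> B" for p
        using mult_mono[of "\<theta> n (snd p)" 1 "\<bar>\<xi> p\<bar>" B] \<theta>(2,3)[of n "snd p"] B by (simp add: f_def abs_mult)
      show "\<bar>f n (t, x) - f n (s, x)\<bar> \<le> \<Lambda> * \<bar>t - s\<bar>" for t s x
      proof -
        have "\<bar>f n (t, x) - f n (s, x)\<bar> = \<theta> n x * \<bar>\<xi> (t, x) - \<xi> (s, x)\<bar>"
          using \<theta>(2)[of n x] by (simp add: f_def right_diff_distrib[symmetric] abs_mult)
        also have "\<dots> \<le> 1 * (\<Lambda> * norm ((t, x) - (s, x)))" using \<theta>(2,3) by (intro mult_mono lip) auto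
        finally show ?thesis by (simp add: norm_Pair)
      qed
      show "integrable L (\<lambda>t. \<kappa> t + \<epsilon> * (1/2 + \<kappa> t))"
        using ke_integrable(2) finite_L by (intro Bochner_Integration.integrable_add integrable_mult_right finite_measure.integrable_const)
      show "AE t in L. t \<in> {a..b} \<longrightarrow> flux (f n) t \<le> \<kappa> t + \<epsilon> * (1/2 + \<kappa> t)"
      proof (rule AE_mp[OF _ AE_mp])
        show "AE t in L. integrable (\<rho> t) (\<lambda>x. fder (f n) (t, x) (1, v (fst (t, x)) (snd (t, x))))"
          by (rule double_integrable(1)[OF derivative_borel[OF fC] linear_growth_fin[of _ "\<Lambda> + \<epsilon>"]])
            (use Dfb \<Lambda>0 \<epsilon>0 in auto)
        show "AE t in L. integrable (\<rho> t) (\<lambda>x. ke (t, x))" by (rule ke_integrable)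
        show "AE t in L. integrable (\<rho> t) (\<lambda>x. ke (t, x)) \<longrightarrow>
            integrable (\<rho> t) (\<lambda>x. fder (f n) (t, x) (1, v (fst (t, x)) (snd (t, x)))) \<longrightarrow>
            t \<in> {a..b} \<longrightarrow> flux (f n) t \<le> \<kappa> t + \<epsilon> * (1/2 + \<kappa> t)"
        proof (intro AE_I2 impI)
          fix t assume i: "integrable (\<rho> t) (\<lambda>x. ke (t, x))"
            "integrable (\<rho> t) (\<lambda>x. fder (f n) (t, x) (1, v (fst (t, x)) (snd (t, x))))" and t: "t \<in> {a..b}"
          interpret prob_space "\<rho> t" using t ab by (intro prob) auto
          have "flux (f n) t \<le> (\<integral>x. ke (t, x) + \<epsilon> * (1/2 + ke (t, x)) \<partial>\<rho> t)"
            using i Dfle[OF t] by (intro integral_mono) auto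
          also have "\<dots> = \<kappa> t + \<epsilon> * (1/2 + \<kappa> t)" using i(1) by (simp add: \<kappa>_def prob_space)
          finally show "flux (f n) t \<le> \<kappa> t + \<epsilon> * (1/2 + \<kappa> t)" .
        qed
      qed
    qed (use ab Dfb \<Lambda>0 \<epsilon>0 \<kappa>_nonneg in auto)
    also
    have i: "integrable L (\<lambda>t. \<epsilon> * (1/2 + \<kappa> t))"
      using ke_integrable(2) finite_L by (intro Bochner_Integration.integrable_add integrable_mult_right finite_measure.integrable_const)
    have "(\<integral>t. indicator {a..b} t * (\<kappa> t + \<epsilon> * (1/2 + \<kappa> t)) \<partial>L) \<le> (\<integral>t. indicator {a..b} t * \<kappa> t + \<epsilon> * (1/2 + \<kappa> t) \<partial>L)"
    proof (rule integral_mono)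
      show i2: "integrable L (\<lambda>t. indicator {a..b} t * \<kappa> t + \<epsilon> * (1/2 + \<kappa> t))"
        by (intro Bochner_Integration.integrable_add act_integrable i)
      show le: "indicator {a..b} t * (\<kappa> t + \<epsilon> * (1/2 + \<kappa> t)) \<le> indicator {a..b} t * \<kappa> t + \<epsilon> * (1/2 + \<kappa> t)" for t
        using \<epsilon>0 \<kappa>_nonneg[of t] by (simp add: indicator_def)
      have "(\<lambda>t. indicator {a..b} t :: real) \<in> borel_measurable L" by (rule measurable_L) simp
      then show "integrable L (\<lambda>t. indicator {a..b} t * (\<kappa> t + \<epsilon> * (1/2 + \<kappa> t)))"
        using borel_measurable_integrable[OF ke_integrable(2)] le \<epsilon>0 \<kappa>_nonneg
        by (intro Bochner_Integration.integrable_bound[OF i2]) (auto simp: indicator_def)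
    qed
    also have "\<dots> = act a b + \<epsilon> * (\<integral>t. 1/2 + \<kappa> t \<partial>L)"
      by (subst Bochner_Integration.integral_add[OF act_integrable i]) (simp add: act_def)
    finally show ?thesis by (simp add: \<epsilon>_def)
  qed
  have conv: "(\<lambda>n. \<integral>x. f n (t, x) \<partial>\<rho> t) \<longlonglongrightarrow> (\<integral>x. \<xi> (t, x) \<partial>\<rho> t)" if t: "t \<in> {0..T}" for t
  proof -
    interpret prob_space "\<rho> t" by (rule prob[OF t])
    note [measurable_cong] = sets_\<rho>[OF t]
    have [measurable]: "(\<lambda>x. \<xi> (t, x)) \<in> borel_measurable borel" by (rule slice_measurable[OF \<xi>m])
    have [measurable]: "\<theta> n \<in> borel_measurable borel" for n
      by (rule borel_measurable_continuous_onI[OF C_k_continuous[OF \<theta>(1)[of 0]]])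
    show ?thesis
    proof (rule integral_dominated_convergence[where w = "\<lambda>_. B"])
      show "AE x in \<rho> t. (\<lambda>n. f n (t, x)) \<longlonglongrightarrow> \<xi> (t, x)"
      proof (rule AE_I2)
        fix x :: 'a
        obtain N where N: "norm x \<le> real N" using real_arch_simple by blast
        have "f n (t, x) = \<xi> (t, x)" if "n \<ge> N" for n
          using \<theta>(4)[of x n] N that by (simp add: f_def order.trans[OF N])
        then show "(\<lambda>n. f n (t, x)) \<longlonglongrightarrow> \<xi> (t, x)" by (intro tendsto_eventually) (auto simp: eventually_sequentially)
      qed
      show "AE x in \<rho> t. norm (f n (t, x)) \<le> B" for n
        using mult_mono[of "\<theta> n _" 1 "\<bar>\<xi> (t, _)\<bar>" B] \<theta>(2,3) B by (intro AE_I2) (simp add: f_def abs_mult)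
    qed (auto simp: f_def)
  qed
  have "(\<lambda>n. act a b + B / real (Suc n) * (\<integral>t. 1/2 + \<kappa> t \<partial>L)) \<longlonglongrightarrow> act a b + 0 * (\<integral>t. 1/2 + \<kappa> t \<partial>L)"
    by (intro tendsto_intros LIMSEQ_Suc[OF lim_const_over_n])
  moreover have "(\<lambda>n. (\<integral>x. f n (b, x) \<partial>\<rho> b) - (\<integral>x. f n (a, x) \<partial>\<rho> a)) \<longlonglongrightarrow> (\<integral>x. \<xi> (b, x) \<partial>\<rho> b) - (\<integral>x. \<xi> (a, x) \<partial>\<rho> a)"
    using ab by (intro tendsto_diff conv) auto
  ultimately show ?thesis using step by (auto intro: LIMSEQ_le)
qed

text \<open>The Hopf--Lax evolution is a subsolution of the Hamilton--Jacobi equation in the finite-difference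
  form \<open>\<xi>(t + s, x + s w) \<le> \<xi>(t, x) + s |w|^2 / 2\<close>, which survives mollification.\<close>

theorem dual_bound_act:
  assumes ab: "0 \<le> a" "a < b" "b \<le> T"
  shows "dual_bound (b - a) (\<rho> a) (\<rho> b) (act a b)"
  unfolding dual_bound_def
proof (intro allI impI)
  fix h :: "'a \<Rightarrow> real" assume h: "bdd_lipschitz h"
  obtain B M where B: "B \<ge> 0" "\<And>x. \<bar>h x\<bar> \<le> B" and M: "M \<ge> 0" "\<And>x y. \<bar>h x - h y\<bar> \<le> M * norm (x - y)"
    using bdd_lipschitzE[OF h] by metis
  \<comment> \<open>A Lipschitz constant of the Hopf--Lax evolution in space and time: M in space,
    M^2/2 in time by \<open>hopf_time\<close>.\<close>
  define \<Lambda> where "\<Lambda> = M + M^2 / 2"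
  have \<Lambda>: "\<Lambda> \<ge> 0" using M by (simp add: \<Lambda>_def)
  have abT: "a \<in> {0..T}" "b \<in> {0..T}" using ab by auto
  have "(\<integral>z. h z \<partial>\<rho> b) - (\<integral>x. hopf (b - a) h x \<partial>\<rho> a) \<le> act a b + \<eta>" if \<eta>: "\<eta> > 0" for \<eta>
  proof -
    \<comment> \<open>The total error is \<delta> (2 \<Lambda> + M^2): mollification costs \<Lambda>
      \<delta> at either end and the delay by 2 \<delta> costs \<delta> M^2. The summand 1 keeps the
      denominator positive.\<close>
    define \<delta> where "\<delta> = \<eta> / (2 * \<Lambda> + M^2 + 1)"
    have den: "2 * \<Lambda> + M^2 + 1 > 0" using \<Lambda> by (simp add: add_nonneg_pos)
    have \<delta>: "\<delta> > 0" using \<eta> den by (simp add: \<delta>_def)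
    \<comment> \<open>The evolution is delayed by 2 \<delta> so that its time argument stays
      nonnegative up to t = b after a shift by less than \<delta> from mollification and a time step
      s < \<delta>. The maximum merely extends the function to all times.\<close>
    define \<xi>0 where "\<xi>0 p = hopf (max 0 (b + 2 * \<delta> - fst p)) h (snd p)" for p
    have hopf_sig: "\<bar>hopf \<sigma> h x - hopf \<sigma>' h x\<bar> \<le> M^2 / 2 * \<bar>\<sigma> - \<sigma>'\<bar>" if "\<sigma> \<ge> 0" "\<sigma>' \<ge> 0" for \<sigma> \<sigma>' x
    proof -
      have le: "\<bar>hopf \<sigma> h x - hopf \<sigma>' h x\<bar> \<le> M^2 / 2 * \<bar>\<sigma> - \<sigma>'\<bar>" if "\<sigma> \<ge> 0" "\<sigma> \<le> \<sigma>'" for \<sigma> \<sigma>'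
      proof -
        have "hopf \<sigma> h x \<le> hopf (\<sigma> + (\<sigma>' - \<sigma>)) h x"
          by (rule hopf_time(1)[OF B(2) _ _ M(2)]) (use that in auto)
        moreover have "hopf (\<sigma> + (\<sigma>' - \<sigma>)) h x \<le> hopf \<sigma> h x + (\<sigma>' - \<sigma>) * M^2 / 2"
          by (rule hopf_time(2)[OF B(2) _ _ M(2)]) (use that in auto)
        moreover have "M^2 / 2 * \<bar>\<sigma> - \<sigma>'\<bar> = (\<sigma>' - \<sigma>) * M^2 / 2" "\<sigma> + (\<sigma>' - \<sigma>) = \<sigma>'" using that by auto
        ultimately show ?thesis by (simp only:)
      qed
      show ?thesis
        using le[of \<sigma> \<sigma>'] le[of \<sigma>' \<sigma>] that by (cases "\<sigma> \<le> \<sigma>'") (auto simp: abs_minus_commute)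
    qed
    have \<xi>0_lip: "\<bar>\<xi>0 p - \<xi>0 q\<bar> \<le> \<Lambda> * norm (p - q)" for p q
    proof -
      have "\<bar>\<xi>0 p - \<xi>0 q\<bar> \<le> \<bar>hopf (max 0 (b + 2 * \<delta> - fst p)) h (snd p) - hopf (max 0 (b + 2 * \<delta> - fst p)) h (snd q)\<bar>
        + \<bar>hopf (max 0 (b + 2 * \<delta> - fst p)) h (snd q) - hopf (max 0 (b + 2 * \<delta> - fst q)) h (snd q)\<bar>"
        unfolding \<xi>0_def by linarith
      also have "\<dots> \<le> M * norm (snd p - snd q) + M^2 / 2 * \<bar>max 0 (b + 2 * \<delta> - fst p) - max 0 (b + 2 * \<delta> - fst q)\<bar>"
        by (intro add_mono hopf_lipschitz[OF B(2) _ M(2)] hopf_sig) auto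
      also have "\<dots> \<le> M * norm (p - q) + M^2 / 2 * norm (p - q)"
      proof (intro add_mono mult_left_mono)
        have pq: "p - q = (fst p - fst q, snd p - snd q)" by (cases p, cases q) simp
        show "norm (snd p - snd q) \<le> norm (p - q)" unfolding pq by (rule norm_snd_le)
        have "\<bar>max 0 (b + 2 * \<delta> - fst p) - max 0 (b + 2 * \<delta> - fst q)\<bar> \<le> \<bar>fst p - fst q\<bar>" by linarith
        also have "\<dots> \<le> norm (p - q)" unfolding pq using norm_fst_le[of "fst p - fst q" "snd p - snd q"] by simp
        finally show "\<bar>max 0 (b + 2 * \<delta> - fst p) - max 0 (b + 2 * \<delta> - fst q)\<bar> \<le> norm (p - q)" .
      qed (use M in auto)
      finally show ?thesis by (simp add: \<Lambda>_def distrib_right)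
    qed
    have \<xi>0c: "continuous_on UNIV \<xi>0" by (rule Lipschitz_continuous[OF \<xi>0_lip])
    have \<xi>0B: "\<bar>\<xi>0 p\<bar> \<le> B" for p unfolding \<xi>0_def by (rule hopf_bounded(2)[OF B(2)]) simp
    define \<xi> where "\<xi> = mollify \<delta> \<xi>0"
    have \<xi>C: "C_k k \<xi>" for k unfolding \<xi>_def by (rule C_k_mollify[OF \<delta> \<xi>0c])
    have \<xi>B: "\<bar>\<xi> p\<bar> \<le> B" for p
    proof -
      have "\<xi>0 q \<le> B" "- B \<le> \<xi>0 q" for q using \<xi>0B[of q] by linarith+
      note b = this
      have "\<xi> p \<le> B" unfolding \<xi>_def by (rule mollify_le[OF \<delta> \<xi>0c b(1)])
      moreover have "- B \<le> \<xi> p" unfolding \<xi>_def by (rule mollify_ge[OF \<delta> \<xi>0c b(2)])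
      ultimately show ?thesis by (simp add: abs_le_iff)
    qed
    have \<xi>_lip: "\<bar>\<xi> p - \<xi> q\<bar> \<le> \<Lambda> * norm (p - q)" for p q
      unfolding \<xi>_def by (rule mollify_lipschitz[OF \<delta> \<xi>0_lip \<xi>0c])
    have near: "\<bar>\<xi> p - \<xi>0 p\<bar> \<le> \<Lambda> * \<delta>" for p
    proof -
      have pt: "\<bar>\<xi>0 (p + q) - \<xi>0 p\<bar> \<le> \<Lambda> * \<delta>" if "norm q < \<delta>" for q
        using \<xi>0_lip[of "p + q" p] mult_left_mono[OF less_imp_le[OF that] \<Lambda>] by simp
      have "\<xi> p \<le> \<xi>0 p + \<Lambda> * \<delta>" unfolding \<xi>_def
        by (rule mollify_le[OF \<delta> \<xi>0c]) (use pt in \<open>auto simp: abs_le_iff algebra_simps\<close>)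
      moreover have "\<xi>0 p - \<Lambda> * \<delta> \<le> \<xi> p" unfolding \<xi>_def
        by (rule mollify_ge[OF \<delta> \<xi>0c]) (use pt in \<open>auto simp: abs_le_iff algebra_simps\<close>)
      ultimately show ?thesis by (simp add: abs_le_iff algebra_simps)
    qed
    have sub: "fder \<xi> (t, x) (1, w) \<le> 1/2 * (norm w)^2" if t: "t \<in> {a..b}" for t x w
    proof (rule has_derivative_le[OF C_k_Suc_has_derivative[OF \<xi>C[of "Suc 0"]] _ \<delta>])
      fix s assume s: "0 < s" "s < \<delta>"
      show "\<xi> ((t, x) + s *\<^sub>R (1, w)) \<le> \<xi> (t, x) + s * (1/2 * (norm w)^2)"
        unfolding \<xi>_def
      proof (rule mollify_mono[OF \<delta> \<xi>0c \<xi>0c])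
        fix q :: "real \<times> 'a" assume q: "norm q < \<delta>"
        define \<sigma> where "\<sigma> = b + 2 * \<delta> - t - fst q - s"
        have "\<bar>fst q\<bar> < \<delta>" using q norm_fst_le[of "fst q" "snd q"] by simp
        moreover have "t \<le> b" using t by simp
        ultimately have \<sigma>: "\<sigma> \<ge> 0" using s unfolding \<sigma>_def by linarith
        have m: "max 0 (b + 2 * \<delta> - (t + s + fst q)) = \<sigma>" "max 0 (b + 2 * \<delta> - (t + fst q)) = \<sigma> + s"
          using \<sigma> s by (auto simp: \<sigma>_def)
        have "hopf \<sigma> h ((x + snd q) + s *\<^sub>R w) \<le> hopf (\<sigma> + s) h (x + snd q) + s / 2 * (norm w)^2"
          by (rule hopf_semigroup_ge[OF B(2) \<sigma> s(1)])
        moreover have e: "(t, x) + s *\<^sub>R (1, w) + q = (t + s + fst q, (x + snd q) + s *\<^sub>R w)" "(t, x) + q = (t + fst q, x + snd q)"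
          by (cases q, simp)+
        ultimately show "\<xi>0 ((t, x) + s *\<^sub>R (1, w) + q) \<le> \<xi>0 ((t, x) + q) + s * (1/2 * (norm w)^2)"
          unfolding e \<xi>0_def fst_conv snd_conv m by simp
      qed
    qed
    have main: "(\<integral>x. \<xi> (b, x) \<partial>\<rho> b) - (\<integral>x. \<xi> (a, x) \<partial>\<rho> a) \<le> act a b"
      by (rule smooth_bound[OF ab \<xi>C \<xi>B \<xi>_lip sub])
    have i\<xi>: "integrable (\<rho> t) (\<lambda>x. \<xi> (t, x))" if t: "t \<in> {0..T}" for t
      by (rule integrable_bounded[OF prob[OF t] sets_\<rho>[OF t] slice_measurable[OF borel_measurable_continuous_onI[OF C_k_continuous[OF \<xi>C[of 0]]]] \<xi>B])
    have ih: "integrable (\<rho> t) h" if t: "t \<in> {0..T}" for t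
      by (rule integrable_bdd_lipschitz[OF prob[OF t] sets_\<rho>[OF t] h])
    have iH: "integrable (\<rho> t) (hopf (b - a) h)" if t: "t \<in> {0..T}" for t
      using ab by (intro integrable_bdd_lipschitz[OF prob[OF t] sets_\<rho>[OF t]] bdd_lipschitz_hopf h) simp
    interpret pb: prob_space "\<rho> b" by (rule prob[OF abT(2)])
    interpret pa: prob_space "\<rho> a" by (rule prob[OF abT(1)])
    have hb: "h x - \<Lambda> * \<delta> \<le> \<xi> (b, x)" for x
      using near[of "(b, x)"] hopf_bounded(1)[where b = h and x = x and \<sigma> = "2 * \<delta>", OF B(2)] \<delta>
      by (simp add: \<xi>0_def abs_le_iff)
    have ha: "\<xi> (a, x) \<le> hopf (b - a) h x + (\<Lambda> * \<delta> + \<delta> * M^2)" for x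
    proof -
      have "hopf (b - a + 2 * \<delta>) h x \<le> hopf (b - a) h x + 2 * \<delta> * M^2 / 2"
        using ab \<delta> by (intro hopf_time(2)[OF B(2) _ _ M(2)]) auto
      moreover have "\<xi>0 (a, x) = hopf (b - a + 2 * \<delta>) h x" using ab \<delta> by (simp add: \<xi>0_def algebra_simps)
      ultimately show ?thesis using near[of "(a, x)"] by (simp add: abs_le_iff)
    qed
    have "(\<integral>x. h x - \<Lambda> * \<delta> \<partial>\<rho> b) \<le> (\<integral>x. \<xi> (b, x) \<partial>\<rho> b)"
      using hb ih[OF abT(2)] i\<xi>[OF abT(2)] by (intro integral_mono) auto
    moreover have "(\<integral>x. \<xi> (a, x) \<partial>\<rho> a) \<le> (\<integral>x. hopf (b - a) h x + (\<Lambda> * \<delta> + \<delta> * M^2) \<partial>\<rho> a)"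
      using ha iH[OF abT(1)] i\<xi>[OF abT(1)] by (intro integral_mono) auto
    ultimately have "(\<integral>z. h z \<partial>\<rho> b) - (\<integral>x. hopf (b - a) h x \<partial>\<rho> a) \<le> act a b + \<delta> * (2 * \<Lambda> + M^2)"
      using main ih[OF abT(2)] iH[OF abT(1)] by (simp add: pa.prob_space pb.prob_space algebra_simps)
    also have "\<delta> * (2 * \<Lambda> + M^2) \<le> \<delta> * (2 * \<Lambda> + M^2 + 1)" using \<delta> by (intro mult_left_mono) auto
    also have "\<dots> = \<eta>" using den by (simp add: \<delta>_def)
    finally show ?thesis by simp
  qed
  then show "(\<integral>z. h z \<partial>\<rho> b) - (\<integral>x. hopf (b - a) h x \<partial>\<rho> a) \<le> act a b" by (rule field_le_epsilon)
qed

end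

section \<open>Optimal maps\<close>

locale ot_setting =
  fixes T \<epsilon>0 :: real and r0 rT :: "'a::euclidean_space \<Rightarrow> real" and \<Omega>0 \<Omega>T :: "'a set" and Q :: "'a \<Rightarrow> real"
  assumes T: "T > 0" and dom: "bounded_domain \<Omega>0" "bounded_domain \<Omega>T"
    and dens: "prob_density_on \<Omega>0 r0" "prob_density_on \<Omega>T rT"
    and sc: "strongly_convex (Qtilde T Q) \<epsilon>0"
begin

sublocale q: strongly_convex "Qtilde T Q" \<epsilon>0 by (rule sc)

abbreviation "qt \<equiv> Qtilde T Q"
abbreviation "qs \<equiv> legendre (Qtilde T Q)"
abbreviation "\<mu>0 \<equiv> of_density r0"
abbreviation "\<mu>T \<equiv> of_density rT"
abbreviation "fun1 \<equiv> I_functional T Q"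
abbreviation "fun2 \<equiv> J_functional T Q \<mu>0"
abbreviation "fun3 \<equiv> K_functional T Q \<mu>0 \<mu>T"
abbreviation "adm1 \<equiv> admissible1 T \<mu>0 \<mu>T"
abbreviation "adm2 \<Gamma> \<equiv> admissible2 T \<Gamma> \<mu>0 \<mu>T"
abbreviation "opt1 \<equiv> optimal1 T Q \<mu>0 \<mu>T"
abbreviation "opt2 \<Gamma> \<equiv> optimal2 T \<Gamma> Q \<mu>0 \<mu>T"
abbreviation "opt3 \<equiv> optimal3 T Q \<mu>0 \<mu>T"

lemma \<Omega>: "open \<Omega>0" "open \<Omega>T" "\<Omega>0 \<noteq> {}" "\<Omega>T \<noteq> {}" "bounded \<Omega>0" "bounded \<Omega>T"
  using dom by (auto simp: bounded_domain_def)

lemma compact_closures: "compact (closure \<Omega>0)" "compact (closure \<Omega>T)" "closure \<Omega>0 \<noteq> {}" "closure \<Omega>T \<noteq> {}"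
  using \<Omega> by auto

lemma density_AE:
  assumes "prob_density_on \<Omega> r"
  shows "sets (of_density r) = sets borel" "prob_space (of_density r)" "AE x in of_density r. x \<in> \<Omega>"
    "(AE x in lborel. P x) \<Longrightarrow> AE x in of_density r. P x"
proof -
  have [measurable]: "r \<in> borel_measurable borel" using assms by (simp add: prob_density_on_def)
  show "sets (of_density r) = sets borel" by (simp add: of_density_def)
  show "prob_space (of_density r)" using assms by (simp add: prob_density_on_def)
  show "AE x in of_density r. x \<in> \<Omega>"
    unfolding of_density_def using assms
    by (subst AE_density) (simp, rule AE_I2, force simp: prob_density_on_def)
  show "AE x in of_density r. P x" if "AE x in lborel. P x"
    unfolding of_density_def using that by (subst AE_density) (auto elim: eventually_mono)
qed

lemmas \<mu>0 = density_AE[OF dens(1)] and \<mu>T = density_AE[OF dens(2)]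

sublocale M0: prob_space \<mu>0 by (rule \<mu>0(2))
sublocale MT: prob_space \<mu>T by (rule \<mu>T(2))

sublocale c: sum_cost qs
proof
  show "continuous_on UNIV qs" by (rule q.continuous_legendre)
  fix R
  \<comment> \<open>A bound for the gradient of \<open>qs\<close> on the ball, from the Lipschitz
    continuity of \<open>conj_grad\<close>; the subgradient inequality turns it into a Lipschitz
    constant.\<close>
  define L where "L = norm (q.conj_grad 0) + \<bar>R\<bar> / \<epsilon>0"
  have L: "norm (q.conj_grad p) \<le> L" if "norm p \<le> R" for p
  proof -
    have "norm (q.conj_grad p) \<le> norm (q.conj_grad 0) + norm (q.conj_grad p - q.conj_grad 0)"
      using norm_triangle_ineq[of "q.conj_grad 0" "q.conj_grad p - q.conj_grad 0"] by simp
    also have "\<dots> \<le> norm (q.conj_grad 0) + norm (p - 0) / \<epsilon>0" by (intro add_left_mono q.conj_grad_lipschitz)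
    also have "\<dots> \<le> L" using that q.eps by (simp add: L_def divide_right_mono)
    finally show ?thesis .
  qed
  have "qs p - qs p' \<le> L * norm (p - p')" if "norm p \<le> R" for p p'
  proof -
    have "qs p - qs p' \<le> q.conj_grad p \<bullet> (p - p')" using q.legendre_ge[of p p'] by (simp add: inner_diff_right)
    also have "\<dots> \<le> norm (q.conj_grad p) * norm (p - p')" by (rule norm_cauchy_schwarz)
    also have "\<dots> \<le> L * norm (p - p')" using L[OF that] by (intro mult_right_mono) auto
    finally show ?thesis .
  qed
  note le = this
  have "\<forall>p p'. norm p \<le> R \<longrightarrow> norm p' \<le> R \<longrightarrow> \<bar>qs p - qs p'\<bar> \<le> L * norm (p - p')"
  proof (intro allI impI)
    fix p p' :: 'a assume "norm p \<le> R" "norm p' \<le> R"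
    then show "\<bar>qs p - qs p'\<bar> \<le> L * norm (p - p')"
      using le[of p p'] le[of p' p] by (simp add: abs_le_iff norm_minus_commute)
  qed
  moreover have "L \<ge> 0" using q.eps by (simp add: L_def)
  ultimately show "\<exists>L\<ge>0. \<forall>p p'. norm p \<le> R \<longrightarrow> norm p' \<le> R \<longrightarrow> \<bar>qs p - qs p'\<bar> \<le> L * norm (p - p')" by blast
qed

lemma AE_closures: "AE x in \<mu>0. x \<in> closure \<Omega>0" "AE y in \<mu>T. y \<in> closure \<Omega>T"
  using \<mu>0(3) \<mu>T(3) closure_subset by (auto elim!: eventually_mono)

sublocale d: dual_problem qs "closure \<Omega>0" "closure \<Omega>T" \<mu>0 \<mu>T
  by unfold_locales (use compact_closures \<mu>0 \<mu>T AE_closures in auto)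

text \<open>The cost is a convex function of x + y, so its transforms are genuinely convex, and
  their differentiability follows from the theory of convex functions.\<close>

lemma convex_ctrans:
  assumes "bounded Y" "Y \<noteq> {}" "c.admissible Y g"
  shows "convex_function (ctrans Y qs g)"
proof (intro convex_function.intro convex_onI)
  fix t :: real and x x' :: 'a assume t: "0 < t" "t < 1"
  show "ctrans Y qs g ((1 - t) *\<^sub>R x + t *\<^sub>R x') \<le> (1 - t) * ctrans Y qs g x + t * ctrans Y qs g x'"
  proof (rule c.ctrans_le[OF assms(2)])
    fix y assume y: "y \<in> Y"
    have "(1 - t) *\<^sub>R x + t *\<^sub>R x' + y = (1 - t) *\<^sub>R (x + y) + t *\<^sub>R (x' + y)" by (simp add: algebra_simps)
    then have "qs ((1 - t) *\<^sub>R x + t *\<^sub>R x' + y) \<le> (1 - t) * qs (x + y) + t * qs (x' + y)"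
      using convex_onD[OF q.convex_legendre, of t "x + y" "x' + y"] t by simp
    moreover have "(1 - t) * (qs (x + y) - g y) \<le> (1 - t) * ctrans Y qs g x" "t * (qs (x' + y) - g y) \<le> t * ctrans Y qs g x'"
      using t by (auto intro!: mult_left_mono c.ctrans_ge assms(1,3) y)
    ultimately show "qs ((1 - t) *\<^sub>R x + t *\<^sub>R x' + y) - g y \<le> (1 - t) * ctrans Y qs g x + t * ctrans Y qs g x'"
      by (simp add: algebra_simps)
  qed
qed simp

lemma Qtilde_Q: "Q z = (2 / T) * (qt z - (norm z)^2)"
  using T by (simp add: Qtilde_def field_simps)

lemma Q_continuous: "continuous_on S Q"
proof -
  have "continuous_on S (\<lambda>z. (2 / T) * (qt z - (norm z)^2))" by (intro continuous_intros q.continuous)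
  then show ?thesis by (simp only: Qtilde_Q[symmetric])
qed

lemma Q_borel: "Q \<in> borel_measurable borel"
  by (rule borel_measurable_continuous_onI[OF Q_continuous])

end

section \<open>The optimal map given by a conjugate pair of potentials\<close>

locale ot_dual = ot_setting T \<epsilon>0 r0 rT \<Omega>0 \<Omega>T Q
  for T \<epsilon>0 :: real and r0 rT :: "'a::euclidean_space \<Rightarrow> real" and \<Omega>0 \<Omega>T :: "'a set" and Q :: "'a \<Rightarrow> real" +
  fixes \<phi> \<psi> :: "'a \<Rightarrow> real"
  assumes \<psi>_adm: "c.admissible (closure \<Omega>T) \<psi>" and \<phi>_eq: "\<phi> = ctrans (closure \<Omega>T) qs \<psi>"
    and \<psi>_eq: "\<psi> = ctrans (closure \<Omega>0) qs \<phi>"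
    and minimal: "\<And>g. c.admissible (closure \<Omega>T) g \<Longrightarrow> d.dual \<psi> \<le> d.dual g"
begin

lemma \<phi>_adm: "c.admissible (closure \<Omega>0) \<phi>"
  unfolding \<phi>_eq using d.bX d.bY compact_closures \<psi>_adm by (intro c.ctrans_admissible) auto

lemma \<phi>_convex: "convex_function \<phi>"
  unfolding \<phi>_eq by (rule convex_ctrans[OF d.bY compact_closures(4) \<psi>_adm])

lemma \<psi>_convex: "convex_function \<psi>"
  by (subst \<psi>_eq) (rule convex_ctrans[OF d.bX compact_closures(3) \<phi>_adm])

text \<open>The half [0, T/2] starts from \<mu>0 with potential \<phi>; \<open>h1\<close> below is
  the half [T/2, T] run backwards from \<mu>T with potential \<psi>.\<close>

sublocale h0: half_problem \<phi> \<mu>0 \<Omega>0 "closure \<Omega>0"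
proof (intro half_problem.intro half_problem_axioms.intro \<phi>_convex)
  show "AE x in \<mu>0. \<phi> differentiable at x" by (rule \<mu>0(4)[OF convex_function.AE_differentiable[OF \<phi>_convex]])
qed (use \<mu>0 \<Omega> compact_closures closure_subset in auto)

sublocale h1: half_problem \<psi> \<mu>T \<Omega>T "closure \<Omega>T"
proof (intro half_problem.intro half_problem_axioms.intro \<psi>_convex)
  show "AE x in \<mu>T. \<psi> differentiable at x" by (rule \<mu>T(4)[OF convex_function.AE_differentiable[OF \<psi>_convex]])
qed (use \<mu>T \<Omega> compact_closures closure_subset in auto)

text \<open>Here x is unrestricted, in \<open>ineq'\<close> y is. Each version can thus be
  differentiated in its free variable without regard to the domains.\<close>

lemma ineq: "y \<in> closure \<Omega>T \<Longrightarrow> qs (x + y) \<le> \<phi> x + \<psi> y"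
  using c.ctrans_ge[OF d.bY \<psi>_adm, of y x] by (simp add: \<phi>_eq)

lemma ineq': "x \<in> closure \<Omega>0 \<Longrightarrow> qs (x + y) \<le> \<phi> x + \<psi> y"
  using c.ctrans_ge[OF d.bX \<phi>_adm, of x y] by (simp add: \<psi>_eq[symmetric] add.commute)

definition good :: "'a \<Rightarrow> bool" where "good x \<longleftrightarrow> x \<in> \<Omega>0 \<and> \<phi> differentiable at x"

lemma AE_good: "AE x in \<mu>0. good x"
  using \<mu>0(3) h0.AEd by eventually_elim (simp add: good_def)

text \<open>The candidate for the solution y of D qs (x + y) = D \<phi> x: \<open>grad qt\<close>
  undoes \<open>q.conj_grad\<close>, the gradient of \<open>qs\<close>.\<close>

definition m0 :: "'a \<Rightarrow> 'a" where "m0 x = grad qt (grad \<phi> x) - x"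

lemma m0_borel: "m0 \<in> borel_measurable borel"
proof -
  have [measurable]: "grad \<phi> \<in> borel_measurable borel" by (rule h0.grad_measurable)
  have [measurable]: "grad qt \<in> borel_measurable borel" by (rule borel_measurable_continuous_onI[OF q.cont_grad])
  show ?thesis unfolding m0_def[abs_def] by measurable
qed

lemma affine_minorant: "y \<in> closure \<Omega>T \<Longrightarrow> (qs (x + y) - \<psi> y) + q.conj_grad (x + y) \<bullet> (x' - x) \<le> \<phi> x'"
  using ineq[of y x'] q.legendre_ge[of "x + y" "x' + y"] by simp

lemma contactD:
  assumes "good x" "y \<in> closure \<Omega>T" "\<phi> x + \<psi> y \<le> qs (x + y)"
  shows "q.conj_grad (x + y) = grad \<phi> x" "y = m0 x"
proof -
  have "\<phi> differentiable at x" using assms(1) by (simp add: good_def)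
  from differentiable_GDERIV[OF this] show *: "q.conj_grad (x + y) = grad \<phi> x"
  proof (rule slope_eq_gradient[OF _ open_UNIV UNIV_I])
    fix x' show "\<phi> x + q.conj_grad (x + y) \<bullet> (x' - x) \<le> \<phi> x'"
      using affine_minorant[OF assms(2), of x x'] assms(3) by simp
  qed
  show "y = m0 x" unfolding m0_def *[symmetric] q.grad_conj_grad by simp
qed

text \<open>By compactness some y in the closure attains the supremum that defines
  \<open>\<phi> x\<close>. Differentiability of \<phi> at x then leaves \<open>m0 x\<close> as the
  only possibility.\<close>

lemma contact:
  assumes "good x"
  shows "m0 x \<in> closure \<Omega>T" "\<phi> x + \<psi> (m0 x) = qs (x + m0 x)" "q.conj_grad (x + m0 x) = grad \<phi> x"
proof -
  have "continuous_on (closure \<Omega>T) (\<lambda>y. qs (x + y) - \<psi> y)"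
    by (intro continuous_intros continuous_on_compose2[OF q.continuous_legendre[of UNIV]] h1.cont) auto
  from continuous_attains_sup[OF compact_closures(2,4) this] obtain y where
    y: "y \<in> closure \<Omega>T" "\<forall>y'\<in>closure \<Omega>T. qs (x + y') - \<psi> y' \<le> qs (x + y) - \<psi> y" by blast
  have "\<phi> x \<le> qs (x + y) - \<psi> y" unfolding \<phi>_eq using y compact_closures by (intro c.ctrans_le) auto
  then have le: "\<phi> x + \<psi> y \<le> qs (x + y)" by simp
  note D = contactD[OF assms y(1) le]
  show "m0 x \<in> closure \<Omega>T" "\<phi> x + \<psi> (m0 x) = qs (x + m0 x)" "q.conj_grad (x + m0 x) = grad \<phi> x"
    using D(1) y(1) le ineq[OF y(1), of x] unfolding D(2)[symmetric] by auto
qed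

text \<open>\<open>grad qt\<close> maps the slope \<open>q.conj_grad (x + y)\<close> back to x + y.
  By its continuity, a y away from \<open>m0 x\<close> has a slope away from the gradient of \<phi>,
  and \<open>slope_gap\<close> gives the loss.\<close>

lemma well_posed_m0:
  assumes x: "good x" shows "well_posed (closure \<Omega>T) (\<lambda>y. qs (x + y) - \<psi> y) (m0 x)"
  unfolding well_posed_def
proof (intro conjI ballI allI impI)
  note c = contact[OF x]
  show "m0 x \<in> closure \<Omega>T" by fact
  show "qs (x + y) - \<psi> y \<le> qs (x + m0 x) - \<psi> (m0 x)" if "y \<in> closure \<Omega>T" for y
    using ineq[OF that, of x] c(2) by simp
  fix \<delta> :: real assume \<delta>: "\<delta> > 0"
  have "isCont (grad qt) (grad \<phi> x)" using q.cont_grad by (simp add: continuous_on_eq_continuous_at)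
  then obtain \<delta>' where \<delta>': "\<delta>' > 0" "\<And>p. dist p (grad \<phi> x) < \<delta>' \<Longrightarrow> dist (grad qt p) (grad qt (grad \<phi> x)) < \<delta>"
    using \<delta> unfolding continuous_at_eps_delta by blast
  have "\<phi> differentiable at x" using x by (simp add: good_def)
  from slope_gap[OF differentiable_GDERIV[OF this] open_UNIV UNIV_I \<delta>'(1)] obtain \<kappa> where
    \<kappa>: "\<kappa> > 0" "\<And>F p. (\<And>y. y \<in> UNIV \<Longrightarrow> F + p \<bullet> (y - x) \<le> \<phi> y) \<Longrightarrow> norm (p - grad \<phi> x) \<ge> \<delta>' \<Longrightarrow> F \<le> \<phi> x - \<kappa>"
    by metis
  have "qs (x + y) - \<psi> y \<le> qs (x + m0 x) - \<psi> (m0 x) - \<kappa>" if y: "y \<in> closure \<Omega>T" "dist y (m0 x) \<ge> \<delta>" for y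
  proof -
    have "norm (q.conj_grad (x + y) - grad \<phi> x) \<ge> \<delta>'"
    proof (rule ccontr)
      assume "\<not> ?thesis"
      then have "dist (grad qt (q.conj_grad (x + y))) (grad qt (grad \<phi> x)) < \<delta>"
        by (intro \<delta>'(2)) (simp add: dist_norm)
      then show False using y(2) by (simp add: q.grad_conj_grad m0_def dist_norm algebra_simps)
    qed
    then have "qs (x + y) - \<psi> y \<le> \<phi> x - \<kappa>" by (intro \<kappa>(2)) (auto intro: affine_minorant[OF y(1)])
    then show ?thesis using c(2) by simp
  qed
  then show "\<exists>\<kappa>>0. \<forall>y\<in>closure \<Omega>T. dist y (m0 x) \<ge> \<delta> \<longrightarrow> qs (x + y) - \<psi> y \<le> qs (x + m0 x) - \<psi> (m0 x) - \<kappa>"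
    using \<kappa>(1) by blast
qed

lemma qs_borel: "qs \<in> borel_measurable borel"
  by (rule borel_measurable_continuous_onI[OF q.continuous_legendre])

lemma i\<phi>: "integrable \<mu>0 \<phi>" and i\<psi>: "integrable \<mu>T \<psi>"
  by (rule h0.integrable_continuous[OF h0.cont], rule h1.integrable_continuous[OF h1.cont])

text \<open>The transform of \<psi> + e h is the perturbed supremum, so minimality of \<psi> among
  admissible functions is exactly the inequality asked for by
  \<open>pushforward_envelope\<close>.\<close>

lemma push_m0: "\<mu>T = distr \<mu>0 borel m0"
proof (rule pushforward_envelope[where Y = "closure \<Omega>T" and F = "\<lambda>x y. qs (x + y) - \<psi> y", OF \<mu>0(2) \<mu>T(2) \<mu>0(1) \<mu>T(1) m0_borel])
  note [measurable] = m0_borel qs_borel h1.borel h0.borel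
  note [measurable_cong] = \<mu>0(1) \<mu>T(1)
  show "AE x in \<mu>0. well_posed (closure \<Omega>T) (\<lambda>y. qs (x + y) - \<psi> y) (m0 x)"
    using AE_good by eventually_elim (rule well_posed_m0)
  have ae: "AE x in \<mu>0. qs (x + m0 x) - \<psi> (m0 x) = \<phi> x"
    using AE_good
  proof eventually_elim
    case (elim x) then show ?case using contact(2)[OF elim] by simp
  qed
  have m: "(\<lambda>x. qs (x + m0 x) - \<psi> (m0 x)) \<in> borel_measurable \<mu>0" by measurable
  show "integrable \<mu>0 (\<lambda>x. qs (x + m0 x) - \<psi> (m0 x))"
    using i\<phi> by (rule integrable_cong_AE_imp) (use m ae in \<open>auto elim: eventually_mono\<close>)
  have int: "(\<integral>x. qs (x + m0 x) - \<psi> (m0 x) \<partial>\<mu>0) = (\<integral>x. \<phi> x \<partial>\<mu>0)"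
    by (rule integral_cong_AE) (use m ae i\<phi> in auto)
  fix h :: "'a \<Rightarrow> real" and e :: real assume h: "bdd_lipschitz h" and e: "e > 0"
  obtain B where B: "\<And>x. \<bar>h x\<bar> \<le> B" using bdd_lipschitzE[OF h] by metis
  have hb: "h \<in> borel_measurable borel" by (rule bdd_lipschitz_borel[OF h])
  have adm: "c.admissible (closure \<Omega>T) (\<lambda>y. \<psi> y + e * h y)"
  proof -
    obtain C where C: "\<forall>y\<in>closure \<Omega>T. \<bar>\<psi> y\<bar> \<le> C" using \<psi>_adm by (auto simp: c.admissible_def)
    have "\<bar>\<psi> y + e * h y\<bar> \<le> C + e * B" if "y \<in> closure \<Omega>T" for y
    proof -
      have "\<bar>e * h y\<bar> \<le> e * B" using B[of y] e by (simp add: abs_mult)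
      then show ?thesis using C that by (auto intro: order.trans[OF abs_triangle_ineq] add_mono)
    qed
    then show ?thesis using hb \<psi>_adm by (auto simp: c.admissible_def)
  qed
  define G where "G = ctrans (closure \<Omega>T) qs (\<lambda>y. \<psi> y + e * h y)"
  have "d.dual \<psi> \<le> d.dual (\<lambda>y. \<psi> y + e * h y)" by (rule minimal[OF adm])
  then have "(\<integral>x. \<phi> x \<partial>\<mu>0) \<le> (\<integral>x. G x \<partial>\<mu>0) + e * (\<integral>y. h y \<partial>\<mu>T)"
    using i\<psi> integrable_bdd_lipschitz[OF \<mu>T(2,1) h] by (simp add: d.dual_def G_def \<phi>_eq)
  moreover have "G \<in> borel_measurable \<mu>0"
    using c.ctrans_borel[OF d.bY compact_closures(4) adm] by (simp add: G_def cong: measurable_cong_sets)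
  moreover have "G x = (SUP y\<in>closure \<Omega>T. qs (x + y) - \<psi> y - e * h y)" for x
    by (simp add: G_def ctrans_def diff_diff_eq)
  ultimately show "\<exists>G. G \<in> borel_measurable \<mu>0 \<and> (AE x in \<mu>0. G x = (SUP y\<in>closure \<Omega>T. qs (x + y) - \<psi> y - e * h y)) \<and>
      (\<integral>x. qs (x + m0 x) - \<psi> (m0 x) \<partial>\<mu>0) \<le> (\<integral>x. G x \<partial>\<mu>0) + e * (\<integral>y. h y \<partial>\<mu>T)"
    using int by (intro exI[of _ G]) auto
qed

lemma AE_m0:
  assumes "AE y in \<mu>T. P y" shows "AE x in \<mu>0. P (m0 x)"
proof -
  have "m0 \<in> measurable \<mu>0 borel" using m0_borel \<mu>0(1) by (simp cong: measurable_cong_sets)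
  then show ?thesis using assms unfolding push_m0 by (rule AE_distrD)
qed

abbreviation "cst \<equiv> cost T Q"
abbreviation "opt \<equiv> optimal_map (cost T Q) \<Omega>0 \<Omega>T r0 rT"

definition D :: real where "D = (\<integral>x. \<phi> x \<partial>\<mu>0) + (\<integral>y. \<psi> y \<partial>\<mu>T)"

lemma integral_of_density:
  assumes f: "f \<in> borel_measurable borel"
  shows "(LINT x:\<Omega>0|lborel. r0 x * f x) = (\<integral>x. f x \<partial>\<mu>0)"
proof -
  have r: "r0 \<in> borel_measurable borel" "\<And>x. r0 x \<ge> 0" "\<And>x. x \<notin> \<Omega>0 \<Longrightarrow> r0 x = 0"
    using dens(1) by (auto simp: prob_density_on_def)
  have "(LINT x:\<Omega>0|lborel. r0 x * f x) = (\<integral>x. r0 x * f x \<partial>lborel)"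
    unfolding set_lebesgue_integral_def
    by (rule Bochner_Integration.integral_cong) (use r(3) in \<open>auto simp: indicator_def\<close>)
  also have "\<dots> = (\<integral>x. f x \<partial>\<mu>0)"
    unfolding of_density_def using r f by (subst integral_real_density) auto
  finally show ?thesis .
qed

text \<open>The gap \<phi> x + \<psi> (s x) - qs (x + s x) is nonnegative, and its integral is D
  minus the transport value because s carries \<mu>0 to \<mu>T. A vanishing gap is contact. Values
  in \<Omega>T are asked almost everywhere, so that ends of curves qualify too.\<close>

lemma transport_facts:
  assumes s: "s \<in> borel_measurable borel" "distr \<mu>0 borel s = \<mu>T" and sT: "AE x in \<mu>0. s x \<in> \<Omega>T"
  shows "integrable \<mu>0 (\<lambda>x. qs (x + s x))" "(\<integral>x. qs (x + s x) \<partial>\<mu>0) \<le> D"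
    "D \<le> (\<integral>x. qs (x + s x) \<partial>\<mu>0) \<Longrightarrow> AE x in \<mu>0. s x = m0 x"
    "AE x in \<mu>0. s x = m0 x \<Longrightarrow> (\<integral>x. qs (x + s x) \<partial>\<mu>0) = D"
proof -
  note [measurable] = s(1) qs_borel h1.borel h0.borel
  note [measurable_cong] = \<mu>0(1) \<mu>T(1)
  obtain R1 where R1: "\<And>x. x \<in> \<Omega>0 \<Longrightarrow> norm x \<le> R1" using \<Omega>(5) by (auto simp: bounded_iff)
  obtain R2 where R2: "\<And>x. x \<in> \<Omega>T \<Longrightarrow> norm x \<le> R2" using \<Omega>(6) by (auto simp: bounded_iff)
  obtain B where "\<forall>p\<in>cball 0 (R1 + R2). \<bar>qs (0 + p)\<bar> \<le> B" using c.cost_bounded[OF bounded_cball] by blast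
  then have B: "\<And>p. norm p \<le> R1 + R2 \<Longrightarrow> \<bar>qs p\<bar> \<le> B" by simp
  have sm: "s \<in> measurable \<mu>0 borel" by measurable
  show i: "integrable \<mu>0 (\<lambda>x. qs (x + s x))"
  proof (rule M0.integrable_const_bound[of _ B])
    show "AE x in \<mu>0. norm (qs (x + s x)) \<le> B"
      using sT \<mu>0(3)
    proof eventually_elim
      case (elim x)
      then show ?case using B[of "x + s x"] R1[of x] R2[of "s x"] norm_triangle_ineq[of x "s x"] by simp
    qed
  qed measurable
  have i\<psi>s: "integrable \<mu>0 (\<lambda>x. \<psi> (s x))" using i\<psi> unfolding s(2)[symmetric] by (rule integrable_distr[OF sm])
  have \<psi>s: "(\<integral>x. \<psi> (s x) \<partial>\<mu>0) = (\<integral>y. \<psi> y \<partial>\<mu>T)"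
    unfolding s(2)[symmetric] using sm by (subst integral_distr) auto
  have gap: "AE x in \<mu>0. 0 \<le> \<phi> x + \<psi> (s x) - qs (x + s x)"
    using sT by eventually_elim (use ineq closure_subset in \<open>auto simp: subset_eq\<close>)
  have ig: "integrable \<mu>0 (\<lambda>x. \<phi> x + \<psi> (s x) - qs (x + s x))" using i i\<phi> i\<psi>s by simp
  have gi: "(\<integral>x. \<phi> x + \<psi> (s x) - qs (x + s x) \<partial>\<mu>0) = D - (\<integral>x. qs (x + s x) \<partial>\<mu>0)"
    using i i\<phi> i\<psi>s \<psi>s by (simp add: D_def)
  have "0 \<le> (\<integral>x. \<phi> x + \<psi> (s x) - qs (x + s x) \<partial>\<mu>0)" using gap by (rule integral_nonneg_AE)
  then show "(\<integral>x. qs (x + s x) \<partial>\<mu>0) \<le> D" using gi by simp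
  show "AE x in \<mu>0. s x = m0 x" if "D \<le> (\<integral>x. qs (x + s x) \<partial>\<mu>0)"
  proof -
    have "(\<integral>x. \<phi> x + \<psi> (s x) - qs (x + s x) \<partial>\<mu>0) = 0"
      using that gi integral_nonneg_AE[OF gap] by simp
    then have "AE x in \<mu>0. \<phi> x + \<psi> (s x) - qs (x + s x) = 0"
      using integral_nonneg_eq_0_iff_AE[OF ig gap] by simp
    then show ?thesis using AE_good sT
    proof eventually_elim
      case (elim x)
      then show ?case using contactD(2)[of x "s x"] closure_subset by auto
    qed
  qed
  show "(\<integral>x. qs (x + s x) \<partial>\<mu>0) = D" if ae: "AE x in \<mu>0. s x = m0 x"
  proof -
    have "(\<integral>x. \<phi> x + \<psi> (s x) - qs (x + s x) \<partial>\<mu>0) = (\<integral>x. 0 \<partial>\<mu>0)"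
    proof (rule integral_cong_AE)
      show "AE x in \<mu>0. \<phi> x + \<psi> (s x) - qs (x + s x) = 0"
        using ae AE_good by eventually_elim (use contact(2) in simp)
    qed measurable
    then show ?thesis using gi by simp
  qed
qed

lemma transport_mapD:
  assumes "transport_map \<Omega>0 \<Omega>T r0 rT s"
  shows "s \<in> borel_measurable borel" "distr \<mu>0 borel s = \<mu>T" "AE x in \<mu>0. s x \<in> \<Omega>T"
    "transport_value cst \<Omega>0 r0 s = (\<integral>x. qs (x + s x) \<partial>\<mu>0)"
proof -
  show s: "s \<in> borel_measurable borel" "distr \<mu>0 borel s = \<mu>T" using assms by (auto simp: transport_map_def)
  show "AE x in \<mu>0. s x \<in> \<Omega>T" using \<mu>0(3) by eventually_elim (use assms in \<open>auto simp: transport_map_def\<close>)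
  have "(\<lambda>x. qs (x + s x)) \<in> borel_measurable borel" using s(1) qs_borel by measurable
  from integral_of_density[OF this] show "transport_value cst \<Omega>0 r0 s = (\<integral>x. qs (x + s x) \<partial>\<mu>0)"
    by (simp add: transport_value_def cost_def)
qed

text \<open>A transport map has to take values in \<Omega>T at every point of \<Omega>0, whereas
  \<open>m0\<close> does so only almost everywhere. The exceptional points are sent to an arbitrary
  point of \<Omega>T.\<close>

definition m1 :: "'a \<Rightarrow> 'a" where "m1 x = (if m0 x \<in> \<Omega>T then m0 x else (SOME y. y \<in> \<Omega>T))"

lemma repair:
  assumes s: "s \<in> borel_measurable borel" and ae: "AE x in \<mu>0. s x = m0 x"
  shows "transport_map \<Omega>0 \<Omega>T r0 rT (\<lambda>x. if s x \<in> \<Omega>T then s x else (SOME y. y \<in> \<Omega>T))"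
    "AE x in \<mu>0. (if s x \<in> \<Omega>T then s x else (SOME y. y \<in> \<Omega>T)) = m0 x"
proof -
  have y0: "(SOME y. y \<in> \<Omega>T) \<in> \<Omega>T" using \<Omega>(4) by (simp add: some_in_eq)
  have [measurable]: "s \<in> borel_measurable borel" "\<Omega>T \<in> sets borel" using s \<Omega> by auto
  show ae': "AE x in \<mu>0. (if s x \<in> \<Omega>T then s x else (SOME y. y \<in> \<Omega>T)) = m0 x"
    using ae AE_m0[OF \<mu>T(3)] by eventually_elim auto
  have meas: "(\<lambda>x. if s x \<in> \<Omega>T then s x else (SOME y. y \<in> \<Omega>T)) \<in> borel_measurable borel" by measurable
  have "distr \<mu>0 borel (\<lambda>x. if s x \<in> \<Omega>T then s x else (SOME y. y \<in> \<Omega>T)) = distr \<mu>0 borel m0"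
    using ae' by (rule distr_cong_AE[OF refl refl]) (use meas m0_borel \<mu>0(1) in \<open>simp_all cong: measurable_cong_sets\<close>)
  then show "transport_map \<Omega>0 \<Omega>T r0 rT (\<lambda>x. if s x \<in> \<Omega>T then s x else (SOME y. y \<in> \<Omega>T))"
    using meas y0 push_m0 by (auto simp: transport_map_def)
qed

lemma m1: "transport_map \<Omega>0 \<Omega>T r0 rT m1" "AE x in \<mu>0. m1 x = m0 x"
  using repair[OF m0_borel] by (auto simp: m1_def[abs_def])

lemma opt_iff: "opt s \<longleftrightarrow> transport_map \<Omega>0 \<Omega>T r0 rT s \<and> (AE x in \<mu>0. s x = m0 x)"
proof
  assume s: "opt s"
  then have t: "transport_map \<Omega>0 \<Omega>T r0 rT s" by (simp add: is_arg_max_def)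
  have "transport_value cst \<Omega>0 r0 m1 \<le> transport_value cst \<Omega>0 r0 s"
    using s m1(1) by (auto simp: is_arg_max_def not_less)
  then have "D \<le> (\<integral>x. qs (x + s x) \<partial>\<mu>0)"
    using transport_facts(4)[OF transport_mapD(1,2,3)[OF m1(1)] m1(2)] transport_mapD(4)[OF m1(1)] transport_mapD(4)[OF t] by simp
  then show "transport_map \<Omega>0 \<Omega>T r0 rT s \<and> (AE x in \<mu>0. s x = m0 x)"
    using t transport_facts(3)[OF transport_mapD(1,2,3)[OF t]] by simp
next
  assume s: "transport_map \<Omega>0 \<Omega>T r0 rT s \<and> (AE x in \<mu>0. s x = m0 x)"
  have "transport_value cst \<Omega>0 r0 s = D"
    using s transport_facts(4)[OF transport_mapD(1,2,3)] transport_mapD(4) by auto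
  moreover have "transport_value cst \<Omega>0 r0 s' \<le> D" if "transport_map \<Omega>0 \<Omega>T r0 rT s'" for s'
    using transport_facts(2)[OF transport_mapD(1,2,3)[OF that]] transport_mapD(4)[OF that] by simp
  ultimately show "opt s" using s by (auto simp: is_arg_max_def not_less)
qed

lemma opt_value: "opt s \<Longrightarrow> transport_value cst \<Omega>0 r0 s = D"
  using transport_facts(4)[OF transport_mapD(1,2,3)] transport_mapD(4) by (auto simp: opt_iff)

lemma opt_m1: "opt m1" using m1 by (simp add: opt_iff)

section \<open>The static three-marginal problem\<close>

definition \<tau> :: real where "\<tau> = T / 2"

lemma \<tau>: "\<tau> > 0" using T by (simp add: \<tau>_def)

definition val :: real where
  "val = 1/T * ((\<integral>x. (norm x)^2 \<partial>\<mu>0) + (\<integral>y. (norm y)^2 \<partial>\<mu>T)) - 2/T * D"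

lemma iN: "integrable \<mu>0 (\<lambda>x. (norm x)^2)" "integrable \<mu>T (\<lambda>x. (norm x)^2)"
  by (intro h0.integrable_continuous continuous_intros, intro h1.integrable_continuous continuous_intros)

text \<open>This is what remains of the sum of both half inequalities once the
  \<open>\<beta>\<close> terms are cancelled against Q.\<close>

lemma val_alpha: "(\<integral>x. h0.\<alpha> \<tau> x \<partial>\<mu>0) + (\<integral>x. h1.\<alpha> \<tau> x \<partial>\<mu>T) = val"
proof -
  have "(\<integral>x. h0.\<alpha> \<tau> x \<partial>\<mu>0) = ((\<integral>x. (norm x)^2 \<partial>\<mu>0) / 2 - (\<integral>x. \<phi> x \<partial>\<mu>0)) / \<tau>"
    using iN(1) i\<phi> by (simp add: h0.\<alpha>_def)
  moreover have "(\<integral>x. h1.\<alpha> \<tau> x \<partial>\<mu>T) = ((\<integral>x. (norm x)^2 \<partial>\<mu>T) / 2 - (\<integral>x. \<psi> x \<partial>\<mu>T)) / \<tau>"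
    using iN(2) i\<psi> by (simp add: h1.\<alpha>_def)
  moreover have "(a / 2 - p) / (T / 2) + (b / 2 - r) / (T / 2) = 1/T * (a + b) - 2/T * (p + r)" for a b p r
    using T by (simp add: field_simps)
  ultimately show ?thesis by (simp only: val_def D_def \<tau>_def)
qed

text \<open>For x and y in the closures, x . z + y . z \<le> qs (x + y) + qt z \<le> \<phi> x +
  \<psi> y + qt z. The suprema over x and y can be taken separately.\<close>

lemma g_sum_le: "h0.g z + h1.g z \<le> qt z"
proof -
  have "h0.g z \<le> qt z - h1.g z"
  proof (rule h0.g_least)
    fix x assume x: "x \<in> closure \<Omega>0"
    have "h1.g z \<le> qt z - (x \<bullet> z - \<phi> x)"
    proof (rule h1.g_least)
      fix y assume y: "y \<in> closure \<Omega>T"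
      show "y \<bullet> z - \<psi> y \<le> qt z - (x \<bullet> z - \<phi> x)"
        using ineq[OF y, of x] q.fenchel_young[of "x + y" z] by (simp add: inner_add_left)
    qed
    then show "x \<bullet> z - \<phi> x \<le> qt z - h1.g z" by simp
  qed
  then show ?thesis by simp
qed

text \<open>The squares in the two \<open>\<beta>\<close> cancel the one in \<open>Qtilde\<close>,
  so that Q plus both \<open>\<beta>\<close> equals (qt - h0.g - h1.g) / \<tau>.\<close>

lemma Q_ge: "- (h0.\<beta> \<tau> z + h1.\<beta> \<tau> z) \<le> Q z"
proof -
  have "Q z + h0.\<beta> \<tau> z + h1.\<beta> \<tau> z = (qt z - h0.g z - h1.g z) / \<tau>"
    using T by (simp add: Qtilde_def h0.\<beta>_def h1.\<beta>_def \<tau>_def field_simps)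
  also have "\<dots> \<ge> 0" using g_sum_le[of z] \<tau> by simp
  finally show ?thesis by simp
qed

lemma PE_integrable: "integrable \<rho> Q \<Longrightarrow> potential_energy Q \<rho> = ereal (\<integral>x. Q x \<partial>\<rho>)"
proof -
  assume i: "integrable \<rho> Q"
  have f: "(\<integral>\<^sup>+x. ennreal (Q x) \<partial>\<rho>) < \<infinity>" "(\<integral>\<^sup>+x. ennreal (- Q x) \<partial>\<rho>) < \<infinity>"
    using i by (auto simp: real_integrable_def less_top)
  have "(\<integral>x. Q x \<partial>\<rho>) = enn2real (\<integral>\<^sup>+x. ennreal (Q x) \<partial>\<rho>) - enn2real (\<integral>\<^sup>+x. ennreal (- Q x) \<partial>\<rho>)"
    by (rule real_lebesgue_integral_def[OF i])
  moreover have "enn2ereal x = ereal (enn2real x)" if "x < \<infinity>" for x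
    using that by (cases x) auto
  ultimately show ?thesis using f by (simp add: potential_energy_def)
qed

text \<open>By \<open>Q_ge\<close> the negative part of Q is dominated by functions of quadratic
  growth, integrable against \<rho>. The difference in \<open>potential_energy\<close> is therefore
  never of the form \<infinity> - \<infinity>.\<close>

lemma PE_cases:
  assumes \<rho>: "P2 \<rho>" shows "integrable \<rho> Q \<or> potential_energy Q \<rho> = \<infinity>"
proof (cases "integrable \<rho> Q")
  case False
  have [measurable_cong]: "sets \<rho> = sets borel" using \<rho> by (simp add: P2_def)
  have Qm: "Q \<in> borel_measurable \<rho>" using Q_borel by measurable
  have ib: "integrable \<rho> (\<lambda>z. h0.\<beta> \<tau> z + h1.\<beta> \<tau> z)"
    using h0.\<beta>_integrable[OF \<rho> \<tau>] h1.\<beta>_integrable[OF \<rho> \<tau>] by simp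
  have "(\<integral>\<^sup>+x. ennreal (- Q x) \<partial>\<rho>) \<le> (\<integral>\<^sup>+x. ennreal (norm (h0.\<beta> \<tau> x + h1.\<beta> \<tau> x)) \<partial>\<rho>)"
  proof (intro nn_integral_mono ennreal_leI)
    fix x show "- Q x \<le> norm (h0.\<beta> \<tau> x + h1.\<beta> \<tau> x)" using Q_ge[of x] unfolding real_norm_def by linarith
  qed
  also have "\<dots> < \<infinity>" using ib by (simp add: integrable_iff_bounded)
  finally have neg: "(\<integral>\<^sup>+x. ennreal (- Q x) \<partial>\<rho>) < \<infinity>" .
  then have "(\<integral>\<^sup>+x. ennreal (Q x) \<partial>\<rho>) = \<infinity>"
    using False Qm by (simp add: real_integrable_def less_top[symmetric])
  then show ?thesis by (simp add: potential_energy_def)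
qed simp

text \<open>The common lower bound of Problems 1 and 3, where w0 and w1 are actions and transport
  costs respectively. It adds \<open>half_ineq\<close> at both ends and \<open>Q_ge\<close> at the
  middle; equality in the sum forces equality in each half.\<close>

lemma combine:
  assumes \<rho>: "P2 \<rho>" and d0: "dual_bound \<tau> \<mu>0 \<rho> w0" and d1: "dual_bound \<tau> \<mu>T \<rho> w1"
  shows "ereal val \<le> ereal w0 + potential_energy Q \<rho> + ereal w1"
    and "ereal w0 + potential_energy Q \<rho> + ereal w1 \<le> ereal val \<Longrightarrow>
      \<rho> = distr \<mu>0 borel (grad \<phi>) \<and> w0 \<le> (\<integral>z. h0.\<beta> \<tau> z \<partial>\<rho>) + (\<integral>x. h0.\<alpha> \<tau> x \<partial>\<mu>0)
        \<and> w1 \<le> (\<integral>z. h1.\<beta> \<tau> z \<partial>\<rho>) + (\<integral>x. h1.\<alpha> \<tau> x \<partial>\<mu>T)"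
proof -
  note a = h0.half_ineq[OF \<tau> \<rho> d0] h1.half_ineq[OF \<tau> \<rho> d1]
  note b = h0.\<beta>_integrable[OF \<rho> \<tau>] h1.\<beta>_integrable[OF \<rho> \<tau>]
  have Qb: "- ((\<integral>z. h0.\<beta> \<tau> z \<partial>\<rho>) + (\<integral>z. h1.\<beta> \<tau> z \<partial>\<rho>)) \<le> (\<integral>z. Q z \<partial>\<rho>)" if "integrable \<rho> Q"
  proof -
    have "(\<integral>z. - (h0.\<beta> \<tau> z + h1.\<beta> \<tau> z) \<partial>\<rho>) \<le> (\<integral>z. Q z \<partial>\<rho>)"
      using b that Q_ge by (intro integral_mono) auto
    then show ?thesis using b by simp
  qed
  show "ereal val \<le> ereal w0 + potential_energy Q \<rho> + ereal w1"
    using PE_cases[OF \<rho>] PE_integrable[of \<rho>] a Qb val_alpha by auto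
  assume le: "ereal w0 + potential_energy Q \<rho> + ereal w1 \<le> ereal val"
  then have i: "integrable \<rho> Q" using PE_cases[OF \<rho>] by auto
  have w: "w0 + (\<integral>z. Q z \<partial>\<rho>) + w1 \<le> val" using le PE_integrable[OF i] by simp
  have w0: "w0 \<le> (\<integral>z. h0.\<beta> \<tau> z \<partial>\<rho>) + (\<integral>x. h0.\<alpha> \<tau> x \<partial>\<mu>0)"
    using w a(2) Qb[OF i] val_alpha by linarith
  moreover have "w1 \<le> (\<integral>z. h1.\<beta> \<tau> z \<partial>\<rho>) + (\<integral>x. h1.\<alpha> \<tau> x \<partial>\<mu>T)"
    using w a(1) Qb[OF i] val_alpha by linarith
  ultimately show "\<rho> = distr \<mu>0 borel (grad \<phi>) \<and> w0 \<le> (\<integral>z. h0.\<beta> \<tau> z \<partial>\<rho>) + (\<integral>x. h0.\<alpha> \<tau> x \<partial>\<mu>0)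
        \<and> w1 \<le> (\<integral>z. h1.\<beta> \<tau> z \<partial>\<rho>) + (\<integral>x. h1.\<alpha> \<tau> x \<partial>\<mu>T)"
    using h0.half_eq[OF \<tau> \<rho> d0 w0] by simp
qed

end

lemma coupling_distr:
  fixes f g :: "'a::euclidean_space \<Rightarrow> 'a"
  assumes \<mu>: "prob_space \<mu>" "sets \<mu> = sets borel" and [measurable]: "f \<in> borel_measurable borel" "g \<in> borel_measurable borel"
  shows "W2sq (distr \<mu> borel f) (distr \<mu> borel g) \<le> (\<integral>\<^sup>+x. ennreal (1/2 * (norm (f x - g x))^2) \<partial>\<mu>)"
proof -
  note [measurable_cong] = \<mu>(2)
  have m: "(\<lambda>x. (f x, g x)) \<in> measurable \<mu> borel" by (simp add: borel_prod[symmetric])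
  have fs: "fst \<in> measurable (borel :: ('a \<times> 'a) measure) borel" "snd \<in> measurable (borel :: ('a \<times> 'a) measure) borel"
    by (auto intro!: borel_measurable_continuous_onI continuous_intros)
  let ?\<pi> = "distr \<mu> borel (\<lambda>x. (f x, g x))"
  have "?\<pi> \<in> couplings (distr \<mu> borel f) (distr \<mu> borel g)"
    unfolding couplings_def using m fs
    by (auto simp: distr_distr comp_def intro!: prob_space.prob_space_distr[OF \<mu>(1)])
  then have "W2sq (distr \<mu> borel f) (distr \<mu> borel g) \<le> (\<integral>\<^sup>+(x, y). ennreal (1/2 * (norm (x - y))^2) \<partial>?\<pi>)"
    unfolding W2sq_def by (rule INF_lower)
  also have "\<dots> = (\<integral>\<^sup>+x. ennreal (1/2 * (norm (f x - g x))^2) \<partial>\<mu>)"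
  proof -
    have "continuous_on UNIV (\<lambda>p::'a \<times> 'a. 1/2 * (norm (fst p - snd p))^2)" by (intro continuous_intros)
    from measurable_compose[OF borel_measurable_continuous_onI[OF this] measurable_ennreal]
    have "(\<lambda>p::'a \<times> 'a. ennreal (1/2 * (norm (fst p - snd p))^2)) \<in> borel_measurable borel" .
    then show ?thesis using nn_integral_distr[OF m] by (simp add: split_beta')
  qed
  finally show ?thesis .
qed

lemma distr_id_borel: "sets \<mu> = sets borel \<Longrightarrow> distr \<mu> borel (\<lambda>x. x) = \<mu>"
  by (rule measure_eqI) (auto simp: emeasure_distr vimage_def dest: sets_eq_imp_space_eq)

section \<open>Value and minimiser of Problem 3\<close>

context ot_dual
begin

definition Z :: "'a \<Rightarrow> 'a" where "Z = grad \<phi>"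

lemma Z_borel: "Z \<in> borel_measurable borel" unfolding Z_def by (rule h0.grad_measurable)

lemma midpoint: "midpoint_of T Q x y = q.conj_grad (x + y)"
  by (simp add: midpoint_of_def q.grad_legendre)

lemma good_bounds:
  obtains B where "B \<ge> 0" "\<And>x. good x \<Longrightarrow> norm x \<le> B" "\<And>x. good x \<Longrightarrow> norm (Z x) \<le> B" "\<And>x. good x \<Longrightarrow> norm (m0 x) \<le> B"
proof -
  obtain R1 where R1: "\<And>x. x \<in> \<Omega>0 \<Longrightarrow> norm x \<le> R1" using \<Omega>(5) by (auto simp: bounded_iff)
  obtain R2 where R2: "\<And>x. x \<in> closure \<Omega>T \<Longrightarrow> norm x \<le> R2" using compact_imp_bounded[OF compact_closures(2)] by (auto simp: bounded_iff)
  have "compact (q.conj_grad ` cball 0 (R1 + R2))" by (intro compact_continuous_image q.continuous_conj_grad) simp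
  then obtain R3 where R3: "\<And>p. norm p \<le> R1 + R2 \<Longrightarrow> norm (q.conj_grad p) \<le> R3"
    using compact_imp_bounded by (fastforce simp: bounded_iff)
  have g: "norm x \<le> R1" "norm (m0 x) \<le> R2" "norm (Z x) \<le> R3" if x: "good x" for x
  proof -
    show a: "norm x \<le> R1" using x R1 by (simp add: good_def)
    show b: "norm (m0 x) \<le> R2" using contact(1)[OF x] R2 by simp
    have "norm (x + m0 x) \<le> R1 + R2" using a b norm_triangle_ineq[of x "m0 x"] by linarith
    from R3[OF this] show "norm (Z x) \<le> R3" using contact(3)[OF x] by (simp add: Z_def)
  qed
  show ?thesis
    by (rule that[of "max 0 (max R1 (max R2 R3))"]) (use g in \<open>simp_all add: le_max_iff_disj\<close>)
qed

text \<open>All triples (x, Z x, m0 x) with x good lie in one compact set, so continuous expressions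
  in them are bounded almost everywhere.\<close>

lemma integrable_good:
  fixes f :: "'a \<Rightarrow> 'a \<Rightarrow> 'a \<Rightarrow> real"
  assumes f: "continuous_on UNIV (\<lambda>(x, z, y). f x z y)"
  shows "integrable \<mu>0 (\<lambda>x. f x (Z x) (m0 x))"
proof -
  obtain B where B: "B \<ge> 0" "\<And>x. good x \<Longrightarrow> norm x \<le> B" "\<And>x. good x \<Longrightarrow> norm (Z x) \<le> B" "\<And>x. good x \<Longrightarrow> norm (m0 x) \<le> B"
    using good_bounds by blast
  have cmp: "compact ((\<lambda>(x, z, y). f x z y) ` (cball 0 B \<times> cball 0 B \<times> cball 0 B))"
    by (rule compact_continuous_image[OF continuous_on_subset[OF f subset_UNIV]]) (intro compact_Times compact_cball)
  then obtain C where C: "\<forall>p\<in>(\<lambda>(x, z, y). f x z y) ` (cball 0 B \<times> cball 0 B \<times> cball 0 B). norm p \<le> C"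
    using compact_imp_bounded[OF cmp] unfolding bounded_iff by blast
  show ?thesis
  proof (rule M0.integrable_const_bound[of _ C])
    show "AE x in \<mu>0. norm (f x (Z x) (m0 x)) \<le> C"
      using AE_good
    proof eventually_elim
      case (elim x)
      have "(x, Z x, m0 x) \<in> cball 0 B \<times> cball 0 B \<times> cball 0 B" using B elim by auto
      from bspec[OF C imageI[OF this]] show ?case by simp
    qed
    have "(\<lambda>x. (x, Z x, m0 x)) \<in> measurable borel borel"
      using Z_borel m0_borel by (simp add: borel_prod[symmetric])
    from measurable_compose[OF this borel_measurable_continuous_onI[OF f]]
    show "(\<lambda>x. f x (Z x) (m0 x)) \<in> borel_measurable \<mu>0" using \<mu>0(1) by (simp cong: measurable_cong_sets)
  qed
qed

lemma split_identity:
  "(norm (x - z))^2 / T + Q z + (norm (z - y))^2 / T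
     = ((norm x)^2 + (norm y)^2) / T - 2/T * qs (x + y) + 2/T * (qs (x + y) + qt z - (x + y) \<bullet> z)"
proof -
  have "(norm (x - z))^2 + (norm (z - y))^2 = (norm x)^2 + (norm y)^2 + 2 * (norm z)^2 - 2 * ((x + y) \<bullet> z)"
    unfolding power2_norm_eq_inner by (simp add: inner_simps inner_commute)
  moreover have "T * Q z = 2 * qt z - 2 * (norm z)^2" by (simp add: Qtilde_def)
  moreover have "a / T + r + b / T = (c + d) / T - 2/T * e + 2/T * (e + f - h)"
    if "a + b = c + d + 2 * k - 2 * h" "T * r = 2 * f - 2 * k" for a b c d e f h k r
  proof -
    have "T * (a / T + r + b / T) = a + b + T * r" "T * ((c + d) / T - 2/T * e + 2/T * (e + f - h)) = c + d + 2 * f - 2 * h"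
      using T by (simp_all add: field_simps)
    then have "T * (a / T + r + b / T) = T * ((c + d) / T - 2/T * e + 2/T * (e + f - h))" using that by linarith
    then show ?thesis using T by simp
  qed
  ultimately show ?thesis by blast
qed

lemma pointwise_ge:
  "((norm x)^2 + (norm y)^2) / T - 2/T * qs (x + y) \<le> (norm (x - z))^2 / T + Q z + (norm (z - y))^2 / T"
proof -
  have "0 \<le> 2/T * (qs (x + y) + qt z - (x + y) \<bullet> z)" using q.fenchel_young[of "x + y" z] T by simp
  then show ?thesis using split_identity[of x z y] by linarith
qed

lemma pointwise_eqD:
  assumes "(norm (x - z))^2 / T + Q z + (norm (z - y))^2 / T = ((norm x)^2 + (norm y)^2) / T - 2/T * qs (x + y)"
  shows "z = q.conj_grad (x + y)"
proof (rule q.fenchel_eqD)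
  have "2/T * (qs (x + y) + qt z - (x + y) \<bullet> z) = 0" using assms split_identity[of x z y] by linarith
  then show "qs (x + y) + qt z = (x + y) \<bullet> z" using T by simp
qed

lemma pointwise_eq:
  assumes "good x"
  shows "(norm (x - Z x))^2 / T + Q (Z x) + (norm (Z x - m0 x))^2 / T = ((norm x)^2 + (norm (m0 x))^2) / T - 2/T * qs (x + m0 x)"
proof -
  have "Z x = q.conj_grad (x + m0 x)" using contact(3)[OF assms] by (simp add: Z_def)
  then have "qs (x + m0 x) + qt (Z x) - (x + m0 x) \<bullet> Z x = 0" by (simp add: q.legendre_eq)
  then show ?thesis using split_identity[of x "Z x" "m0 x"] by simp
qed

definition \<rho>s :: "'a measure" where "\<rho>s = distr \<mu>0 borel Z"

lemma Z_meas: "Z \<in> measurable \<mu>0 borel" "m0 \<in> measurable \<mu>0 borel"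
  using Z_borel m0_borel \<mu>0(1) by (simp_all cong: measurable_cong_sets)

lemma P2_distr:
  assumes s: "s \<in> borel_measurable borel" and i: "integrable \<mu>0 (\<lambda>x. (norm (s x))^2)"
  shows "P2 (distr \<mu>0 borel s)"
proof -
  have sm: "s \<in> measurable \<mu>0 borel" using s \<mu>0(1) by (simp cong: measurable_cong_sets)
  have "(\<integral>\<^sup>+x. ennreal ((norm x)^2) \<partial>distr \<mu>0 borel s) = (\<integral>\<^sup>+x. ennreal (norm ((norm (s x))^2)) \<partial>\<mu>0)"
    using sm by (subst nn_integral_distr) auto
  also have "\<dots> < \<infinity>" using i by (simp add: integrable_iff_bounded)
  finally show ?thesis using M0.prob_space_distr[OF sm] by (simp add: P2_def)
qed

lemma P2_\<rho>s: "P2 \<rho>s"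
  unfolding \<rho>s_def by (intro P2_distr Z_borel integrable_good[of "\<lambda>x z y. (norm z)^2"]) (auto simp: split_beta' intro!: continuous_intros)

lemma iQZ: "integrable \<mu>0 (\<lambda>x. Q (Z x))"
  by (rule integrable_good[of "\<lambda>x z y. Q z"])
    (auto simp: split_beta' intro!: continuous_on_compose2[OF Q_continuous[of UNIV]] continuous_intros)

lemma PE_\<rho>s: "potential_energy Q \<rho>s = ereal (\<integral>x. Q (Z x) \<partial>\<mu>0)"
proof -
  have "integrable \<rho>s Q" unfolding \<rho>s_def using iQZ Q_borel Z_meas by (subst integrable_distr_eq) auto
  from PE_integrable[OF this] show ?thesis unfolding \<rho>s_def using Q_borel Z_meas by (simp add: integral_distr)
qed

text \<open>The action of uniform motion from x to \<open>Z x\<close> during T/2: one half of the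
  squared speed (2 |x - Z x| / T)^2, times T/2.\<close>

definition kin0 :: "'a \<Rightarrow> real" where "kin0 x = (norm (x - Z x))^2 / T"
definition kin1 :: "'a \<Rightarrow> real" where "kin1 x = (norm (Z x - m0 x))^2 / T"
abbreviation "E0 \<equiv> \<integral>x. kin0 x \<partial>\<mu>0"
abbreviation "E1 \<equiv> \<integral>x. kin1 x \<partial>\<mu>0"

lemma ikin: "integrable \<mu>0 kin0" "integrable \<mu>0 kin1"
proof -
  have "integrable \<mu>0 (\<lambda>x. (norm (x - Z x))^2)"
    by (rule integrable_good[of "\<lambda>x z y. (norm (x - z))^2"]) (auto simp: split_beta' intro!: continuous_intros)
  then show "integrable \<mu>0 kin0" by (simp add: kin0_def[abs_def])
  have "integrable \<mu>0 (\<lambda>x. (norm (Z x - m0 x))^2)"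
    by (rule integrable_good[of "\<lambda>x z y. (norm (z - y))^2"]) (auto simp: split_beta' intro!: continuous_intros)
  then show "integrable \<mu>0 kin1" by (simp add: kin1_def[abs_def])
qed

lemma kin_val: "E0 + (\<integral>x. Q (Z x) \<partial>\<mu>0) + E1 = val"
proof -
  have AEm: "AE x in \<mu>0. m0 x \<in> \<Omega>T" by (rule AE_m0[OF \<mu>T(3)])
  have iqs: "integrable \<mu>0 (\<lambda>x. qs (x + m0 x))" "(\<integral>x. qs (x + m0 x) \<partial>\<mu>0) = D"
    using transport_facts(1,4)[OF m0_borel push_m0[symmetric] AEm] by auto
  have im: "integrable \<mu>0 (\<lambda>x. (norm (m0 x))^2)"
    by (rule integrable_good[of "\<lambda>x z y. (norm y)^2"]) (auto simp: split_beta' intro!: continuous_intros)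
  have my: "(\<integral>x. (norm (m0 x))^2 \<partial>\<mu>0) = (\<integral>y. (norm y)^2 \<partial>\<mu>T)"
    by (subst push_m0, subst integral_distr) (use Z_meas in auto)
  have "E0 + (\<integral>x. Q (Z x) \<partial>\<mu>0) + E1 = (\<integral>x. kin0 x + Q (Z x) + kin1 x \<partial>\<mu>0)"
    using ikin iQZ by simp
  also have "\<dots> = (\<integral>x. ((norm x)^2 + (norm (m0 x))^2) / T - 2/T * qs (x + m0 x) \<partial>\<mu>0)"
  proof (rule integral_cong_AE)
    show "AE x in \<mu>0. kin0 x + Q (Z x) + kin1 x = ((norm x)^2 + (norm (m0 x))^2) / T - 2/T * qs (x + m0 x)"
      using AE_good
    proof eventually_elim
      case (elim x) show ?case using pointwise_eq[OF elim] by (simp add: kin0_def kin1_def)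
    qed
  qed (use ikin iQZ iN im iqs in auto)
  also have "\<dots> = val" using iN im iqs my by (simp add: val_def add_divide_distrib)
  finally show ?thesis .
qed

lemma K_lower:
  assumes \<rho>: "P2 \<rho>" shows "ereal val \<le> fun3 \<rho>"
    and "fun3 \<rho> \<le> ereal val \<Longrightarrow> \<rho> = \<rho>s"
proof -
  have \<rho>': "prob_space \<rho>" "sets \<rho> = sets borel" using \<rho> by (auto simp: P2_def)
  have PE: "potential_energy Q \<rho> \<noteq> - \<infinity>" using PE_cases[OF \<rho>] PE_integrable by auto
  have "ereal val \<le> fun3 \<rho> \<and> (fun3 \<rho> \<le> ereal val \<longrightarrow> \<rho> = \<rho>s)"
  proof (cases "W2sq \<mu>0 \<rho> < \<infinity> \<and> W2sq \<rho> \<mu>T < \<infinity>")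
    case True
    have d0: "dual_bound \<tau> \<mu>0 \<rho> (enn2real (W2sq \<mu>0 \<rho>) / \<tau>)"
      by (rule dual_bound_W2sq[OF \<mu>0(2,1) \<rho>' \<tau>]) (use True in simp)
    have d1: "dual_bound \<tau> \<mu>T \<rho> (enn2real (W2sq \<rho> \<mu>T) / \<tau>)"
      by (rule dual_bound_sym[OF dual_bound_W2sq[OF \<rho>' \<mu>T(2,1) \<tau>] \<tau> \<rho>' \<mu>T(2,1)]) (use True in simp)
    have e: "enn2ereal x = ereal (enn2real x)" if "x < \<infinity>" for x using that by (cases x) auto
    \<comment> \<open>The weight 2/T of Problem 3 equals 1/\<tau>, which matches the scaling in
      \<open>dual_bound_W2sq\<close>.\<close>
    have K: "fun3 \<rho> = ereal (enn2real (W2sq \<mu>0 \<rho>) / \<tau>) + potential_energy Q \<rho> + ereal (enn2real (W2sq \<rho> \<mu>T) / \<tau>)"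
      using True T by (simp add: K_functional_def e \<tau>_def mult.commute)
    show ?thesis unfolding K using combine[OF \<rho> d0 d1] by (auto simp: \<rho>s_def Z_def)
  next
    case False
    have "ereal (2/T) * enn2ereal (W2sq \<mu>0 \<rho>) \<ge> 0" "ereal (2/T) * enn2ereal (W2sq \<rho> \<mu>T) \<ge> 0"
      using T by (auto intro!: ereal_0_le_mult)
    moreover have "ereal (2/T) * enn2ereal (W2sq \<mu>0 \<rho>) = \<infinity> \<or> ereal (2/T) * enn2ereal (W2sq \<rho> \<mu>T) = \<infinity>"
      using False T by (auto simp: top.not_eq_extremum[symmetric])
    ultimately have "fun3 \<rho> = \<infinity>"
      using PE unfolding K_functional_def by auto
    then show ?thesis by simp
  qed
  then show "ereal val \<le> fun3 \<rho>" "fun3 \<rho> \<le> ereal val \<Longrightarrow> \<rho> = \<rho>s" by auto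
qed

text \<open>The couplings (x, Z x) and (Z x, m0 x) give upper bounds for the transport terms. Since
  the sum of these bounds is already the lower bound \<open>val\<close>, their optimality need not
  be shown separately.\<close>

lemma K_\<rho>s: "fun3 \<rho>s = ereal val"
proof (rule antisym[OF _ K_lower(1)[OF P2_\<rho>s]])
  have nn: "(\<integral>\<^sup>+x. ennreal (1/2 * (norm (x - Z x))^2) \<partial>\<mu>0) = ennreal (T/2 * E0)"
    "(\<integral>\<^sup>+x. ennreal (1/2 * (norm (Z x - m0 x))^2) \<partial>\<mu>0) = ennreal (T/2 * E1)"
  proof -
    have e: "1/2 * (norm (x - Z x))^2 = T/2 * kin0 x" "1/2 * (norm (Z x - m0 x))^2 = T/2 * kin1 x" for x
      using T by (auto simp: kin0_def kin1_def)
    show "(\<integral>\<^sup>+x. ennreal (1/2 * (norm (x - Z x))^2) \<partial>\<mu>0) = ennreal (T/2 * E0)"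
      "(\<integral>\<^sup>+x. ennreal (1/2 * (norm (Z x - m0 x))^2) \<partial>\<mu>0) = ennreal (T/2 * E1)"
      unfolding e using ikin T by (subst nn_integral_eq_integral; simp; simp add: kin0_def kin1_def)+
  qed
  have p: "E0 \<ge> 0" "E1 \<ge> 0"
    using T by (auto intro!: Bochner_Integration.integral_nonneg simp: kin0_def kin1_def)
  have "W2sq \<mu>0 \<rho>s \<le> ennreal (T/2 * E0)"
    using coupling_distr[OF \<mu>0(2,1) _ Z_borel, of "\<lambda>x. x"] by (simp add: distr_id_borel[OF \<mu>0(1)] \<rho>s_def nn[simplified])
  then have 1: "ereal (2/T) * enn2ereal (W2sq \<mu>0 \<rho>s) \<le> ereal E0"
    using T p by (cases "W2sq \<mu>0 \<rho>s") (auto simp: field_simps ennreal_le_iff top_unique)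
  have "W2sq \<rho>s \<mu>T \<le> ennreal (T/2 * E1)"
    using coupling_distr[OF \<mu>0(2,1) Z_borel m0_borel] push_m0 by (simp add: \<rho>s_def nn[simplified])
  then have 2: "ereal (2/T) * enn2ereal (W2sq \<rho>s \<mu>T) \<le> ereal E1"
    using T p by (cases "W2sq \<rho>s \<mu>T") (auto simp: field_simps ennreal_le_iff top_unique)
  have "fun3 \<rho>s \<le> ereal E0 + ereal (\<integral>x. Q (Z x) \<partial>\<mu>0) + ereal E1"
    unfolding K_functional_def PE_\<rho>s by (intro add_mono 1 2 order.refl)
  then show "fun3 \<rho>s \<le> ereal val" using kin_val by simp
qed

lemma opt3_iff: "opt3 \<rho> \<longleftrightarrow> \<rho> = \<rho>s"
proof
  assume "opt3 \<rho>"
  then have "P2 \<rho>" "fun3 \<rho> \<le> fun3 \<rho>s"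
    using P2_\<rho>s by (auto simp: is_arg_min_def not_less)
  then show "\<rho> = \<rho>s" using K_lower(2) K_\<rho>s by simp
next
  assume "\<rho> = \<rho>s"
  then show "opt3 \<rho>" using P2_\<rho>s K_lower(1) K_\<rho>s by (auto simp: is_arg_min_def not_less)
qed

lemma INF_K: "(INF \<rho>\<in>Collect P2. fun3 \<rho>) = ereal val"
proof (rule antisym)
  show "(INF \<rho>\<in>Collect P2. fun3 \<rho>) \<le> ereal val"
    using INF_lower[of \<rho>s "Collect P2" "fun3"] P2_\<rho>s K_\<rho>s by simp
qed (auto intro!: INF_greatest K_lower)

lemma midpoint_m: "opt m \<Longrightarrow> AE x in \<mu>0. midpoint_of T Q x (m x) = Z x"
proof -
  assume "opt m"
  then have "AE x in \<mu>0. m x = m0 x" by (simp add: opt_iff)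
  then show ?thesis using AE_good
  proof eventually_elim
    case (elim x) then show ?case using contact(3)[of x] by (simp add: midpoint Z_def)
  qed
qed

end

section \<open>The action of curves\<close>

abbreviation "speed T g t \<equiv> 1/2 * (norm (vector_derivative g (at t within {0..T})))^2"

definition energy :: "real \<Rightarrow> (real \<Rightarrow> 'a::euclidean_space) \<Rightarrow> ennreal" where
  "energy T g = (\<integral>\<^sup>+t\<in>{0..T}. ennreal (speed T g t) \<partial>lborel)"

lemma C1_on_subset:
  assumes "g \<in> C1_on a b" "a \<le> a'" "b' \<le> b" shows "g \<in> C1_on a' b'"
proof -
  obtain g' where g': "\<And>t. t \<in> {a..b} \<Longrightarrow> (g has_vector_derivative g' t) (at t within {a..b})" "continuous_on {a..b} g'"
    using assms(1) unfolding C1_on_def by blast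
  have "(g has_vector_derivative g' t) (at t within {a'..b'})" if "t \<in> {a'..b'}" for t
    by (rule has_vector_derivative_within_subset[OF g'(1)]) (use that assms in auto)
  moreover have "continuous_on {a'..b'} g'" using g'(2) assms by (auto intro: continuous_on_subset)
  ultimately show ?thesis unfolding C1_on_def by blast
qed

text \<open>The energy of the uniform motion on [a,b] with the same end positions as g.\<close>

definition chord :: "(real \<Rightarrow> 'a::euclidean_space) \<Rightarrow> real \<Rightarrow> real \<Rightarrow> real" where
  "chord g a b = (norm (g b - g a))^2 / (2 * (b - a))"

text \<open>With e the mean velocity, e . g' - |e|^2/2 \<le> |g'|^2/2, and the left side integrates
  to the chord energy by the fundamental theorem. The interval is open because a kinked curve may
  have no derivative at its ends.\<close>

lemma chord_le:
  assumes g: "g \<in> C1_on a b" and ab: "0 \<le> a" "a < b" "b \<le> T"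
  shows "(\<lambda>t. ennreal (speed T g t) * indicator {a<..<b} t) \<in> borel_measurable borel"
    and "ennreal (chord g a b) \<le> (\<integral>\<^sup>+t. ennreal (speed T g t) * indicator {a<..<b} t \<partial>lborel)"
proof -
  obtain g' where g': "\<And>t. t \<in> {a..b} \<Longrightarrow> (g has_vector_derivative g' t) (at t within {a..b})" "continuous_on {a..b} g'"
    using g unfolding C1_on_def by blast
  have vd: "vector_derivative g (at t within {0..T}) = g' t" if t: "t \<in> {a<..<b}" for t
  proof -
    have "at t within {a..b} = at t" using t by (intro at_within_interior) auto
    then have "(g has_vector_derivative g' t) (at t)" using g'(1)[of t] t by simp
    moreover have "at t within {0..T} = at t" using t ab by (intro at_within_interior) auto
    ultimately show ?thesis by (simp add: vector_derivative_at)
  qed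
  have eq: "ennreal (speed T g t) * indicator {a<..<b} t
      = ennreal (indicator {a<..<b} t *\<^sub>R (1/2 * (norm (g' t))^2))" for t
    using vd[of t] by (auto simp: indicator_def)
  have m: "(\<lambda>t. indicator {a<..<b} t *\<^sub>R (1/2 * (norm (g' t))^2)) \<in> borel_measurable borel"
    by (intro borel_measurable_continuous_on_indicator continuous_intros continuous_on_subset[OF g'(2)]) auto
  show "(\<lambda>t. ennreal (speed T g t) * indicator {a<..<b} t) \<in> borel_measurable borel"
    unfolding eq using m by measurable
  define e where "e = (1 / (b - a)) *\<^sub>R (g b - g a)"
  define f where "f t = e \<bullet> g' t - 1/2 * (norm e)^2" for t
  have fc: "continuous_on {a..b} f" unfolding f_def[abs_def] by (intro continuous_intros g'(2))
  have si: "set_integrable lborel {a..b} f" unfolding set_integrable_def by (intro borel_integrable_compact fc) auto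
  have "((\<lambda>t. e \<bullet> g' t) has_integral (e \<bullet> g b - e \<bullet> g a)) {a..b}"
  proof (rule fundamental_theorem_of_calculus)
    fix t assume "t \<in> {a..b}"
    from bounded_linear.has_vector_derivative[OF bounded_linear_inner_right g'(1)[OF this]]
    show "((\<lambda>t. e \<bullet> g t) has_vector_derivative e \<bullet> g' t) (at t within {a..b})" .
  qed (use ab in simp)
  then have "(f has_integral (e \<bullet> g b - e \<bullet> g a) - (b - a) * (1/2 * (norm e)^2)) {a..b}"
    unfolding f_def[abs_def] using ab has_integral_const_real[of "1/2 * (norm e)^2" a b]
    by (intro has_integral_diff) simp_all
  then have "integral {a..b} f = (e \<bullet> g b - e \<bullet> g a) - (b - a) * (1/2 * (norm e)^2)" by (rule integral_unique)
  also have "\<dots> = chord g a b"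
  proof -
    have e: "g b - g a = (b - a) *\<^sub>R e" using ab by (simp add: e_def)
    have "e \<bullet> g b - e \<bullet> g a = (b - a) * (norm e)^2"
      unfolding inner_diff_right[symmetric] e by (simp add: power2_norm_eq_inner)
    moreover have "chord g a b = (b - a) * (1/2 * (norm e)^2)"
      unfolding chord_def e using ab by (simp add: power_mult_distrib power2_eq_square divide_simps)
    ultimately show ?thesis by simp
  qed
  finally have int: "(\<integral>t. indicator {a..b} t *\<^sub>R f t \<partial>lborel) = chord g a b"
    using set_borel_integral_eq_integral(2)[OF si] by (simp add: set_lebesgue_integral_def)
  have "ennreal (chord g a b) \<le> (\<integral>\<^sup>+t. ennreal (indicator {a..b} t *\<^sub>R (1/2 * (norm (g' t))^2)) \<partial>lborel)"
    unfolding int[symmetric]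
  proof (rule integral_le_nn_integral)
    show "integrable lborel (\<lambda>t. indicator {a..b} t *\<^sub>R f t)" using si by (simp add: set_integrable_def)
    fix t
    have "0 \<le> (norm (e - g' t))^2" by simp
    then have "f t \<le> 1/2 * (norm (g' t))^2"
      unfolding f_def power2_norm_eq_inner by (simp add: inner_simps inner_commute)
    then show "indicator {a..b} t *\<^sub>R f t \<le> indicator {a..b} t *\<^sub>R (1/2 * (norm (g' t))^2)" by (simp add: indicator_def)
  qed
  also have "\<dots> = (\<integral>\<^sup>+t. ennreal (indicator {a<..<b} t *\<^sub>R (1/2 * (norm (g' t))^2)) \<partial>lborel)"
  proof (rule nn_integral_cong_AE)
    show "AE t in lborel. ennreal (indicator {a..b} t *\<^sub>R (1/2 * (norm (g' t))^2)) = ennreal (indicator {a<..<b} t *\<^sub>R (1/2 * (norm (g' t))^2))"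
      using AE_lborel_singleton[of a] AE_lborel_singleton[of b] by eventually_elim (auto simp: indicator_def)
  qed
  finally show "ennreal (chord g a b) \<le> (\<integral>\<^sup>+t. ennreal (speed T g t) * indicator {a<..<b} t \<partial>lborel)"
    unfolding eq .
qed

text \<open>One of the two cuts will be T/2, where a kink is possible; the other is a time at which
  the position of the curve is to be tested.\<close>

lemma energy_ge3:
  assumes g: "g \<in> C1_on 0 s" "g \<in> C1_on s u" "g \<in> C1_on u T" and su: "0 < s" "s < u" "u < T"
  shows "ennreal (chord g 0 s + chord g s u + chord g u T) \<le> energy T g"
proof -
  let ?f = "\<lambda>t. ennreal (speed T g t)"
  have c: "chord g 0 s \<ge> 0" "chord g s u \<ge> 0" "chord g u T \<ge> 0" using su by (auto simp: chord_def)
  note c1 = chord_le[where T = T, OF g(1)] and c2 = chord_le[where T = T, OF g(2)] and c3 = chord_le[where T = T, OF g(3)]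
  have "ennreal (chord g 0 s + chord g s u + chord g u T) = ennreal (chord g 0 s) + ennreal (chord g s u) + ennreal (chord g u T)"
    using c by simp
  also have "\<dots> \<le> (\<integral>\<^sup>+t. ?f t * indicator {0<..<s} t \<partial>lborel) + (\<integral>\<^sup>+t. ?f t * indicator {s<..<u} t \<partial>lborel) + (\<integral>\<^sup>+t. ?f t * indicator {u<..<T} t \<partial>lborel)"
    using su by (intro add_mono c1(2) c2(2) c3(2)) auto
  also have "\<dots> = (\<integral>\<^sup>+t. ?f t * indicator {0<..<s} t + ?f t * indicator {s<..<u} t + ?f t * indicator {u<..<T} t \<partial>lborel)"
    using su c1(1) c2(1) c3(1) by (simp add: nn_integral_add)
  also have "\<dots> \<le> energy T g"
    unfolding energy_def using su by (intro nn_integral_mono) (auto simp: indicator_def)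
  finally show ?thesis .
qed

text \<open>The defect of inserting an intermediate time is an exact square. It vanishes only if the
  curve passes the chord at the proportional point.\<close>

lemma chord_split:
  assumes "a < b" "b < c"
  shows "chord g a b + chord g b c
    = chord g a c + (norm ((c - b) *\<^sub>R (g b - g a) - (b - a) *\<^sub>R (g c - g b)))^2 / (2 * (b - a) * (c - b) * (c - a))"
proof -
  define p q where "p = b - a" and "q = c - b"
  define u w where "u = g b - g a" and "w = g c - g b"
  have pq: "p > 0" "q > 0" "c - a = p + q" "g c - g a = u + w" using assms by (auto simp: p_def q_def u_def w_def)
  have "U / (2 * p) + W / (2 * q) = (U + 2 * V + W) / (2 * (p + q)) + (q^2 * U - 2 * (p * q) * V + p^2 * W) / (2 * p * q * (p + q))" for U V W
    using pq(1,2) by (simp add: divide_simps) (simp add: algebra_simps power2_eq_square)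
  moreover have "(norm (u + w))^2 = (norm u)^2 + 2 * (u \<bullet> w) + (norm w)^2"
    unfolding power2_norm_eq_inner by (simp add: inner_simps inner_commute)
  moreover have "(norm (q *\<^sub>R u - p *\<^sub>R w))^2 = q^2 * (norm u)^2 - 2 * (p * q) * (u \<bullet> w) + p^2 * (norm w)^2"
    unfolding power2_norm_eq_inner by (simp add: inner_simps inner_commute power2_eq_square)
  ultimately show ?thesis unfolding chord_def pq(3,4) p_def[symmetric] q_def[symmetric] u_def[symmetric] w_def[symmetric] by simp
qed

lemma chord_split_ge: "a < b \<Longrightarrow> b < c \<Longrightarrow> chord g a c \<le> chord g a b + chord g b c"
  by (simp add: chord_split)

lemma chord_split_eqD:
  assumes "a < b" "b < c" "chord g a b + chord g b c = chord g a c"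
  shows "g b = g a + ((b - a) / (c - a)) *\<^sub>R (g c - g a)"
proof -
  have "(norm ((c - b) *\<^sub>R (g b - g a) - (b - a) *\<^sub>R (g c - g b)))^2 / (2 * (b - a) * (c - b) * (c - a)) = 0"
    using assms(3) chord_split[OF assms(1,2), of g] by simp
  then have "(c - b) *\<^sub>R (g b - g a) = (b - a) *\<^sub>R (g c - g b)" using assms by simp
  then have "(c - a) *\<^sub>R g b = (c - a) *\<^sub>R g a + (b - a) *\<^sub>R (g c - g a)" by (simp add: algebra_simps)
  then have "(1 / (c - a)) *\<^sub>R ((c - a) *\<^sub>R g b) = (1 / (c - a)) *\<^sub>R ((c - a) *\<^sub>R g a + (b - a) *\<^sub>R (g c - g a))" by simp
  then show ?thesis using assms by (simp add: scaleR_add_right)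
qed

text \<open>The complement of the support is covered by the null sets of a countable base.\<close>

lemma AE_msupport:
  fixes M :: "'a::second_countable_topology measure"
  assumes "sets M = sets borel" shows "AE x in M. x \<in> msupport M"
proof -
  obtain B :: "'a set set" where B: "countable B" "topological_basis B" using ex_countable_basis by blast
  define N where "N = \<Union>{b \<in> B. emeasure M b = 0}"
  have op: "open b" if "b \<in> B" for b using B(2) that by (rule topological_basis_open)
  have "(\<Union>b\<in>{b \<in> B. emeasure M b = 0}. b) \<in> null_sets M"
  proof (rule null_sets_UN')
    show "countable {b \<in> B. emeasure M b = 0}" using B(1) by simp
    fix b assume "b \<in> {b \<in> B. emeasure M b = 0}"
    then show "b \<in> null_sets M" using op assms by auto
  qed
  then have "N \<in> null_sets M" by (simp add: N_def)
  moreover have "{x \<in> space M. x \<notin> msupport M} \<subseteq> N"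
  proof
    fix x assume "x \<in> {x \<in> space M. x \<notin> msupport M}"
    then obtain U where U: "open U" "x \<in> U" "emeasure M U = 0"
      unfolding msupport_def by (auto simp: not_gr_zero)
    obtain b where b: "b \<in> B" "x \<in> b" "b \<subseteq> U" using topological_basisE[OF B(2) U(1,2)] by blast
    have "emeasure M b \<le> emeasure M U" using b U(1) assms by (intro emeasure_mono) auto
    then show "x \<in> N" using b U(3) by (auto simp: N_def)
  qed
  ultimately show ?thesis by (rule AE_I')
qed

lemma energy_cong:
  assumes "\<And>t. t \<in> {0..T} \<Longrightarrow> g t = h t" shows "energy T g = energy T h"
proof -
  have "vector_derivative g (at t within {0..T}) = vector_derivative h (at t within {0..T})" if "t \<in> {0..T}" for t
  proof -
    have "(g has_vector_derivative d) (at t within {0..T}) \<longleftrightarrow> (h has_vector_derivative d) (at t within {0..T})" for d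
      by (intro iffI; elim has_vector_derivative_transform[OF that, rotated]) (simp_all add: assms)
    then show ?thesis by (simp add: vector_derivative_def)
  qed
  then show ?thesis unfolding energy_def by (intro nn_integral_cong) (auto simp: indicator_def)
qed

lemma energy_le:
  assumes T: "T > 0"
    and d0: "\<And>t. 0 < t \<Longrightarrow> t < T/2 \<Longrightarrow> (g has_vector_derivative g' t) (at t) \<and> norm (g' t) \<le> A"
    and d1: "\<And>t. T/2 < t \<Longrightarrow> t < T \<Longrightarrow> (g has_vector_derivative g' t) (at t) \<and> norm (g' t) \<le> B"
  shows "energy T g \<le> ennreal (T/4 * A^2 + T/4 * B^2)"
proof -
  have sq: "ennreal (speed T g t) \<le> ennreal (1/2 * C^2)"
    if "0 < t" "t < T" "(g has_vector_derivative g' t) (at t) \<and> norm (g' t) \<le> C" for t C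
  proof -
    have "at t within {0..T} = at t" using that by (intro at_within_interior) auto
    then have "vector_derivative g (at t within {0..T}) = g' t" using that by (simp add: vector_derivative_at)
    then show ?thesis using that by (auto intro!: ennreal_leI power_mono)
  qed
  have "energy T g \<le> (\<integral>\<^sup>+t. ennreal (1/2 * A^2) * indicator {0..T/2} t + ennreal (1/2 * B^2) * indicator {T/2..T} t \<partial>lborel)"
    unfolding energy_def
  proof (rule nn_integral_mono_AE)
    show "AE t in lborel. ennreal (speed T g t) * indicator {0..T} t
        \<le> ennreal (1/2 * A^2) * indicator {0..T/2} t + ennreal (1/2 * B^2) * indicator {T/2..T} t"
      using AE_lborel_singleton[of 0] AE_lborel_singleton[of "T/2"] AE_lborel_singleton[of T]
    proof eventually_elim
      case (elim t)
      consider "t < 0 \<or> t > T" | "0 < t" "t < T/2" | "T/2 < t" "t < T" using elim by linarith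
      then show ?case
      proof cases
        case 2 then show ?thesis using sq[of t A] d0[of t] by (simp add: indicator_def)
      next
        case 3 then show ?thesis using sq[of t B] d1[of t] T by (simp add: indicator_def)
      qed (auto simp: indicator_def)
    qed
  qed
  also have "\<dots> = ennreal (1/2 * A^2) * ennreal (T/2) + ennreal (1/2 * B^2) * ennreal (T/2)"
    using T by (subst nn_integral_add) (simp_all add: nn_integral_cmult_indicator)
  also have "\<dots> = ennreal (T/4 * A^2 + T/4 * B^2)"
    using T by (simp add: ennreal_mult[symmetric] ennreal_plus[symmetric] field_simps del: ennreal_plus)
  finally show ?thesis .
qed

text \<open>The profiles \<open>s\<close> with \<open>s' 1 = 0\<close> remove the kink of the broken line at time \<open>T/2\<close>.\<close>

definition profile_curve :: "(real \<Rightarrow> real) \<Rightarrow> real \<Rightarrow> 'a::real_vector \<Rightarrow> 'a \<Rightarrow> 'a \<Rightarrow> real \<Rightarrow> 'a" where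
  "profile_curve s T x z y t = (if t \<le> T/2 then x + s (2*t/T) *\<^sub>R (z - x) else y + s (2 - 2*t/T) *\<^sub>R (z - y))"

lemma profile_curve_id: "profile_curve (\<lambda>u. u) T x z y = broken_line T x z y"
  by (rule ext) (simp add: profile_curve_def broken_line_def algebra_simps scaleR_2)

text \<open>The second half uses the same s, run backwards from y, so the one-sided velocities at
  T/2 are both multiples of \<open>s' 1\<close>. The bound c measures the excess of energy over the
  broken line, for which c = 1.\<close>

locale profile =
  fixes s s' :: "real \<Rightarrow> real" and c T :: real
  assumes T: "T > 0" and s01: "s 0 = 0" "s 1 = 1" and ds: "\<And>u. (s has_real_derivative s' u) (at u)"
    and cs: "continuous_on UNIV s'" and bs: "\<And>u. 0 \<le> u \<Longrightarrow> u \<le> 1 \<Longrightarrow> \<bar>s' u\<bar> \<le> c"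
begin

abbreviation "d0 t x z \<equiv> (2/T * s' (2*t/T)) *\<^sub>R (z - x)"
abbreviation "d1 t z y \<equiv> (- (2/T) * s' (2 - 2*t/T)) *\<^sub>R (z - y)"

lemma halves:
  fixes x z y :: "'a::euclidean_space"
  shows "((\<lambda>t. x + s (2*t/T) *\<^sub>R (z - x)) has_vector_derivative d0 t x z) (at t within S)"
    and "((\<lambda>t. y + s (2 - 2*t/T) *\<^sub>R (z - y)) has_vector_derivative d1 t z y) (at t within S)"
    and "continuous_on A (\<lambda>t. d0 t x z)"
    and "continuous_on A (\<lambda>t. d1 t z y)"
proof -
  have a: "((\<lambda>t. s (2*t/T)) has_real_derivative s' (2*t/T) * (2/T)) (at t)"
    by (rule DERIV_chain2[OF ds]) (use T in \<open>auto intro!: derivative_eq_intros\<close>)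
  have b: "((\<lambda>t. s (2 - 2*t/T)) has_real_derivative s' (2 - 2*t/T) * (- (2/T))) (at t)"
    by (rule DERIV_chain2[OF ds]) (use T in \<open>auto intro!: derivative_eq_intros\<close>)
  have "((\<lambda>t. x + s (2*t/T) *\<^sub>R (z - x)) has_vector_derivative 0 + (s (2*t/T) *\<^sub>R 0 + (s' (2*t/T) * (2/T)) *\<^sub>R (z - x))) (at t within S)"
    by (intro has_vector_derivative_add has_vector_derivative_const has_vector_derivative_scaleR has_field_derivative_at_within[OF a])
  then show "((\<lambda>t. x + s (2*t/T) *\<^sub>R (z - x)) has_vector_derivative d0 t x z) (at t within S)"
    by (simp add: mult.commute)
  have "((\<lambda>t. y + s (2 - 2*t/T) *\<^sub>R (z - y)) has_vector_derivative 0 + (s (2 - 2*t/T) *\<^sub>R 0 + (s' (2 - 2*t/T) * (- (2/T))) *\<^sub>R (z - y))) (at t within S)"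
    by (intro has_vector_derivative_add has_vector_derivative_const has_vector_derivative_scaleR has_field_derivative_at_within[OF b])
  then show "((\<lambda>t. y + s (2 - 2*t/T) *\<^sub>R (z - y)) has_vector_derivative d1 t z y) (at t within S)"
    by (simp add: mult.commute)
  show "continuous_on A (\<lambda>t. d0 t x z)"
    using T by (intro continuous_intros continuous_on_compose2[OF cs]) auto
  show "continuous_on A (\<lambda>t. d1 t z y)"
    using T by (intro continuous_intros continuous_on_compose2[OF cs]) auto
qed

lemma profile_kinked:
  fixes x z y :: "'a::euclidean_space"
  shows "profile_curve s T x z y \<in> C1_on 0 (T/2) \<inter> C1_on (T/2) T" (is "?c \<in> _")
proof
  have D: "(?c has_vector_derivative d0 t x z) (at t within {0..T/2})" if "t \<in> {0..T/2}" for t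
    by (rule has_vector_derivative_transform[OF that _ halves(1)]) (simp add: profile_curve_def)
  show "?c \<in> C1_on 0 (T/2)"
    unfolding C1_on_def by (intro CollectI exI[of _ "\<lambda>t. d0 t x z"] conjI ballI D halves(3))
  have D: "(?c has_vector_derivative d1 t z y) (at t within {T/2..T})" if "t \<in> {T/2..T}" for t
    by (rule has_vector_derivative_transform[OF that _ halves(2)]) (use T s01 in \<open>auto simp: profile_curve_def\<close>)
  show "?c \<in> C1_on (T/2) T"
    unfolding C1_on_def by (intro CollectI exI[of _ "\<lambda>t. d1 t z y"] conjI ballI D halves(4))
qed

lemma profile_C1:
  fixes x z y :: "'a::euclidean_space"
  assumes s1: "s' 1 = 0" shows "profile_curve s T x z y \<in> C1_on 0 T" (is "?c \<in> _")
proof -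
  define f' where "f' t = d0 t x z" for t
  define g' where "g' t = d1 t z y" for t
  have TT: "{0..T} = {0..T/2} \<union> {T/2..T}" "{0..T/2} \<inter> {T/2..T} = {T/2}" using T by auto
  have h: "f' (T/2) = 0" "g' (T/2) = 0" using T s1 by (auto simp: f'_def g'_def)
  have "(?c has_vector_derivative (if t \<in> {0..T/2} then f' t else g' t)) (at t within {0..T})" if "t \<in> {0..T}" for t
  proof (rule has_vector_derivative_transform[OF that _
      has_vector_derivative_If_within_closures[where S = "{0..T/2}" and T = "{T/2..T}" and f = "\<lambda>t. x + s (2*t/T) *\<^sub>R (z - x)"
        and g = "\<lambda>t. y + s (2 - 2*t/T) *\<^sub>R (z - y)"]])
    show "?c t = (if t \<in> {0..T/2} then x + s (2*t/T) *\<^sub>R (z - x) else y + s (2 - 2*t/T) *\<^sub>R (z - y))" if "t \<in> {0..T}" for t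
      using that by (auto simp: profile_curve_def)
    show "((\<lambda>t. x + s (2*t/T) *\<^sub>R (z - x)) has_vector_derivative f' t) (at t within {0..T/2} \<union> closure {0..T/2} \<inter> closure {T/2..T})"
      unfolding f'_def by (rule halves)
    show "((\<lambda>t. y + s (2 - 2*t/T) *\<^sub>R (z - y)) has_vector_derivative g' t) (at t within {T/2..T} \<union> closure {0..T/2} \<inter> closure {T/2..T})"
      unfolding g'_def by (rule halves)
    assume "t \<in> closure {0..T/2}" "t \<in> closure {T/2..T}"
    then have t: "t = T/2" by simp
    show "x + s (2*t/T) *\<^sub>R (z - x) = y + s (2 - 2*t/T) *\<^sub>R (z - y)" "f' t = g' t" unfolding t using h T s01 by auto
  qed (use that TT in auto)
  moreover have "continuous_on {0..T} (\<lambda>t. if t \<in> {0..T/2} then f' t else g' t)"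
    unfolding TT(1)
  proof (rule continuous_on_cases)
    show "continuous_on {0..T/2} f'" "continuous_on {T/2..T} g'" unfolding f'_def[abs_def] g'_def[abs_def] by (rule halves)+
    show "\<forall>t. t \<in> {0..T/2} \<and> t \<notin> {0..T/2} \<or> t \<in> {T/2..T} \<and> t \<in> {0..T/2} \<longrightarrow> f' t = g' t"
    proof (intro allI impI)
      fix t assume "t \<in> {0..T/2} \<and> t \<notin> {0..T/2} \<or> t \<in> {T/2..T} \<and> t \<in> {0..T/2}"
      then have t: "t = T/2" by auto
      show "f' t = g' t" unfolding t using h by simp
    qed
  qed auto
  ultimately show ?thesis
    unfolding C1_on_def by (intro CollectI exI[of _ "\<lambda>t. if t \<in> {0..T/2} then f' t else g' t"] conjI ballI)
qed

lemma profile_energy: "energy T (profile_curve s T x z y) \<le> ennreal (c^2 * ((norm (x - z))^2 / T + (norm (z - y))^2 / T))" (is "energy T ?c \<le> _")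
proof -
  define g' where "g' t = (if t \<le> T/2 then d0 t x z else d1 t z y)" for t
  have c: "c \<ge> 0" using bs[of 0] by linarith
  have "energy T ?c \<le> ennreal (T/4 * (2/T * c * norm (x - z))^2 + T/4 * (2/T * c * norm (z - y))^2)"
  proof (rule energy_le[OF T, where g' = g'])
    fix t :: real assume t: "0 < t" "t < T/2"
    have "(?c has_vector_derivative d0 t x z) (at t)"
      by (rule has_vector_derivative_transform_within_open[OF halves(1), of "{..<T/2}"]) (use t in \<open>auto simp: profile_curve_def\<close>)
    moreover have "\<bar>2/T * s' (2*t/T)\<bar> \<le> 2/T * c" unfolding abs_mult using T t by (intro mult_mono bs) (auto simp: field_simps)
    from mult_right_mono[OF this norm_ge_zero[of "z - x"]]
    have "norm (d0 t x z) \<le> 2/T * c * norm (x - z)" by (simp only: norm_scaleR norm_minus_commute)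
    ultimately show "(?c has_vector_derivative g' t) (at t) \<and> norm (g' t) \<le> 2/T * c * norm (x - z)"
      using t by (simp add: g'_def)
  next
    fix t :: real assume t: "T/2 < t" "t < T"
    have "(?c has_vector_derivative d1 t z y) (at t)"
      by (rule has_vector_derivative_transform_within_open[OF halves(2), of "{T/2<..}"]) (use t in \<open>auto simp: profile_curve_def\<close>)
    moreover have "\<bar>- (2/T) * s' (2 - 2*t/T)\<bar> \<le> 2/T * c" unfolding abs_mult using T t by (intro mult_mono bs) (auto simp: field_simps)
    from mult_right_mono[OF this norm_ge_zero[of "z - y"]]
    have "norm (d1 t z y) \<le> 2/T * c * norm (z - y)" by (simp only: norm_scaleR)
    ultimately show "(?c has_vector_derivative g' t) (at t) \<and> norm (g' t) \<le> 2/T * c * norm (z - y)"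
      using t by (simp add: g'_def)
  qed
  also have "T/4 * (2/T * c * norm (x - z))^2 + T/4 * (2/T * c * norm (z - y))^2 = c^2 * ((norm (x - z))^2 / T + (norm (z - y))^2 / T)"
    using T by (simp add: power2_eq_square field_simps)
  finally show ?thesis .
qed

end

lemma profile_linear: "T > 0 \<Longrightarrow> profile (\<lambda>u. u) (\<lambda>u. 1) 1 T"
  by unfold_locales auto

text \<open>With k = n + 1 this is s(u) = ((k+1) u - u^(k+1)) / k. Its derivative (k+1)(1 - u^k)/k
  vanishes at 1 and is bounded by (k+1)/k, which tends to 1.\<close>

lemma profile_smooth:
  assumes "T > 0"
  shows "profile (\<lambda>u. (real (Suc n + 1) * u - u ^ (Suc n + 1)) / real (Suc n)) (\<lambda>u. (real (Suc n + 1) - real (Suc n + 1) * u ^ Suc n) / real (Suc n))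
    (real (Suc n + 1) / real (Suc n)) T"
proof
  fix u :: real
  show "((\<lambda>u. (real (Suc n + 1) * u - u ^ (Suc n + 1)) / real (Suc n)) has_real_derivative (real (Suc n + 1) - real (Suc n + 1) * u ^ Suc n) / real (Suc n)) (at u)"
    by (auto intro!: derivative_eq_intros simp del: power_Suc)
  assume u: "0 \<le> u" "u \<le> 1"
  then have p: "0 \<le> u ^ Suc n" "u ^ Suc n \<le> 1" by (auto intro!: power_le_one zero_le_power simp del: power_Suc)
  have "0 \<le> real (Suc n + 1) * u ^ Suc n" "real (Suc n + 1) * u ^ Suc n \<le> real (Suc n + 1) * 1"
    using p by (intro mult_nonneg_nonneg mult_left_mono; simp del: power_Suc)+
  moreover have "\<bar>k - a\<bar> \<le> k" if "0 \<le> a" "a \<le> k * 1" for a k :: real using that by linarith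
  ultimately have "\<bar>real (Suc n + 1) - real (Suc n + 1) * u ^ Suc n\<bar> \<le> real (Suc n + 1)" by blast
  then show "\<bar>(real (Suc n + 1) - real (Suc n + 1) * u ^ Suc n) / real (Suc n)\<bar> \<le> real (Suc n + 1) / real (Suc n)"
    unfolding abs_divide by (simp add: divide_right_mono del: power_Suc)
qed (use assms in \<open>auto intro!: continuous_intros\<close>)

lemma broken_line_derivative_0:
  fixes x :: "'a::euclidean_space"
  assumes T: "T > 0" and g: "\<And>t. t \<in> {0..T} \<Longrightarrow> g t = broken_line T x z y t"
  shows "vector_derivative g (at 0 within {0..T}) = (2/T) *\<^sub>R (z - x)"
proof -
  interpret profile "\<lambda>u. u" "\<lambda>u. 1" 1 T by (rule profile_linear[OF T])
  have "(g has_vector_derivative (2/T * 1) *\<^sub>R (z - x)) (at 0 within {0..T})"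
    by (rule has_vector_derivative_transform_within[OF halves(1), of "T/2"]) (use g T in \<open>auto simp: broken_line_def dist_real_def\<close>)
  then show ?thesis using vector_derivative_within_cbox[of 0 T 0 g] T by simp
qed

section \<open>Value and minimisers of Problem 2\<close>

context ot_dual
begin

abbreviation "on_broken \<gamma> \<equiv> AE x in \<mu>0. \<forall>t\<in>{0..T}. \<gamma> x t = broken_line T x (Z x) (m0 x) t"

lemma J_energy: "fun2 \<gamma> = enn2ereal (\<integral>\<^sup>+x. energy T (\<gamma> x) \<partial>\<mu>0) + potential_energy Q (distr \<mu>0 borel (\<lambda>x. \<gamma> x (T/2)))"
  by (simp add: J_functional_def energy_def)

lemma AE_supp: "AE x in \<mu>0. x \<in> msupport \<mu>0" by (rule AE_msupport[OF \<mu>0(1)])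

lemma profile_admissible:
  assumes "profile s s' c T" and \<Gamma>: "\<And>x z y :: 'a. profile_curve s T x z y \<in> \<Gamma>"
  shows "adm2 \<Gamma> (\<lambda>x. profile_curve s T x (Z x) (m0 x))"
    and "fun2 (\<lambda>x. profile_curve s T x (Z x) (m0 x)) \<le> ereal (c^2 * (E0 + E1) + (\<integral>x. Q (Z x) \<partial>\<mu>0))"
proof -
  interpret p: profile s s' c T by fact
  note [measurable] = Z_borel m0_borel
  have "(\<lambda>x. profile_curve s T x (Z x) (m0 x) t) \<in> borel_measurable borel" for t
    by (cases "t \<le> T/2") (simp_all add: profile_curve_def)
  moreover have e: "(\<lambda>x. profile_curve s T x (Z x) (m0 x) T) = m0" "(\<lambda>x. profile_curve s T x (Z x) (m0 x) (T/2)) = Z"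
    using T p.s01 by (auto simp: profile_curve_def)
  moreover have "profile_curve s T x (Z x) (m0 x) 0 = x" for x using T p.s01 by (simp add: profile_curve_def)
  ultimately show "adm2 \<Gamma> (\<lambda>x. profile_curve s T x (Z x) (m0 x))"
    using \<Gamma> push_m0 by (simp add: admissible2_def)
  have k: "0 \<le> kin0 x" "0 \<le> kin1 x" for x using T by (auto simp: kin0_def kin1_def)
  have "(\<integral>\<^sup>+x. energy T (profile_curve s T x (Z x) (m0 x)) \<partial>\<mu>0) \<le> (\<integral>\<^sup>+x. ennreal (c^2 * (kin0 x + kin1 x)) \<partial>\<mu>0)"
    unfolding kin0_def kin1_def by (intro nn_integral_mono p.profile_energy)
  also have "\<dots> = ennreal (\<integral>x. c^2 * (kin0 x + kin1 x) \<partial>\<mu>0)" using ikin k by (intro nn_integral_eq_integral) auto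
  also have "(\<integral>x. c^2 * (kin0 x + kin1 x) \<partial>\<mu>0) = c^2 * (E0 + E1)" using ikin by simp
  finally have le: "(\<integral>\<^sup>+x. energy T (profile_curve s T x (Z x) (m0 x)) \<partial>\<mu>0) \<le> ennreal (c^2 * (E0 + E1))" .
  have nn: "0 \<le> c^2 * (E0 + E1)" using k by (auto intro!: mult_nonneg_nonneg add_nonneg_nonneg Bochner_Integration.integral_nonneg)
  have "enn2ereal (\<integral>\<^sup>+x. energy T (profile_curve s T x (Z x) (m0 x)) \<partial>\<mu>0) \<le> ereal (c^2 * (E0 + E1))"
    using le unfolding less_eq_ennreal.rep_eq enn2ereal_ennreal[OF nn] .
  then show "fun2 (\<lambda>x. profile_curve s T x (Z x) (m0 x)) \<le> ereal (c^2 * (E0 + E1) + (\<integral>x. Q (Z x) \<partial>\<mu>0))"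
    unfolding J_energy e(2) \<rho>s_def[symmetric] PE_\<rho>s plus_ereal.simps(1)[symmetric] by (intro add_mono) auto
qed

lemma broken_admissible:
  shows "adm2 (kinked_curves T) (\<lambda>x. broken_line T x (Z x) (m0 x))"
    and "fun2 (\<lambda>x. broken_line T x (Z x) (m0 x)) \<le> ereal val"
  using profile_admissible[OF profile_linear[OF T], of "kinked_curves T"] profile.profile_kinked[OF profile_linear[OF T]] kin_val
  by (auto simp: profile_curve_id algebra_simps)

lemma C1_kinked: "C1_curves T \<subseteq> kinked_curves T"
  using T by (auto intro: C1_on_subset)

text \<open>The profiles of \<open>profile_smooth\<close> multiply the kinetic part by c^2, which
  tends to 1, and leave the midpoint and the end unchanged. So the restriction to C1 curves does not
  raise the infimum.\<close>

lemma C1_approx: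
  assumes \<Gamma>: "\<Gamma> \<in> {C1_curves T, kinked_curves T}" and e: "e > 0"
  shows "\<exists>\<gamma>. adm2 \<Gamma> \<gamma> \<and> fun2 \<gamma> \<le> ereal (val + e)"
proof -
  define K where "K = E0 + E1"
  have "(\<lambda>n. (1 + inverse (real (Suc n)))^2 * K) \<longlonglongrightarrow> (1 + 0)^2 * K"
    by (intro tendsto_intros LIMSEQ_inverse_real_of_nat)
  moreover have "(1 + 0)^2 * K < K + e" using e by simp
  ultimately have "\<forall>\<^sub>F n in sequentially. (1 + inverse (real (Suc n)))^2 * K < K + e" by (rule order_tendstoD)
  then obtain n where n: "(1 + inverse (real (Suc n)))^2 * K < K + e" using eventually_happens by force
  let ?s = "\<lambda>u. (real (Suc n + 1) * u - u ^ (Suc n + 1)) / real (Suc n)"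
  have c: "real (Suc n + 1) / real (Suc n) = 1 + inverse (real (Suc n))" by (simp add: field_simps)
  note p = profile_smooth[OF T, of n]
  have "profile_curve ?s T x z y \<in> C1_curves T" for x z y :: 'a by (rule profile.profile_C1[OF p]) simp
  then have g: "profile_curve ?s T x z y \<in> \<Gamma>" for x z y :: 'a using \<Gamma> C1_kinked by blast
  note A = profile_admissible[OF p g]
  have "(real (Suc n + 1) / real (Suc n))^2 * K + (\<integral>x. Q (Z x) \<partial>\<mu>0) \<le> val + e" unfolding c using n kin_val by (simp add: K_def)
  then show ?thesis using A order.trans[OF A(2)] unfolding K_def by (intro exI conjI[OF A(1)]) auto
qed

text \<open>The energy of the polygon through the positions at 0, t, T/2 and T. It exceeds
  \<open>len2\<close> unless the curve is on its own broken line at time t.\<close>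

definition len3 :: "real \<Rightarrow> (real \<Rightarrow> 'a) \<Rightarrow> real" where
  "len3 t g = (if t < T/2 then chord g 0 t + chord g t (T/2) + chord g (T/2) T
    else chord g 0 (T/2) + chord g (T/2) t + chord g t T)"

definition len2 :: "(real \<Rightarrow> 'a) \<Rightarrow> real" where "len2 g = chord g 0 (T/2) + chord g (T/2) T"

lemma len2_le: "0 < t \<Longrightarrow> t < T \<Longrightarrow> t \<noteq> T/2 \<Longrightarrow> len2 g \<le> len3 t g"
  using chord_split_ge[of 0 t "T/2" g] chord_split_ge[of "T/2" t T g] by (auto simp: len3_def len2_def)

lemma len3_energy:
  assumes "g \<in> kinked_curves T" "0 < t" "t < T" "t \<noteq> T/2" shows "ennreal (len3 t g) \<le> energy T g"
proof (cases "t < T/2")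
  case True
  then show ?thesis unfolding len3_def using assms
    by (simp del: ennreal_plus, intro energy_ge3) (auto intro: C1_on_subset)
next
  case False
  then show ?thesis unfolding len3_def using assms
    by (simp del: ennreal_plus, intro energy_ge3) (auto intro: C1_on_subset)
qed

lemma len3_eqD:
  assumes "0 < t" "t < T" "t \<noteq> T/2" "len3 t g = len2 g"
  shows "g t = broken_line T (g 0) (g (T/2)) (g T) t"
proof (cases "t < T/2")
  case True
  have "g t = g 0 + ((t - 0) / (T/2 - 0)) *\<^sub>R (g (T/2) - g 0)"
    by (rule chord_split_eqD) (use True assms in \<open>auto simp: len3_def len2_def\<close>)
  then show ?thesis using True by (simp add: broken_line_def mult.commute)
next
  case False
  have "g t = g (T/2) + ((t - T/2) / (T - T/2)) *\<^sub>R (g T - g (T/2))"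
    by (rule chord_split_eqD) (use False assms in \<open>auto simp: len3_def len2_def\<close>)
  moreover have "(t - T/2) / (T - T/2) = 2*t/T - 1" using T by (simp add: field_simps)
  ultimately show ?thesis using False assms by (simp add: broken_line_def)
qed

lemma kinked_continuous:
  assumes "g \<in> kinked_curves T" shows "continuous_on {0..T} g"
proof -
  have "continuous_on {a..b} g" if "g \<in> C1_on a b" for a b
    using that unfolding C1_on_def continuous_on_eq_continuous_within
    by (auto dest: has_vector_derivative_continuous)
  then have "continuous_on ({0..T/2} \<union> {T/2..T}) g" using assms by (intro continuous_on_closed_Un) auto
  then show ?thesis using T by (simp add: ivl_disj_un_two_touch(4))
qed

text \<open>Almost everywhere statements can be collected over countably many times only. Rational
  times away from 0, T/2 and T are dense in [0,T], and continuity supplies the rest.\<close>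

lemma kinked_eq_broken:
  fixes x z y :: 'a
  assumes g: "g \<in> kinked_curves T" and eq: "\<And>t. t \<in> \<rat> \<Longrightarrow> 0 < t \<Longrightarrow> t < T \<Longrightarrow> t \<noteq> T/2 \<Longrightarrow> g t = broken_line T x z y t"
    and t: "t \<in> {0..T}"
  shows "g t = broken_line T x z y t"
proof -
  define A where "A = {0<..<T/2} \<union> {T/2<..<T}"
  have "closure (A \<inter> \<rat>) = closure A" by (rule closure_open_Int_superset) (auto simp: A_def Rats_closure_real)
  also have "\<dots> = {0..T}" using T by (auto simp: A_def closure_Un)
  finally have cl: "closure (A \<inter> \<rat>) = {0..T}" .
  have "broken_line T x z y \<in> kinked_curves T"
    using profile.profile_kinked[OF profile_linear[OF T], of x z y] by (simp only: profile_curve_id)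
  then have "continuous_on {0..T} (\<lambda>t. g t - broken_line T x z y t)"
    by (intro continuous_on_diff kinked_continuous g)
  then have "g t - broken_line T x z y t = 0"
  proof (rule continuous_constant_on_closure[of "A \<inter> \<rat>", unfolded cl])
    fix r assume "r \<in> A \<inter> \<rat>"
    then have "r \<in> \<rat>" "0 < r" "r < T" "r \<noteq> T/2" using T by (auto simp: A_def)
    from eq[OF this] show "g r - broken_line T x z y r = 0" by simp
  qed (rule t)
  then show ?thesis by simp
qed

text \<open>Three nonnegative defects add up to at most J - val: that of the curve against its
  polygon at time t, that of its midpoint against the best one for its ends, and that of its end map
  against the optimal map. If J does not exceed val, all of them vanish.\<close>

lemma J_lower:
  assumes adm: "adm2 (kinked_curves T) \<gamma>"
  shows "ereal val \<le> fun2 \<gamma>"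
    and "fun2 \<gamma> \<le> ereal val \<Longrightarrow> on_broken \<gamma>"
proof -
  have sx: "\<gamma> x \<in> kinked_curves T" "\<gamma> x 0 = x" if "x \<in> msupport \<mu>0" for x using adm that by (auto simp: admissible2_def)
  have gm: "(\<lambda>x. \<gamma> x t) \<in> borel_measurable borel" if "0 \<le> t" "t \<le> T" for t using adm that by (simp add: admissible2_def)
  define z where "z = (\<lambda>x. \<gamma> x (T/2))"
  define y where "y = (\<lambda>x. \<gamma> x T)"
  have zy: "z \<in> borel_measurable borel" "y \<in> borel_measurable borel" unfolding z_def y_def by (rule gm; use T in simp)+
  note [measurable] = zy qs_borel
  note [measurable_cong] = \<mu>0(1)
  have yT: "distr \<mu>0 borel y = \<mu>T" using adm by (simp add: admissible2_def y_def)
  have AEy: "AE x in \<mu>0. y x \<in> \<Omega>T"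
  proof (rule AE_distrD[where M' = borel and f = y and P = "\<lambda>x. x \<in> \<Omega>T"])
    show "y \<in> measurable \<mu>0 borel" by measurable
    show "AE x in distr \<mu>0 borel y. x \<in> \<Omega>T" unfolding yT by (rule \<mu>T(3))
  qed
  note tf = transport_facts[OF zy(2) yT AEy]
  let ?E = "\<integral>\<^sup>+x. energy T (\<gamma> x) \<partial>\<mu>0"
  have "ereal val \<le> fun2 \<gamma> \<and> (fun2 \<gamma> \<le> ereal val \<longrightarrow> (on_broken \<gamma>))"
  proof (cases "?E = \<infinity>")
    case True then show ?thesis by (simp add: J_energy)
  next
    case False
    then obtain e where e: "e \<ge> 0" "?E = ennreal e" by (cases ?E) auto
    have lm: "(\<lambda>x. chord (\<gamma> x) a b) \<in> borel_measurable \<mu>0" if "0 \<le> a" "a \<le> T" "0 \<le> b" "b \<le> T" for a b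
      unfolding chord_def using gm[of a] gm[of b] that by measurable
    have l0m: "(\<lambda>x. len2 (\<gamma> x)) \<in> borel_measurable \<mu>0" unfolding len2_def using lm T by auto
    \<comment> \<open>Admissibility makes the position at each fixed time measurable in x, hence
      also \<open>len3\<close>. The energy itself occurs only as the larger side of a comparison of
      nonnegative integrals.\<close>
    have l_int: "integrable \<mu>0 (\<lambda>x. len3 t (\<gamma> x))" "(\<integral>x. len3 t (\<gamma> x) \<partial>\<mu>0) \<le> e" if t: "0 < t" "t < T" "t \<noteq> T/2" for t
    proof -
      have nn: "0 \<le> len3 t g" for g using t T by (auto simp: len3_def chord_def)
      have m: "(\<lambda>x. len3 t (\<gamma> x)) \<in> borel_measurable \<mu>0" unfolding len3_def using lm T t by auto
      have le: "(\<integral>\<^sup>+x. ennreal (len3 t (\<gamma> x)) \<partial>\<mu>0) \<le> ennreal e"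
        unfolding e(2)[symmetric]
      proof (rule nn_integral_mono_AE)
        show "AE x in \<mu>0. ennreal (len3 t (\<gamma> x)) \<le> energy T (\<gamma> x)"
          using AE_supp by eventually_elim (rule len3_energy[OF sx(1) t])
      qed
      show i: "integrable \<mu>0 (\<lambda>x. len3 t (\<gamma> x))"
        using m nn le by (intro integrableI_bounded) (auto intro: order.strict_trans1)
      from le show "(\<integral>x. len3 t (\<gamma> x) \<partial>\<mu>0) \<le> e" using nn_integral_eq_integral[OF i] nn e by simp
    qed
    have l0: "AE x in \<mu>0. len2 (\<gamma> x) = (norm (x - z x))^2 / T + (norm (z x - y x))^2 / T"
      using AE_supp
    proof eventually_elim
      case (elim x) show ?case using sx(2)[OF elim] T by (simp add: len2_def chord_def z_def y_def norm_minus_commute)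
    qed
    have nn0: "0 \<le> len2 g" for g using T by (simp add: len2_def chord_def)
    \<comment> \<open>Any time other than 0, T/2 and T would do where a single inner time is
      needed.\<close>
    have t4: "0 < T/4" "T/4 < T" "T/4 \<noteq> T/2" using T by auto
    have "norm (len2 g) \<le> norm (len3 (T/4) g)" for g using nn0[of g] len2_le[OF t4, of g] by simp
    then have i0: "integrable \<mu>0 (\<lambda>x. len2 (\<gamma> x))"
      by (intro Bochner_Integration.integrable_bound[OF l_int(1)[OF t4] l0m] AE_I2)
    \<comment> \<open>Finite energy bounds the second moment of the midpoint, so its law is in
      \<open>P2\<close> and its potential energy cannot be -\<infinity>.\<close>
    have iz: "integrable \<mu>0 (\<lambda>x. (norm (z x))^2)"
    proof (rule Bochner_Integration.integrable_bound)
      show "integrable \<mu>0 (\<lambda>x. 2 * (norm x)^2 + 2 * T * len2 (\<gamma> x))" using iN(1) i0 by simp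
      show "AE x in \<mu>0. norm ((norm (z x))^2) \<le> norm (2 * (norm x)^2 + 2 * T * len2 (\<gamma> x))"
        using l0
      proof eventually_elim
        case (elim x)
        have "0 \<le> (norm (2 *\<^sub>R x - z x))^2" by simp
        then have a: "(norm (z x))^2 \<le> 2 * (norm x)^2 + 2 * (norm (x - z x))^2"
          unfolding power2_norm_eq_inner by (simp add: inner_simps inner_commute)
        have "(norm (x - z x))^2 = T * ((norm (x - z x))^2 / T)" using T by simp
        also have "\<dots> \<le> T * len2 (\<gamma> x)" unfolding elim using T by (intro mult_left_mono) auto
        finally show ?case using a by simp
      qed
    qed measurable
    let ?\<rho> = "distr \<mu>0 borel z"
    have P: "P2 ?\<rho>" by (rule P2_distr[OF zy(1) iz])
    have J: "fun2 \<gamma> = ereal e + potential_energy Q ?\<rho>" unfolding J_energy e(2) z_def using e(1) by simp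
    show ?thesis
    proof (cases "integrable ?\<rho> Q")
      case False then show ?thesis using PE_cases[OF P] J by auto
    next
      case True
      have zm: "z \<in> measurable \<mu>0 borel" by measurable
      have iQ: "integrable \<mu>0 (\<lambda>x. Q (z x))" by (rule integrable_distr[OF zm True])
      have J: "fun2 \<gamma> = ereal (e + (\<integral>x. Q (z x) \<partial>\<mu>0))"
        unfolding J using PE_integrable[OF True] integral_distr[OF zm Q_borel] by simp
      have ym: "y \<in> measurable \<mu>0 borel" by measurable
      have iy: "integrable \<mu>0 (\<lambda>x. (norm (y x))^2)"
        by (rule integrable_distr[OF ym]) (simp only: yT iN(2))
      have vy: "(\<integral>x. (norm (y x))^2 \<partial>\<mu>0) = (\<integral>y. (norm y)^2 \<partial>\<mu>T)"
        unfolding yT[symmetric] by (subst integral_distr) auto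
      define pw where "pw x = ((norm x)^2 + (norm (y x))^2) / T - 2/T * qs (x + y x)" for x
      have ipw: "integrable \<mu>0 pw" unfolding pw_def using iN(1) iy tf(1) by simp
      have vpw: "(\<integral>x. pw x \<partial>\<mu>0) = val + 2/T * (D - (\<integral>x. qs (x + y x) \<partial>\<mu>0))"
        unfolding pw_def val_def using iN(1) iy tf(1) vy by (simp add: add_divide_distrib right_diff_distrib)
      have pwge: "AE x in \<mu>0. 0 \<le> len2 (\<gamma> x) + Q (z x) - pw x"
        using l0
      proof eventually_elim
        case (elim x) show ?case unfolding elim pw_def using pointwise_ge[of x "y x" "z x"] by linarith
      qed
      have ige: "integrable \<mu>0 (\<lambda>x. len2 (\<gamma> x) + Q (z x) - pw x)" using i0 iQ ipw by simp
      have nn1: "0 \<le> (\<integral>x. len2 (\<gamma> x) + Q (z x) - pw x \<partial>\<mu>0)" using pwge by (rule integral_nonneg_AE)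
      have nn2: "0 \<le> 2/T * (D - (\<integral>x. qs (x + y x) \<partial>\<mu>0))" using tf(2) T by simp
      have nn3: "0 \<le> (\<integral>x. len3 t (\<gamma> x) - len2 (\<gamma> x) \<partial>\<mu>0)" if "0 < t" "t < T" "t \<noteq> T/2" for t
        using len2_le[OF that] by (intro integral_nonneg_AE) auto
      have total: "(\<integral>x. len3 t (\<gamma> x) - len2 (\<gamma> x) \<partial>\<mu>0) + (\<integral>x. len2 (\<gamma> x) + Q (z x) - pw x \<partial>\<mu>0) + 2/T * (D - (\<integral>x. qs (x + y x) \<partial>\<mu>0))
          \<le> e + (\<integral>x. Q (z x) \<partial>\<mu>0) - val" if "0 < t" "t < T" "t \<noteq> T/2" for t
        using l_int[OF that] i0 iQ ipw vpw by simp
      have "val \<le> e + (\<integral>x. Q (z x) \<partial>\<mu>0)" using total[OF t4] nn3[OF t4] nn1 nn2 by linarith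
      moreover have "on_broken \<gamma>" if le: "e + (\<integral>x. Q (z x) \<partial>\<mu>0) \<le> val"
      proof -
        have "2/T * (D - (\<integral>x. qs (x + y x) \<partial>\<mu>0)) \<le> 0" using total[OF t4] nn3[OF t4] nn1 le by linarith
        then have ym: "AE x in \<mu>0. y x = m0 x" 
          using T by (intro tf(3)) (auto simp only: mult_le_0_iff divide_le_0_iff)
        have "(\<integral>x. len2 (\<gamma> x) + Q (z x) - pw x \<partial>\<mu>0) = 0" using total[OF t4] nn3[OF t4] nn1 nn2 le by linarith
        then have zc: "AE x in \<mu>0. len2 (\<gamma> x) + Q (z x) - pw x = 0"
          using integral_nonneg_eq_0_iff_AE[OF ige pwge] by simp
        have lt: "AE x in \<mu>0. len3 t (\<gamma> x) = len2 (\<gamma> x)" if t: "0 < t" "t < T" "t \<noteq> T/2" for t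
        proof -
          have "(\<integral>x. len3 t (\<gamma> x) - len2 (\<gamma> x) \<partial>\<mu>0) = 0" using total[OF t] nn3[OF t] nn1 nn2 le by linarith
          then have "AE x in \<mu>0. len3 t (\<gamma> x) - len2 (\<gamma> x) = 0"
            using integral_nonneg_eq_0_iff_AE[of \<mu>0 "\<lambda>x. len3 t (\<gamma> x) - len2 (\<gamma> x)"] l_int(1)[OF t] i0 len2_le[OF t] by simp
          then show ?thesis by eventually_elim simp
        qed
        have "AE x in \<mu>0. \<forall>t\<in>{t\<in>\<rat>. 0 < t \<and> t < T \<and> t \<noteq> T/2}. len3 t (\<gamma> x) = len2 (\<gamma> x)"
          by (subst AE_ball_countable) (use lt countable_rat in \<open>auto intro: countable_subset\<close>)
        then show ?thesis using AE_supp ym zc l0 AE_good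
        proof eventually_elim
          case (elim x)
          note s = sx[OF elim(2)]
          have "(norm (x - z x))^2 / T + Q (z x) + (norm (z x - y x))^2 / T = ((norm x)^2 + (norm (y x))^2) / T - 2/T * qs (x + y x)"
            using elim(4) unfolding elim(5) pw_def by linarith
          from pointwise_eqD[OF this] have zz: "z x = Z x" using contact(3)[OF elim(6)] elim(3) by (simp add: Z_def)
          show ?case
          proof
            fix t assume t: "t \<in> {0..T}"
            show "\<gamma> x t = broken_line T x (Z x) (m0 x) t"
            proof (rule kinked_eq_broken[OF s(1) _ t])
              fix r assume r: "r \<in> \<rat>" "0 < r" "r < T" "r \<noteq> T/2"
              then have "len3 r (\<gamma> x) = len2 (\<gamma> x)" using elim(1) by simp
              from len3_eqD[OF r(2-4) this] show "\<gamma> x r = broken_line T x (Z x) (m0 x) r"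
                using zz elim(3) s(2) by (simp add: z_def y_def)
            qed
          qed
        qed
      qed
      ultimately show ?thesis unfolding J by simp
    qed
  qed
  then show "ereal val \<le> fun2 \<gamma>" "fun2 \<gamma> \<le> ereal val \<Longrightarrow> on_broken \<gamma>" by auto
qed

lemma adm2_kinked:
  assumes "\<Gamma> \<in> {C1_curves T, kinked_curves T}" "adm2 \<Gamma> \<gamma>"
  shows "adm2 (kinked_curves T) \<gamma>"
  using assms C1_kinked unfolding admissible2_def by blast

lemma INF_J:
  assumes \<Gamma>: "\<Gamma> \<in> {C1_curves T, kinked_curves T}"
  shows "(INF \<gamma>\<in>Collect (adm2 \<Gamma>). fun2 \<gamma>) = ereal val"
proof (rule antisym)
  show "(INF \<gamma>\<in>Collect (adm2 \<Gamma>). fun2 \<gamma>) \<le> ereal val"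
  proof (rule ereal_le_epsilon2)
    fix e :: real assume "0 < e"
    from C1_approx[OF \<Gamma> this] obtain \<gamma> where g: "adm2 \<Gamma> \<gamma>" "fun2 \<gamma> \<le> ereal (val + e)" by blast
    have "(INF \<gamma>\<in>Collect (adm2 \<Gamma>). fun2 \<gamma>) \<le> fun2 \<gamma>" by (rule INF_lower) (use g in simp)
    then show "(INF \<gamma>\<in>Collect (adm2 \<Gamma>). fun2 \<gamma>) \<le> ereal val + ereal e" using g(2) by simp
  qed
  show "ereal val \<le> (INF \<gamma>\<in>Collect (adm2 \<Gamma>). fun2 \<gamma>)"
    by (rule INF_greatest) (use J_lower(1) adm2_kinked[OF \<Gamma>] in auto)
qed

text \<open>Over C1 curves a minimiser may fail to exist, and then both sides are false for every
  \<gamma>. The comparison is therefore made with the infimum and not with a minimiser.\<close>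

lemma opt2_iff:
  assumes \<Gamma>: "\<Gamma> \<in> {C1_curves T, kinked_curves T}"
  shows "opt2 \<Gamma> \<gamma> \<longleftrightarrow> adm2 \<Gamma> \<gamma> \<and> (on_broken \<gamma>)"
proof
  assume o: "opt2 \<Gamma> \<gamma>"
  then have a: "adm2 \<Gamma> \<gamma>" by (simp add: is_arg_min_def)
  have "fun2 \<gamma> \<le> (INF \<gamma>\<in>Collect (adm2 \<Gamma>). fun2 \<gamma>)"
    by (rule INF_greatest) (use o in \<open>auto simp: is_arg_min_def not_less\<close>)
  then show "adm2 \<Gamma> \<gamma> \<and> (on_broken \<gamma>)"
    using a J_lower(2)[OF adm2_kinked[OF \<Gamma> a]] INF_J[OF \<Gamma>] by simp
next
  assume r: "adm2 \<Gamma> \<gamma> \<and> (on_broken \<gamma>)"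
  have T2: "T/2 \<in> {0..T}" using T by simp
  have zb: "broken_line T x (Z x) (m0 x) (T/2) = Z x" for x using T by (simp add: broken_line_def)
  have "(\<integral>\<^sup>+x. energy T (\<gamma> x) \<partial>\<mu>0) = (\<integral>\<^sup>+x. energy T (broken_line T x (Z x) (m0 x)) \<partial>\<mu>0)"
    using r by (intro nn_integral_cong_AE) (auto elim!: eventually_mono intro!: energy_cong)
  moreover have "distr \<mu>0 borel (\<lambda>x. \<gamma> x (T/2)) = distr \<mu>0 borel (\<lambda>x. broken_line T x (Z x) (m0 x) (T/2))"
  proof (rule distr_cong_AE[OF refl refl])
    show "AE x in \<mu>0. \<gamma> x (T/2) = broken_line T x (Z x) (m0 x) (T/2)" using conjunct2[OF r] by eventually_elim (use T2 in blast)
    have "(\<lambda>x. \<gamma> x (T/2)) \<in> borel_measurable borel" using r T2 by (auto simp: admissible2_def)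
    then show "(\<lambda>x. \<gamma> x (T/2)) \<in> measurable \<mu>0 borel" using \<mu>0(1) by (simp cong: measurable_cong_sets)
    show "(\<lambda>x. broken_line T x (Z x) (m0 x) (T/2)) \<in> measurable \<mu>0 borel" unfolding zb by (rule Z_meas)
  qed
  ultimately have "fun2 \<gamma> \<le> ereal val" using broken_admissible(2) by (simp add: J_energy)
  then show "opt2 \<Gamma> \<gamma>"
    using r J_lower(1)[OF adm2_kinked[OF \<Gamma>]] by (auto simp: is_arg_min_def not_less intro: order.trans)
qed

end

section \<open>Recovering the initial position from the interpolated one\<close>

context half_problem
begin

text \<open>The conjugate of the interpolated potential with s as an argument: the velocity field
  built from it has to be Borel in time and space jointly.\<close>

definition G :: "real \<Rightarrow> 'a \<Rightarrow> real" where "G s z = (SUP x\<in>X. x \<bullet> z - interp s x)"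

lemma G_bounded: "bdd_above ((\<lambda>x. x \<bullet> z - interp s x) ` X)"
proof -
  have "continuous_on X (\<lambda>x. x \<bullet> z - interp s x)" unfolding interp_def by (intro continuous_intros cont) simp_all
  from bounded_on_X[OF this] obtain B where "\<forall>x\<in>X. \<bar>x \<bullet> z - interp s x\<bar> \<le> B" by blast
  then show ?thesis by (intro bdd_aboveI[of _ B]) (auto simp: abs_le_iff)
qed

lemma G_ge: "x \<in> X \<Longrightarrow> x \<bullet> z - interp s x \<le> G s z"
  unfolding G_def by (intro cSUP_upper G_bounded)

lemma G_le: "(\<And>x. x \<in> X \<Longrightarrow> x \<bullet> z - interp s x \<le> B) \<Longrightarrow> G s z \<le> B"
  unfolding G_def using X_ne by (intro cSUP_least)

text \<open>Each function in the supremum is affine in (s, z). Its coefficients are x and |x|^2/2 -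
  \<Psi> x, both bounded on X, which gives one Lipschitz constant for all of them.\<close>

lemma G_continuous: "continuous_on UNIV (\<lambda>p. G (fst p) (snd p))"
proof -
  obtain R where R: "\<And>x. x \<in> X \<Longrightarrow> norm x \<le> R" using compact_imp_bounded[OF X] by (auto simp: bounded_iff)
  have R0: "R \<ge> 0" using R X_ne norm_ge_zero order.trans by blast
  have "continuous_on X (\<lambda>x. (norm x)^2 / 2 - \<Psi> x)" by (intro continuous_intros cont) simp_all
  from bounded_on_X[OF this] obtain C where C: "\<forall>x\<in>X. \<bar>(norm x)^2 / 2 - \<Psi> x\<bar> \<le> C" by blast
  have C0: "C \<ge> 0" using C X_ne abs_ge_zero order.trans by blast
  have le: "G (fst p) (snd p) \<le> G (fst p') (snd p') + (R + C) * norm (p - p')" for p p'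
  proof (rule G_le)
    fix x assume x: "x \<in> X"
    have n: "\<bar>fst p - fst p'\<bar> \<le> norm (p - p')" "norm (snd p - snd p') \<le> norm (p - p')"
      using norm_fst_le[of "fst (p - p')" "snd (p - p')"] norm_snd_le[of "snd (p - p')" "fst (p - p')"]
      unfolding prod.collapse by auto
    have "x \<bullet> (snd p - snd p') \<le> norm x * norm (snd p - snd p')" by (rule norm_cauchy_schwarz)
    also have "\<dots> \<le> R * norm (p - p')"
      using R[OF x] R0 n(2) by (intro mult_mono) auto
    finally have a: "x \<bullet> (snd p - snd p') \<le> R * norm (p - p')" .
    have "(fst p - fst p') * ((norm x)^2 / 2 - \<Psi> x) \<le> \<bar>fst p - fst p'\<bar> * \<bar>(norm x)^2 / 2 - \<Psi> x\<bar>"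
      unfolding abs_mult[symmetric] by (rule abs_ge_self)
    also have "\<dots> \<le> norm (p - p') * C"
      using C x n(1) by (intro mult_mono) auto
    finally have b: "(fst p - fst p') * ((norm x)^2 / 2 - \<Psi> x) \<le> C * norm (p - p')" by (simp add: mult.commute)
    have "x \<bullet> snd p - interp (fst p) x = (x \<bullet> snd p' - interp (fst p') x) + x \<bullet> (snd p - snd p') + (fst p - fst p') * ((norm x)^2 / 2 - \<Psi> x)"
    proof -
      have "a - ((1 - s) * N + s * P) = (b - ((1 - s') * N + s' * P)) + (a - b) + (s - s') * (N - P)" for a b s s' N P :: real
        by (simp add: algebra_simps)
      then show ?thesis unfolding interp_def inner_diff_right .
    qed
    then show "x \<bullet> snd p - interp (fst p) x \<le> G (fst p') (snd p') + (R + C) * norm (p - p')"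
      using a b G_ge[OF x, of "snd p'" "fst p'"] by (simp add: distrib_right)
  qed
  have "\<bar>G (fst p) (snd p) - G (fst p') (snd p')\<bar> \<le> (R + C) * norm (p - p')" for p p'
    using le[of p p'] le[of p' p] by (simp add: norm_minus_commute abs_le_iff)
  from Lipschitz_continuous[of "\<lambda>p. G (fst p) (snd p)", OF this] show ?thesis .
qed

text \<open>\<open>interp s\<close> is \<open>(1 - s)\<close>-strongly convex, so its conjugate \<open>G s\<close> is differentiable at
  \<open>grad (interp s) x\<close>, with gradient \<open>x\<close>.\<close>

lemma G_expansion:
  assumes x: "x \<in> X" "\<Psi> differentiable at x" and s: "0 \<le> s" "s < 1" and z: "z = (1 - s) *\<^sub>R x + s *\<^sub>R grad \<Psi> x"
  shows "\<bar>G s (z + h) - G s z - x \<bullet> h\<bar> \<le> (norm h)^2 / (2 * (1 - s))"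
proof -
  have up: "G s (z + h) \<le> x \<bullet> (z + h) - interp s x + (norm h)^2 / (2 * (1 - s))" for h
  proof (rule G_le)
    fix y assume "y \<in> X"
    have "interp s x + z \<bullet> (y - x) + (1 - s) / 2 * (norm (y - x))^2 \<le> interp s y"
    proof -
      have "s * (\<Psi> x + grad \<Psi> x \<bullet> (y - x)) \<le> s * \<Psi> y"
        using subgradient[OF differentiable_GDERIV[OF x(2)], of y] s by (intro mult_left_mono) auto
      moreover have "(1 - s) * ((norm x)^2 / 2) + (1 - s) * (x \<bullet> (y - x)) + (1 - s) / 2 * (norm (y - x))^2 = (1 - s) * ((norm y)^2 / 2)"
      proof -
        have "(norm x)^2 / 2 + x \<bullet> (y - x) + (norm (y - x))^2 / 2 = (norm y)^2 / 2"
          unfolding power2_norm_eq_inner by (simp add: inner_simps inner_commute add_divide_distrib diff_divide_distrib)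
        then have "(1 - s) * ((norm x)^2 / 2 + x \<bullet> (y - x) + (norm (y - x))^2 / 2) = (1 - s) * ((norm y)^2 / 2)" by simp
        then show ?thesis by (simp add: distrib_left)
      qed
      ultimately show ?thesis unfolding interp_def z by (simp add: inner_add_left distrib_left)
    qed
    moreover have "h \<bullet> (y - x) \<le> (1 - s) / 2 * (norm (y - x))^2 + (norm h)^2 / (2 * (1 - s))"
    proof -
      have "0 \<le> (norm (h - (1 - s) *\<^sub>R (y - x)))^2" by simp
      then have "2 * (1 - s) * (h \<bullet> (y - x)) \<le> (1 - s)^2 * (norm (y - x))^2 + (norm h)^2"
        unfolding power2_norm_eq_inner by (simp add: inner_simps inner_commute power2_eq_square algebra_simps)
      also have "\<dots> = 2 * (1 - s) * ((1 - s) / 2 * (norm (y - x))^2 + (norm h)^2 / (2 * (1 - s)))"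
        using s by (simp add: power2_eq_square distrib_left)
      finally show ?thesis using s by simp
    qed
    ultimately show "y \<bullet> (z + h) - interp s y \<le> x \<bullet> (z + h) - interp s x + (norm h)^2 / (2 * (1 - s))"
      by (simp add: inner_simps inner_commute)
  qed
  have lo: "x \<bullet> (z + h) - interp s x \<le> G s (z + h)" for h by (rule G_ge[OF x(1)])
  have "G s z = x \<bullet> z - interp s x" using up[of 0] lo[of 0] by simp
  moreover have "0 \<le> (norm h)^2 / (2 * (1 - s))" using s by simp
  ultimately show ?thesis using up[of h] lo[of h] unfolding abs_le_iff by (auto simp: inner_add_right)
qed

text \<open>The gradient of \<open>G s\<close> through difference quotients along 1/(n+1). Using
  \<open>lim\<close> makes it Borel everywhere, although it is evaluated only where
  \<open>G_expansion\<close> proves convergence.\<close>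

definition source :: "real \<times> 'a \<Rightarrow> 'a" where
  "source p = (\<Sum>b\<in>Basis. lim (\<lambda>n. real (Suc n) * (G (fst p) (snd p + (1 / real (Suc n)) *\<^sub>R b) - G (fst p) (snd p))) *\<^sub>R b)"

lemma source_borel: "source \<in> borel_measurable borel"
proof -
  have m: "(\<lambda>p. real (Suc n) * (G (fst p) (snd p + (1 / real (Suc n)) *\<^sub>R b) - G (fst p) (snd p))) \<in> borel_measurable borel" for n b
  proof (intro borel_measurable_continuous_onI continuous_intros G_continuous)
    show "continuous_on UNIV (\<lambda>p. G (fst p) (snd p + (1 / real (Suc n)) *\<^sub>R b))"
    proof -
      have "continuous_on UNIV (\<lambda>p::real \<times> 'a. (fst p, snd p + (1 / real (Suc n)) *\<^sub>R b))" by (intro continuous_intros)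
      from continuous_on_compose2[OF G_continuous this] show ?thesis by simp
    qed
  qed
  show ?thesis unfolding source_def[abs_def]
    by (intro borel_measurable_sum borel_measurable_scaleR borel_measurable_const borel_measurable_lim_metric m)
qed

lemma source_interp:
  assumes x: "x \<in> X" "\<Psi> differentiable at x" and s: "0 \<le> s" "s < 1"
  shows "source (s, (1 - s) *\<^sub>R x + s *\<^sub>R grad \<Psi> x) = x"
proof -
  define z where "z = (1 - s) *\<^sub>R x + s *\<^sub>R grad \<Psi> x"
  have "(\<lambda>n. real (Suc n) * (G s (z + (1 / real (Suc n)) *\<^sub>R b) - G s z)) \<longlonglongrightarrow> x \<bullet> b" if b: "b \<in> Basis" for b
  proof (rule LIMSEQ_I)
    fix r :: real assume r: "r > 0"
    define c where "c = 1 / (2 * (1 - s))"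
    have c: "c > 0" using s by (simp add: c_def)
    obtain N where N: "inverse (real (Suc N)) < r / c" using reals_Archimedean[of "r / c"] r c by auto
    show "\<exists>no. \<forall>n\<ge>no. norm (real (Suc n) * (G s (z + (1 / real (Suc n)) *\<^sub>R b) - G s z) - x \<bullet> b) < r"
    proof (intro exI allI impI)
      fix n assume n: "N \<le> n"
      define k where "k = real (Suc n)"
      have k: "k > 0" by (simp add: k_def)
      have "inverse k \<le> inverse (real (Suc N))" using n by (simp add: k_def divide_simps)
      then have "c * inverse k \<le> c * inverse (real (Suc N))" using c by (intro mult_left_mono) auto
      also have "\<dots> < r" using N c by (simp only: pos_less_divide_eq mult.commute)
      finally have "c * inverse k < r" .
      moreover have "\<bar>G s (z + (1 / k) *\<^sub>R b) - G s z - x \<bullet> ((1 / k) *\<^sub>R b)\<bar> \<le> c * (1 / k)^2"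
        using G_expansion[OF x s z_def, of "(1 / k) *\<^sub>R b"] b k by (simp add: c_def power_mult_distrib)
      then have "k * \<bar>G s (z + (1 / k) *\<^sub>R b) - G s z - x \<bullet> ((1 / k) *\<^sub>R b)\<bar> \<le> k * (c * (1 / k)^2)"
        using k by (intro mult_left_mono) auto
      moreover have "k * (c * (1 / k)^2) = c * inverse k" using k by (simp add: power2_eq_square divide_simps)
      moreover have "k * (G s (z + (1 / k) *\<^sub>R b) - G s z) - x \<bullet> b = k * (G s (z + (1 / k) *\<^sub>R b) - G s z - x \<bullet> ((1 / k) *\<^sub>R b))"
        using k by (simp add: right_diff_distrib)
      ultimately show "norm (real (Suc n) * (G s (z + (1 / real (Suc n)) *\<^sub>R b) - G s z) - x \<bullet> b) < r"
        using k unfolding k_def[symmetric] by (simp add: abs_mult)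
    qed
  qed
  then have "lim (\<lambda>n. real (Suc n) * (G s (z + (1 / real (Suc n)) *\<^sub>R b) - G s z)) = x \<bullet> b" if "b \<in> Basis" for b
    using that limI by blast
  then show ?thesis unfolding z_def[symmetric] source_def by (simp add: euclidean_representation)
qed

end

section \<open>Test functions\<close>

text \<open>The growth bound is uniform in p since the derivatives in fixed directions are
  continuous and vanish outside a compact set. It makes the weak equation integrable for fields of
  finite action.\<close>

lemma test_functionD:
  assumes "\<zeta> \<in> test_functions T"
  shows "C_k 1 \<zeta>" "t \<le> 0 \<or> T \<le> t \<Longrightarrow> \<zeta> (t, x) = 0"
    "\<exists>C\<ge>0. \<forall>p w. \<bar>fder \<zeta> p (1, w)\<bar> \<le> C * (1 + norm w)"
proof -
  define S where "S = closure {p. \<zeta> p \<noteq> 0}"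
  have z: "\<And>k. C_k k \<zeta>" and S: "compact S" "S \<subseteq> {0<..<T} \<times> UNIV" using assms by (auto simp: test_functions_def S_def)
  show z1: "C_k 1 \<zeta>" by (rule z)
  show "\<zeta> (t, x) = 0" if "t \<le> 0 \<or> T \<le> t"
  proof (rule ccontr)
    assume "\<zeta> (t, x) \<noteq> 0"
    then have "(t, x) \<in> S" unfolding S_def using closure_subset by fastforce
    then show False using S(2) that by auto
  qed
  have "\<zeta> p = 0" if "p \<notin> S" for p using that closure_subset[of "{p. \<zeta> p \<noteq> 0}"] by (auto simp: S_def)
  moreover have "closed S" by (simp add: S_def)
  ultimately have out: "fder \<zeta> p h = 0" if "p \<notin> S" for p h
    using frechet_derivative_eq_0_outside[OF _ _ that, of \<zeta>] by metis
  have bd: "\<exists>B. \<forall>p. \<bar>fder \<zeta> p h\<bar> \<le> B" for h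
  proof -
    have "compact ((\<lambda>p. fder \<zeta> p h) ` S)"
      by (rule compact_continuous_image[OF continuous_on_subset[OF derivative_split(2)[OF z1] subset_UNIV] S(1)])
    from compact_imp_bounded[OF this] obtain B where B': "\<forall>y\<in>(\<lambda>p. fder \<zeta> p h) ` S. norm y \<le> B"
      unfolding bounded_iff by blast
    have B: "\<bar>fder \<zeta> p h\<bar> \<le> B" if "p \<in> S" for p using bspec[OF B' imageI[OF that]] by simp
    have "\<bar>fder \<zeta> p h\<bar> \<le> max 0 B" for p using B[of p] out[of p h] by (cases "p \<in> S") auto
    then show ?thesis by blast
  qed
  then obtain B where B: "\<forall>h p. \<bar>fder \<zeta> p h\<bar> \<le> B h" using choice[of "\<lambda>h B. \<forall>p. \<bar>fder \<zeta> p h\<bar> \<le> B"] by blast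
  have B0: "B h \<ge> 0" for h using B abs_ge_zero order.trans by blast
  define C where "C = B (1, 0) + (\<Sum>b\<in>Basis. B (0, b))"
  have "\<bar>fder \<zeta> p (1, w)\<bar> \<le> C * (1 + norm w)" for p and w :: 'a
  proof -
    have "\<bar>fder \<zeta> p (1, w)\<bar> \<le> \<bar>fder \<zeta> p (1, 0)\<bar> + (\<Sum>b\<in>Basis. \<bar>(w \<bullet> b) * fder \<zeta> p (0, b)\<bar>)"
      unfolding derivative_split(1)[OF z1, of p w] by (intro order.trans[OF abs_triangle_ineq] add_left_mono sum_abs)
    also have "\<dots> \<le> B (1, 0) * (1 + norm w) + (\<Sum>b\<in>Basis. B (0, b) * (1 + norm w))"
    proof (intro add_mono sum_mono)
      have "B (1, 0) * 1 \<le> B (1, 0) * (1 + norm w)" by (intro mult_left_mono B0) auto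
      then show "\<bar>fder \<zeta> p (1, 0)\<bar> \<le> B (1, 0) * (1 + norm w)" using B[THEN spec, of "(1, 0)", THEN spec, of p] by linarith
      fix b :: 'a assume "b \<in> Basis"
      then have "\<bar>w \<bullet> b\<bar> \<le> 1 + norm w" using Basis_le_norm[of b w] by simp
      then show "\<bar>(w \<bullet> b) * fder \<zeta> p (0, b)\<bar> \<le> B (0, b) * (1 + norm w)"
        unfolding abs_mult using mult_mono[OF _ B[THEN spec, of "(0, b)", THEN spec, of p] _ abs_ge_zero, of "\<bar>w \<bullet> b\<bar>" "1 + norm w"]
        by (simp add: mult.commute)
    qed
    also have "\<dots> = C * (1 + norm w)" by (simp add: C_def distrib_right sum_distrib_right)
    finally show ?thesis .
  qed
  moreover have "C \<ge> 0" unfolding C_def using B0 by (intro add_nonneg_nonneg sum_nonneg) auto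
  ultimately show "\<exists>C\<ge>0. \<forall>p w. \<bar>fder \<zeta> p (1, w)\<bar> \<le> C * (1 + norm w)" by blast
qed

lemma line_integral:
  fixes f :: "real \<times> 'a::euclidean_space \<Rightarrow> real"
  assumes f: "C_k 1 f" and ab: "a \<le> b"
  shows "(\<integral>t. indicator {a..b} t *\<^sub>R fder f (t, q + t *\<^sub>R w) (1, w) \<partial>lborel) = f (b, q + b *\<^sub>R w) - f (a, q + a *\<^sub>R w)"
    and "integrable lborel (\<lambda>t. indicator {a..b} t *\<^sub>R fder f (t, q + t *\<^sub>R w) (1, w))"
proof -
  have cont: "continuous_on {a..b} (\<lambda>t. fder f (t, q + t *\<^sub>R w) (1, w))"
    by (rule continuous_on_compose2[OF derivative_split(2)[OF f]]) (auto intro!: continuous_intros)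
  show "integrable lborel (\<lambda>t. indicator {a..b} t *\<^sub>R fder f (t, q + t *\<^sub>R w) (1, w))"
    by (rule borel_integrable_compact[OF _ cont]) simp
  show "(\<integral>t. indicator {a..b} t *\<^sub>R fder f (t, q + t *\<^sub>R w) (1, w) \<partial>lborel) = f (b, q + b *\<^sub>R w) - f (a, q + a *\<^sub>R w)"
  proof (rule integral_FTC_atLeastAtMost[OF ab _ cont, where F = "\<lambda>t. f (t, q + t *\<^sub>R w)"])
    fix t
    have f': "C_k (Suc 0) f" using f by simp
    have D: "(f has_derivative fder f (t, q + t *\<^sub>R w)) (at (t, q + t *\<^sub>R w))" by (rule C_k_Suc_has_derivative[OF f'])
    have "((\<lambda>t. (t, q + t *\<^sub>R w)) has_derivative (\<lambda>s. s *\<^sub>R (1, w))) (at t within {a..b})"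
      by (auto intro!: derivative_eq_intros)
    from has_derivative_compose[OF this D]
    show "((\<lambda>t. f (t, q + t *\<^sub>R w)) has_vector_derivative fder f (t, q + t *\<^sub>R w) (1, w)) (at t within {a..b})"
      unfolding has_vector_derivative_def by (simp only: linear_scale[OF has_derivative_linear[OF D]])
  qed
qed

section \<open>Problem 1\<close>

context ot_dual
begin

definition path :: "real \<Rightarrow> 'a \<Rightarrow> 'a" where "path t x = broken_line T x (Z x) (m0 x) t"

definition vel :: "real \<Rightarrow> 'a \<Rightarrow> 'a" where
  "vel t x = (2/T) *\<^sub>R (if t < T/2 then Z x - x else m0 x - Z x)"

lemma path_first: "t \<le> T/2 \<Longrightarrow> path t x = x + t *\<^sub>R ((2/T) *\<^sub>R (Z x - x))"
  by (simp add: path_def broken_line_def)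

lemma path_second: "T/2 \<le> t \<Longrightarrow> path t x = (2 *\<^sub>R Z x - m0 x) + t *\<^sub>R ((2/T) *\<^sub>R (m0 x - Z x))"
  using T by (cases "t = T/2") (auto simp: path_def broken_line_def algebra_simps scaleR_2)

lemma path_ends: "path 0 x = x" "path (T/2) x = Z x" "path T x = m0 x"
  using T by (auto simp: path_def broken_line_def)

lemma path_kinked: "(\<lambda>t. path t x) \<in> kinked_curves T"
  using profile.profile_kinked[OF profile_linear[OF T], of x "Z x" "m0 x"] unfolding path_def by (simp only: profile_curve_id)

lemma path_measurable:
  "(\<lambda>p. path (fst p) (snd p)) \<in> borel_measurable (lborel \<Otimes>\<^sub>M \<mu>0)" "(\<lambda>p. vel (fst p) (snd p)) \<in> borel_measurable (lborel \<Otimes>\<^sub>M \<mu>0)"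
  "path t \<in> borel_measurable borel"
proof -
  note [measurable] = Z_meas Z_borel m0_borel
  note [measurable_cong] = \<mu>0(1)
  show "(\<lambda>p. path (fst p) (snd p)) \<in> borel_measurable (lborel \<Otimes>\<^sub>M \<mu>0)" unfolding path_def broken_line_def by measurable
  show "(\<lambda>p. vel (fst p) (snd p)) \<in> borel_measurable (lborel \<Otimes>\<^sub>M \<mu>0)" unfolding vel_def by measurable
  show "path t \<in> borel_measurable borel" unfolding path_def[abs_def] broken_line_def by (cases "t \<le> T/2") simp_all
qed

lemma path_meas: "path t \<in> measurable \<mu>0 borel"
  using path_measurable(3) \<mu>0(1) by (simp cong: measurable_cong_sets)

definition on_path :: "(real \<Rightarrow> 'a measure) \<Rightarrow> bool" where
  "on_path \<rho> \<longleftrightarrow> (\<forall>t\<in>{0..T}. \<rho> t = distr \<mu>0 borel (path t))"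

text \<open>Problem 1 sees a velocity field only along the particles and at almost every time, so it
  can be determined only in this sense.\<close>

definition with_vel :: "(real \<Rightarrow> 'a \<Rightarrow> 'a) \<Rightarrow> bool" where
  "with_vel v \<longleftrightarrow> (AE t in lborel. t \<in> {0..T} \<longrightarrow> (AE x in \<mu>0. v t (path t x) = vel t x))"

lemma path_P2: "P2 (distr \<mu>0 borel (path t))"
proof (rule P2_distr[OF path_measurable(3)])
  show "integrable \<mu>0 (\<lambda>x. (norm (path t x))^2)"
    unfolding path_def
    by (rule integrable_good[of "\<lambda>x z y. (norm (broken_line T x z y t))^2"])
      (cases "t \<le> T/2", auto simp: split_beta' broken_line_def intro!: continuous_intros)
qed

lemma path_narrow:
  assumes \<rho>: "on_path \<rho>" shows "narrowly_continuous T \<rho>"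
  unfolding narrowly_continuous_def
proof (intro allI impI)
  fix f :: "'a \<Rightarrow> real" assume f: "continuous_on UNIV f" "bounded (range f)"
  obtain B where B: "\<And>x. norm (f x) \<le> B" using f(2) by (auto simp: bounded_iff)
  have fm: "f \<in> borel_measurable borel" by (rule borel_measurable_continuous_onI[OF f(1)])
  have "continuous_on {0..T} (\<lambda>t. \<integral>x. f (path t x) \<partial>\<mu>0)"
    unfolding continuous_on_sequentially
  proof (intro allI ballI impI)
    fix s t assume st: "t \<in> {0..T}" "(\<forall>n. s n \<in> {0..T}) \<and> s \<longlonglongrightarrow> t"
    have "(\<lambda>n. \<integral>x. f (path (s n) x) \<partial>\<mu>0) \<longlonglongrightarrow> (\<integral>x. f (path t x) \<partial>\<mu>0)"
    proof (rule integral_dominated_convergence[where w = "\<lambda>x. B"])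
      show "AE x in \<mu>0. (\<lambda>n. f (path (s n) x)) \<longlonglongrightarrow> f (path t x)"
      proof (rule AE_I2)
        fix x
        have "continuous_on {0..T} (\<lambda>t. f (path t x))"
          by (rule continuous_on_compose2[OF f(1) kinked_continuous[OF path_kinked]]) simp
        then show "(\<lambda>n. f (path (s n) x)) \<longlonglongrightarrow> f (path t x)"
          using st unfolding continuous_on_sequentially by (auto simp: comp_def)
      qed
    qed (use B measurable_compose[OF path_meas fm] in auto)
    then show "((\<lambda>t. \<integral>x. f (path t x) \<partial>\<mu>0) \<circ> s) \<longlonglongrightarrow> (\<integral>x. f (path t x) \<partial>\<mu>0)" by (simp add: comp_def)
  qed
  then show "continuous_on {0..T} (\<lambda>t. \<integral>x. f x \<partial>\<rho> t)"
    using \<rho> by (subst continuous_on_cong[OF refl]) (auto simp: on_path_def integral_distr[OF path_meas fm])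
qed

lemma path_kinetic:
  assumes \<rho>: "on_path \<rho>" and vb: "(\<lambda>(t, x). v t x) \<in> borel_measurable borel" and v: "with_vel v"
  shows "kinetic_action T \<rho> v = ennreal (E0 + E1)"
proof -
  have k: "0 \<le> kin0 x" "0 \<le> kin1 x" for x using T by (auto simp: kin0_def kin1_def)
  then have kk: "0 \<le> E0" "0 \<le> E1" by (auto intro: Bochner_Integration.integral_nonneg)
  have vm: "v t \<in> borel_measurable borel" for t
    using measurable_compose[OF borel_measurable_continuous_onI[of "\<lambda>x::'a. (t, x)"] vb] by (simp add: continuous_on_Pair)
  have "kinetic_action T \<rho> v = (\<integral>\<^sup>+t. ennreal (2/T * E0) * indicator {0..T/2} t + ennreal (2/T * E1) * indicator {T/2..T} t \<partial>lborel)"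
    unfolding kinetic_action_def
  proof (rule nn_integral_cong_AE)
    show "AE t in lborel. (\<integral>\<^sup>+x. ennreal (1/2 * (norm (v t x))^2) \<partial>\<rho> t) * indicator {0..T} t
        = ennreal (2/T * E0) * indicator {0..T/2} t + ennreal (2/T * E1) * indicator {T/2..T} t"
      using v[unfolded with_vel_def] AE_lborel_singleton[of "T/2"]
    proof eventually_elim
      case (elim t)
      show ?case
      proof (cases "t \<in> {0..T}")
        case False then show ?thesis using T by (auto simp: indicator_def)
      next
        case True
        have "(\<integral>\<^sup>+x. ennreal (1/2 * (norm (v t x))^2) \<partial>\<rho> t) = (\<integral>\<^sup>+x. ennreal (1/2 * (norm (v t (path t x)))^2) \<partial>\<mu>0)"
          unfolding \<rho>[unfolded on_path_def, THEN bspec, OF True] using vm[of t] by (intro nn_integral_distr[OF path_meas]) simp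
        also have "\<dots> = (\<integral>\<^sup>+x. ennreal (1/2 * (norm (vel t x))^2) \<partial>\<mu>0)"
          using elim(1) True by (intro nn_integral_cong_AE) (auto elim!: eventually_mono)
        also have "\<dots> = (if t < T/2 then ennreal (2/T * E0) else ennreal (2/T * E1))"
        proof -
          have "1/2 * (norm (vel t x))^2 = (if t < T/2 then 2/T * kin0 x else 2/T * kin1 x)" for x
            using T by (simp add: vel_def kin0_def kin1_def norm_minus_commute power_mult_distrib power2_eq_square)
          moreover have "(\<integral>\<^sup>+x. ennreal (2/T * kin0 x) \<partial>\<mu>0) = ennreal (2/T * E0)"
            using nn_integral_eq_integral[of \<mu>0 "\<lambda>x. 2/T * kin0 x"] ikin k T by simp
          moreover have "(\<integral>\<^sup>+x. ennreal (2/T * kin1 x) \<partial>\<mu>0) = ennreal (2/T * E1)"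
            using nn_integral_eq_integral[of \<mu>0 "\<lambda>x. 2/T * kin1 x"] ikin k T by simp
          ultimately show ?thesis by simp
        qed
        finally show ?thesis using True elim(2) by (auto simp: indicator_def)
      qed
    qed
  qed
  also have "\<dots> = ennreal (2/T * E0) * ennreal (T/2) + ennreal (2/T * E1) * ennreal (T/2)"
    using T by (subst nn_integral_add) (simp_all add: nn_integral_cmult_indicator)
  also have "\<dots> = ennreal (E0 + E1)"
    using T kk by (simp add: ennreal_mult[symmetric])
  finally show ?thesis .
qed

text \<open>Transported back to \<mu>0 and after exchanging the integrals, the weak equation becomes
  the fundamental theorem along each broken line. The contributions at T/2 cancel, and test
  functions vanish at times 0 and T.\<close>

lemma path_continuity_equation:
  assumes \<rho>: "on_path \<rho>" and vb: "(\<lambda>(t, x). v t x) \<in> borel_measurable borel" and v: "with_vel v"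
  shows "continuity_equation T \<rho> v"
  unfolding continuity_equation_def
proof
  fix \<zeta> :: "real \<times> 'a \<Rightarrow> real" assume z: "\<zeta> \<in> test_functions T"
  note z1 = test_functionD(1)[OF z]
  obtain C where C: "C \<ge> 0" "\<forall>p w. \<bar>fder \<zeta> p (1, w)\<bar> \<le> C * (1 + norm w)" using test_functionD(3)[OF z] by blast
  interpret P: pair_sigma_finite lborel \<mu>0
    by (intro pair_sigma_finite.intro lborel.sigma_finite_measure_axioms M0.sigma_finite_measure_axioms)
  have vb': "(\<lambda>p. v (fst p) (snd p)) \<in> borel_measurable borel" using vb by (simp add: split_beta')
  have pm: "(\<lambda>p. (fst p, path (fst p) (snd p))) \<in> borel_measurable (lborel \<Otimes>\<^sub>M \<mu>0)"
    unfolding borel_prod[symmetric] using path_measurable(1) by measurable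
  define F where "F t x = indicator {0..T} t *\<^sub>R fder \<zeta> (t, path t x) (1, vel t x)" for t x
  define F' where "F' t x = indicator {0..T} t *\<^sub>R fder \<zeta> (t, path t x) (1, v t (path t x))" for t x
  have im: "(\<lambda>p. indicator {0..T} (fst p)) \<in> borel_measurable (lborel \<Otimes>\<^sub>M \<mu>0)" by measurable
  have Fm: "(\<lambda>p. F (fst p) (snd p)) \<in> borel_measurable (lborel \<Otimes>\<^sub>M \<mu>0)"
    unfolding F_def by (intro borel_measurable_scaleR im derivative_measurable[OF z1 pm path_measurable(2)])
  have F'm: "(\<lambda>p. F' (fst p) (snd p)) \<in> borel_measurable (lborel \<Otimes>\<^sub>M \<mu>0)"
    unfolding F'_def using measurable_compose[OF pm vb'] by (intro borel_measurable_scaleR im derivative_measurable[OF z1 pm]) simp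
  have Fx: "(\<lambda>x. F t x) \<in> borel_measurable \<mu>0" for t using measurable_compose[OF measurable_Pair1' Fm, of t] by simp
  have F'x: "(\<lambda>x. F' t x) \<in> borel_measurable \<mu>0" for t using measurable_compose[OF measurable_Pair1' F'm, of t] by simp
  have Ft: "(\<lambda>t. F t x) \<in> borel_measurable lborel" if "x \<in> space \<mu>0" for x using measurable_compose[OF measurable_Pair2'[OF that] Fm] by simp
  have si: "(\<lambda>t. \<integral>x. F t x \<partial>\<mu>0) \<in> borel_measurable lborel" "(\<lambda>t. \<integral>x. F' t x \<partial>\<mu>0) \<in> borel_measurable lborel" "(\<lambda>t. \<integral>x. norm (F t x) \<partial>\<mu>0) \<in> borel_measurable lborel"
    using Fm F'm by (auto intro!: M0.borel_measurable_lebesgue_integral simp: split_beta')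
  have "(LINT t:{0..T}|lborel. (\<integral>x. fder \<zeta> (t, x) (1, v t x) \<partial>\<rho> t)) = (\<integral>t. (\<integral>x. F' t x \<partial>\<mu>0) \<partial>lborel)"
    unfolding set_lebesgue_integral_def
  proof (rule Bochner_Integration.integral_cong[OF refl])
    fix t
    have dm: "(\<lambda>x. fder \<zeta> (t, x) (1, v t x)) \<in> borel_measurable borel"
    proof (rule derivative_measurable[OF z1])
      show p: "(\<lambda>x::'a. (t, x)) \<in> borel_measurable borel" by (intro borel_measurable_continuous_onI continuous_intros)
      show "v t \<in> borel_measurable borel" using measurable_compose[OF p vb'] by simp
    qed
    show "indicator {0..T} t *\<^sub>R (\<integral>x. fder \<zeta> (t, x) (1, v t x) \<partial>\<rho> t) = (\<integral>x. F' t x \<partial>\<mu>0)"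
    proof (cases "t \<in> {0..T}")
      case True
      then have "\<rho> t = distr \<mu>0 borel (path t)" using \<rho> by (simp add: on_path_def)
      then show ?thesis using integral_distr[OF path_meas dm] True by (simp add: F'_def)
    qed (simp add: F'_def)
  qed
  also have "\<dots> = (\<integral>t. (\<integral>x. F t x \<partial>\<mu>0) \<partial>lborel)"
  proof (rule integral_cong_AE)
    show "AE t in lborel. (\<integral>x. F' t x \<partial>\<mu>0) = (\<integral>x. F t x \<partial>\<mu>0)"
      using v[unfolded with_vel_def]
    proof eventually_elim
      case (elim t)
      show ?case
      proof (cases "t \<in> {0..T}")
        case True
        then have "AE x in \<mu>0. v t (path t x) = vel t x" using elim by simp
        then have "AE x in \<mu>0. F' t x = F t x" by eventually_elim (simp add: F_def F'_def)
        then show ?thesis by (rule integral_cong_AE[OF F'x Fx])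
      qed (simp add: F_def F'_def)
    qed
  qed (use si in auto)
  also have "\<dots> = (\<integral>x. (\<integral>t. F t x \<partial>lborel) \<partial>\<mu>0)"
  proof -
    define V where "V x = (2/T) * (norm (Z x - x) + norm (m0 x - Z x))" for x
    have iV: "integrable \<mu>0 (\<lambda>x. C * (1 + V x))"
      unfolding V_def
      by (rule integrable_good[of "\<lambda>x z y. C * (1 + (2/T) * (norm (z - x) + norm (y - z)))"]) (use T in \<open>auto simp: split_beta' intro!: continuous_intros\<close>)
    have le: "norm (F t x) \<le> indicator {0..T} t * (C * (1 + V x))" for t x
    proof -
      have "norm (vel t x) \<le> V x" using T by (simp add: vel_def V_def divide_right_mono)
      then have "C * (1 + norm (vel t x)) \<le> C * (1 + V x)" using C(1) by (intro mult_left_mono) auto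
      then have "\<bar>fder \<zeta> (t, path t x) (1, vel t x)\<bar> \<le> C * (1 + V x)"
        using C(2)[THEN spec, of "(t, path t x)", THEN spec, of "vel t x"] by linarith
      then show ?thesis by (simp add: F_def indicator_def)
    qed
    have iF: "integrable \<mu>0 (F t)" for t
    proof (rule Bochner_Integration.integrable_bound)
      show "integrable \<mu>0 (\<lambda>x. indicator {0..T} t * (C * (1 + V x)))" using iV by (intro integrable_mult_right) simp
      show "AE x in \<mu>0. norm (F t x) \<le> norm (indicator {0..T} t * (C * (1 + V x)))"
        by (intro AE_I2) (use le[of t] in \<open>metis abs_ge_self order.trans real_norm_def\<close>)
    qed (rule Fx)
    have "integrable (lborel \<Otimes>\<^sub>M \<mu>0) (\<lambda>(t, x). F t x)"
    proof (rule P.Fubini_integrable)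
      show "(\<lambda>(t, x). F t x) \<in> borel_measurable (lborel \<Otimes>\<^sub>M \<mu>0)" using Fm by (simp add: split_beta')
      show "AE t in lborel. integrable \<mu>0 (\<lambda>x. (\<lambda>(t, x). F t x) (t, x))" using iF by simp
      have "integrable lborel (\<lambda>t. \<integral>x. norm (F t x) \<partial>\<mu>0)"
      proof (rule Bochner_Integration.integrable_bound[OF _ si(3)])
        show "integrable lborel (\<lambda>t. indicator {0..T} t * (\<integral>x. C * (1 + V x) \<partial>\<mu>0))" by (simp add: emeasure_lborel_Icc_eq)
        show "AE t in lborel. norm (\<integral>x. norm (F t x) \<partial>\<mu>0) \<le> norm (indicator {0..T} t * (\<integral>x. C * (1 + V x) \<partial>\<mu>0))"
        proof (rule AE_I2)
          fix t
          have "(\<integral>x. norm (F t x) \<partial>\<mu>0) \<le> (\<integral>x. indicator {0..T} t * (C * (1 + V x)) \<partial>\<mu>0)"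
            by (intro integral_mono integrable_norm iF integrable_mult_right iV le)
          also have "\<dots> = indicator {0..T} t * (\<integral>x. C * (1 + V x) \<partial>\<mu>0)" by simp
          finally show "norm (\<integral>x. norm (F t x) \<partial>\<mu>0) \<le> norm (indicator {0..T} t * (\<integral>x. C * (1 + V x) \<partial>\<mu>0))"
            by simp
        qed
      qed
      then show "integrable lborel (\<lambda>t. \<integral>x. norm ((\<lambda>(t, x). F t x) (t, x)) \<partial>\<mu>0)" by simp
    qed
    from P.Fubini_integral[OF this] show ?thesis by simp
  qed
  also have "\<dots> = (\<integral>x. 0 \<partial>\<mu>0)"
  proof (rule Bochner_Integration.integral_cong[OF refl])
    fix x assume x: "x \<in> space \<mu>0"
    define w0 w1 where "w0 = (2/T) *\<^sub>R (Z x - x)" and "w1 = (2/T) *\<^sub>R (m0 x - Z x)"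
    define q where "q = 2 *\<^sub>R Z x - m0 x"
    let ?f0 = "\<lambda>t. indicator {0..T/2} t *\<^sub>R fder \<zeta> (t, x + t *\<^sub>R w0) (1, w0)"
    let ?f1 = "\<lambda>t. indicator {T/2..T} t *\<^sub>R fder \<zeta> (t, q + t *\<^sub>R w1) (1, w1)"
    have TT: "0 \<le> T/2" "T/2 \<le> T" using T by auto
    note l0 = line_integral[OF z1 TT(1), of x w0] and l1 = line_integral[OF z1 TT(2), of q w1]
    have "(\<integral>t. F t x \<partial>lborel) = (\<integral>t. ?f0 t + ?f1 t \<partial>lborel)"
    proof (rule integral_cong_AE)
      show "AE t in lborel. F t x = ?f0 t + ?f1 t"
        using AE_lborel_singleton[of "T/2"]
      proof eventually_elim
        case (elim t)
        show ?case
        proof (cases "t < T/2")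
          case True
          have "path t x = x + t *\<^sub>R w0" "vel t x = w0" using True path_first[of t x] by (auto simp: w0_def vel_def)
          then show ?thesis using True T by (auto simp: F_def indicator_def)
        next
          case False
          have "path t x = q + t *\<^sub>R w1" "vel t x = w1" using False path_second[of t x] by (auto simp: w1_def q_def vel_def)
          then show ?thesis using False elim T by (auto simp: F_def indicator_def)
        qed
      qed
      show "(\<lambda>t. ?f0 t + ?f1 t) \<in> borel_measurable lborel" using l0(2) l1(2) by (intro borel_measurable_add borel_measurable_integrable)
    qed (rule Ft[OF x])
    also have "\<dots> = \<zeta> (T/2, x + (T/2) *\<^sub>R w0) - \<zeta> (0, x + 0 *\<^sub>R w0) + (\<zeta> (T, q + T *\<^sub>R w1) - \<zeta> (T/2, q + (T/2) *\<^sub>R w1))"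
      unfolding l0(1)[symmetric] l1(1)[symmetric] by (rule Bochner_Integration.integral_add[OF l0(2) l1(2)])
    also have "\<dots> = 0"
      using path_first[of "T/2" x] path_second[of "T/2" x] test_functionD(2)[OF z] unfolding w0_def w1_def q_def by simp
    finally show "(\<integral>t. F t x \<partial>lborel) = 0" .
  qed
  finally show "(LINT t:{0..T}|lborel. (\<integral>x. fder \<zeta> (t, x) (1, v t x) \<partial>\<rho> t)) = 0" by simp
qed

lemma path_admissible:
  assumes \<rho>: "on_path \<rho>" and vb: "(\<lambda>(t, x). v t x) \<in> borel_measurable borel" and v: "with_vel v"
  shows "adm1 (\<rho>, v)" "fun1 (\<rho>, v) = ereal val"
proof -
  have t: "\<rho> t = distr \<mu>0 borel (path t)" if "t \<in> {0..T}" for t using \<rho> that by (simp add: on_path_def)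
  have p: "path 0 = (\<lambda>x. x)" "path T = m0" "path (T/2) = Z" by (auto simp: path_ends)
  have "\<rho> 0 = \<mu>0" "\<rho> T = \<mu>T" using t[of 0] t[of T] T distr_id_borel[OF \<mu>0(1)] push_m0 by (auto simp: p)
  then show "adm1 (\<rho>, v)"
    unfolding admissible1_def using path_narrow[OF \<rho>] path_kinetic[OF \<rho> vb v] path_continuity_equation[OF \<rho> vb v] vb path_P2 t by auto
  have k: "0 \<le> E0" "0 \<le> E1"
    using T by (auto intro!: Bochner_Integration.integral_nonneg simp: kin0_def kin1_def)
  have "\<rho> (T/2) = \<rho>s" using t[of "T/2"] T by (simp add: p \<rho>s_def)
  then show "fun1 (\<rho>, v) = ereal val"
    unfolding I_functional_def prod.case path_kinetic[OF \<rho> vb v] enn2ereal_ennreal[OF add_nonneg_nonneg[OF k]]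
    using PE_\<rho>s kin_val by (simp add: algebra_simps)
qed

text \<open>The cost depends on x + y, so its derivatives in x and in y agree. At a contact pair the
  gradient of \<psi> at the end is thus the same midpoint as the gradient of \<phi> at the
  start.\<close>

lemma AE_contact_\<psi>: "AE x in \<mu>0. good x \<and> m0 x \<in> \<Omega>T \<and> \<psi> differentiable at (m0 x) \<and> grad \<psi> (m0 x) = Z x"
  using AE_good AE_m0[OF \<mu>T(3)] AE_m0[OF h1.AEd]
proof eventually_elim
  case (elim x)
  note c = contact[OF elim(1)]
  have "x \<in> closure \<Omega>0" using elim(1) closure_subset by (auto simp: good_def)
  then have "\<psi> (m0 x) + q.conj_grad (x + m0 x) \<bullet> (y - m0 x) \<le> \<psi> y" for y
    using ineq'[of x y] q.legendre_ge[of "x + m0 x" "x + y"] c(2) by simp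
  from slope_eq_gradient[OF differentiable_GDERIV[OF elim(3)] open_UNIV UNIV_I this]
  have "q.conj_grad (x + m0 x) = grad \<psi> (m0 x)" by simp
  then show ?case using elim c(3) by (simp add: Z_def)
qed

text \<open>In the first half a particle is traced back to its start, in the second forward to its
  end, where \<open>grad \<psi>\<close> gives its midpoint. Either datum determines the constant
  velocity on that half.\<close>

definition opt_vel :: "real \<Rightarrow> 'a \<Rightarrow> 'a" where
  "opt_vel t z = (2/T) *\<^sub>R (if t < T/2 then Z (h0.source (2*t/T, z)) - h0.source (2*t/T, z)
     else h1.source (2 - 2*t/T, z) - grad \<psi> (h1.source (2 - 2*t/T, z)))"

lemma opt_vel_borel: "(\<lambda>(t, z). opt_vel t z) \<in> borel_measurable borel"
proof -
  have [measurable]: "grad \<psi> \<in> borel_measurable borel" by (rule h1.grad_measurable)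
  note [measurable] = Z_borel
  have "(\<lambda>p::real \<times> 'a. (2 * fst p / T, snd p)) \<in> borel_measurable borel" "(\<lambda>p::real \<times> 'a. (2 - 2 * fst p / T, snd p)) \<in> borel_measurable borel"
    using T by (auto intro!: borel_measurable_continuous_onI continuous_intros)
  note [measurable] = measurable_compose[OF this(1) h0.source_borel] measurable_compose[OF this(2) h1.source_borel]
  have [measurable]: "fst \<in> borel_measurable (borel :: (real \<times> 'a) measure)" by (intro borel_measurable_continuous_onI continuous_intros)
  show ?thesis unfolding opt_vel_def split_beta' by measurable
qed

lemma opt_vel_path:
  assumes t: "0 \<le> t" "t \<le> T" "t \<noteq> T/2" shows "AE x in \<mu>0. opt_vel t (path t x) = vel t x"
  using AE_contact_\<psi>
proof eventually_elim
  case (elim x)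
  show ?case
  proof (cases "t < T/2")
    case True
    have "h0.source (2*t/T, (1 - 2*t/T) *\<^sub>R x + (2*t/T) *\<^sub>R grad \<phi> x) = x"
      by (rule h0.source_interp) (use elim closure_subset[of \<Omega>0] True t T in \<open>auto simp: good_def\<close>)
    moreover have "path t x = (1 - 2*t/T) *\<^sub>R x + (2*t/T) *\<^sub>R grad \<phi> x"
      using True by (simp add: path_def broken_line_def Z_def algebra_simps)
    ultimately show ?thesis using True by (simp add: opt_vel_def vel_def)
  next
    case False
    then have tT: "t > T/2" using t by simp
    have "h1.source (2 - 2*t/T, (1 - (2 - 2*t/T)) *\<^sub>R m0 x + (2 - 2*t/T) *\<^sub>R grad \<psi> (m0 x)) = m0 x"
      by (rule h1.source_interp) (use elim closure_subset[of \<Omega>T] tT t T in \<open>auto simp: field_simps\<close>)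
    moreover have "path t x = (1 - (2 - 2*t/T)) *\<^sub>R m0 x + (2 - 2*t/T) *\<^sub>R grad \<psi> (m0 x)"
      using elim tT by (simp add: path_def broken_line_def algebra_simps scaleR_2)
    ultimately show ?thesis using False elim by (simp add: opt_vel_def vel_def)
  qed
qed

lemma opt_vel_with_vel: "with_vel opt_vel"
  unfolding with_vel_def using AE_lborel_singleton[of "T/2"] by eventually_elim (auto intro: opt_vel_path)

end

section \<open>Strict convexity of the action in the velocity\<close>

context continuity_curve
begin

lemma nn_add:
  fixes f g :: "real \<times> 'a \<Rightarrow> ennreal"
  assumes f: "f \<in> borel_measurable borel" and g: "g \<in> borel_measurable borel"
  shows "nnL (\<lambda>t x. f (t, x) + g (t, x)) = nnL (\<lambda>t x. f (t, x)) + nnL (\<lambda>t x. g (t, x))"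
proof -
  have "nnL (\<lambda>t x. f (t, x) + g (t, x)) = (\<integral>\<^sup>+t. (\<integral>\<^sup>+x. f (t, x) \<partial>\<rho> t) + (\<integral>\<^sup>+x. g (t, x) \<partial>\<rho> t) \<partial>L)"
  proof (rule nn_integral_cong)
    fix t assume "t \<in> space L"
    then have [measurable_cong]: "sets (\<rho> t) = sets borel" using sets_\<rho> by (simp add: space_L)
    have "(\<lambda>x. (t, x)) \<in> borel_measurable (borel :: 'a measure)" by (intro borel_measurable_continuous_onI continuous_intros)
    note [measurable] = measurable_compose[OF this f] measurable_compose[OF this g]
    show "(\<integral>\<^sup>+x. f (t, x) + g (t, x) \<partial>\<rho> t) = (\<integral>\<^sup>+x. f (t, x) \<partial>\<rho> t) + (\<integral>\<^sup>+x. g (t, x) \<partial>\<rho> t)"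
      by (rule nn_integral_add) measurable
  qed
  also have "\<dots> = nnL (\<lambda>t x. f (t, x)) + nnL (\<lambda>t x. g (t, x))"
    by (rule nn_integral_add[OF nn_measurable[OF f] nn_measurable[OF g]])
  finally show ?thesis .
qed

lemma kinetic_L: "kinetic_action T \<rho> w = nnL (\<lambda>t x. ennreal (1/2 * (norm (w t x))^2))"
  unfolding kinetic_action_def L_def by (subst nn_integral_restrict_space) auto

lemma kinetic_half:
  assumes w: "(\<lambda>p. w (fst p) (snd p)) \<in> borel_measurable borel"
  shows "nnL (\<lambda>t x. ennreal (1/2 * (1/2 * (norm (w t x))^2))) = ennreal (1/2) * kinetic_action T \<rho> w"
proof -
  have m: "(\<lambda>p. ennreal (1/2 * (norm (w (fst p) (snd p)))^2)) \<in> borel_measurable borel" using w by measurable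
  have "nnL (\<lambda>t x. ennreal (1/2 * (1/2 * (norm (w t x))^2))) = (\<integral>\<^sup>+t. ennreal (1/2) * (\<integral>\<^sup>+x. ennreal (1/2 * (norm (w t x))^2) \<partial>\<rho> t) \<partial>L)"
  proof (rule nn_integral_cong)
    fix t assume "t \<in> space L"
    then have [measurable_cong]: "sets (\<rho> t) = sets borel" using sets_\<rho> by (simp add: space_L)
    have "(\<lambda>x. (t, x)) \<in> borel_measurable (borel :: 'a measure)" by (intro borel_measurable_continuous_onI continuous_intros)
    from measurable_compose[OF this m] have m': "(\<lambda>x. ennreal (1/2 * (norm (w t x))^2)) \<in> borel_measurable (\<rho> t)"
      by (simp cong: measurable_cong_sets)
    have "ennreal (1/2 * (1/2 * (norm (w t x))^2)) = ennreal (1/2) * ennreal (1/2 * (norm (w t x))^2)" for x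
      by (rule ennreal_mult') simp
    then    show "(\<integral>\<^sup>+x. ennreal (1/2 * (1/2 * (norm (w t x))^2)) \<partial>\<rho> t) = ennreal (1/2) * (\<integral>\<^sup>+x. ennreal (1/2 * (norm (w t x))^2) \<partial>\<rho> t)"
      by (simp only: nn_integral_cmult[OF m'])
  qed
  also have "\<dots> = ennreal (1/2) * kinetic_action T \<rho> w"
    unfolding kinetic_L using nn_measurable[OF m] by (subst nn_integral_cmult) auto
  finally show ?thesis .
qed

lemma test_integrable:
  assumes z: "\<zeta> \<in> test_functions T"
  shows "AE t in L. integrable (\<rho> t) (\<lambda>x. fder \<zeta> (t, x) (1, v t x))"
    "integrable L (\<lambda>t. \<integral>x. fder \<zeta> (t, x) (1, v t x) \<partial>\<rho> t)"
    "(\<integral>t. flux \<zeta> t \<partial>L) = 0"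
proof -
  obtain C where C: "C \<ge> 0" "\<forall>p w. \<bar>fder \<zeta> p (1, w)\<bar> \<le> C * (1 + norm w)" using test_functionD(3)[OF z] by blast
  let ?F = "\<lambda>p. fder \<zeta> p (1, v (fst p) (snd p))"
  have fin: "nnL (\<lambda>t x. ennreal \<bar>?F (t, x)\<bar>) < \<infinity>"
    by (rule linear_growth_fin[OF _ C(1)]) (use C(2) in simp)
  from double_integrable[OF derivative_borel[OF test_functionD(1)[OF z]] fin]
  show "AE t in L. integrable (\<rho> t) (\<lambda>x. fder \<zeta> (t, x) (1, v t x))"
    "integrable L (\<lambda>t. \<integral>x. fder \<zeta> (t, x) (1, v t x) \<partial>\<rho> t)" by simp_all
  show "(\<integral>t. flux \<zeta> t \<partial>L) = 0"
    using ce z unfolding L_def continuity_equation_def set_lebesgue_integral_def by (subst integral_restrict_space) auto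
qed

end

text \<open>The kinetic action is strictly convex in the velocity, and the continuity equation is linear
  in it.\<close>

lemma midpoint_velocity:
  assumes "continuity_curve T \<rho> v" "continuity_curve T \<rho> u"
    and eq: "kinetic_action T \<rho> u = ennreal K" "kinetic_action T \<rho> v = ennreal K" "K \<ge> 0"
  defines "w \<equiv> \<lambda>t x. (1/2) *\<^sub>R (u t x + v t x)"
  shows "(\<lambda>(t, x). w t x) \<in> borel_measurable borel" "kinetic_action T \<rho> w \<le> ennreal K" "continuity_equation T \<rho> w"
    and "ennreal K \<le> kinetic_action T \<rho> w \<Longrightarrow> AE t in lborel. t \<in> {0..T} \<longrightarrow> (AE x in \<rho> t. v t x = u t x)"
proof -
  interpret C: continuity_curve T \<rho> v by fact
  interpret U: continuity_curve T \<rho> u by fact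
  let ?d = "\<lambda>t x. (1/2) *\<^sub>R (u t x - v t x)"
  note [measurable] = C.vm' U.vm'
  have wm: "(\<lambda>p. w (fst p) (snd p)) \<in> borel_measurable borel" unfolding w_def by measurable
  then show "(\<lambda>(t, x). w t x) \<in> borel_measurable borel" by (simp add: split_beta')
  have dm: "(\<lambda>p. ?d (fst p) (snd p)) \<in> borel_measurable borel" by measurable
  have mm: "(\<lambda>p. ennreal (1/2 * (norm (f (fst p) (snd p)))^2)) \<in> borel_measurable borel"
      "(\<lambda>p. ennreal (1/2 * (1/2 * (norm (f (fst p) (snd p)))^2))) \<in> borel_measurable borel"
    if "(\<lambda>p. f (fst p) (snd p)) \<in> borel_measurable borel" for f :: "real \<Rightarrow> 'a \<Rightarrow> 'a" using that by measurable
  \<comment> \<open>The parallelogram identity for the mean of the two fields and half their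
    difference.\<close>
  have par: "ennreal (1/2 * (norm (w t x))^2) + ennreal (1/2 * (norm (?d t x))^2) = ennreal (1/2 * (1/2 * (norm (u t x))^2)) + ennreal (1/2 * (1/2 * (norm (v t x))^2))" for t x
  proof -
    have "1/2 * (norm (w t x))^2 + 1/2 * (norm (?d t x))^2 = 1/2 * (1/2 * (norm (u t x))^2) + 1/2 * (1/2 * (norm (v t x))^2)"
      unfolding w_def power2_norm_eq_inner by (simp add: inner_simps inner_commute) (simp add: field_simps)
    then show ?thesis by (simp add: ennreal_plus[symmetric] del: ennreal_plus)
  qed
  have "kinetic_action T \<rho> w + kinetic_action T \<rho> ?d = (\<integral>\<^sup>+t. (\<integral>\<^sup>+x. ennreal (1/2 * (norm (w t x))^2) + ennreal (1/2 * (norm (?d t x))^2) \<partial>\<rho> t) \<partial>C.L)"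
    using C.nn_add[OF mm(1)[OF wm] mm(1)[OF dm]] by (simp add: C.kinetic_L)
  also have "\<dots> = ennreal (1/2) * kinetic_action T \<rho> u + ennreal (1/2) * kinetic_action T \<rho> v"
    unfolding par C.kinetic_half[OF U.vm', symmetric] C.kinetic_half[OF C.vm', symmetric]
    using C.nn_add[OF mm(2)[OF U.vm'] mm(2)[OF C.vm']] by simp
  also have "\<dots> = ennreal K"
  proof -
    have "ennreal (1/2) * ennreal K = ennreal (1/2 * K)" by (rule ennreal_mult'[symmetric]) simp
    moreover have "ennreal (1/2 * K) + ennreal (1/2 * K) = ennreal (1/2 * K + 1/2 * K)" using eq(3) by (intro ennreal_plus[symmetric]) auto
    ultimately show ?thesis unfolding eq by simp
  qed
  finally have sum: "kinetic_action T \<rho> w + kinetic_action T \<rho> ?d = ennreal K" .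
  show "kinetic_action T \<rho> w \<le> ennreal K" by (rule order.trans[OF _ eq_refl[OF sum]]) simp
  show "continuity_equation T \<rho> w"
    unfolding continuity_equation_def
  proof
    fix \<zeta> :: "real \<times> 'a \<Rightarrow> real" assume z: "\<zeta> \<in> test_functions T"
    note z1 = test_functionD(1)[OF z]
    note a = C.test_integrable[OF z] and b = U.test_integrable[OF z]
    let ?D = "\<lambda>w t x. fder \<zeta> (t, x) (1, w t x)"
    have lin: "?D w t x = 1/2 * ?D u t x + 1/2 * ?D v t x" for t x
    proof -
      have f': "C_k (Suc 0) \<zeta>" using z1 by simp
      have l: "linear (fder \<zeta> (t, x))" using C_k_Suc_has_derivative[OF f'] by (rule has_derivative_linear)
      have "(1::real, w t x) = (1/2) *\<^sub>R (1, u t x) + (1/2) *\<^sub>R (1, v t x)" by (simp add: w_def scaleR_add_right)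
      then show ?thesis by (simp only: linear_add[OF l] linear_scale[OF l] real_scaleR_def)
    qed
    have m: "(\<lambda>t. \<integral>x. ?D w t x \<partial>\<rho> t) \<in> borel_measurable C.L"
      using C.integral_measurable[OF derivative_measurable[OF z1 measurable_ident wm]] by simp
    have "(LINT t:{0..T}|lborel. (\<integral>x. ?D w t x \<partial>\<rho> t)) = (\<integral>t. (\<integral>x. ?D w t x \<partial>\<rho> t) \<partial>C.L)"
      unfolding C.L_def set_lebesgue_integral_def by (subst integral_restrict_space) auto
    also have "\<dots> = (\<integral>t. 1/2 * (\<integral>x. ?D u t x \<partial>\<rho> t) + 1/2 * (\<integral>x. ?D v t x \<partial>\<rho> t) \<partial>C.L)"
    proof (rule integral_cong_AE[OF m])
      show "AE t in C.L. (\<integral>x. ?D w t x \<partial>\<rho> t) = 1/2 * (\<integral>x. ?D u t x \<partial>\<rho> t) + 1/2 * (\<integral>x. ?D v t x \<partial>\<rho> t)"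
        using a(1) b(1) by eventually_elim (simp add: lin)
    qed (use a(2) b(2) in auto)
    also have "\<dots> = 0" using a(2,3) b(2,3) by simp
    finally show "(LINT t:{0..T}|lborel. (\<integral>x. ?D w t x \<partial>\<rho> t)) = 0" .
  qed
  assume ge: "ennreal K \<le> kinetic_action T \<rho> w"
  then have "kinetic_action T \<rho> w = ennreal K" using \<open>kinetic_action T \<rho> w \<le> ennreal K\<close> by simp
  then have "kinetic_action T \<rho> ?d = 0" using sum ennreal_add_left_cancel[of "ennreal K" "kinetic_action T \<rho> ?d" 0] by simp
  then have "AE t in C.L. (\<integral>\<^sup>+x. ennreal (1/2 * (norm (?d t x))^2) \<partial>\<rho> t) = 0"
    using nn_integral_0_iff_AE[OF C.nn_measurable[OF mm(1)[OF dm]]] by (simp add: C.kinetic_L)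
  then have "AE t in lborel. t \<in> {0..T} \<longrightarrow> (\<integral>\<^sup>+x. ennreal (1/2 * (norm (?d t x))^2) \<partial>\<rho> t) = 0"
    unfolding C.L_def by (subst (asm) AE_restrict_space_iff) auto
  then show "AE t in lborel. t \<in> {0..T} \<longrightarrow> (AE x in \<rho> t. v t x = u t x)"
  proof eventually_elim
    case (elim t)
    show ?case
    proof
      assume t: "t \<in> {0..T}"
      have "(\<lambda>x. (t, x)) \<in> borel_measurable (borel :: 'a measure)" by (intro borel_measurable_continuous_onI continuous_intros)
      from measurable_compose[OF this mm(1)[OF dm]] have "(\<lambda>x. ennreal (1/2 * (norm (?d t x))^2)) \<in> borel_measurable (\<rho> t)"
        using C.sets_\<rho>[OF t] by (simp cong: measurable_cong_sets)
      from nn_integral_0_iff_AE[OF this] elim t have "AE x in \<rho> t. ennreal (1/2 * (norm (?d t x))^2) = 0" by simp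
      then show "AE x in \<rho> t. v t x = u t x" by eventually_elim (simp add: ennreal_eq_0_iff)
    qed
  qed
qed

section \<open>Lower bound and optimisers of Problem 1\<close>

context ot_dual
begin

lemma admissible_curve: "adm1 (\<rho>, v) \<Longrightarrow> continuity_curve T \<rho> v"
  using T by (auto simp: admissible1_def intro!: continuity_curve.intro)

text \<open>The time is fixed and the claims concern almost every x, so the half of the interval to
  which each one applies is expressed by a disjunct.\<close>

lemma interp_path:
  shows "AE x in \<mu>0. grad (h0.interp (t / \<tau>)) x = path t x \<or> T/2 < t"
    and "AE x in \<mu>0. grad (h1.interp ((T - t) / \<tau>)) (m0 x) = path t x \<or> t \<le> T/2"
proof -
  have s: "t / \<tau> = 2 * t / T" "(T - t) / \<tau> = 2 - 2 * t / T" using T by (auto simp: \<tau>_def field_simps)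
  show "AE x in \<mu>0. grad (h0.interp (t / \<tau>)) x = path t x \<or> T/2 < t"
    using AE_good
  proof eventually_elim
    case (elim x)
    then have "\<phi> differentiable at x" by (simp add: good_def)
    from h0.grad_interp[OF this] show ?case
      unfolding s by (auto simp: path_def broken_line_def Z_def algebra_simps)
  qed
  show "AE x in \<mu>0. grad (h1.interp ((T - t) / \<tau>)) (m0 x) = path t x \<or> t \<le> T/2"
    using AE_contact_\<psi>
  proof eventually_elim
    case (elim x)
    then show ?case
      unfolding s using h1.grad_interp[of "m0 x" "2 - 2 * t / T"] by (auto simp: path_def broken_line_def algebra_simps scaleR_2)
  qed
qed

text \<open>The actions on the two halves serve as w0 and w1 in \<open>combine\<close>. In the case
  of equality both halves are tight, and \<open>intermediate\<close> applies on the first half from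
  \<mu>0 and on the second, in reversed time, from \<mu>T.\<close>

lemma I_lower:
  assumes adm: "adm1 (\<rho>, v)"
  shows "ereal val \<le> fun1 (\<rho>, v)" and "fun1 (\<rho>, v) \<le> ereal val \<Longrightarrow> on_path \<rho>"
proof -
  interpret C: continuity_curve T \<rho> v by (rule admissible_curve[OF adm])
  have ends: "\<rho> 0 = \<mu>0" "\<rho> T = \<mu>T" using adm by (auto simp: admissible1_def)
  have tT: "0 < \<tau>" "\<tau> < T" "T - \<tau> = \<tau>" "T / 2 = \<tau>" using T by (auto simp: \<tau>_def)
  have fwd: "dual_bound t \<mu>0 (\<rho> t) (C.act 0 t)" if "0 < t" "t \<le> T" for t
    using C.dual_bound_act[of 0 t] that ends by simp
  have bwd: "dual_bound (b - a) (\<rho> b) (\<rho> a) (C.act a b)" if "0 \<le> a" "a < b" "b \<le> T" for a b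
    by (rule dual_bound_sym[OF C.dual_bound_act[OF that]]) (use that C.prob C.sets_\<rho> in auto)
  have d0: "dual_bound \<tau> \<mu>0 (\<rho> \<tau>) (C.act 0 \<tau>)" using fwd tT by simp
  have d1: "dual_bound \<tau> \<mu>T (\<rho> \<tau>) (C.act \<tau> T)" using bwd[of \<tau> T] tT ends by simp
  have P: "P2 (\<rho> \<tau>)" using C.P2\<rho> tT by simp
  have I: "fun1 (\<rho>, v) = ereal (C.act 0 \<tau>) + potential_energy Q (\<rho> \<tau>) + ereal (C.act \<tau> T)"
  proof -
    have "enn2ereal (ennreal (C.act 0 T)) = ereal (C.act 0 \<tau>) + ereal (C.act \<tau> T)"
      using C.act_split[of 0 \<tau> T] tT by (simp add: enn2ereal_ennreal[OF C.act_nonneg])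
    then show ?thesis unfolding I_functional_def prod.case C.kinetic_act tT(4) by (simp add: ac_simps)
  qed
  note c = combine[OF P d0 d1]
  show "ereal val \<le> fun1 (\<rho>, v)" using c(1) unfolding I .
  assume "fun1 (\<rho>, v) \<le> ereal val"
  then have opt: "\<rho> \<tau> = distr \<mu>0 borel (grad \<phi>)" "C.act 0 \<tau> \<le> (\<integral>z. h0.\<beta> \<tau> z \<partial>\<rho> \<tau>) + (\<integral>x. h0.\<alpha> \<tau> x \<partial>\<mu>0)"
    "C.act \<tau> T \<le> (\<integral>z. h1.\<beta> \<tau> z \<partial>\<rho> \<tau>) + (\<integral>x. h1.\<alpha> \<tau> x \<partial>\<mu>T)" using c(2) unfolding I by auto
  show "on_path \<rho>"
    unfolding on_path_def
  proof
    fix t assume t: "t \<in> {0..T}"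
    consider "t = 0" | "t = T" | "t = \<tau>" | "0 < t" "t < \<tau>" | "\<tau> < t" "t < T" using t by fastforce
    then show "\<rho> t = distr \<mu>0 borel (path t)"
    proof cases
      case 1
      have "path 0 = (\<lambda>x. x)" by (rule ext) (rule path_ends)
      then show ?thesis using 1 ends distr_id_borel[OF \<mu>0(1)] by simp
    next
      case 2
      have "path T = m0" by (rule ext) (simp add: path_ends)
      then show ?thesis using 2 ends push_m0 by simp
    next
      case 3
      have "path \<tau> = Z" unfolding tT(4)[symmetric] by (rule ext) (rule path_ends)
      then show ?thesis using 3 opt(1) by (simp add: Z_def)
    next
      case 4
      have Pt: "P2 (\<rho> t)" using C.P2\<rho> t by simp
      have "dual_bound (\<tau> - t) (\<rho> t) (\<rho> \<tau>) (C.act t \<tau>)" using C.dual_bound_act[of t \<tau>] 4 tT by simp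
      moreover have "C.act 0 t + C.act t \<tau> \<le> (\<integral>z. h0.\<beta> \<tau> z \<partial>\<rho> \<tau>) + (\<integral>x. h0.\<alpha> \<tau> x \<partial>\<mu>0)"
        using C.act_split[of 0 t \<tau>] 4 opt(2) by simp
      moreover have "dual_bound t \<mu>0 (\<rho> t) (C.act 0 t)" using fwd[of t] 4 tT by simp
      ultimately have "\<rho> t = distr \<mu>0 borel (grad (h0.interp (t / \<tau>)))"
        using h0.intermediate[OF 4 Pt P] by blast
      also have "\<dots> = distr \<mu>0 borel (path t)"
      proof (rule distr_cong_AE[OF refl refl _ _ path_meas])
        interpret I: half_problem "h0.interp (t / \<tau>)" \<mu>0 \<Omega>0 "closure \<Omega>0" by (rule h0.half_problem_interp) (use 4 in auto)
        show "grad (h0.interp (t / \<tau>)) \<in> measurable \<mu>0 borel" using I.grad_measurable \<mu>0(1) by (simp cong: measurable_cong_sets)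
        show "AE x in \<mu>0. grad (h0.interp (t / \<tau>)) x = path t x"
          using interp_path(1) by eventually_elim (use 4 tT in auto)
      qed
      finally show ?thesis .
    next
      case 5
      have Pt: "P2 (\<rho> t)" using C.P2\<rho> t by simp
      \<comment> \<open>Seen from \<mu>T, time t is reached after T - t, and t - \<tau> then remains
        until the midpoint.\<close>
      have Tt: "0 < T - t" "T - t < \<tau>" and e: "\<tau> - (T - t) = t - \<tau>" using 5 tT by auto
      have "dual_bound (\<tau> - (T - t)) (\<rho> t) (\<rho> \<tau>) (C.act \<tau> t)"
      using bwd[of \<tau> t] 5 tT unfolding e by simp
      moreover have "C.act t T + C.act \<tau> t \<le> (\<integral>z. h1.\<beta> \<tau> z \<partial>\<rho> \<tau>) + (\<integral>x. h1.\<alpha> \<tau> x \<partial>\<mu>T)"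
        using C.act_split[of \<tau> t T] 5 opt(3) by simp
      moreover have "dual_bound (T - t) \<mu>T (\<rho> t) (C.act t T)" using bwd[of t T] 5 tT ends by simp
      ultimately have "\<rho> t = distr \<mu>T borel (grad (h1.interp ((T - t) / \<tau>)))"
        using h1.intermediate[OF Tt Pt P] by blast
      also have "\<dots> = distr \<mu>0 borel (path t)"
      proof -
        interpret I: half_problem "h1.interp ((T - t) / \<tau>)" \<mu>T \<Omega>T "closure \<Omega>T" by (rule h1.half_problem_interp) (use Tt in auto)
        have "distr \<mu>T borel (grad (h1.interp ((T - t) / \<tau>))) = distr \<mu>0 borel (grad (h1.interp ((T - t) / \<tau>)) \<circ> m0)"
          by (subst push_m0) (rule distr_distr[OF I.grad_measurable Z_meas(2)])
        also have "\<dots> = distr \<mu>0 borel (path t)"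
        proof (rule distr_cong_AE[OF refl refl _ _ path_meas])
          show "grad (h1.interp ((T - t) / \<tau>)) \<circ> m0 \<in> measurable \<mu>0 borel" by (rule measurable_comp[OF Z_meas(2) I.grad_measurable])
          show "AE x in \<mu>0. (grad (h1.interp ((T - t) / \<tau>)) \<circ> m0) x = path t x"
            using interp_path(2) by eventually_elim (use 5 tT in auto)
        qed
        finally show ?thesis .
      qed
      finally show ?thesis .
    qed
  qed
qed

lemma on_path_opt: "on_path (\<lambda>t. distr \<mu>0 borel (path t))"
  by (simp add: on_path_def)

text \<open>\<open>I_lower\<close> first determines the curve of an optimal pair. On this curve
  \<open>opt_vel\<close> has the same action; the mean of the two fields is admissible and cannot
  have a smaller one, so strict convexity makes them agree.\<close>

lemma opt1_iff: "opt1 (\<rho>, v) \<longleftrightarrow> adm1 (\<rho>, v) \<and> on_path \<rho> \<and> with_vel v"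
proof
  assume r: "adm1 (\<rho>, v) \<and> on_path \<rho> \<and> with_vel v"
  then have "(\<lambda>(t, x). v t x) \<in> borel_measurable borel" by (simp add: admissible1_def)
  then have "fun1 (\<rho>, v) = ereal val" using path_admissible(2) r by blast
  moreover have "ereal val \<le> fun1 p" if "adm1 p" for p
    using I_lower(1)[of "fst p" "snd p"] that by simp
  ultimately show "opt1 (\<rho>, v)" using r by (auto simp: is_arg_min_def not_less)
next
  assume o: "opt1 (\<rho>, v)"
  then have adm: "adm1 (\<rho>, v)" by (simp add: is_arg_min_def)
  note p = path_admissible[OF on_path_opt opt_vel_borel opt_vel_with_vel]
  have "\<not> fun1 (\<lambda>t. distr \<mu>0 borel (path t), opt_vel) < fun1 (\<rho>, v)"
    using o p(1) unfolding is_arg_min_def by blast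
  then have le: "fun1 (\<rho>, v) \<le> ereal val" unfolding p(2) by simp
  have path: "on_path \<rho>" by (rule I_lower(2)[OF adm le])
  note p' = path_admissible[OF path opt_vel_borel opt_vel_with_vel]
  note C = admissible_curve[OF adm] and U = admissible_curve[OF p'(1)]
  define K where "K = E0 + E1"
  define q where "q = (\<integral>x. Q (Z x) \<partial>\<mu>0)"
  have K0: "K \<ge> 0" unfolding K_def using T by (auto intro!: add_nonneg_nonneg Bochner_Integration.integral_nonneg simp: kin0_def kin1_def)
  have "path (T/2) = Z" by (rule ext) (rule path_ends)
  then have "\<rho> (T/2) = \<rho>s" using path T by (simp add: on_path_def \<rho>s_def)
  then have PE: "potential_energy Q (\<rho> (T/2)) = ereal q" by (simp add: PE_\<rho>s q_def)
  have ku: "kinetic_action T \<rho> opt_vel = ennreal K" unfolding K_def by (rule path_kinetic[OF path opt_vel_borel opt_vel_with_vel])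
  have key: "kinetic_action T \<rho> w = ennreal k \<and> k \<ge> 0 \<and> fun1 (\<rho>, w) = ereal (k + q)"
    if "kinetic_action T \<rho> w = ennreal k" "k \<ge> 0" for w k
    using that PE by (simp add: I_functional_def enn2ereal_ennreal)
  have vK: "val = K + q" using kin_val by (simp add: K_def q_def)
  have fin: "\<exists>k\<ge>0. kinetic_action T \<rho> w = ennreal k" if "kinetic_action T \<rho> w < \<infinity>" for w
    using that by (cases "kinetic_action T \<rho> w") auto
  have "kinetic_action T \<rho> v < \<infinity>" using adm by (simp add: admissible1_def)
  then obtain k where k: "k \<ge> 0" "kinetic_action T \<rho> v = ennreal k" using fin by blast
  have "ereal (k + q) = ereal val" using key[OF k(2,1)] I_lower(1)[OF adm] le by simp
  then have kv: "kinetic_action T \<rho> v = ennreal K" using k vK by simp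
  define w where "w = (\<lambda>t x. (1/2) *\<^sub>R (opt_vel t x + v t x))"
  note mid = midpoint_velocity[OF C U ku kv K0, folded w_def]
  have admw: "adm1 (\<rho>, w)"
    using adm mid(1,3) order.strict_trans1[OF mid(2), of \<infinity>] by (simp add: admissible1_def)
  then have "kinetic_action T \<rho> w < \<infinity>" by (simp add: admissible1_def)
  then obtain k' where k': "k' \<ge> 0" "kinetic_action T \<rho> w = ennreal k'" using fin by blast
  have "val \<le> k' + q" using key[OF k'(2,1)] I_lower(1)[OF admw] by simp
  then have "ennreal K \<le> kinetic_action T \<rho> w" unfolding k' using vK by (intro ennreal_leI) simp
  from mid(4)[OF this] opt_vel_with_vel[unfolded with_vel_def]
  have "with_vel v"
    unfolding with_vel_def
  proof eventually_elim
    case (elim t)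
    show ?case
    proof
      assume t: "t \<in> {0..T}"
      have e: "\<rho> t = distr \<mu>0 borel (path t)" using path t by (simp add: on_path_def)
      have "AE x in distr \<mu>0 borel (path t). v t x = opt_vel t x" unfolding e[symmetric] using elim(1) t by simp
      from AE_distrD[OF path_meas this] show "AE x in \<mu>0. v t (path t x) = vel t x"
        using elim(2) t by (auto elim: eventually_elim2)
    qed
  qed
  then show "adm1 (\<rho>, v) \<and> on_path \<rho> \<and> with_vel v" using adm path by simp
qed

lemma opt1_exists: "opt1 (\<lambda>t. distr \<mu>0 borel (path t), opt_vel)"
  using path_admissible(1)[OF on_path_opt opt_vel_borel opt_vel_with_vel] on_path_opt opt_vel_with_vel by (simp add: opt1_iff)

lemma INF_I: "(INF p\<in>Collect (adm1). fun1 p) = ereal val"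
proof (rule antisym)
  note p = path_admissible[OF on_path_opt opt_vel_borel opt_vel_with_vel]
  show "(INF p\<in>Collect (adm1). fun1 p) \<le> ereal val"
    unfolding p(2)[symmetric] by (rule INF_lower) (use p(1) in simp)
  show "ereal val \<le> (INF p\<in>Collect (adm1). fun1 p)"
  proof (rule INF_greatest)
    fix p assume "p \<in> Collect (adm1)"
    then show "ereal val \<le> fun1 p" using I_lower(1)[of "fst p" "snd p"] by simp
  qed
qed

end

section \<open>Potentials\<close>

context ot_dual
begin

lemma opt_trajectory:
  assumes m: "opt m"
  shows "AE x in \<mu>0. trajectory T Q m x = (\<lambda>t. path t x)"
    and "distr \<mu>0 borel (\<lambda>x. trajectory T Q m x t) = distr \<mu>0 borel (path t)"
    and "distr \<mu>0 borel (\<lambda>x. midpoint_of T Q x (m x)) = \<rho>s"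
proof -
  have mm: "AE x in \<mu>0. m x = m0 x" and mb: "m \<in> borel_measurable borel" using m by (auto simp: opt_iff transport_map_def)
  show tr: "AE x in \<mu>0. trajectory T Q m x = (\<lambda>t. path t x)"
    using mm midpoint_m[OF m] by eventually_elim (simp add: trajectory_def path_def fun_eq_iff)
  have "q.conj_grad \<in> borel_measurable borel" by (rule borel_measurable_continuous_onI[OF q.continuous_conj_grad])
  note [measurable] = mb this
  have zb: "(\<lambda>x. midpoint_of T Q x (m x)) \<in> borel_measurable borel" unfolding midpoint by measurable
  note [measurable] = zb
  have "(\<lambda>x. trajectory T Q m x t) \<in> borel_measurable borel"
    unfolding trajectory_def broken_line_def by (cases "t \<le> T/2") simp_all
  then have tb: "(\<lambda>x. trajectory T Q m x t) \<in> measurable \<mu>0 borel" using \<mu>0(1) by (simp cong: measurable_cong_sets)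
  show "distr \<mu>0 borel (\<lambda>x. trajectory T Q m x t) = distr \<mu>0 borel (path t)"
    by (rule distr_cong_AE[OF refl refl _ tb path_meas]) (use tr in \<open>auto elim!: eventually_mono\<close>)
  have zb': "(\<lambda>x. midpoint_of T Q x (m x)) \<in> measurable \<mu>0 borel" using zb \<mu>0(1) by (simp cong: measurable_cong_sets)
  show "distr \<mu>0 borel (\<lambda>x. midpoint_of T Q x (m x)) = \<rho>s"
    unfolding \<rho>s_def by (rule distr_cong_AE[OF refl refl midpoint_m[OF m] zb' Z_meas(1)])
qed

lemma path_derivative:
  assumes "0 < t" "t < T" "t \<noteq> T/2" shows "vector_derivative (\<lambda>t. path t x) (at t) = vel t x"
proof -
  interpret profile "\<lambda>u. u" "\<lambda>u. 1" 1 T by (rule profile_linear[OF T])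
  have "((\<lambda>t. path t x) has_vector_derivative vel t x) (at t)"
  proof (cases "t < T/2")
    case True
    have "((\<lambda>t. path t x) has_vector_derivative (2/T * 1) *\<^sub>R (Z x - x)) (at t)"
      by (rule has_vector_derivative_transform_within_open[OF halves(1)[of x "Z x"], of "{..<T/2}"])
        (use True in \<open>auto simp: path_def broken_line_def\<close>)
    then show ?thesis using True by (simp add: vel_def)
  next
    case False
    have "((\<lambda>t. path t x) has_vector_derivative (- (2/T) * 1) *\<^sub>R (Z x - m0 x)) (at t)"
      by (rule has_vector_derivative_transform_within_open[OF halves(2)[of "m0 x" "Z x"], of "{T/2<..}"])
        (use False assms in \<open>auto simp: path_def broken_line_def algebra_simps scaleR_2\<close>)
    then show ?thesis using False by (simp add: vel_def algebra_simps)
  qed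
  then show ?thesis by (rule vector_derivative_at)
qed

text \<open>The times 0, T/2 and T form a null set, and away from them the trajectory is locally
  affine.\<close>

lemma with_vel_trajectory:
  assumes m: "opt m"
  shows "with_vel v \<longleftrightarrow> (AE t in lborel. t \<in> {0..T} \<longrightarrow>
    (AE x in \<mu>0. v t (trajectory T Q m x t) = vector_derivative (trajectory T Q m x) (at t)))" (is "_ \<longleftrightarrow> ?R")
proof -
  have eq: "(AE x in \<mu>0. v t (path t x) = vel t x) \<longleftrightarrow> (AE x in \<mu>0. v t (trajectory T Q m x t) = vector_derivative (trajectory T Q m x) (at t))"
    if t: "0 < t" "t < T" "t \<noteq> T/2" for t
  proof
    assume "AE x in \<mu>0. v t (path t x) = vel t x"
    with opt_trajectory(1)[OF m] show "AE x in \<mu>0. v t (trajectory T Q m x t) = vector_derivative (trajectory T Q m x) (at t)"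
      by eventually_elim (simp add: path_derivative[OF t])
  next
    assume "AE x in \<mu>0. v t (trajectory T Q m x t) = vector_derivative (trajectory T Q m x) (at t)"
    with opt_trajectory(1)[OF m] show "AE x in \<mu>0. v t (path t x) = vel t x"
      by eventually_elim (simp add: path_derivative[OF t])
  qed
  note ae = AE_lborel_singleton[of "0::real"] AE_lborel_singleton[of "T/2"] AE_lborel_singleton[of T]
  show ?thesis
  proof
    assume "with_vel v"
    then show ?R unfolding with_vel_def using ae
    proof eventually_elim
      case (elim t) then show ?case using eq[of t] by auto
    qed
  next
    assume ?R
    then show "with_vel v" unfolding with_vel_def using ae
    proof eventually_elim
      case (elim t) then show ?case using eq[of t] by auto
    qed
  qed
qed

lemma grad_cost: "grad (\<lambda>x'. cost T Q x' y) x = q.conj_grad (x + y)"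
proof (rule grad_eq)
  have "((\<lambda>x'. x' + y) has_derivative (\<lambda>h. h)) (at x)" by (auto intro!: derivative_eq_intros)
  from has_derivative_compose[OF this q.legendre_GDERIV[unfolded gderiv_def]]
  show "GDERIV (\<lambda>x'. cost T Q x' y) x :> q.conj_grad (x + y)" by (simp add: gderiv_def cost_def)
qed

lemma \<phi>_transport_potential: "transport_potential (cost T Q) \<Omega>0 \<Omega>T r0 rT \<phi>"
  unfolding transport_potential_def
proof (intro conjI allI impI)
  show "AE x in \<mu>0. \<phi> differentiable at x" by (rule h0.AEd)
  show "c_convex (cost T Q) \<Omega>T \<phi>"
    unfolding c_convex_def
  proof (intro exI allI conjI)
    fix x
    have le: "qs (x + y) - \<psi> y \<le> \<phi> x" if "y \<in> \<Omega>T" for y using ineq[of y x] that closure_subset[of \<Omega>T] by auto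
    show bdd: "bdd_above ((\<lambda>y. cost T Q x y - \<psi> y) ` \<Omega>T)"
      by (rule bdd_aboveI[of _ "\<phi> x"]) (use le in \<open>auto simp: cost_def\<close>)
    \<comment> \<open>\<phi> is a supremum over the closure, whereas \<open>c_convex\<close> takes
      it over \<Omega>T. By continuity of the expression the two suprema agree.\<close>
    have cont: "continuous_on (closure \<Omega>T) (\<lambda>y. cost T Q x y - \<psi> y)"
      unfolding cost_def by (intro continuous_intros continuous_on_compose2[OF q.continuous_legendre[of UNIV]] h1.cont) auto
    show "\<phi> x = (SUP y\<in>\<Omega>T. cost T Q x y - \<psi> y)"
    proof (rule antisym)
      have "cost T Q x y - \<psi> y \<le> (SUP y\<in>\<Omega>T. cost T Q x y - \<psi> y)" if "y \<in> closure \<Omega>T" for y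
        by (rule continuous_le_on_closure[OF cont that]) (rule cSUP_upper[OF _ bdd])
      then show "\<phi> x \<le> (SUP y\<in>\<Omega>T. cost T Q x y - \<psi> y)"
        by (subst \<phi>_eq) (intro c.ctrans_le compact_closures, simp add: cost_def)
      show "(SUP y\<in>\<Omega>T. cost T Q x y - \<psi> y) \<le> \<phi> x"
        using le \<Omega> by (intro cSUP_least) (auto simp: cost_def)
    qed
  qed
  fix m assume m: "opt m"
  then have "AE x in \<mu>0. m x = m0 x" by (simp add: opt_iff)
  then show "AE x in \<mu>0. \<forall>y. grad (\<lambda>x'. cost T Q x' y) x = grad \<phi> x \<longleftrightarrow> y = m x"
    using AE_good
  proof eventually_elim
    case (elim x)
    have "y = m0 x" if "q.conj_grad (x + y) = q.conj_grad (x + m0 x)" for y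
    proof -
      have "grad qt (q.conj_grad (x + y)) = grad qt (q.conj_grad (x + m0 x))" using that by simp
      then show ?thesis unfolding q.grad_conj_grad by simp
    qed
    then show ?case unfolding grad_cost contact(3)[OF elim(2), symmetric] elim(1) by blast
  qed
qed

text \<open>Applied to the optimal map \<open>m1\<close>, the defining property of a potential fixes
  its gradient as that of the cost at (x, m1 x), which is \<open>Z x\<close>. All potentials
  therefore share their gradient almost everywhere.\<close>

lemma potential_gradient:
  assumes p: "transport_potential (cost T Q) \<Omega>0 \<Omega>T r0 rT \<phi>t" and \<Phi>: "\<Phi> = (\<lambda>x. 2/T * (\<phi>t x - (norm x)^2 / 2))"
  shows "AE x in \<mu>0. \<Phi> differentiable at x \<and> grad \<Phi> x = (2/T) *\<^sub>R (Z x - x)"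
proof -
  have "AE x in \<mu>0. \<phi>t differentiable at x" "AE x in \<mu>0. \<forall>y. grad (\<lambda>x'. cost T Q x' y) x = grad \<phi>t x \<longleftrightarrow> y = m1 x"
    using p opt_m1 by (auto simp: transport_potential_def)
  then show ?thesis using m1(2) AE_good
  proof eventually_elim
    case (elim x)
    have "grad (\<lambda>x'. cost T Q x' (m1 x)) x = grad \<phi>t x" using elim(2) by simp
    then have g: "grad \<phi>t x = Z x" using contact(3)[OF elim(4)] elim(3) by (simp add: grad_cost Z_def)
    have "GDERIV \<Phi> x :> (2/T) *\<^sub>R (Z x - x)"
      using has_derivative_mult_right[OF has_derivative_diff[OF differentiable_GDERIV[OF elim(1), unfolded gderiv_def g] h0.norm_sq_GDERIV[of x, unfolded gderiv_def]], of "2/T"]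
      by (simp add: gderiv_def \<Phi> inner_diff_right)
    then show ?case using GDERIV_differentiable grad_eq by blast
  qed
qed

text \<open>Equal images make integrals of functions of N and of Z coincide. Hence the integral of
  \<Phi> + B.g(Z) equals that of \<Phi> + B.g(N) = x . N, which is at most that of \<phi> + h0.g(N),
  equal to that of \<phi> + h0.g(Z) = x . Z. So Fenchel's inequality for \<Phi> is tight at (x, Z
  x).\<close>

lemma brenier_unique:
  assumes b: "brenier_potential \<mu>0 \<rho>s \<Phi>" shows "AE x in \<mu>0. grad \<Phi> x = Z x"
proof -
  interpret B: half_problem \<Phi> \<mu>0 \<Omega>0 "closure \<Omega>0"
    by (intro half_problem.intro convex_function.intro half_problem_axioms.intro)
      (use b \<mu>0 \<Omega> compact_closures closure_subset in \<open>auto simp: brenier_potential_def\<close>)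
  define N where "N = grad \<Phi>"
  have Nm: "N \<in> measurable \<mu>0 borel" unfolding N_def using B.grad_measurable \<mu>0(1) by (simp cong: measurable_cong_sets)
  have N: "distr \<mu>0 borel N = distr \<mu>0 borel Z" using b by (simp add: brenier_potential_def N_def \<rho>s_def)
  have push: "integrable \<mu>0 (\<lambda>x. f (Z x))" "integrable \<mu>0 (\<lambda>x. f (N x))" "(\<integral>x. f (N x) \<partial>\<mu>0) = (\<integral>x. f (Z x) \<partial>\<mu>0)"
    if f: "continuous_on UNIV f" for f :: "'a \<Rightarrow> real"
  proof -
    have fm: "f \<in> borel_measurable borel" by (rule borel_measurable_continuous_onI[OF f])
    show i: "integrable \<mu>0 (\<lambda>x. f (Z x))"
      by (rule integrable_good[of "\<lambda>x z y. f z"]) (auto simp: split_beta' intro!: continuous_on_compose2[OF f] continuous_intros)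
    have "integrable (distr \<mu>0 borel N) f" unfolding N using integrable_distr_eq[OF Z_meas(1) fm] i by simp
    then show "integrable \<mu>0 (\<lambda>x. f (N x))" by (rule integrable_distr[OF Nm])
    show "(\<integral>x. f (N x) \<partial>\<mu>0) = (\<integral>x. f (Z x) \<partial>\<mu>0)"
      using integral_distr[OF Nm fm] integral_distr[OF Z_meas(1) fm] N by simp
  qed
  note pB = push[OF B.g_continuous] and p0 = push[OF h0.g_continuous]
  have iS: "integrable \<mu>0 (\<lambda>x. x \<bullet> Z x)"
    by (rule integrable_good[of "\<lambda>x z y. x \<bullet> z"]) (auto simp: split_beta' intro!: continuous_intros)
  have i\<Phi>: "integrable \<mu>0 \<Phi>" by (rule B.integrable_continuous[OF B.cont])
  have X: "AE x in \<mu>0. x \<in> \<Omega>0 \<and> x \<in> closure \<Omega>0" using \<mu>0(3) closure_subset by (auto elim!: eventually_mono)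
  have N_eq: "AE x in \<mu>0. x \<bullet> N x = \<Phi> x + B.g (N x)"
    using X B.AEd by eventually_elim (simp add: N_def B.fenchel_eq)
  have Z_eq: "AE x in \<mu>0. x \<bullet> Z x = \<phi> x + h0.g (Z x)"
    using X h0.AEd by eventually_elim (simp add: Z_def h0.fenchel_eq)
  have "(\<integral>x. x \<bullet> Z x \<partial>\<mu>0) = (\<integral>x. \<phi> x + h0.g (Z x) \<partial>\<mu>0)"
    by (rule integral_cong_AE[OF _ _ Z_eq]) (use iS i\<phi> p0 in auto)
  then have S: "(\<integral>x. x \<bullet> Z x \<partial>\<mu>0) = (\<integral>x. \<phi> x \<partial>\<mu>0) + (\<integral>x. h0.g (N x) \<partial>\<mu>0)" using i\<phi> p0 by simp
  have "AE x in \<mu>0. \<Phi> x + B.g (N x) \<le> \<phi> x + h0.g (N x)"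
    using X N_eq
  proof eventually_elim
    case (elim x) then show ?case using h0.fenchel[of x "N x"] by simp
  qed
  then have "(\<integral>x. \<Phi> x + B.g (N x) \<partial>\<mu>0) \<le> (\<integral>x. \<phi> x + h0.g (N x) \<partial>\<mu>0)"
    by (intro integral_mono_AE) (use i\<Phi> pB i\<phi> p0 in auto)
  then have le: "(\<integral>x. \<Phi> x + B.g (Z x) - x \<bullet> Z x \<partial>\<mu>0) \<le> 0" using i\<Phi> pB i\<phi> p0 iS S by simp
  have nn: "AE x in \<mu>0. 0 \<le> \<Phi> x + B.g (Z x) - x \<bullet> Z x"
    using X
  proof eventually_elim
    case (elim x) then show ?case using B.fenchel[of x "Z x"] by simp
  qed
  have "(\<integral>x. \<Phi> x + B.g (Z x) - x \<bullet> Z x \<partial>\<mu>0) = 0" using le integral_nonneg_AE[OF nn] by simp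
  then have "AE x in \<mu>0. \<Phi> x + B.g (Z x) - x \<bullet> Z x = 0"
    using integral_nonneg_eq_0_iff_AE[OF _ nn] i\<Phi> pB iS by simp
  then show ?thesis using X B.AEd
  proof eventually_elim
    case (elim x) then show ?case using B.fenchel_eqD[of x "Z x"] by simp
  qed
qed

lemma initial_potential:
  assumes p: "transport_potential (cost T Q) \<Omega>0 \<Omega>T r0 rT \<phi>t" and \<Phi>: "\<Phi> = (\<lambda>x. 2/T * (\<phi>t x - (norm x)^2 / 2))"
  shows "initial_velocity_potential T Q \<mu>0 \<mu>T \<Phi>"
  unfolding initial_velocity_potential_def
proof (intro conjI allI impI)
  note g = potential_gradient[OF assms]
  show "AE x in \<mu>0. \<Phi> differentiable at x" using g by eventually_elim simp
  fix \<rho> assume "opt3 \<rho>"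
  then have \<rho>: "\<rho> = \<rho>s" by (simp add: opt3_iff)
  show "\<exists>\<Phi>. brenier_potential \<mu>0 \<rho> \<Phi>"
    unfolding brenier_potential_def \<rho> \<rho>s_def Z_def by (intro exI[of _ \<phi>] conjI h0.conv h0.AEd refl)
  fix \<Phi>' assume "brenier_potential \<mu>0 \<rho> \<Phi>'"
  from brenier_unique[OF this[unfolded \<rho>]] g show "AE x in \<mu>0. grad \<Phi> x = (2/T) *\<^sub>R (grad \<Phi>' x - x)"
    by eventually_elim simp
qed

lemma initial_velocity:
  assumes g: "AE x in \<mu>0. w x = (2/T) *\<^sub>R (Z x - x)"
  shows "initial_velocity1 T Q \<mu>0 \<mu>T w"
  unfolding initial_velocity1_def
proof (intro conjI allI impI exI[of _ "\<lambda>t. distr \<mu>0 borel (path t)"] exI[of _ opt_vel])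
  have tr: "AE x in \<mu>0. v t (x + t *\<^sub>R w x) = w x" if v: "AE x in \<mu>0. v t (path t x) = vel t x" and t: "t < T/2" for v t
    using v g by eventually_elim (use path_first[of t] t in \<open>simp add: vel_def\<close>)
  fix \<rho> v assume "opt1 (\<rho>, v)"
  then have "with_vel v" by (simp add: opt1_iff)
  then show "AE t in lborel. 0 < t \<and> t < T/2 \<longrightarrow> (AE x in \<mu>0. v t (x + t *\<^sub>R w x) = w x)"
    unfolding with_vel_def
  proof eventually_elim
    case (elim t) then show ?case using tr[of v t] by auto
  qed
next
  show "opt1 (\<lambda>t. distr \<mu>0 borel (path t), opt_vel)" by (rule opt1_exists)
next
  fix t :: real assume t: "0 \<le> t \<and> t < T/2"
  have "AE x in \<mu>0. opt_vel t (path t x) = vel t x" by (rule opt_vel_path) (use t T in auto)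
  then show "AE x in \<mu>0. opt_vel t (x + t *\<^sub>R w x) = w x"
    using g by eventually_elim (use path_first[of t] t in \<open>simp add: vel_def\<close>)
qed

lemma initial_velocity2:
  assumes \<Gamma>: "\<Gamma> \<in> {C1_curves T, kinked_curves T}" and o: "opt2 \<Gamma> \<gamma>"
  shows "AE x in \<mu>0. vector_derivative (\<gamma> x) (at 0 within {0..T}) = (2/T) *\<^sub>R (Z x - x)"
proof -
  have "on_broken \<gamma>" using o opt2_iff[OF \<Gamma>] by blast
  then show ?thesis by eventually_elim (rule broken_line_derivative_0[OF T], blast)
qed

lemma opt1_char: "opt1 (\<rho>, v) \<longleftrightarrow> adm1 (\<rho>, v) \<and>
    (\<exists>m. opt m \<and> (\<forall>t\<in>{0..T}. \<rho> t = distr \<mu>0 borel (\<lambda>x. trajectory T Q m x t)) \<and>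
      (AE t in lborel. t \<in> {0..T} \<longrightarrow> (AE x in \<mu>0. v t (trajectory T Q m x t) = vector_derivative (trajectory T Q m x) (at t))))"
    (is "_ \<longleftrightarrow> _ \<and> (\<exists>m. opt m \<and> ?A m \<and> ?B m)")
proof -
  have "on_path \<rho> \<and> with_vel v \<longleftrightarrow> ?A m \<and> ?B m" if "opt m" for m
    unfolding on_path_def opt_trajectory(2)[OF that] with_vel_trajectory[OF that] by (rule refl)
  then have "on_path \<rho> \<and> with_vel v \<longleftrightarrow> (\<exists>m. opt m \<and> ?A m \<and> ?B m)" using opt_m1 by blast
  then show ?thesis unfolding opt1_iff by (rule arg_cong)
qed

lemma opt2_char:
  assumes "\<Gamma> \<in> {C1_curves T, kinked_curves T}"
  shows "opt2 \<Gamma> \<gamma> \<longleftrightarrow> adm2 \<Gamma> \<gamma> \<and>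
    (\<exists>m. opt m \<and> (AE x in \<mu>0. \<forall>t\<in>{0..T}. \<gamma> x t = trajectory T Q m x t))"
proof -
  have "(on_broken \<gamma>) \<longleftrightarrow> (AE x in \<mu>0. \<forall>t\<in>{0..T}. \<gamma> x t = trajectory T Q m x t)"
    (is "?A \<longleftrightarrow> ?B") if "opt m" for m
  proof
    assume ?A with opt_trajectory(1)[OF that] show ?B by eventually_elim (simp add: path_def)
  next
    assume ?B with opt_trajectory(1)[OF that] show ?A by eventually_elim (simp add: path_def)
  qed
  then show ?thesis unfolding opt2_iff[OF assms] using opt_m1 by blast
qed

lemma opt3_char: "opt3 \<rho> \<longleftrightarrow> (\<exists>m. opt m \<and> \<rho> = distr \<mu>0 borel (\<lambda>x. midpoint_of T Q x (m x)))"
  unfolding opt3_iff using opt_trajectory(3) opt_m1 by metis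

lemma opt_unique: "opt m \<Longrightarrow> opt m' \<Longrightarrow> AE x in \<mu>0. m x = m' x"
proof -
  assume "opt m" "opt m'"
  then have "AE x in \<mu>0. m x = m0 x" "AE x in \<mu>0. m' x = m0 x" by (auto simp: opt_iff)
  then show ?thesis by eventually_elim simp
qed

lemma val_opt:
  "opt m \<Longrightarrow> ereal (1/T * ((\<integral>x. (norm x)^2 \<partial>\<mu>0) + (\<integral>y. (norm y)^2 \<partial>\<mu>T)) - 2/T * transport_value (cost T Q) \<Omega>0 r0 m) = ereal val"
  by (simp add: val_def opt_value)

end


theorem theorem2p1:
  fixes T \<epsilon>0 :: real
    and r0 rT :: "'a::euclidean_space \<Rightarrow> real"
    and \<Omega>0 \<Omega>T :: "'a set"
    and Q :: "'a \<Rightarrow> real"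
    and \<mu>0 \<mu>T :: "'a measure"
    and c :: "'a \<Rightarrow> 'a \<Rightarrow> real"
  assumes "T > 0"
    and "bounded_domain \<Omega>0" and "bounded_domain \<Omega>T"
    and "prob_density_on \<Omega>0 r0" and "prob_density_on \<Omega>T rT"
    and "C_k 4 (Qtilde T Q)"
    and "\<epsilon>0 > 0" and "\<forall>x h. hessian (Qtilde T Q) x h h \<ge> \<epsilon>0 * (norm h)\<^sup>2"
    and \<mu>0: "\<mu>0 = of_density r0" and \<mu>T: "\<mu>T = of_density rT"
    and c: "c = cost T Q"
  shows
    \<comment> \<open>the transport problem has a solution, unique almost everywhere\<close>
    "(\<exists>m. optimal_map c \<Omega>0 \<Omega>T r0 rT m) \<and>
     (\<forall>m m'. optimal_map c \<Omega>0 \<Omega>T r0 rT m \<longrightarrow> optimal_map c \<Omega>0 \<Omega>T r0 rT m' \<longrightarrow>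
        (AE x in \<mu>0. m x = m' x)) \<and>
    \<comment> \<open>equivalence: all problems have the same value, and their optimisers are those given by the
        optimal transport map\<close>
     (\<forall>m. optimal_map c \<Omega>0 \<Omega>T r0 rT m \<longrightarrow>
        (let val = ereal (1/T * ((\<integral>x. (norm x)\<^sup>2 \<partial>\<mu>0) + (\<integral>y. (norm y)\<^sup>2 \<partial>\<mu>T))
                          - 2/T * transport_value c \<Omega>0 r0 m)
         in (INF p\<in>Collect (admissible1 T \<mu>0 \<mu>T). I_functional T Q p) = val \<and>
            (\<forall>\<Gamma>\<in>{C1_curves T, kinked_curves T}.
               (INF \<gamma>\<in>Collect (admissible2 T \<Gamma> \<mu>0 \<mu>T). J_functional T Q \<mu>0 \<gamma>) = val) \<and>
            (INF \<rho>\<in>Collect P2. K_functional T Q \<mu>0 \<mu>T \<rho>) = val)) \<and>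
     (\<forall>\<rho> v. optimal1 T Q \<mu>0 \<mu>T (\<rho>, v) \<longleftrightarrow>
        admissible1 T \<mu>0 \<mu>T (\<rho>, v) \<and>
        (\<exists>m. optimal_map c \<Omega>0 \<Omega>T r0 rT m \<and>
           (\<forall>t\<in>{0..T}. \<rho> t = distr \<mu>0 borel (\<lambda>x. trajectory T Q m x t)) \<and>
           (AE t in lborel. t \<in> {0..T} \<longrightarrow>
              (AE x in \<mu>0. v t (trajectory T Q m x t)
                            = vector_derivative (trajectory T Q m x) (at t))))) \<and>
     (\<forall>\<Gamma>\<in>{C1_curves T, kinked_curves T}. \<forall>\<gamma>. optimal2 T \<Gamma> Q \<mu>0 \<mu>T \<gamma> \<longleftrightarrow>
        admissible2 T \<Gamma> \<mu>0 \<mu>T \<gamma> \<and>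
        (\<exists>m. optimal_map c \<Omega>0 \<Omega>T r0 rT m \<and>
           (AE x in \<mu>0. \<forall>t\<in>{0..T}. \<gamma> x t = trajectory T Q m x t))) \<and>
     (\<forall>\<rho>. optimal3 T Q \<mu>0 \<mu>T \<rho> \<longleftrightarrow>
        (\<exists>m. optimal_map c \<Omega>0 \<Omega>T r0 rT m \<and> \<rho> = distr \<mu>0 borel (\<lambda>x. midpoint_of T Q x (m x)))) \<and>
     (\<exists>p. optimal1 T Q \<mu>0 \<mu>T p) \<and>
     (\<exists>\<gamma>. optimal2 T (kinked_curves T) Q \<mu>0 \<mu>T \<gamma>) \<and>
     (\<exists>!\<rho>. optimal3 T Q \<mu>0 \<mu>T \<rho>) \<and>
    \<comment> \<open>the potential of the optimal map and the initial velocity potential\<close>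
     (\<exists>\<phi>t. transport_potential c \<Omega>0 \<Omega>T r0 rT \<phi>t) \<and>
     (\<forall>\<phi>t \<phi>. transport_potential c \<Omega>0 \<Omega>T r0 rT \<phi>t \<longrightarrow>
        \<phi> = (\<lambda>x. 2/T * (\<phi>t x - (norm x)\<^sup>2 / 2)) \<longrightarrow>
        initial_velocity_potential T Q \<mu>0 \<mu>T \<phi> \<and>
        initial_velocity1 T Q \<mu>0 \<mu>T (grad \<phi>) \<and>
        (\<forall>\<Gamma>\<in>{C1_curves T, kinked_curves T}. \<forall>\<gamma>. optimal2 T \<Gamma> Q \<mu>0 \<mu>T \<gamma> \<longrightarrow>
           (AE x in \<mu>0. vector_derivative (\<gamma> x) (at 0 within {0..T}) = grad \<phi> x)))"
proof -
  have four: "4 = Suc (Suc 2)" by simp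
  have "C_k 2 (Qtilde T Q)" by (rule C_k_SucD[OF C_k_SucD[OF assms(6)[unfolded four]]])
  then have "strongly_convex (Qtilde T Q) \<epsilon>0" using assms(7,8) by (rule strongly_convex_hessian)
  then interpret S: ot_setting T \<epsilon>0 r0 rT \<Omega>0 \<Omega>T Q using assms by (intro ot_setting.intro)
  obtain \<phi> \<psi> where dual: "S.c.admissible (closure \<Omega>T) \<psi>" "\<phi> = ctrans (closure \<Omega>T) S.qs \<psi>" "\<psi> = ctrans (closure \<Omega>0) S.qs \<phi>"
    "\<And>g. S.c.admissible (closure \<Omega>T) g \<Longrightarrow> S.d.dual \<psi> \<le> S.d.dual g"
    using S.d.dual_minimiser by metis
  interpret ot_dual T \<epsilon>0 r0 rT \<Omega>0 \<Omega>T Q \<phi> \<psi>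
    by (intro ot_dual.intro ot_dual_axioms.intro S.ot_setting_axioms dual)
  show ?thesis
    unfolding \<mu>0 \<mu>T c Let_def
  proof (intro conjI allI impI ballI)
    show "\<exists>m. opt m" using opt_m1 by blast
    show "\<exists>p. optimal1 T Q S.\<mu>0 S.\<mu>T p" using opt1_exists by blast
    show "\<exists>!\<rho>. optimal3 T Q S.\<mu>0 S.\<mu>T \<rho>" by (simp add: opt3_iff)
    show "\<exists>\<phi>t. transport_potential (cost T Q) \<Omega>0 \<Omega>T r0 rT \<phi>t" using \<phi>_transport_potential by blast
    show "\<exists>\<gamma>. optimal2 T (kinked_curves T) Q S.\<mu>0 S.\<mu>T \<gamma>"
      using broken_admissible(1) opt2_iff[of "kinked_curves T" "\<lambda>x. broken_line T x (Z x) (m0 x)"] by auto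
  next
    fix m m' assume "opt m" "opt m'" then show "AE x in S.\<mu>0. m x = m' x" by (rule opt_unique)
  next
    fix m assume m: "opt m"
    note v = val_opt[OF m]
    show "(INF p\<in>Collect (admissible1 T S.\<mu>0 S.\<mu>T). I_functional T Q p) =
        ereal (1/T * ((\<integral>x. (norm x)\<^sup>2 \<partial>S.\<mu>0) + (\<integral>y. (norm y)\<^sup>2 \<partial>S.\<mu>T)) - 2/T * transport_value (cost T Q) \<Omega>0 r0 m)"
      unfolding v by (rule INF_I)
    show "(INF \<rho>\<in>Collect P2. K_functional T Q S.\<mu>0 S.\<mu>T \<rho>) =
        ereal (1/T * ((\<integral>x. (norm x)\<^sup>2 \<partial>S.\<mu>0) + (\<integral>y. (norm y)\<^sup>2 \<partial>S.\<mu>T)) - 2/T * transport_value (cost T Q) \<Omega>0 r0 m)"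
      unfolding v by (rule INF_K)
    fix \<Gamma> :: "(real \<Rightarrow> 'a) set" assume "\<Gamma> \<in> {C1_curves T, kinked_curves T}"
    then show "(INF \<gamma>\<in>Collect (admissible2 T \<Gamma> S.\<mu>0 S.\<mu>T). J_functional T Q S.\<mu>0 \<gamma>) =
        ereal (1/T * ((\<integral>x. (norm x)\<^sup>2 \<partial>S.\<mu>0) + (\<integral>y. (norm y)\<^sup>2 \<partial>S.\<mu>T)) - 2/T * transport_value (cost T Q) \<Omega>0 r0 m)"
      unfolding v by (rule INF_J)
  next
    fix \<phi>t \<Phi> assume p: "transport_potential (cost T Q) \<Omega>0 \<Omega>T r0 rT \<phi>t" "\<Phi> = (\<lambda>x. 2/T * (\<phi>t x - (norm x)\<^sup>2 / 2))"
    note g = potential_gradient[OF p]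
    show "initial_velocity_potential T Q S.\<mu>0 S.\<mu>T \<Phi>" by (rule initial_potential[OF p])
    show "initial_velocity1 T Q S.\<mu>0 S.\<mu>T (grad \<Phi>)"
      by (rule initial_velocity) (use g in \<open>auto elim!: eventually_mono\<close>)
    fix \<Gamma> \<gamma> assume "\<Gamma> \<in> {C1_curves T, kinked_curves T}" "optimal2 T \<Gamma> Q S.\<mu>0 S.\<mu>T \<gamma>"
    from initial_velocity2[OF this] g show "AE x in S.\<mu>0. vector_derivative (\<gamma> x) (at 0 within {0..T}) = grad \<Phi> x"
      by eventually_elim simp
  qed (rule opt1_char opt3_char | (rule opt2_char, assumption))+
qed

end
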